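(* Let $\sigma:\mathbb{R}_+\times\mathbb{R}^n\to M_n(\mathbb{R})$ be continuous and bounded with $a=\sigma\sigma^*$ strictly elliptic, and let $\Lambda$ be a closed convex multivalued Borel mapping from $\mathbb{R}_+\times\mathbb{R}^n$ into $\mathbb{R}^n$. Let $g:\mathbb{R}_+\times\mathbb{R}^n\times\mathbb{R}^n\to\mathbb{R}\cup\{+\infty\}$ be Borel with $\{\lambda:g(u,x,\lambda)<\infty\}=\Lambda(u,x)$ for all $(u,x)$; assume that $g$ has polynomial growth on $\Lambda$ and that $(u,x)\mapsto g(u,x,0)$ is bounded from above. Let $0\le r\le T$, $y\in\mathbb{R}^n$. Given $r$-stopping times $r\le s\le t\le T$ taking finitely many values, the formula $$\Pi^{r,y}_{s,t}(Y)=\operatorname{ess\,sup}_{P^{\sigma,\mu}_{r,y}\in(\tilde{\mathcal Q}_{r,y})_S(\Lambda)}\big(E_{P^{\sigma,\mu}_{r,y}}(Y\mid\mathcal B^r_s)-\alpha_{s,t}(P^{\sigma,\mu}_{r,y})\big),\qquad \alpha_{s,t}(P^{\sigma,\mu}_{r,y})=E_{P^{\sigma,\mu}_{r,y}}\Big(\int_s^tg(u,X_u,\mu(u,\omega))du\Big|\mathcal B^r_s\Big),$$ defines a convex monotone map, continuous from below, on the set of $\mathcal B^r_t$-measurable random variables essentially bounded from below, with values in the set of $\mathcal B^r_s$-measurable random variables essentially bounded from below. Given $r$ and $y$, $(\Pi^{r,y}_{s,t})$ is a convex dynamic process which is time consistent for stopping times taking finitely many values: $\Pi^{r,y}_{s_0,s}(\Pi^{r,y}_{s,t}(Y))=\Pi^{r,y}_{s_0,t}(Y)$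 for all such $s_0\le s\le t$ and all $Y$ that are $\mathcal B^r_t$-measurable and essentially bounded from below.
   Context: For $r\ge0$, $\Omega^r=C([r,\infty),\mathbb{R}^n)$ with the topology of uniform convergence on compact sets; $X$ is the coordinate process; $\mathcal B^r=\sigma(X_u:u\ge r)$. Strictly elliptic means $a(t,x)$ is positive definite for every $(t,x)$. $^*$ denotes transpose. For $\lambda:\mathbb{R}_+\times\mathbb{R}^n\to\mathbb{R}^n$ bounded Borel, $Q^{\sigma,\lambda}_{r,y}$ is the unique probability measure on $(\Omega^r,\mathcal B^r)$ (existence and uniqueness are due to Stroock and Varadhan) such that $Q^{\sigma,\lambda}_{r,y}(X_r=y)=1$ and, for every $\theta\in\mathbb{R}^n$, $\exp\{\theta^*(X_t-y)-\int_r^t\theta^*(\sigma\lambda)(u,X_u)du-\frac12\int_r^t\theta^*a(u,X_u)\theta\,du\}$, $t\ge r$, is a martingale for the filtration generated by $X$. $Q^a_{r,y}:=Q^{\sigma,0}_{r,y}$. $(\mathcal B^r_s)_{s\ge r}$ denotes the $Q^a_{r,y}$-completion of the filtration $\sigma(X_u:r\le u\le s)$. An $r$-stopping time is a stopping time with values $\ge r$ for this filtration. Random variables essentially bounded from below are allowed to take the value $+\infty$; "essentially" refers to $Q^a_{r,y}$. A multivalued Borel mapping $\Lambda$ assigns to each $(t,x)$ a subset $\Lambda(t,x)$ of $\mathbb{R}^n$ containing $0$, with Borel graph; it is closed (convex) if each $\Lambda(t,x)$ is. $L(\Lambda)$ is the set of bounded Borel maps $\lambda$ with $\lambda(t,x)\in\Lambda(t,x)$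 for all $(t,x)$. $g$ has polynomial growth on $\Lambda$ if there are $C>0$, $m\in\mathbb{N}$ with $\sup_{\lambda\in\Lambda(u,x)}|g(u,x,\lambda)|\le C(1+\|x\|^m)$ for all $(u,x)$. For a bounded predictable process $\mu$ on $[r,T]$, $P^{\sigma,\mu}_{r,y}$ is the probability measure on $\mathcal B^r_T$ with density with respect to $Q^a_{r,y}$ equal to $\exp(\int_r^T\mu^*(u,\omega)\sigma^{-1}(u,X_u)dX_u-\frac12\int_r^T\|\mu(u,\omega)\|^2du)$. $\tilde{\mathcal S}^r_T(\Lambda)$ is the set of processes $\mu$ for which there are a finite subdivision $r=s_0<\dots<s_N=T$ and, for each $i<N$, a finite partition $(A_{i,j})_{j\in I_i}$ of $\Omega^r$ into $\mathcal B^r_{s_i}$-measurable sets and continuous maps $\lambda_{i,j}\in L(\Lambda)$ with $\mu(u,\omega)=\sum_{j\in I_i}\lambda_{i,j}(u,X_u(\omega))1_{A_{i,j}}(\omega)$ for $s_i<u\le s_{i+1}$. $(\tilde{\mathcal Q}_{r,y})_S(\Lambda)=\{P^{\sigma,\mu}_{r,y}:\mu\in\tilde{\mathcal S}^r_T(\Lambda)\}$ (the smallest set of measures on $\mathcal B^r_T$, stable by composition and bifurcation, containing all $Q^{\sigma,\lambda}_{r,y}$ with $\lambda\in L(\Lambda)$ continuous). A convex dynamic process is a family of maps $\Pi_{s,t}$, $s\le t$, that are monotone, translation invariant ($\Pi_{s,t}(Y+Z)=\Pi_{s,t}(Y)+Z$ for $Z$ bounded $\mathcal B^r_s$-measurable),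 convex, and continuous from below (if $Y_n\uparrow Y$ a.s. then $\Pi_{s,t}(Y_n)\uparrow\Pi_{s,t}(Y)$ a.s.). *)

theory Defs
  imports "HOL-Probability.Probability"
begin

section \<open>Path space and martingale problem\<close>

type_synonym 'n path = "real \<Rightarrow> real ^ 'n"

text \<open>A path on \<open>[r, \<infinity>)\<close> is a total function; \<open>extensional\<close> pins its values outside
  \<open>[r, \<infinity>)\<close>, so that \<open>path_space r\<close> is in bijection with \<open>C([r, \<infinity>), R^n)\<close>.
  The coordinate process at time \<open>u\<close> is \<open>\<lambda>\<omega>. \<omega> u\<close>.\<close>

definition path_space :: "real \<Rightarrow> ('n::finite) path set" where
  "path_space r = {\<omega> \<in> extensional {r..}. continuous_on {r..} \<omega>}"

definition path_algebra :: "real \<Rightarrow> ('n::finite) path measure" where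
  "path_algebra r = sigma (path_space r)
     {(\<lambda>\<omega>. \<omega> u) -` A \<inter> path_space r | u A. r \<le> u \<and> A \<in> sets borel}"

definition path_filtration :: "real \<Rightarrow> real \<Rightarrow> ('n::finite) path measure" where
  "path_filtration r s = sigma (path_space r)
     {(\<lambda>\<omega>. \<omega> u) -` A \<inter> path_space r | u A. r \<le> u \<and> u \<le> s \<and> A \<in> sets borel}"

definition is_martingale ::
  "'a measure \<Rightarrow> (real \<Rightarrow> 'a measure) \<Rightarrow> real \<Rightarrow> (real \<Rightarrow> 'a \<Rightarrow> real) \<Rightarrow> bool" where
  "is_martingale M F r Z \<longleftrightarrow>
     (\<forall>t\<ge>r. Z t \<in> borel_measurable (F t) \<and> integrable M (Z t)) \<and>
     (\<forall>s t. r \<le> s \<and> s \<le> t \<longrightarrow> (AE \<omega> in M. real_cond_exp M (F s) (Z t) \<omega> = Z s \<omega>))"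

definition diffusion_matrix ::
  "(real \<Rightarrow> real ^ 'n \<Rightarrow> real ^ 'n ^ 'n) \<Rightarrow> real \<Rightarrow> real ^ ('n::finite) \<Rightarrow> real ^ 'n ^ 'n" where
  "diffusion_matrix \<sigma> t x = \<sigma> t x ** transpose (\<sigma> t x)"

definition strictly_elliptic :: "(real \<Rightarrow> real ^ 'n \<Rightarrow> real ^ 'n ^ 'n) \<Rightarrow> bool" where
  "strictly_elliptic a \<longleftrightarrow>
     (\<forall>t\<ge>0. \<forall>x::real ^ ('n::finite). \<forall>\<theta>. \<theta> \<noteq> 0 \<longrightarrow> \<theta> \<bullet> (a t x *v \<theta>) > 0)"

text \<open>The characterization of the law of the diffusion with coefficients \<open>\<sigma>\<close>, \<open>\<sigma>\<lambda>\<close> started at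
  \<open>y\<close> at time \<open>r\<close>. For continuous bounded strictly elliptic data and bounded Borel \<open>\<lambda>\<close> there is
  exactly one such measure (Stroock and Varadhan); we keep it as a predicate on \<open>Q\<close>.\<close>

definition martingale_problem ::
  "(real \<Rightarrow> real ^ 'n \<Rightarrow> real ^ 'n ^ 'n) \<Rightarrow> (real \<Rightarrow> real ^ 'n \<Rightarrow> real ^ 'n) \<Rightarrow>
   real \<Rightarrow> real ^ 'n \<Rightarrow> ('n::finite) path measure \<Rightarrow> bool" where
  "martingale_problem \<sigma> lam r y Q \<longleftrightarrow>
     prob_space Q \<and> sets Q = sets (path_algebra r) \<and>
     measure Q {\<omega> \<in> space Q. \<omega> r = y} = 1 \<and>
     (\<forall>\<theta>. is_martingale Q (path_filtration r) r
        (\<lambda>t \<omega>. exp (\<theta> \<bullet> (\<omega> t - y)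
           - (LBINT u=r..t. \<theta> \<bullet> (\<sigma> u (\<omega> u) *v lam u (\<omega> u)))
           - (LBINT u=r..t. \<theta> \<bullet> (diffusion_matrix \<sigma> u (\<omega> u) *v \<theta>)) / 2)))"

section \<open>Completed filtration and stopping times\<close>

definition completed_filtration ::
  "real \<Rightarrow> ('n::finite) path measure \<Rightarrow> real \<Rightarrow> 'n path measure" where
  "completed_filtration r Q s = sigma (path_space r)
     (sets (path_filtration r s) \<union> null_sets (completion Q))"

definition simple_stopping_times ::
  "real \<Rightarrow> real \<Rightarrow> ('n::finite) path measure \<Rightarrow> ('n path \<Rightarrow> real) set" where
  "simple_stopping_times r T Q = {\<tau>. stopping_time (completed_filtration r Q) \<tau> \<and>
     (\<forall>\<omega>\<in>path_space r. r \<le> \<tau> \<omega> \<and> \<tau> \<omega> \<le> T) \<and> finite (\<tau> ` path_space r)}"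

abbreviation stopped_algebra ::
  "real \<Rightarrow> ('n::finite) path measure \<Rightarrow> ('n path \<Rightarrow> real) \<Rightarrow> 'n path measure" where
  "stopped_algebra r Q \<tau> \<equiv> filtration.pre_sigma (path_space r) (completed_filtration r Q) \<tau>"

section \<open>Stochastic integral with respect to the coordinate process\<close>

definition elementary_integrand ::
  "real \<Rightarrow> real \<Rightarrow> ('n::finite) path measure \<Rightarrow> nat \<Rightarrow> (nat \<Rightarrow> real) \<Rightarrow>
   (nat \<Rightarrow> 'n path \<Rightarrow> real ^ 'n) \<Rightarrow> bool" where
  "elementary_integrand r T Q N t h \<longleftrightarrow>
     t 0 = r \<and> t N = T \<and> (\<forall>i<N. t i < t (Suc i)) \<and>
     (\<forall>i<N. h i \<in> borel_measurable (completed_filtration r Q (t i)) \<and> bounded (h i ` path_space r))"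

definition elementary_process ::
  "nat \<Rightarrow> (nat \<Rightarrow> real) \<Rightarrow> (nat \<Rightarrow> ('n::finite) path \<Rightarrow> real ^ 'n) \<Rightarrow> real \<Rightarrow> 'n path \<Rightarrow> real ^ 'n" where
  "elementary_process N t h u \<omega> = (\<Sum>i<N. indicator {t i<..t (Suc i)} u *\<^sub>R h i \<omega>)"

definition elementary_integral ::
  "nat \<Rightarrow> (nat \<Rightarrow> real) \<Rightarrow> (nat \<Rightarrow> ('n::finite) path \<Rightarrow> real ^ 'n) \<Rightarrow> 'n path \<Rightarrow> real" where
  "elementary_integral N t h \<omega> = (\<Sum>i<N. h i \<omega> \<bullet> (\<omega> (t (Suc i)) - \<omega> (t i)))"

text \<open>\<open>I\<close> is (a version of) the Ito integral of the predictable process \<open>H\<close> over \<open>[r, T]\<close> with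
  respect to the coordinate process under \<open>Q\<close>, a solution of the driftless martingale problem:
  then \<open>X\<close> is a martingale with \<open>d\<langle>X\<rangle> = a(u, X_u) du\<close>, and \<open>I\<close> is the limit in \<open>L^2(Q)\<close> of
  the integrals of elementary processes approximating \<open>H\<close> in \<open>L^2(d\<langle>X\<rangle> dQ)\<close>.\<close>

definition is_ito_integral ::
  "(real \<Rightarrow> real ^ 'n \<Rightarrow> real ^ 'n ^ 'n) \<Rightarrow> real \<Rightarrow> real \<Rightarrow> ('n::finite) path measure \<Rightarrow>
   (real \<Rightarrow> 'n path \<Rightarrow> real ^ 'n) \<Rightarrow> ('n path \<Rightarrow> real) \<Rightarrow> bool" where
  "is_ito_integral \<sigma> r T Q H I \<longleftrightarrow>
     I \<in> borel_measurable (completed_filtration r Q T) \<and>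
     (\<exists>N t h. (\<forall>k. elementary_integrand r T Q (N k) (t k) (h k)) \<and>
        ((\<lambda>k. \<integral>\<^sup>+\<omega>. (\<integral>\<^sup>+u\<in>{r<..T}.
             (let d = H u \<omega> - elementary_process (N k) (t k) (h k) u \<omega>
              in ennreal (d \<bullet> (diffusion_matrix \<sigma> u (\<omega> u) *v d))) \<partial>lborel) \<partial>completion Q)
           \<longlonglongrightarrow> 0) \<and>
        ((\<lambda>k. \<integral>\<^sup>+\<omega>. ennreal ((I \<omega> - elementary_integral (N k) (t k) (h k) \<omega>)\<^sup>2) \<partial>completion Q)
           \<longlonglongrightarrow> 0))"

definition ito_integral ::
  "(real \<Rightarrow> real ^ 'n \<Rightarrow> real ^ 'n ^ 'n) \<Rightarrow> real \<Rightarrow> real \<Rightarrow> ('n::finite) path measure \<Rightarrow>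
   (real \<Rightarrow> 'n path \<Rightarrow> real ^ 'n) \<Rightarrow> 'n path \<Rightarrow> real" where
  "ito_integral \<sigma> r T Q H = (SOME I. is_ito_integral \<sigma> r T Q H I)"

text \<open>The measure on \<open>completed_filtration r Q T\<close> with the Girsanov density of \<open>\<mu>\<close>. The integrand
  \<open>\<mu>\<^sup>* \<sigma>\<^sup>-\<^sup>1\<close> is a row vector, hence \<open>v*\<close>.\<close>

definition controlled_measure ::
  "(real \<Rightarrow> real ^ 'n \<Rightarrow> real ^ 'n ^ 'n) \<Rightarrow> real \<Rightarrow> real \<Rightarrow> ('n::finite) path measure \<Rightarrow>
   (real \<Rightarrow> 'n path \<Rightarrow> real ^ 'n) \<Rightarrow> 'n path measure" where
  "controlled_measure \<sigma> r T Q \<mu> =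
     density (restr_to_subalg (completion Q) (completed_filtration r Q T))
       (\<lambda>\<omega>. ennreal (exp (ito_integral \<sigma> r T Q (\<lambda>u \<omega>. \<mu> u \<omega> v* matrix_inv (\<sigma> u (\<omega> u))) \<omega>
                     - (LBINT u=r..T. (norm (\<mu> u \<omega>))\<^sup>2) / 2)))"

section \<open>Controls\<close>

definition multivalued_borel :: "(real \<Rightarrow> real ^ 'n \<Rightarrow> (real ^ ('n::finite)) set) \<Rightarrow> bool" where
  "multivalued_borel \<Lambda> \<longleftrightarrow>
     (\<forall>t\<ge>0. \<forall>x. 0 \<in> \<Lambda> t x) \<and> {(t, x, l). 0 \<le> t \<and> l \<in> \<Lambda> t x} \<in> sets borel"

definition selections ::
  "(real \<Rightarrow> real ^ 'n \<Rightarrow> (real ^ ('n::finite)) set) \<Rightarrow> (real \<Rightarrow> real ^ 'n \<Rightarrow> real ^ 'n) set" where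
  "selections \<Lambda> = {lam.
     (\<lambda>(t, x). lam t x) \<in> borel_measurable (restrict_space borel ({0..} \<times> UNIV)) \<and>
     bounded ((\<lambda>(t, x). lam t x) ` ({0..} \<times> UNIV)) \<and>
     (\<forall>t\<ge>0. \<forall>x. lam t x \<in> \<Lambda> t x)}"

definition polynomial_growth_on ::
  "(real \<Rightarrow> real ^ 'n \<Rightarrow> (real ^ ('n::finite)) set) \<Rightarrow>
   (real \<Rightarrow> real ^ 'n \<Rightarrow> real ^ 'n \<Rightarrow> ereal) \<Rightarrow> bool" where
  "polynomial_growth_on \<Lambda> g \<longleftrightarrow>
     (\<exists>C>0. \<exists>m::nat. \<forall>u\<ge>0. \<forall>x. (SUP l\<in>\<Lambda> u x. \<bar>g u x l\<bar>) \<le> ereal (C * (1 + norm x ^ m)))"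

text \<open>Values of a control outside \<open>(r, T]\<close> are irrelevant: everything below only uses the
  restriction of a control to \<open>(r, T]\<close>. The subdivision may be empty (\<open>N = 0\<close>) only if
  \<open>r = T\<close>.\<close>

definition simple_controls ::
  "(real \<Rightarrow> real ^ 'n \<Rightarrow> (real ^ 'n) set) \<Rightarrow> real \<Rightarrow> real \<Rightarrow> ('n::finite) path measure \<Rightarrow>
   (real \<Rightarrow> 'n path \<Rightarrow> real ^ 'n) set" where
  "simple_controls \<Lambda> r T Q = {\<mu>. \<exists>(N::nat) (s::nat \<Rightarrow> real) (J::nat \<Rightarrow> nat set) A lam.
     s 0 = r \<and> s N = T \<and> (\<forall>i<N. s i < s (Suc i)) \<and>
     (\<forall>i<N. finite (J i) \<and> disjoint_family_on (A i) (J i) \<and> (\<Union>j\<in>J i. A i j) = path_space r \<and>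
        (\<forall>j\<in>J i. A i j \<in> sets (completed_filtration r Q (s i)) \<and> lam i j \<in> selections \<Lambda> \<and>
           continuous_on ({0..} \<times> UNIV) (\<lambda>(t, x). lam i j t x)) \<and>
        (\<forall>u \<omega>. s i < u \<and> u \<le> s (Suc i) \<and> \<omega> \<in> path_space r \<longrightarrow>
           \<mu> u \<omega> = (\<Sum>j\<in>J i. indicator (A i j) \<omega> *\<^sub>R lam i j u (\<omega> u))))}"

section \<open>Conditional expectation and essential supremum\<close>

text \<open>\<open>E(Y^+ | F) - E(Y^- | F)\<close> for extended real \<open>Y\<close> (\<open>e2ennreal\<close> maps negative values to \<open>0\<close>);
  used only when \<open>Y^-\<close> is essentially bounded.\<close>

definition ereal_cond_exp :: "'a measure \<Rightarrow> 'a measure \<Rightarrow> ('a \<Rightarrow> ereal) \<Rightarrow> 'a \<Rightarrow> ereal" where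
  "ereal_cond_exp M F Y \<omega> =
     enn2ereal (nn_cond_exp M F (\<lambda>\<omega>. e2ennreal (Y \<omega>)) \<omega>)
     - enn2ereal (nn_cond_exp M F (\<lambda>\<omega>. e2ennreal (- Y \<omega>)) \<omega>)"

definition is_ess_sup :: "'a measure \<Rightarrow> ('a \<Rightarrow> ereal) set \<Rightarrow> ('a \<Rightarrow> ereal) \<Rightarrow> bool" where
  "is_ess_sup M S Z \<longleftrightarrow>
     Z \<in> borel_measurable M \<and> (\<forall>f\<in>S. AE \<omega> in M. f \<omega> \<le> Z \<omega>) \<and>
     (\<forall>Z'\<in>borel_measurable M. (\<forall>f\<in>S. AE \<omega> in M. f \<omega> \<le> Z' \<omega>) \<longrightarrow> (AE \<omega> in M. Z \<omega> \<le> Z' \<omega>))"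

definition ess_sup :: "'a measure \<Rightarrow> ('a \<Rightarrow> ereal) set \<Rightarrow> 'a \<Rightarrow> ereal" where
  "ess_sup M S = (SOME Z. is_ess_sup M S Z)"

section \<open>The dynamic process\<close>

text \<open>\<open>g\<close> is finite along every control in \<open>simple_controls \<Lambda> r T Q\<close>, since it is finite on
  \<open>\<Lambda>\<close>.\<close>

definition penalty ::
  "(real \<Rightarrow> real ^ 'n \<Rightarrow> real ^ 'n ^ 'n) \<Rightarrow> (real \<Rightarrow> real ^ 'n \<Rightarrow> real ^ 'n \<Rightarrow> ereal) \<Rightarrow>
   real \<Rightarrow> real \<Rightarrow> ('n::finite) path measure \<Rightarrow> ('n path \<Rightarrow> real) \<Rightarrow> ('n path \<Rightarrow> real) \<Rightarrow>
   (real \<Rightarrow> 'n path \<Rightarrow> real ^ 'n) \<Rightarrow> 'n path \<Rightarrow> real" where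
  "penalty \<sigma> g r T Q s t \<mu> =
     real_cond_exp (controlled_measure \<sigma> r T Q \<mu>) (stopped_algebra r Q s)
       (\<lambda>\<omega>. LBINT u=s \<omega>..t \<omega>. real_of_ereal (g u (\<omega> u) (\<mu> u \<omega>)))"

definition penalized_expectations ::
  "(real \<Rightarrow> real ^ 'n \<Rightarrow> real ^ 'n ^ 'n) \<Rightarrow> (real \<Rightarrow> real ^ 'n \<Rightarrow> (real ^ 'n) set) \<Rightarrow>
   (real \<Rightarrow> real ^ 'n \<Rightarrow> real ^ 'n \<Rightarrow> ereal) \<Rightarrow> real \<Rightarrow> real \<Rightarrow> ('n::finite) path measure \<Rightarrow>
   ('n path \<Rightarrow> real) \<Rightarrow> ('n path \<Rightarrow> real) \<Rightarrow> ('n path \<Rightarrow> ereal) \<Rightarrow> ('n path \<Rightarrow> ereal) set" where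
  "penalized_expectations \<sigma> \<Lambda> g r T Q s t Y =
     {(\<lambda>\<omega>. ereal_cond_exp (controlled_measure \<sigma> r T Q \<mu>) (stopped_algebra r Q s) Y \<omega>
          - ereal (penalty \<sigma> g r T Q s t \<mu> \<omega>)) | \<mu>. \<mu> \<in> simple_controls \<Lambda> r T Q}"

definition dynamic_process ::
  "(real \<Rightarrow> real ^ 'n \<Rightarrow> real ^ 'n ^ 'n) \<Rightarrow> (real \<Rightarrow> real ^ 'n \<Rightarrow> (real ^ 'n) set) \<Rightarrow>
   (real \<Rightarrow> real ^ 'n \<Rightarrow> real ^ 'n \<Rightarrow> ereal) \<Rightarrow> real \<Rightarrow> real \<Rightarrow> ('n::finite) path measure \<Rightarrow>
   ('n path \<Rightarrow> real) \<Rightarrow> ('n path \<Rightarrow> real) \<Rightarrow> ('n path \<Rightarrow> ereal) \<Rightarrow> 'n path \<Rightarrow> ereal" where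
  "dynamic_process \<sigma> \<Lambda> g r T Q s t Y =
     ess_sup (completion Q) (penalized_expectations \<sigma> \<Lambda> g r T Q s t Y)"

definition bounded_below_rvs :: "'a measure \<Rightarrow> 'a measure \<Rightarrow> ('a \<Rightarrow> ereal) set" where
  "bounded_below_rvs Q G = {Y \<in> borel_measurable G. \<exists>c::real. AE \<omega> in Q. ereal c \<le> Y \<omega>}"

text \<open>Properties of one map \<open>P\<close> on the random variables essentially bounded from below that are
  measurable for \<open>G\<close>, up to \<open>Q\<close>-null sets.\<close>

definition monotone_operator ::
  "'a measure \<Rightarrow> 'a measure \<Rightarrow> (('a \<Rightarrow> ereal) \<Rightarrow> 'a \<Rightarrow> ereal) \<Rightarrow> bool" where
  "monotone_operator Q G P \<longleftrightarrow>
     (\<forall>Y\<in>bounded_below_rvs Q G. \<forall>Y'\<in>bounded_below_rvs Q G.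
        (AE \<omega> in Q. Y \<omega> \<le> Y' \<omega>) \<longrightarrow> (AE \<omega> in Q. P Y \<omega> \<le> P Y' \<omega>))"

definition convex_operator ::
  "'a measure \<Rightarrow> 'a measure \<Rightarrow> (('a \<Rightarrow> ereal) \<Rightarrow> 'a \<Rightarrow> ereal) \<Rightarrow> bool" where
  "convex_operator Q G P \<longleftrightarrow>
     (\<forall>Y\<in>bounded_below_rvs Q G. \<forall>Y'\<in>bounded_below_rvs Q G. \<forall>c\<in>{0..1::real}.
        AE \<omega> in Q. P (\<lambda>\<omega>. ereal c * Y \<omega> + ereal (1 - c) * Y' \<omega>) \<omega>
          \<le> ereal c * P Y \<omega> + ereal (1 - c) * P Y' \<omega>)"

definition continuous_from_below ::
  "'a measure \<Rightarrow> 'a measure \<Rightarrow> (('a \<Rightarrow> ereal) \<Rightarrow> 'a \<Rightarrow> ereal) \<Rightarrow> bool" where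
  "continuous_from_below Q G P \<longleftrightarrow>
     (\<forall>Y Z. (\<forall>k::nat. Y k \<in> bounded_below_rvs Q G) \<and> Z \<in> bounded_below_rvs Q G \<and>
        (AE \<omega> in Q. incseq (\<lambda>k. Y k \<omega>) \<and> (\<lambda>k. Y k \<omega>) \<longlonglongrightarrow> Z \<omega>) \<longrightarrow>
        (AE \<omega> in Q. incseq (\<lambda>k. P (Y k) \<omega>) \<and> (\<lambda>k. P (Y k) \<omega>) \<longlonglongrightarrow> P Z \<omega>))"

text \<open>\<open>G\<close> is the target \<open>\<sigma>\<close>-algebra here and \<open>G'\<close> the source one.\<close>

definition translation_invariant ::
  "'a measure \<Rightarrow> 'a measure \<Rightarrow> 'a measure \<Rightarrow> (('a \<Rightarrow> ereal) \<Rightarrow> 'a \<Rightarrow> ereal) \<Rightarrow> bool" where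
  "translation_invariant Q G G' P \<longleftrightarrow>
     (\<forall>Y\<in>bounded_below_rvs Q G'. \<forall>Z\<in>borel_measurable G. bounded (Z ` space G) \<longrightarrow>
        (AE \<omega> in Q. P (\<lambda>\<omega>. Y \<omega> + ereal (Z \<omega>)) \<omega> = P Y \<omega> + ereal (Z \<omega>)))"

definition convex_dynamic_process ::
  "real \<Rightarrow> real \<Rightarrow> ('n::finite) path measure \<Rightarrow>
   (('n path \<Rightarrow> real) \<Rightarrow> ('n path \<Rightarrow> real) \<Rightarrow> ('n path \<Rightarrow> ereal) \<Rightarrow> 'n path \<Rightarrow> ereal) \<Rightarrow> bool" where
  "convex_dynamic_process r T Q P \<longleftrightarrow>
     (\<forall>s\<in>simple_stopping_times r T Q. \<forall>t\<in>simple_stopping_times r T Q.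
        (\<forall>\<omega>\<in>path_space r. s \<omega> \<le> t \<omega>) \<longrightarrow>
          monotone_operator Q (stopped_algebra r Q t) (P s t) \<and>
          translation_invariant Q (stopped_algebra r Q s) (stopped_algebra r Q t) (P s t) \<and>
          convex_operator Q (stopped_algebra r Q t) (P s t) \<and>
          continuous_from_below Q (stopped_algebra r Q t) (P s t))"

definition time_consistent ::
  "real \<Rightarrow> real \<Rightarrow> ('n::finite) path measure \<Rightarrow>
   (('n path \<Rightarrow> real) \<Rightarrow> ('n path \<Rightarrow> real) \<Rightarrow> ('n path \<Rightarrow> ereal) \<Rightarrow> 'n path \<Rightarrow> ereal) \<Rightarrow> bool" where
  "time_consistent r T Q P \<longleftrightarrow>
     (\<forall>s0\<in>simple_stopping_times r T Q. \<forall>s\<in>simple_stopping_times r T Q.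
      \<forall>t\<in>simple_stopping_times r T Q.
        (\<forall>\<omega>\<in>path_space r. s0 \<omega> \<le> s \<omega> \<and> s \<omega> \<le> t \<omega>) \<longrightarrow>
          (\<forall>Y\<in>bounded_below_rvs Q (stopped_algebra r Q t).
             AE \<omega> in Q. P s0 s (P s t Y) \<omega> = P s0 t Y \<omega>))"

end

theory Submission
  imports Defs
begin

text \<open>Elementary integrands have exponential martingales; comparing \<open>exp (\<epsilon> J) + exp (- \<epsilon> J)\<close> with its
  expansion yields the Ito isometry bound and shows that the exponential martingale property passes
  to mean square limits. Hence the Girsanov density of a control restricted to \<open>(s, t]\<close> has unit conditional
  expectation given the past at \<open>s\<close>, is multiplicative in the interval and depends on the control only locally. By
  Bayes' formula the conditional expectation at a stopping time \<open>s\<close> under a controlled measure involves only the control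
  after \<open>s\<close>, and controls can be pasted at stopping times. Pasting makes the family of penalized
  expectations directed, so that the essential supremum is an increasing limit starting from the zero
  control, whose value is bounded below. All properties of the dynamic process, in particular time
  consistency, then follow from the tower property and monotone convergence.\<close>

section \<open>Densities with unit conditional expectation\<close>

text \<open>Ellipticity is assumed only pointwise, so \<open>matrix_inv (\<sigma> u x)\<close>, and
  with it the Girsanov integrand, may be unbounded. What stays bounded is the integrand times
  \<sigma>, which is the control itself; integrands are therefore measured by that product
  throughout. The martingale problem supplies nothing but exponential martingales with a constant
  exponent \<theta> for the uncompleted filtration, and the integral of the statement is a
  \<open>SOME\<close>, so its existence and its uniqueness up to null sets have to be derived from
  those exponentials; sharp constants never matter for this. Controls and stopping times take their
  decisions at finitely many times, hence densities over intervals with deterministic ends suffice.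
  All controlled measures share their null sets, so every almost sure statement can be moved to
  \<open>completion Q\<close>. The cost of a general control is only known to be integrable, whereas
  that of the zero control is bounded above, which is why monotone limits of values have to start
  there.\<close>

definition cond_unit :: "'a measure \<Rightarrow> 'a measure \<Rightarrow> ('a \<Rightarrow> ennreal) \<Rightarrow> bool" where
  "cond_unit M F D \<longleftrightarrow> D \<in> borel_measurable M \<and> (\<forall>A\<in>sets F. (\<integral>\<^sup>+x\<in>A. D x \<partial>M) = emeasure M A)"

text \<open>\<open>cond_unit\<close> expresses E[D | F] = 1 through integrals over sets of F,
  without choosing a conditional expectation: \<open>density M D\<close> and M have the same
  restriction to F, so functions measurable for F have equal integrals under both.\<close>

lemma cond_unit_nn_integral:
  assumes F: "subalgebra M F" and D: "cond_unit M F D" and Z: "Z \<in> borel_measurable F"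
  shows "(\<integral>\<^sup>+x. Z x * D x \<partial>M) = (\<integral>\<^sup>+x. Z x \<partial>M)"
proof -
  have [measurable]: "D \<in> borel_measurable M" "Z \<in> borel_measurable M"
    using D Z measurable_from_subalg[OF F] by (auto simp: cond_unit_def)
  have F': "subalgebra (density M D) F" using F by (simp add: subalgebra_def)
  have "restr_to_subalg (density M D) F = restr_to_subalg M F"
  proof (rule measure_eqI)
    show "sets (restr_to_subalg (density M D) F) = sets (restr_to_subalg M F)"
      using F F' by (simp add: sets_restr_to_subalg)
    fix A assume "A \<in> sets (restr_to_subalg (density M D) F)"
    then have A: "A \<in> sets F" using F' by (simp add: sets_restr_to_subalg)
    then have [measurable]: "A \<in> sets M" using F by (auto simp: subalgebra_def)
    show "emeasure (restr_to_subalg (density M D) F) A = emeasure (restr_to_subalg M F) A"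
      using D A F F' by (simp add: emeasure_restr_to_subalg emeasure_density cond_unit_def)
  qed
  then have "(\<integral>\<^sup>+x. Z x \<partial>density M D) = (\<integral>\<^sup>+x. Z x \<partial>M)"
    by (metis nn_integral_subalgebra2 F F' Z)
  then show ?thesis by (simp add: nn_integral_density mult.commute)
qed

text \<open>The tower property for densities: E is integrated out first, given the larger algebra G,
  for which D is known. This is what lets densities over consecutive intervals be
  multiplied.\<close>

lemma cond_unit_mult:
  assumes F: "subalgebra M F" "subalgebra M G" "sets F \<subseteq> sets G"
    and D: "cond_unit M F D" "D \<in> borel_measurable G" and E: "cond_unit M G E"
  shows "cond_unit M F (\<lambda>x. D x * E x)"
proof -
  have sub: "subalgebra G F" using F by (auto simp: subalgebra_def)
  have [measurable]: "D \<in> borel_measurable M" "E \<in> borel_measurable M"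
    using D E by (auto simp: cond_unit_def)
  have "(\<integral>\<^sup>+x\<in>A. D x * E x \<partial>M) = emeasure M A" if A: "A \<in> sets F" for A
  proof -
    have A': "A \<in> sets G" using A F by auto
    have "(\<integral>\<^sup>+x\<in>A. D x * E x \<partial>M) = (\<integral>\<^sup>+x. (D x * indicator A x) * E x \<partial>M)"
      by (simp add: mult_ac)
    also have "\<dots> = (\<integral>\<^sup>+x. D x * indicator A x \<partial>M)"
      by (rule cond_unit_nn_integral[OF F(2) E]) (use D(2) A' in measurable)
    finally show ?thesis using D(1) A by (simp add: cond_unit_def)
  qed
  then show ?thesis by (auto simp: cond_unit_def)
qed

lemma cond_unit_cong_AE:
  assumes "cond_unit M F D" "E \<in> borel_measurable M" "AE x in M. D x = E x"
  shows "cond_unit M F E"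
proof -
  have "(\<integral>\<^sup>+x\<in>A. D x \<partial>M) = (\<integral>\<^sup>+x\<in>A. E x \<partial>M)" for A
    by (rule nn_integral_cong_AE) (use assms(3) in auto)
  with assms show ?thesis by (auto simp: cond_unit_def)
qed

text \<open>Fatou gives one inequality. For the other, the second moment bound plays the part of
  uniform integrability: cutting d k off at height R loses at most C / R in the integral, uniformly
  in k, and the truncated functions converge by dominated convergence.\<close>

lemma cond_unit_limit:
  fixes d :: "nat \<Rightarrow> 'a \<Rightarrow> real"
  assumes "finite_measure M" and F: "subalgebra M F"
    and d: "\<And>k. cond_unit M F (\<lambda>x. ennreal (d k x))" and [measurable]: "\<And>k. d k \<in> borel_measurable M"
    and nonneg: "\<And>k x. 0 \<le> d k x"
    and C: "\<And>k. (\<integral>\<^sup>+x. ennreal ((d k x)\<^sup>2) \<partial>M) \<le> ennreal C"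
    and [measurable]: "D \<in> borel_measurable M"
    and lim: "AE x in M. (\<lambda>k. d k x) \<longlonglongrightarrow> D x"
  shows "cond_unit M F (\<lambda>x. ennreal (D x))"
  unfolding cond_unit_def
proof (intro conjI ballI antisym)
  interpret finite_measure M by fact
  fix A assume A: "A \<in> sets F"
  then have [measurable]: "A \<in> sets M" using F by (auto simp: subalgebra_def)
  have eq: "(\<integral>\<^sup>+x\<in>A. ennreal (d k x) \<partial>M) = emeasure M A" for k
    using d[of k] A by (simp add: cond_unit_def)
  have "(\<integral>\<^sup>+x\<in>A. ennreal (D x) \<partial>M) = (\<integral>\<^sup>+x. liminf (\<lambda>k. ennreal (d k x) * indicator A x) \<partial>M)"
  proof (rule nn_integral_cong_AE, use lim in eventually_elim)
    fix x assume "(\<lambda>k. d k x) \<longlonglongrightarrow> D x"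
    then have "(\<lambda>k. ennreal (d k x) * indicator A x) \<longlonglongrightarrow> ennreal (D x) * indicator A x"
      by (auto simp: indicator_def)
    then show "ennreal (D x) * indicator A x = liminf (\<lambda>k. ennreal (d k x) * indicator A x)"
      by (simp add: lim_imp_Liminf)
  qed
  also have "\<dots> \<le> liminf (\<lambda>k. (\<integral>\<^sup>+x\<in>A. ennreal (d k x) \<partial>M))"
    by (rule nn_integral_liminf) auto
  also have "\<dots> = emeasure M A" by (simp add: eq Liminf_const)
  finally show "(\<integral>\<^sup>+x\<in>A. ennreal (D x) \<partial>M) \<le> emeasure M A" .
  have bnd: "emeasure M A \<le> (\<integral>\<^sup>+x\<in>A. ennreal (D x) \<partial>M) + ennreal (C / R)" if R: "R > 0" for R
  proof -
    have "(\<lambda>k. (\<integral>\<^sup>+x. ennreal (min (d k x) R) * indicator A x \<partial>M)) \<longlonglongrightarrow>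
        (\<integral>\<^sup>+x. ennreal (min (D x) R) * indicator A x \<partial>M)"
    proof (rule nn_integral_dominated_convergence[where w = "\<lambda>_. ennreal R"])
      show "AE x in M. ennreal (min (d k x) R) * indicator A x \<le> ennreal R" for k
        by (auto simp: indicator_def intro!: ennreal_leI)
      show "AE x in M. (\<lambda>k. ennreal (min (d k x) R) * indicator A x) \<longlonglongrightarrow> ennreal (min (D x) R) * indicator A x"
        using lim by eventually_elim (auto simp: indicator_def intro!: tendsto_ennrealI tendsto_min)
      show "(\<integral>\<^sup>+ x. ennreal R \<partial>M) < \<infinity>" by (simp add: emeasure_eq_measure ennreal_mult_less_top)
    qed auto
    then have "(\<lambda>k. (\<integral>\<^sup>+x. ennreal (min (d k x) R) * indicator A x \<partial>M) + ennreal (C / R)) \<longlonglongrightarrow>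
        (\<integral>\<^sup>+x. ennreal (min (D x) R) * indicator A x \<partial>M) + ennreal (C / R)"
      by (intro tendsto_add) auto
    moreover have "emeasure M A \<le> (\<integral>\<^sup>+x. ennreal (min (d k x) R) * indicator A x \<partial>M) + ennreal (C / R)" for k
    proof -
      \<comment> \<open>Where d exceeds R, the ratio d / R exceeds 1, so d is at most d^2 / R
        there.\<close>
      have "d k x \<le> min (d k x) R + (d k x)\<^sup>2 / R" for x
        using R nonneg[of k x] mult_right_mono[of R "d k x" "d k x"]
        by (auto simp: min_def field_simps power2_eq_square not_le intro: add_increasing)
      then have "ennreal (d k x) * indicator A x \<le> ennreal (min (d k x) R) * indicator A x + ennreal (1 / R) * ennreal ((d k x)\<^sup>2)" for x
        using R nonneg[of k x]
        by (auto simp: indicator_def ennreal_mult[symmetric] ennreal_plus[symmetric] simp del: ennreal_plus intro!: ennreal_leI)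
      then have "emeasure M A \<le> (\<integral>\<^sup>+x. ennreal (min (d k x) R) * indicator A x + ennreal (1 / R) * ennreal ((d k x)\<^sup>2) \<partial>M)"
        unfolding eq[of k, symmetric] by (intro nn_integral_mono)
      also have "\<dots> = (\<integral>\<^sup>+x. ennreal (min (d k x) R) * indicator A x \<partial>M) + ennreal (1 / R) * (\<integral>\<^sup>+x. ennreal ((d k x)\<^sup>2) \<partial>M)"
        by (simp add: nn_integral_add nn_integral_cmult)
      also have "\<dots> \<le> (\<integral>\<^sup>+x. ennreal (min (d k x) R) * indicator A x \<partial>M) + ennreal (1 / R) * ennreal C"
        by (intro add_left_mono mult_left_mono C) auto
      finally show ?thesis using R by (simp add: ennreal_mult'[symmetric])
    qed
    ultimately have "emeasure M A \<le> (\<integral>\<^sup>+x. ennreal (min (D x) R) * indicator A x \<partial>M) + ennreal (C / R)"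
      by (meson LIMSEQ_le_const)
    also have "\<dots> \<le> (\<integral>\<^sup>+x\<in>A. ennreal (D x) \<partial>M) + ennreal (C / R)"
      by (intro add_right_mono nn_integral_mono) (auto simp: indicator_def intro!: ennreal_leI)
    finally show ?thesis .
  qed
  have "(\<lambda>n. C / real (Suc n)) \<longlonglongrightarrow> 0" by real_asymp
  then have "(\<lambda>n. (\<integral>\<^sup>+x\<in>A. ennreal (D x) \<partial>M) + ennreal (C / real (Suc n))) \<longlonglongrightarrow> (\<integral>\<^sup>+x\<in>A. ennreal (D x) \<partial>M) + ennreal 0"
    by (intro tendsto_add tendsto_ennrealI) auto
  then show "emeasure M A \<le> (\<integral>\<^sup>+x\<in>A. ennreal (D x) \<partial>M)"
    using LIMSEQ_le_const[of _ _ "emeasure M A"] bnd by fastforce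
qed simp

section \<open>Mean square convergence\<close>

lemma AE_summable_of_nn_integral:
  fixes w :: "nat \<Rightarrow> 'a \<Rightarrow> real"
  assumes [measurable]: "\<And>k. w k \<in> borel_measurable M" and "\<And>k x. 0 \<le> w k x"
    and "\<And>k. (\<integral>\<^sup>+x. ennreal (w k x) \<partial>M) \<le> ennreal (b k)" "summable b" "\<And>k. 0 \<le> b k"
  shows "AE x in M. summable (\<lambda>k. w k x)"
proof -
  have "(\<integral>\<^sup>+x. (\<Sum>k. ennreal (w k x)) \<partial>M) = (\<Sum>k. \<integral>\<^sup>+x. ennreal (w k x) \<partial>M)"
    by (rule nn_integral_suminf) simp
  also have "\<dots> \<le> (\<Sum>k. ennreal (b k))" by (intro suminf_le assms) auto
  also have "\<dots> < \<infinity>" using assms(4,5) by (simp add: ennreal_suminf_neq_top less_top)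
  finally have "AE x in M. (\<Sum>k. ennreal (w k x)) \<noteq> \<infinity>"
    by (intro nn_integral_PInf_AE) auto
  then show ?thesis
    by eventually_elim (intro summable_suminf_not_top assms, auto)
qed

text \<open>The indices are chosen recursively so that the n-th integral is at most 2^-n; summable
  integrals force summability, hence convergence to 0, at almost every point.\<close>

lemma AE_subseq_of_nn_integral:
  fixes w :: "nat \<Rightarrow> 'a \<Rightarrow> real"
  assumes [measurable]: "\<And>k. w k \<in> borel_measurable M" and nn: "\<And>k x. 0 \<le> w k x"
    and lim: "(\<lambda>k. \<integral>\<^sup>+x. ennreal (w k x) \<partial>M) \<longlonglongrightarrow> 0"
  shows "\<exists>s. strict_mono s \<and> (AE x in M. (\<lambda>k. w (s k) x) \<longlonglongrightarrow> 0)"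
proof -
  have "\<forall>n m. \<exists>k. (m::nat) < k \<and> (\<integral>\<^sup>+x. ennreal (w k x) \<partial>M) \<le> ennreal ((1/2)^n)"
  proof (intro allI)
    fix n m :: nat
    have "eventually (\<lambda>k. (\<integral>\<^sup>+x. ennreal (w k x) \<partial>M) < ennreal ((1/2)^n)) sequentially"
      by (rule order_tendstoD(2)[OF lim]) (simp add: zero_less_power)
    then have "eventually (\<lambda>k. (\<integral>\<^sup>+x. ennreal (w k x) \<partial>M) < ennreal ((1/2)^n) \<and> m < k) sequentially"
      by (intro eventually_conj eventually_gt_at_top)
    then show "\<exists>k. m < k \<and> (\<integral>\<^sup>+x. ennreal (w k x) \<partial>M) \<le> ennreal ((1/2)^n)"
      by (metis (no_types, lifting) eventually_sequentially less_imp_le order_refl)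
  qed
  then obtain h where h: "\<And>n m. m < h n m" "\<And>n m. (\<integral>\<^sup>+x. ennreal (w (h n m) x) \<partial>M) \<le> ennreal ((1/2)^n)"
    by metis
  define s where "s = rec_nat (h 0 0) (\<lambda>n m. h (Suc n) m)"
  have s: "s (Suc n) = h (Suc n) (s n)" "s 0 = h 0 0" for n by (auto simp: s_def)
  have "strict_mono s" by (rule strict_mono_Suc_iff[THEN iffD2]) (auto simp: s h)
  moreover have "(\<integral>\<^sup>+x. ennreal (w (s n) x) \<partial>M) \<le> ennreal ((1/2)^n)" for n
    by (cases n) (auto simp: s simp del: power_Suc intro: h(2) order_trans[OF h(2)])
  then have "AE x in M. summable (\<lambda>k. w (s k) x)"
    by (intro AE_summable_of_nn_integral[where b = "\<lambda>n. (1/2)^n"]) (auto simp: nn)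
  then have "AE x in M. (\<lambda>k. w (s k) x) \<longlonglongrightarrow> 0"
    by eventually_elim (rule summable_LIMSEQ_zero)
  ultimately show ?thesis by auto
qed

text \<open>The Riesz-Fischer argument, with attention to F: the limit is taken pointwise by
  \<open>lim\<close> along a subsequence, which yields a function measurable for F itself and not
  merely for M. Fatou then bounds its distance to each J n.\<close>

lemma L2_complete:
  fixes J :: "nat \<Rightarrow> 'a \<Rightarrow> real"
  assumes "finite_measure M" and F: "subalgebra M F" and JF[measurable]: "\<And>n. J n \<in> borel_measurable F"
    and cauchy: "\<And>e. e > 0 \<Longrightarrow> \<exists>N. \<forall>m\<ge>N. \<forall>n\<ge>N. (\<integral>\<^sup>+x. ennreal ((J m x - J n x)\<^sup>2) \<partial>M) < ennreal e"
  shows "\<exists>I\<in>borel_measurable F. (\<lambda>n. \<integral>\<^sup>+x. ennreal ((I x - J n x)\<^sup>2) \<partial>M) \<longlonglongrightarrow> 0"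
proof -
  interpret finite_measure M by fact
  have [measurable]: "J n \<in> borel_measurable M" for n
    by (rule measurable_from_subalg[OF F]) simp
  have "\<forall>k. \<exists>N. \<forall>m\<ge>N. \<forall>n\<ge>N. (\<integral>\<^sup>+x. ennreal ((J m x - J n x)\<^sup>2) \<partial>M) < ennreal ((1/4)^k)"
    by (intro allI cauchy) simp
  then obtain N where N: "\<And>k m n. N k \<le> m \<Longrightarrow> N k \<le> n \<Longrightarrow> (\<integral>\<^sup>+x. ennreal ((J m x - J n x)\<^sup>2) \<partial>M) < ennreal ((1/4)^k)"
    by metis
  define s where "s k = (\<Sum>i\<le>k. N i) + k" for k
  have s: "N k \<le> s k" "N k \<le> s (Suc k)" "k \<le> s k" for k
    by (auto simp: s_def intro: order_trans[OF member_le_sum[of k "{..k}" N]])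
  define w where "w k x = \<bar>J (s (Suc k)) x - J (s k) x\<bar>" for k x
  have [measurable]: "w k \<in> borel_measurable M" for k unfolding w_def by measurable
  have "(\<integral>\<^sup>+x. ennreal (w k x) \<partial>M) \<le> ennreal ((1 + measure M (space M)) * (1/2)^k)" for k
  proof -
    \<comment> \<open>A weighted arithmetic-geometric mean inequality turns mean square bounds into
      first moments. The squares have integral at most 4^-k, so both terms on the right are of order
      2^-k and summable.\<close>
    have "w k x \<le> 2^k * (w k x)\<^sup>2 + (1/2)^k" for x
    proof -
      have "0 \<le> (2^k * w k x - 1)\<^sup>2" by simp
      then have "2 * (2^k * w k x) \<le> (2^k * w k x)\<^sup>2 + 1" by (simp add: power2_diff)
      moreover have "0 \<le> 2^k * w k x" by (simp add: w_def)
      ultimately have "2^k * w k x \<le> (2^k * w k x)\<^sup>2 + 1" by linarith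
      then have "w k x \<le> ((2^k * w k x)\<^sup>2 + 1) / 2^k" by (simp add: field_simps)
      also have "\<dots> = 2^k * (w k x)\<^sup>2 + (1/2)^k" by (simp add: field_simps power2_eq_square power_one_over)
      finally show ?thesis .
    qed
    then have "ennreal (w k x) \<le> ennreal (2^k) * ennreal ((J (s (Suc k)) x - J (s k) x)\<^sup>2) + ennreal ((1/2)^k)" for x
      by (subst ennreal_mult[symmetric]) (auto simp: w_def ennreal_plus[symmetric] simp del: ennreal_plus intro!: ennreal_leI)
    then have "(\<integral>\<^sup>+x. ennreal (w k x) \<partial>M) \<le> (\<integral>\<^sup>+x. ennreal (2^k) * ennreal ((J (s (Suc k)) x - J (s k) x)\<^sup>2) + ennreal ((1/2)^k) \<partial>M)"
      by (rule nn_integral_mono)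
    also have "\<dots> = ennreal (2^k) * (\<integral>\<^sup>+x. ennreal ((J (s (Suc k)) x - J (s k) x)\<^sup>2) \<partial>M) + ennreal ((1/2)^k) * emeasure M (space M)"
      by (simp add: nn_integral_add nn_integral_cmult)
    also have "\<dots> \<le> ennreal (2^k) * ennreal ((1/4)^k) + ennreal ((1/2)^k) * emeasure M (space M)"
      by (intro add_right_mono mult_left_mono less_imp_le[OF N] s) auto
    also have "\<dots> = ennreal (2^k * (1/4)^k + (1/2)^k * measure M (space M))"
      by (simp add: emeasure_eq_measure ennreal_mult[symmetric] ennreal_plus[symmetric] del: ennreal_plus)
    also have "(2::real)^k * (1/4)^k = (1/2)^k" by (simp add: power_mult_distrib[symmetric])
    finally show ?thesis by (simp add: algebra_simps)
  qed
  then have "AE x in M. summable (\<lambda>k. w k x)"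
    by (rule AE_summable_of_nn_integral[rotated 2]) (auto simp: w_def intro!: summable_mult add_nonneg_nonneg)
  then have conv: "AE x in M. convergent (\<lambda>k. J (s k) x)"
  proof eventually_elim
    fix x assume "summable (\<lambda>k. w k x)"
    then have "summable (\<lambda>k. J (s (Suc k)) x - J (s k) x)"
      unfolding w_def by (rule summable_rabs_cancel)
    then have "convergent (\<lambda>n. (\<Sum>k<n. J (s (Suc k)) x - J (s k) x))"
      by (simp add: summable_iff_convergent)
    then have "convergent (\<lambda>n. J (s n) x - J (s 0) x)"
      by (simp only: sum_lessThan_telescope[of "\<lambda>k. J (s k) x"])
    then show "convergent (\<lambda>k. J (s k) x)"
      by (simp add: convergent_diff_const_right_iff)
  qed
  define I where "I x = lim (\<lambda>k. J (s k) x)" for x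
  have [measurable]: "I \<in> borel_measurable F" unfolding I_def by measurable
  have [measurable]: "I \<in> borel_measurable M" by (rule measurable_from_subalg[OF F]) simp
  have bnd: "(\<integral>\<^sup>+x. ennreal ((I x - J n x)\<^sup>2) \<partial>M) \<le> ennreal e"
    if n: "\<And>m. m \<ge> n \<Longrightarrow> (\<integral>\<^sup>+x. ennreal ((J m x - J n x)\<^sup>2) \<partial>M) < ennreal e" for n e
  proof -
    have "(\<integral>\<^sup>+x. ennreal ((I x - J n x)\<^sup>2) \<partial>M) = (\<integral>\<^sup>+x. liminf (\<lambda>k. ennreal ((J (s k) x - J n x)\<^sup>2)) \<partial>M)"
    proof (rule nn_integral_cong_AE, use conv in eventually_elim)
      fix x assume "convergent (\<lambda>k. J (s k) x)"
      then have "(\<lambda>k. J (s k) x) \<longlonglongrightarrow> I x" by (simp add: I_def convergent_LIMSEQ_iff)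
      then have "(\<lambda>k. ennreal ((J (s k) x - J n x)\<^sup>2)) \<longlonglongrightarrow> ennreal ((I x - J n x)\<^sup>2)"
        by (intro tendsto_ennrealI tendsto_power tendsto_diff) auto
      then show "ennreal ((I x - J n x)\<^sup>2) = liminf (\<lambda>k. ennreal ((J (s k) x - J n x)\<^sup>2))"
        by (rule lim_imp_Liminf[OF trivial_limit_sequentially, symmetric])
    qed
    also have "\<dots> \<le> liminf (\<lambda>k. \<integral>\<^sup>+x. ennreal ((J (s k) x - J n x)\<^sup>2) \<partial>M)"
      by (rule nn_integral_liminf) auto
    also have "\<dots> \<le> ennreal e"
    proof (rule Liminf_le)
      show "\<forall>\<^sub>F k in sequentially. (\<integral>\<^sup>+x. ennreal ((J (s k) x - J n x)\<^sup>2) \<partial>M) \<le> ennreal e"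
        using eventually_ge_at_top[of n]
        by eventually_elim (intro less_imp_le[OF n] order_trans[OF _ s(3)])
    qed auto
    finally show ?thesis .
  qed
  have "(\<lambda>n. \<integral>\<^sup>+x. ennreal ((I x - J n x)\<^sup>2) \<partial>M) \<longlonglongrightarrow> 0"
  proof (rule order_tendstoI)
    fix a :: ennreal assume "0 < a"
    then obtain e :: real where e: "0 < e" "ennreal e < a"
      by (metis dense ennreal_cases ennreal_less_zero_iff not_less_zero top_greatest leD less_ennreal.rep_eq)
    obtain N where "\<forall>m\<ge>N. \<forall>n\<ge>N. (\<integral>\<^sup>+x. ennreal ((J m x - J n x)\<^sup>2) \<partial>M) < ennreal e" using cauchy[OF e(1)] by auto
    then have "(\<integral>\<^sup>+x. ennreal ((I x - J n x)\<^sup>2) \<partial>M) \<le> ennreal e" if "n \<ge> N" for n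
      using that by (intro bnd) auto
    then show "\<forall>\<^sub>F n in sequentially. (\<integral>\<^sup>+x. ennreal ((I x - J n x)\<^sup>2) \<partial>M) < a"
      unfolding eventually_sequentially using e(2) by (meson le_less_trans)
  qed simp
  then show ?thesis by auto
qed

section \<open>Essential suprema\<close>

text \<open>For each rational level q, a countable subfamily is picked for which the set where some
  member exceeds q has maximal measure. No further member of S can enlarge that set by more than a
  null set, so the union of these subfamilies over q dominates every member almost
  everywhere.\<close>

lemma is_ess_sup_countable:
  assumes "finite_measure M" and S: "S \<subseteq> borel_measurable M"
  shows "\<exists>C\<subseteq>S. countable C \<and> is_ess_sup M S (\<lambda>x. SUP f\<in>C. f x)"
proof -
  interpret finite_measure M by fact
  define U where "U C q = (\<Union>f\<in>C. {x\<in>space M. ereal (of_rat q) < f x})" for C :: "('a \<Rightarrow> ereal) set" and q :: rat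
  have Um: "U C q \<in> sets M" if "C \<subseteq> S" "countable C" for C q
    unfolding U_def
  proof (rule sets.countable_UN'[OF that(2)], safe)
    fix f assume "f \<in> C"
    then have [measurable]: "f \<in> borel_measurable M" using S that by auto
    show "{x \<in> space M. ereal (real_of_rat q) < f x} \<in> sets M" by measurable
  qed
  have "\<exists>C. countable C \<and> C \<subseteq> S \<and> emeasure M (U C q) = (SUP C\<in>{C. countable C \<and> C \<subseteq> S}. emeasure M (U C q))" for q
  proof -
    have "{C. countable C \<and> C \<subseteq> S} \<noteq> {}" by auto
    then obtain f :: "nat \<Rightarrow> ennreal" where f: "range f \<subseteq> (\<lambda>C. emeasure M (U C q)) ` {C. countable C \<and> C \<subseteq> S}"
      "(SUP C\<in>{C. countable C \<and> C \<subseteq> S}. emeasure M (U C q)) = (SUP i. f i)"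
      using ennreal_SUP_countable_SUP[of "{C. countable C \<and> C \<subseteq> S}" "\<lambda>C. emeasure M (U C q)"] by auto
    then have "\<forall>i. \<exists>C. countable C \<and> C \<subseteq> S \<and> f i = emeasure M (U C q)" by blast
    then obtain C where C: "\<And>i. countable (C i)" "\<And>i. C i \<subseteq> S" "\<And>i. f i = emeasure M (U (C i) q)" by metis
    let ?C = "\<Union>i. C i"
    have "f i \<le> emeasure M (U ?C q)" for i
      unfolding C(3) by (intro emeasure_mono Um) (use C in \<open>auto simp: U_def\<close>)
    then have "(SUP i. f i) \<le> emeasure M (U ?C q)" by (rule SUP_least)
    moreover have "emeasure M (U ?C q) \<le> (SUP C\<in>{C. countable C \<and> C \<subseteq> S}. emeasure M (U C q))"
      by (rule SUP_upper) (use C in auto)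
    ultimately show ?thesis using f(2) C by (intro exI[of _ ?C]) auto
  qed
  from choice[OF allI, OF this] obtain D where D': "\<forall>q. countable (D q) \<and> D q \<subseteq> S \<and>
    emeasure M (U (D q) q) = (SUP C\<in>{C. countable C \<and> C \<subseteq> S}. emeasure M (U C q))" ..
  then have D: "countable (D q)" "D q \<subseteq> S"
    "emeasure M (U (D q) q) = (SUP C\<in>{C. countable C \<and> C \<subseteq> S}. emeasure M (U C q))" for q by simp_all
  let ?C = "\<Union>q. D q"
  have C: "countable ?C" "?C \<subseteq> S" using D by auto
  have [measurable]: "(\<lambda>x. SUP f\<in>?C. f x) \<in> borel_measurable M"
    by (rule borel_measurable_SUP[OF C(1)]) (use C S in auto)
  have le: "AE x in M. f x \<le> (SUP f\<in>?C. f x)" if f: "f \<in> S" for f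
  proof -
    have [measurable]: "f \<in> borel_measurable M" using f S by auto
    have "AE x in M. ereal (of_rat q) < f x \<longrightarrow> x \<in> U (D q) q" for q
    proof -
      let ?E = "{x\<in>space M. ereal (of_rat q) < f x}"
      have [measurable]: "U (D q) q \<in> sets M" by (intro Um D)
      have eq: "U (insert f (D q)) q = U (D q) q \<union> ?E" by (auto simp: U_def)
      have "emeasure M (U (insert f (D q)) q) \<le> emeasure M (U (D q) q)"
        unfolding D(3) by (rule SUP_upper) (use D f in auto)
      then have 1: "emeasure M (U (D q) q \<union> ?E) \<le> emeasure M (U (D q) q)" unfolding eq .
      have 2: "emeasure M (U (D q) q) + emeasure M (?E - U (D q) q) = emeasure M (U (D q) q \<union> ?E)"
        by (subst plus_emeasure) (auto simp del: emeasure_Diff)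
      have "emeasure M (U (D q) q) + emeasure M (?E - U (D q) q) \<le> emeasure M (U (D q) q) + 0"
        using 1 unfolding 2 by simp
      then have "emeasure M (?E - U (D q) q) = 0"
        unfolding ennreal_add_left_cancel_le using emeasure_finite[of "U (D q) q"] by simp
      then have "?E - U (D q) q \<in> null_sets M" by auto
      then show ?thesis by (rule AE_I') auto
    qed
    then have "AE x in M. \<forall>q. ereal (of_rat q) < f x \<longrightarrow> x \<in> U (D q) q"
      by (simp add: AE_all_countable)
    then show ?thesis
    proof eventually_elim
      fix x assume x: "\<forall>q. ereal (of_rat q) < f x \<longrightarrow> x \<in> U (D q) q"
      show "f x \<le> (SUP f\<in>?C. f x)"
      proof (rule ccontr)
        assume "\<not> ?thesis"
        then have "(SUP f\<in>?C. f x) < f x" by simp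
        then obtain z where z: "(SUP f\<in>?C. f x) < ereal z" "ereal z < f x" by (meson ereal_dense2)
        then obtain z' where z': "z < z'" "ereal z' < f x" by (metis ereal_dense2 less_ereal.simps(1))
        obtain q where q: "z < of_rat q" "of_rat q < z'" using of_rat_dense[OF z'(1)] by auto
        then have "x \<in> U (D q) q" using x z' by (metis less_ereal.simps(1) less_trans)
        then obtain f' where "f' \<in> D q" "ereal (of_rat q) < f' x" by (auto simp: U_def)
        then have "ereal (of_rat q) < (SUP f\<in>?C. f x)" by (intro less_SUP_iff[THEN iffD2]) auto
        with z(1) q(1) show False by (metis less_ereal.simps(1) less_trans less_irrefl)
      qed
    qed
  qed
  have "AE x in M. (SUP f\<in>?C. f x) \<le> Z x" if "Z \<in> borel_measurable M" "\<forall>f\<in>S. AE x in M. f x \<le> Z x" for Z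
  proof -
    have "AE x in M. \<forall>f\<in>?C. f x \<le> Z x"
      by (rule AE_ball_countable[THEN iffD2]) (use C that in auto)
    then show ?thesis by eventually_elim (rule SUP_least, auto)
  qed
  then have "is_ess_sup M S (\<lambda>x. SUP f\<in>?C. f x)"
    unfolding is_ess_sup_def using le by auto
  then show ?thesis using C by blast
qed

lemma is_ess_sup_unique:
  assumes "is_ess_sup M S Z" "is_ess_sup M S Z'"
  shows "AE x in M. Z x = Z' x"
proof -
  have "AE x in M. Z x \<le> Z' x" "AE x in M. Z' x \<le> Z x"
    using assms unfolding is_ess_sup_def by auto
  then show ?thesis by eventually_elim auto
qed

section \<open>Conditional expectations of extended real random variables\<close>

definition quasi_integrable :: "'a measure \<Rightarrow> ('a \<Rightarrow> ereal) \<Rightarrow> bool" where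
  "quasi_integrable M Y \<longleftrightarrow> Y \<in> borel_measurable M \<and> (\<integral>\<^sup>+x. e2ennreal (- Y x) \<partial>M) < \<infinity>"

lemma ereal_pos_neg_parts: "Y = enn2ereal (e2ennreal Y) - enn2ereal (e2ennreal (- Y))"
proof (cases "0 \<le> Y")
  case True
  then show ?thesis by (simp add: enn2ereal_e2ennreal e2ennreal_neg zero_ennreal.rep_eq)
next
  case False
  then have "Y \<le> 0" "0 \<le> - Y" by (auto simp: ereal_0_le_uminus_iff)
  then show ?thesis by (simp add: enn2ereal_e2ennreal e2ennreal_neg zero_ennreal.rep_eq)
qed

text \<open>Comparing p + m with q + n avoids differences of infinities; finite n and m can then be
  moved across. This makes a conditional expectation independent of the chosen decomposition into
  nonnegative parts.\<close>

lemma enn2ereal_diff_eq: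
  assumes "p + m = q + n" "n \<noteq> top" "m \<noteq> top"
  shows "enn2ereal p - enn2ereal n = enn2ereal q - enn2ereal m"
  using assms
  by (cases p; cases q; cases n; cases m) (auto simp: ennreal_plus[symmetric] simp del: ennreal_plus)

lemma quasi_integrable_bounded_below:
  assumes "finite_measure M" "Y \<in> borel_measurable M" "AE x in M. ereal c \<le> Y x"
  shows "quasi_integrable M Y"
proof -
  interpret finite_measure M by fact
  have "(\<integral>\<^sup>+x. e2ennreal (- Y x) \<partial>M) \<le> (\<integral>\<^sup>+x. ennreal \<bar>c\<bar> \<partial>M)"
  proof (rule nn_integral_mono_AE, use assms(3) in eventually_elim)
    fix x assume "ereal c \<le> Y x"
    then have "- Y x \<le> ereal \<bar>c\<bar>" by (cases "Y x") auto
    then show "e2ennreal (- Y x) \<le> ennreal \<bar>c\<bar>" using e2ennreal_mono by fastforce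
  qed
  also have "\<dots> < \<infinity>" by (simp add: emeasure_eq_measure ennreal_mult_less_top)
  finally show ?thesis using assms by (simp add: quasi_integrable_def)
qed

lemma quasi_integrable_ereal:
  assumes "integrable M G"
  shows "quasi_integrable M (\<lambda>x. ereal (G x))"
proof -
  have "(\<integral>\<^sup>+x. ennreal (- G x) \<partial>M) \<le> (\<integral>\<^sup>+x. ennreal (norm (G x)) \<partial>M)"
    by (intro nn_integral_mono ennreal_leI) auto
  also have "\<dots> < \<infinity>" using assms by (simp add: integrable_iff_bounded)
  finally show ?thesis using assms by (simp add: quasi_integrable_def)
qed

lemma e2ennreal_uminus_add: "e2ennreal (- (Y + Z)) \<le> e2ennreal (- Y) + e2ennreal (- Z)"
  by (cases Y; cases Z) (auto simp: ennreal_plus_if ennreal_neg top_unique intro!: ennreal_leI)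

lemma quasi_integrable_add:
  assumes "quasi_integrable M Y" "quasi_integrable M Z"
  shows "quasi_integrable M (\<lambda>x. Y x + Z x)"
proof -
  have [measurable]: "Y \<in> borel_measurable M" "Z \<in> borel_measurable M"
    using assms by (auto simp: quasi_integrable_def)
  have "(\<integral>\<^sup>+x. e2ennreal (- (Y x + Z x)) \<partial>M) \<le> (\<integral>\<^sup>+x. e2ennreal (- Y x) + e2ennreal (- Z x) \<partial>M)"
    by (intro nn_integral_mono e2ennreal_uminus_add)
  also have "\<dots> = (\<integral>\<^sup>+x. e2ennreal (- Y x) \<partial>M) + (\<integral>\<^sup>+x. e2ennreal (- Z x) \<partial>M)"
    by (rule nn_integral_add) auto
  also have "\<dots> < \<infinity>" using assms by (simp add: quasi_integrable_def)
  finally show ?thesis by (simp add: quasi_integrable_def)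
qed

lemma quasi_integrable_cmult:
  assumes "quasi_integrable M Y" "0 \<le> c"
  shows "quasi_integrable M (\<lambda>x. ereal c * Y x)"
proof -
  have [measurable]: "Y \<in> borel_measurable M"
    using assms by (auto simp: quasi_integrable_def)
  have "e2ennreal (- (ereal c * Y x)) \<le> ennreal c * e2ennreal (- Y x)" for x
    using assms(2) by (cases "Y x"; cases "c = 0") (auto simp: ennreal_mult'[symmetric] ennreal_mult_top e2ennreal_neg)
  then have "(\<integral>\<^sup>+x. e2ennreal (- (ereal c * Y x)) \<partial>M) \<le> (\<integral>\<^sup>+x. ennreal c * e2ennreal (- Y x) \<partial>M)"
    by (rule nn_integral_mono)
  also have "\<dots> = ennreal c * (\<integral>\<^sup>+x. e2ennreal (- Y x) \<partial>M)"
    by (rule nn_integral_cmult) auto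
  also have "\<dots> < \<infinity>" using assms by (simp add: quasi_integrable_def ennreal_mult_less_top)
  finally show ?thesis by (simp add: quasi_integrable_def)
qed

lemma borel_measurable_ereal_cond_exp [measurable]: "ereal_cond_exp M F Y \<in> borel_measurable F"
  unfolding ereal_cond_exp_def[abs_def] by measurable

context sigma_finite_subalgebra
begin

lemma nn_cond_exp_finite:
  assumes [measurable]: "N \<in> borel_measurable M" and "(\<integral>\<^sup>+x. N x \<partial>M) < \<infinity>"
  shows "AE x in M. nn_cond_exp M F N x \<noteq> top"
proof -
  have "(\<integral>\<^sup>+x. nn_cond_exp M F N x \<partial>M) = (\<integral>\<^sup>+x. N x \<partial>M)"
    using nn_cond_exp_intg[of "\<lambda>_. 1" N] by simp
  then have "AE x in M. nn_cond_exp M F N x \<noteq> \<infinity>"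
    using assms(2) by (intro nn_integral_PInf_AE) auto
  then show ?thesis by simp
qed

text \<open>Representing \<open>Y\<close> as a difference of nonnegative functions reduces every property of the
  extended conditional expectation to one of \<^const>\<open>nn_cond_exp\<close>.\<close>

lemma ereal_cond_exp_rep:
  assumes [measurable]: "Y \<in> borel_measurable M" "P \<in> borel_measurable M" "N \<in> borel_measurable M"
    and fin: "(\<integral>\<^sup>+x. N x \<partial>M) < \<infinity>" and Y: "AE x in M. Y x = enn2ereal (P x) - enn2ereal (N x)"
  shows "AE x in M. ereal_cond_exp M F Y x = enn2ereal (nn_cond_exp M F P x) - enn2ereal (nn_cond_exp M F N x)"
proof -
  have "AE x in M. N x \<noteq> \<infinity>" using fin by (intro nn_integral_PInf_AE) auto
  with Y have *: "AE x in M. e2ennreal (- Y x) \<le> N x \<and> P x + e2ennreal (- Y x) = e2ennreal (Y x) + N x"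
  proof eventually_elim
    fix x assume "Y x = enn2ereal (P x) - enn2ereal (N x)" "N x \<noteq> \<infinity>"
    then show "e2ennreal (- Y x) \<le> N x \<and> P x + e2ennreal (- Y x) = e2ennreal (Y x) + N x"
      by (cases "P x"; cases "N x") (auto simp: ennreal_plus_if ennreal_neg e2ennreal_neg intro!: ennreal_leI)
  qed
  have "(\<integral>\<^sup>+x. e2ennreal (- Y x) \<partial>M) \<le> (\<integral>\<^sup>+x. N x \<partial>M)"
    by (rule nn_integral_mono_AE) (use * in auto)
  then have fin': "(\<integral>\<^sup>+x. e2ennreal (- Y x) \<partial>M) < \<infinity>" using fin by simp
  have "AE x in M. nn_cond_exp M F (\<lambda>x. P x + e2ennreal (- Y x)) x = nn_cond_exp M F (\<lambda>x. e2ennreal (Y x) + N x) x"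
    by (rule nn_cond_exp_cong) (use * in auto)
  moreover have "AE x in M. nn_cond_exp M F P x + nn_cond_exp M F (\<lambda>x. e2ennreal (- Y x)) x = nn_cond_exp M F (\<lambda>x. P x + e2ennreal (- Y x)) x"
    by (rule nn_cond_exp_sum) auto
  moreover have "AE x in M. nn_cond_exp M F (\<lambda>x. e2ennreal (Y x)) x + nn_cond_exp M F N x = nn_cond_exp M F (\<lambda>x. e2ennreal (Y x) + N x) x"
    by (rule nn_cond_exp_sum) auto
  moreover have "AE x in M. nn_cond_exp M F N x \<noteq> top" by (rule nn_cond_exp_finite) (use fin in auto)
  moreover have "AE x in M. nn_cond_exp M F (\<lambda>x. e2ennreal (- Y x)) x \<noteq> top"
    by (rule nn_cond_exp_finite) (use fin' in auto)
  ultimately show ?thesis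
    unfolding ereal_cond_exp_def by eventually_elim (rule enn2ereal_diff_eq[symmetric], auto)
qed

lemma ereal_cond_exp_mono:
  assumes "Y \<in> borel_measurable M" "Z \<in> borel_measurable M" "AE x in M. Y x \<le> Z x"
  shows "AE x in M. ereal_cond_exp M F Y x \<le> ereal_cond_exp M F Z x"
proof -
  have [measurable]: "Y \<in> borel_measurable M" "Z \<in> borel_measurable M" by fact+
  have "AE x in M. nn_cond_exp M F (\<lambda>x. e2ennreal (Y x)) x \<le> nn_cond_exp M F (\<lambda>x. e2ennreal (Z x)) x"
    by (rule nn_cond_exp_mono) (use assms(3) in \<open>auto intro!: e2ennreal_mono\<close>)
  moreover have "AE x in M. nn_cond_exp M F (\<lambda>x. e2ennreal (- Z x)) x \<le> nn_cond_exp M F (\<lambda>x. e2ennreal (- Y x)) x"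
    by (rule nn_cond_exp_mono) (use assms(3) in \<open>auto intro!: e2ennreal_mono\<close>)
  ultimately show ?thesis
    unfolding ereal_cond_exp_def by eventually_elim (intro ereal_minus_mono; simp add: less_eq_ennreal.rep_eq)
qed

lemma ereal_cond_exp_cong:
  assumes "Y \<in> borel_measurable M" "Z \<in> borel_measurable M" "AE x in M. Y x = Z x"
  shows "AE x in M. ereal_cond_exp M F Y x = ereal_cond_exp M F Z x"
proof -
  have "AE x in M. Y x \<le> Z x" "AE x in M. Z x \<le> Y x" using assms(3) by auto
  from ereal_cond_exp_mono[OF assms(1,2) this(1)] ereal_cond_exp_mono[OF assms(2,1) this(2)]
  show ?thesis by eventually_elim (rule antisym)
qed

lemma ereal_cond_exp_F_meas:
  assumes "Y \<in> borel_measurable F"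
  shows "AE x in M. ereal_cond_exp M F Y x = Y x"
proof -
  have [measurable]: "Y \<in> borel_measurable F" by fact
  have "AE x in M. e2ennreal (Y x) = nn_cond_exp M F (\<lambda>x. e2ennreal (Y x)) x"
    "AE x in M. e2ennreal (- Y x) = nn_cond_exp M F (\<lambda>x. e2ennreal (- Y x)) x"
    by (rule nn_cond_exp_F_meas, measurable)+
  then show ?thesis unfolding ereal_cond_exp_def by eventually_elim (metis ereal_pos_neg_parts)
qed

lemma ereal_cond_exp_real:
  assumes "integrable M G"
  shows "AE x in M. ereal_cond_exp M F (\<lambda>x. ereal (G x)) x = ereal (real_cond_exp M F G x)"
proof -
  have [measurable]: "G \<in> borel_measurable M" using assms by auto
  have "(\<integral>\<^sup>+x. ennreal (G x) \<partial>M) < \<infinity>" "(\<integral>\<^sup>+x. ennreal (- G x) \<partial>M) < \<infinity>"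
    using assms by (auto simp: real_integrable_def less_top)
  then have "AE x in M. nn_cond_exp M F (\<lambda>x. ennreal (G x)) x \<noteq> top" "AE x in M. nn_cond_exp M F (\<lambda>x. ennreal (- G x)) x \<noteq> top"
    by (auto intro!: nn_cond_exp_finite)
  then show ?thesis
  proof eventually_elim
    fix x assume *: "nn_cond_exp M F (\<lambda>x. ennreal (G x)) x \<noteq> top" "nn_cond_exp M F (\<lambda>x. ennreal (- G x)) x \<noteq> top"
    have **: "enn2ereal a = ereal (enn2real a)" if "a \<noteq> top" for a using that by (cases a) auto
    show "ereal_cond_exp M F (\<lambda>x. ereal (G x)) x = ereal (real_cond_exp M F G x)"
      unfolding ereal_cond_exp_def real_cond_exp_def by (simp add: **[OF *(1)] **[OF *(2)])
  qed
qed

lemma ereal_cond_exp_add: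
  assumes Y: "quasi_integrable M Y" and Z: "quasi_integrable M Z"
  shows "AE x in M. ereal_cond_exp M F (\<lambda>x. Y x + Z x) x = ereal_cond_exp M F Y x + ereal_cond_exp M F Z x"
proof -
  have [measurable]: "Y \<in> borel_measurable M" "Z \<in> borel_measurable M"
    and fin: "(\<integral>\<^sup>+x. e2ennreal (- Y x) \<partial>M) < \<infinity>" "(\<integral>\<^sup>+x. e2ennreal (- Z x) \<partial>M) < \<infinity>"
    using assms by (auto simp: quasi_integrable_def)
  let ?n = "nn_cond_exp M F"
  have finN: "(\<integral>\<^sup>+x. e2ennreal (- Y x) + e2ennreal (- Z x) \<partial>M) < \<infinity>"
    using fin by (subst nn_integral_add) auto
  have "AE x in M. e2ennreal (- Y x) \<noteq> \<infinity>" "AE x in M. e2ennreal (- Z x) \<noteq> \<infinity>"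
    using fin by (intro nn_integral_PInf_AE; auto)+
  then have "AE x in M. Y x + Z x = enn2ereal (e2ennreal (Y x) + e2ennreal (Z x)) - enn2ereal (e2ennreal (- Y x) + e2ennreal (- Z x))"
  proof eventually_elim
    fix x assume "e2ennreal (- Y x) \<noteq> \<infinity>" "e2ennreal (- Z x) \<noteq> \<infinity>"
    then show "Y x + Z x = enn2ereal (e2ennreal (Y x) + e2ennreal (Z x)) - enn2ereal (e2ennreal (- Y x) + e2ennreal (- Z x))"
      by (cases "Y x"; cases "Z x") (auto simp: ennreal_plus_if ennreal_neg zero_ennreal.rep_eq)
  qed
  then have "AE x in M. ereal_cond_exp M F (\<lambda>x. Y x + Z x) x =
      enn2ereal (?n (\<lambda>x. e2ennreal (Y x) + e2ennreal (Z x)) x) - enn2ereal (?n (\<lambda>x. e2ennreal (- Y x) + e2ennreal (- Z x)) x)"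
    by (intro ereal_cond_exp_rep finN) auto
  moreover have "AE x in M. ?n (\<lambda>x. e2ennreal (Y x)) x + ?n (\<lambda>x. e2ennreal (Z x)) x = ?n (\<lambda>x. e2ennreal (Y x) + e2ennreal (Z x)) x"
    "AE x in M. ?n (\<lambda>x. e2ennreal (- Y x)) x + ?n (\<lambda>x. e2ennreal (- Z x)) x = ?n (\<lambda>x. e2ennreal (- Y x) + e2ennreal (- Z x)) x"
    by (rule nn_cond_exp_sum; simp)+
  moreover have "AE x in M. ?n (\<lambda>x. e2ennreal (- Y x)) x \<noteq> top" "AE x in M. ?n (\<lambda>x. e2ennreal (- Z x)) x \<noteq> top"
    using fin by (auto intro!: nn_cond_exp_finite)
  ultimately show ?thesis
  proof eventually_elim
    fix x
    have *: "enn2ereal (p + p') - enn2ereal (n + n') = (enn2ereal p - enn2ereal n) + (enn2ereal p' - enn2ereal n')"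
      if "n \<noteq> top" "n' \<noteq> top" for p p' n n'
      using that by (cases p; cases p'; cases n; cases n') (auto simp: ennreal_plus[symmetric] simp del: ennreal_plus)
    assume x: "ereal_cond_exp M F (\<lambda>x. Y x + Z x) x =
      enn2ereal (?n (\<lambda>x. e2ennreal (Y x) + e2ennreal (Z x)) x) - enn2ereal (?n (\<lambda>x. e2ennreal (- Y x) + e2ennreal (- Z x)) x)"
      "?n (\<lambda>x. e2ennreal (Y x)) x + ?n (\<lambda>x. e2ennreal (Z x)) x = ?n (\<lambda>x. e2ennreal (Y x) + e2ennreal (Z x)) x"
      "?n (\<lambda>x. e2ennreal (- Y x)) x + ?n (\<lambda>x. e2ennreal (- Z x)) x = ?n (\<lambda>x. e2ennreal (- Y x) + e2ennreal (- Z x)) x"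
      "?n (\<lambda>x. e2ennreal (- Y x)) x \<noteq> top" "?n (\<lambda>x. e2ennreal (- Z x)) x \<noteq> top"
    show "ereal_cond_exp M F (\<lambda>x. Y x + Z x) x = ereal_cond_exp M F Y x + ereal_cond_exp M F Z x"
      unfolding x(1) x(2,3)[symmetric] ereal_cond_exp_def[of M F Y] ereal_cond_exp_def[of M F Z] by (rule *[OF x(4,5)])
  qed
qed

lemma ereal_cond_exp_cmult:
  assumes Y: "quasi_integrable M Y" and c: "0 \<le> c"
  shows "AE x in M. ereal_cond_exp M F (\<lambda>x. ereal c * Y x) x = ereal c * ereal_cond_exp M F Y x"
proof -
  have [measurable]: "Y \<in> borel_measurable M"
    and fin: "(\<integral>\<^sup>+x. e2ennreal (- Y x) \<partial>M) < \<infinity>"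
    using assms by (auto simp: quasi_integrable_def)
  let ?n = "nn_cond_exp M F"
  have *: "ereal c * (enn2ereal p - enn2ereal n) = enn2ereal (ennreal c * p) - enn2ereal (ennreal c * n)" if "n \<noteq> top" for p n
    using that c by (cases p; cases n; cases "c = 0") (auto simp: ennreal_mult'[symmetric] ennreal_mult_top zero_ennreal.rep_eq algebra_simps)
  have finN: "(\<integral>\<^sup>+x. ennreal c * e2ennreal (- Y x) \<partial>M) < \<infinity>"
    using fin by (subst nn_integral_cmult) (auto simp: ennreal_mult_less_top)
  have "AE x in M. e2ennreal (- Y x) \<noteq> \<infinity>"
    using fin by (intro nn_integral_PInf_AE; auto)+
  then have "AE x in M. ereal c * Y x = enn2ereal (ennreal c * e2ennreal (Y x)) - enn2ereal (ennreal c * e2ennreal (- Y x))"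
    by eventually_elim (subst *[symmetric], simp_all add: ereal_pos_neg_parts[symmetric])
  then have "AE x in M. ereal_cond_exp M F (\<lambda>x. ereal c * Y x) x =
      enn2ereal (?n (\<lambda>x. ennreal c * e2ennreal (Y x)) x) - enn2ereal (?n (\<lambda>x. ennreal c * e2ennreal (- Y x)) x)"
    by (intro ereal_cond_exp_rep finN) auto
  moreover have "AE x in M. ennreal c * ?n (\<lambda>x. e2ennreal (Y x)) x = ?n (\<lambda>x. ennreal c * e2ennreal (Y x)) x"
    "AE x in M. ennreal c * ?n (\<lambda>x. e2ennreal (- Y x)) x = ?n (\<lambda>x. ennreal c * e2ennreal (- Y x)) x"
    by (rule nn_cond_exp_prod; simp)+
  moreover have "AE x in M. ?n (\<lambda>x. e2ennreal (- Y x)) x \<noteq> top"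
    using fin by (auto intro!: nn_cond_exp_finite)
  ultimately show ?thesis
  proof eventually_elim
    fix x assume x: "ereal_cond_exp M F (\<lambda>x. ereal c * Y x) x =
      enn2ereal (?n (\<lambda>x. ennreal c * e2ennreal (Y x)) x) - enn2ereal (?n (\<lambda>x. ennreal c * e2ennreal (- Y x)) x)"
      "ennreal c * ?n (\<lambda>x. e2ennreal (Y x)) x = ?n (\<lambda>x. ennreal c * e2ennreal (Y x)) x"
      "ennreal c * ?n (\<lambda>x. e2ennreal (- Y x)) x = ?n (\<lambda>x. ennreal c * e2ennreal (- Y x)) x"
      "?n (\<lambda>x. e2ennreal (- Y x)) x \<noteq> top"
    show "ereal_cond_exp M F (\<lambda>x. ereal c * Y x) x = ereal c * ereal_cond_exp M F Y x"
      unfolding x(1) x(2,3)[symmetric] ereal_cond_exp_def[of M F Y] by (rule *[OF x(4), symmetric])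
  qed
qed

text \<open>By its definition the inner conditional expectation is a difference of two nonnegative
  functions, so \<open>ereal_cond_exp_rep\<close> applies to it directly and leaves nested
  expectations of nonnegative functions. For the second claim, its negative part is dominated by the
  conditional expectation of the negative part of Y.\<close>

lemma ereal_cond_exp_nested:
  assumes "subalgebra M G" "subalgebra G F" and Y: "quasi_integrable M Y"
  shows "AE x in M. ereal_cond_exp M F (ereal_cond_exp M G Y) x = ereal_cond_exp M F Y x"
    "quasi_integrable M (ereal_cond_exp M G Y)"
proof -
  interpret G: sigma_finite_subalgebra M G by (rule nested_subalg_is_sigma_finite[OF assms(1,2)])
  have [measurable]: "Y \<in> borel_measurable M" "ereal_cond_exp M G Y \<in> borel_measurable M"
    and fin: "(\<integral>\<^sup>+x. e2ennreal (- Y x) \<partial>M) < \<infinity>"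
    using Y measurable_from_subalg[OF assms(1) borel_measurable_ereal_cond_exp] by (auto simp: quasi_integrable_def)
  let ?P = "nn_cond_exp M G (\<lambda>x. e2ennreal (Y x))" and ?N = "nn_cond_exp M G (\<lambda>x. e2ennreal (- Y x))"
  have N: "(\<integral>\<^sup>+x. ?N x \<partial>M) < \<infinity>"
    using G.nn_cond_exp_intg[of "\<lambda>_. 1" "\<lambda>x. e2ennreal (- Y x)"] fin by simp
  have "AE x in M. ereal_cond_exp M F (ereal_cond_exp M G Y) x = enn2ereal (nn_cond_exp M F ?P x) - enn2ereal (nn_cond_exp M F ?N x)"
    by (rule ereal_cond_exp_rep) (use N in \<open>auto simp: ereal_cond_exp_def\<close>)
  moreover have "AE x in M. nn_cond_exp M F (\<lambda>x. e2ennreal (Y x)) x = nn_cond_exp M F ?P x"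
    "AE x in M. nn_cond_exp M F (\<lambda>x. e2ennreal (- Y x)) x = nn_cond_exp M F ?N x"
    by (rule nn_cond_exp_nested_subalg[OF assms(1,2)]; simp)+
  ultimately show "AE x in M. ereal_cond_exp M F (ereal_cond_exp M G Y) x = ereal_cond_exp M F Y x"
    by eventually_elim (simp add: ereal_cond_exp_def)
  have "e2ennreal (- ereal_cond_exp M G Y x) \<le> ?N x" for x
    unfolding ereal_cond_exp_def
    by (cases "?P x"; cases "?N x") (auto simp: top_unique e2ennreal_neg intro!: ennreal_leI)
  then have "(\<integral>\<^sup>+x. e2ennreal (- ereal_cond_exp M G Y x) \<partial>M) \<le> (\<integral>\<^sup>+x. ?N x \<partial>M)"
    by (rule nn_integral_mono)
  then show "quasi_integrable M (ereal_cond_exp M G Y)" using N by (simp add: quasi_integrable_def)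
qed

text \<open>The pointwise supremum of the conditional expectations is tested against sets of F:
  monotone convergence is used twice under the integral, once for the conditional expectations and
  once for the f n themselves.\<close>

lemma nn_cond_exp_monotone_convergence:
  assumes [measurable]: "\<And>n. f n \<in> borel_measurable M" "g \<in> borel_measurable M"
    and inc: "AE x in M. incseq (\<lambda>n. f n x)" and lim: "AE x in M. (\<lambda>n. f n x) \<longlonglongrightarrow> g x"
  shows "AE x in M. (\<lambda>n. nn_cond_exp M F (f n) x) \<longlonglongrightarrow> nn_cond_exp M F g x"
proof -
  have "AE x in M. nn_cond_exp M F (f n) x \<le> nn_cond_exp M F (f (Suc n)) x" for n
    by (rule nn_cond_exp_mono) (use inc in \<open>auto simp: incseq_Suc_iff\<close>)
  then have inc': "AE x in M. incseq (\<lambda>n. nn_cond_exp M F (f n) x)"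
    by (simp add: incseq_Suc_iff AE_all_countable)
  have "AE x in M. (SUP n. nn_cond_exp M F (f n) x) = nn_cond_exp M F g x"
  proof (rule nn_cond_exp_charact)
    fix A assume A: "A \<in> sets F"
    then have [measurable]: "A \<in> sets M" "A \<in> sets F" using subalg by (auto simp: subalgebra_def)
    have "(\<integral>\<^sup>+x\<in>A. (SUP n. nn_cond_exp M F (f n) x) \<partial>M) = (\<integral>\<^sup>+x. (SUP n. nn_cond_exp M F (f n) x * indicator A x) \<partial>M)"
      by (intro nn_integral_cong) (simp add: SUP_mult_right_ennreal)
    also have "\<dots> = (SUP n. \<integral>\<^sup>+x. nn_cond_exp M F (f n) x * indicator A x \<partial>M)"
      by (rule nn_integral_monotone_convergence_SUP_AE)
        (use inc' in \<open>auto simp: incseq_Suc_iff intro!: mult_right_mono\<close>)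
    also have "\<dots> = (SUP n. \<integral>\<^sup>+x. f n x * indicator A x \<partial>M)"
      using nn_cond_exp_intg[of "indicator A"] by (simp add: mult.commute)
    also have "\<dots> = (\<integral>\<^sup>+x. (SUP n. f n x * indicator A x) \<partial>M)"
      by (rule nn_integral_monotone_convergence_SUP_AE[symmetric])
        (use inc in \<open>auto simp: incseq_Suc_iff intro!: mult_right_mono\<close>)
    also have "\<dots> = (\<integral>\<^sup>+x\<in>A. g x \<partial>M)"
    proof (rule nn_integral_cong_AE, use inc lim in eventually_elim)
      fix x assume "incseq (\<lambda>n. f n x)" "(\<lambda>n. f n x) \<longlonglongrightarrow> g x"
      then have "(SUP n. f n x) = g x" using LIMSEQ_SUP LIMSEQ_unique by blast
      then show "(SUP n. f n x * indicator A x) = g x * indicator A x"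
        by (simp add: SUP_mult_right_ennreal[symmetric])
    qed
    finally show "(\<integral>\<^sup>+x\<in>A. g x \<partial>M) = (\<integral>\<^sup>+x\<in>A. (SUP n. nn_cond_exp M F (f n) x) \<partial>M)" by simp
  qed auto
  with inc' show ?thesis
    by eventually_elim (metis LIMSEQ_SUP)
qed

text \<open>Adding the negative part N of the first term makes the whole sequence nonnegative. The
  nonnegative case applies, and the conditional expectation of N, finite almost everywhere, is
  subtracted again.\<close>

lemma ereal_cond_exp_monotone_convergence:
  assumes Y: "\<And>n. Y n \<in> borel_measurable M" and Z: "Z \<in> borel_measurable M"
    and inc: "AE x in M. incseq (\<lambda>n. Y n x)" and lim: "AE x in M. (\<lambda>n. Y n x) \<longlonglongrightarrow> Z x"
    and quasi: "quasi_integrable M (Y 0)"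
  shows "AE x in M. (\<lambda>n. ereal_cond_exp M F (Y n) x) \<longlonglongrightarrow> ereal_cond_exp M F Z x"
proof -
  have [measurable]: "\<And>n. Y n \<in> borel_measurable M" "Z \<in> borel_measurable M" by fact+
  define N where "N x = e2ennreal (- Y 0 x)" for x
  have [measurable]: "N \<in> borel_measurable M" unfolding N_def[abs_def] by measurable
  have [measurable]: "(\<lambda>x. enn2ereal (N x)) \<in> borel_measurable M"
    by (rule measurable_compose[OF _ measurable_enn2ereal]) measurable
  have fin: "(\<integral>\<^sup>+x. N x \<partial>M) < \<infinity>" using quasi by (simp add: quasi_integrable_def N_def)
  then have Nfin: "AE x in M. N x \<noteq> \<infinity>" by (intro nn_integral_PInf_AE) auto
  define P where "P W x = e2ennreal (W x + enn2ereal (N x))" for W :: "'a \<Rightarrow> ereal" and x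
  have [measurable]: "W \<in> borel_measurable M \<Longrightarrow> P W \<in> borel_measurable M" for W
    unfolding P_def[abs_def]
    by (intro measurable_compose[OF borel_measurable_ereal_add measurable_e2ennreal]) simp_all
  have rep: "W x = enn2ereal (P W x) - enn2ereal (N x)" if le: "Y 0 x \<le> W x" and Nx: "N x \<noteq> \<infinity>" for W x
  proof -
    have "0 \<le> W x + enn2ereal (N x)"
    proof -
      have "- Y 0 x \<le> enn2ereal (N x)"
        by (cases "0 \<le> - Y 0 x") (auto simp: N_def enn2ereal_e2ennreal intro: order_trans[OF _ enn2ereal_nonneg])
      moreover obtain b where b: "enn2ereal (N x) = ereal b" using Nx by (cases "N x") auto
      ultimately have "- Y 0 x \<le> ereal b" by simp
      then show ?thesis using le unfolding b by (cases "Y 0 x"; cases "W x") auto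
    qed
    then have "enn2ereal (P W x) = W x + enn2ereal (N x)" by (simp add: P_def enn2ereal_e2ennreal)
    then show ?thesis using Nx by (cases "N x"; cases "W x") auto
  qed
  have Yn: "AE x in M. \<forall>n. Y 0 x \<le> Y n x" using inc by eventually_elim (auto simp: incseq_def)
  have Z0: "AE x in M. Y 0 x \<le> Z x" using inc lim by eventually_elim (rule incseq_le)
  have "AE x in M. ereal_cond_exp M F (Y n) x = enn2ereal (nn_cond_exp M F (P (Y n)) x) - enn2ereal (nn_cond_exp M F N x)" for n
  proof (rule ereal_cond_exp_rep[OF _ _ _ fin])
    show "AE x in M. Y n x = enn2ereal (P (Y n) x) - enn2ereal (N x)"
      using Yn Nfin by eventually_elim (rule rep, auto)
  qed measurable
  then have 1: "AE x in M. \<forall>n. ereal_cond_exp M F (Y n) x = enn2ereal (nn_cond_exp M F (P (Y n)) x) - enn2ereal (nn_cond_exp M F N x)"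
    by (simp add: AE_all_countable)
  have 2: "AE x in M. ereal_cond_exp M F Z x = enn2ereal (nn_cond_exp M F (P Z) x) - enn2ereal (nn_cond_exp M F N x)"
  proof (rule ereal_cond_exp_rep[OF _ _ _ fin])
    show "AE x in M. Z x = enn2ereal (P Z x) - enn2ereal (N x)"
      using Z0 Nfin by eventually_elim (rule rep, auto)
  qed measurable
  have 3: "AE x in M. (\<lambda>n. nn_cond_exp M F (P (Y n)) x) \<longlonglongrightarrow> nn_cond_exp M F (P Z) x"
  proof (rule nn_cond_exp_monotone_convergence)
    show "AE x in M. incseq (\<lambda>n. P (Y n) x)"
      using inc by eventually_elim (auto simp: P_def incseq_Suc_iff intro!: e2ennreal_mono add_right_mono)
    show "AE x in M. (\<lambda>n. P (Y n) x) \<longlonglongrightarrow> P Z x"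
      using lim Nfin
    proof eventually_elim
      fix x assume x: "(\<lambda>n. Y n x) \<longlonglongrightarrow> Z x" "N x \<noteq> \<infinity>"
      then have "\<bar>enn2ereal (N x)\<bar> \<noteq> \<infinity>" by simp
      then have "(\<lambda>n. Y n x + enn2ereal (N x)) \<longlonglongrightarrow> Z x + enn2ereal (N x)"
        using x by (intro tendsto_add_ereal_general) auto
      then show "(\<lambda>n. P (Y n) x) \<longlonglongrightarrow> P Z x" unfolding P_def
        by (intro tendsto_compose[OF continuous_at_e2ennreal[unfolded continuous_within]])
    qed
  qed auto
  have "AE x in M. nn_cond_exp M F N x \<noteq> top" by (rule nn_cond_exp_finite) (use fin in auto)
  with 1 2 3 show ?thesis
  proof eventually_elim
    fix x assume x: "\<forall>n. ereal_cond_exp M F (Y n) x = enn2ereal (nn_cond_exp M F (P (Y n)) x) - enn2ereal (nn_cond_exp M F N x)"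
      "ereal_cond_exp M F Z x = enn2ereal (nn_cond_exp M F (P Z) x) - enn2ereal (nn_cond_exp M F N x)"
      "(\<lambda>n. nn_cond_exp M F (P (Y n)) x) \<longlonglongrightarrow> nn_cond_exp M F (P Z) x" "nn_cond_exp M F N x \<noteq> top"
    have "(\<lambda>n. enn2ereal (nn_cond_exp M F (P (Y n)) x)) \<longlonglongrightarrow> enn2ereal (nn_cond_exp M F (P Z) x)"
      by (intro tendsto_compose[OF continuous_at_enn2ereal[unfolded continuous_within]] x(3))
    moreover have "\<bar>enn2ereal (nn_cond_exp M F N x)\<bar> \<noteq> \<infinity>" using x(4) by simp
    ultimately show "(\<lambda>n. ereal_cond_exp M F (Y n) x) \<longlonglongrightarrow> ereal_cond_exp M F Z x"
      using x(1,2) by (simp add: tendsto_diff_ereal_general)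
  qed
qed

end

section \<open>Processes with continuous paths\<close>

text \<open>Time is rounded down to multiples of 1 / (k + 1). The rounded process takes its time
  from a countable set, so it is jointly measurable, and continuity of the paths recovers the
  original process as a limit.\<close>

lemma borel_measurable_pair_continuous:
  fixes f :: "real \<Rightarrow> 'a \<Rightarrow> 'b::metric_space"
  assumes f: "\<And>u. f u \<in> borel_measurable M" and cont: "\<And>\<omega>. \<omega> \<in> space M \<Longrightarrow> continuous_on UNIV (\<lambda>u. f u \<omega>)"
  shows "(\<lambda>(u, \<omega>). f u \<omega>) \<in> borel_measurable (borel \<Otimes>\<^sub>M M)"
proof -
  define fl where "fl k u = real_of_int \<lfloor>real (Suc k) * u\<rfloor> / real (Suc k)" for k u
  have lim: "(\<lambda>k. fl k u) \<longlonglongrightarrow> u" for u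
  proof (rule tendsto_sandwich)
    show "\<forall>\<^sub>F k in sequentially. (real (Suc k) * u - 1) / real (Suc k) \<le> fl k u"
      unfolding fl_def by (intro always_eventually allI divide_right_mono) linarith+
    show "\<forall>\<^sub>F k in sequentially. fl k u \<le> u"
      unfolding fl_def by (intro always_eventually allI) (simp add: field_simps)
    show "(\<lambda>k. (real (Suc k) * u - 1) / real (Suc k)) \<longlonglongrightarrow> u" by real_asymp
  qed simp
  show ?thesis
  proof (rule borel_measurable_LIMSEQ_metric)
    fix k
    show "(\<lambda>(u, \<omega>). f (fl k u) \<omega>) \<in> borel_measurable (borel \<Otimes>\<^sub>M M)"
    proof -
      have "(\<lambda>x. f (real_of_int i / real (Suc k)) (snd x)) \<in> borel_measurable (borel \<Otimes>\<^sub>M M)" for i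
        by (rule measurable_compose[OF measurable_snd f])
      moreover have "(\<lambda>x. \<lfloor>real (Suc k) * fst x\<rfloor>) \<in> measurable ((borel :: real measure) \<Otimes>\<^sub>M M) (count_space UNIV)"
        by measurable
      ultimately have "(\<lambda>x. f (real_of_int \<lfloor>real (Suc k) * fst x\<rfloor> / real (Suc k)) (snd x)) \<in> borel_measurable (borel \<Otimes>\<^sub>M M)"
        by (rule measurable_compose_countable)
      then show ?thesis by (simp add: fl_def split_beta')
    qed
  next
    fix x :: "real \<times> 'a" assume "x \<in> space (borel \<Otimes>\<^sub>M M)"
    then have "snd x \<in> space M" by (auto simp: space_pair_measure)
    then have "isCont (\<lambda>u. f u (snd x)) (fst x)"
      using cont by (simp add: continuous_on_eq_continuous_at)
    then show "(\<lambda>k. case x of (u, \<omega>) \<Rightarrow> f (fl k u) \<omega>) \<longlonglongrightarrow> (case x of (u, \<omega>) \<Rightarrow> f u \<omega>)"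
      using isCont_tendsto_compose[OF _ lim] by (simp add: split_beta')
  qed
qed

section \<open>The driftless diffusion\<close>

locale driftless_diffusion =
  fixes \<sigma> :: "real \<Rightarrow> real ^ 'n \<Rightarrow> real ^ 'n ^ ('n::finite)"
    and r :: real and y :: "real ^ 'n" and Q :: "'n path measure"
  assumes \<sigma>_cont: "continuous_on ({0..} \<times> UNIV) (\<lambda>(t, x). \<sigma> t x)"
    and \<sigma>_bdd: "bounded ((\<lambda>(t, x). \<sigma> t x) ` ({0..} \<times> UNIV))"
    and elliptic: "strictly_elliptic (diffusion_matrix \<sigma>)"
    and r_nonneg: "0 \<le> r"
    and mp: "martingale_problem \<sigma> (\<lambda>_ _. 0) r y Q"
begin

abbreviation \<Omega> :: "'n path set" where "\<Omega> \<equiv> path_space r"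
abbreviation C :: "'n path measure" where "C \<equiv> completion Q"
abbreviation F :: "real \<Rightarrow> 'n path measure" where "F \<equiv> completed_filtration r Q"
abbreviation F0 :: "real \<Rightarrow> 'n path measure" where "F0 \<equiv> path_filtration r"

section \<open>Path algebra, completion and filtration\<close>

lemma sets_path_algebra: "sets (path_algebra r :: 'n path measure) = sigma_sets \<Omega> {(\<lambda>\<omega>. \<omega> u) -` A \<inter> \<Omega> | u A. r \<le> u \<and> A \<in> sets borel}"
  and space_path_algebra: "space (path_algebra r :: 'n path measure) = \<Omega>"
  unfolding path_algebra_def by (subst sets_measure_of space_measure_of; auto)+

lemma sets_F0: "sets (F0 s) = sigma_sets \<Omega> {(\<lambda>\<omega>. \<omega> u) -` A \<inter> \<Omega> | u A. r \<le> u \<and> u \<le> s \<and> A \<in> sets borel}"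
  and space_F0 [simp]: "space (F0 s) = \<Omega>"
  unfolding path_filtration_def by (subst sets_measure_of space_measure_of; auto)+

lemma prob_Q: "prob_space Q" and sets_Q: "sets Q = sets (path_algebra r)"
  and exp_martingale: "is_martingale Q F0 r
        (\<lambda>t \<omega>. exp (\<theta> \<bullet> (\<omega> t - y)
           - (LBINT u=r..t. \<theta> \<bullet> (\<sigma> u (\<omega> u) *v 0))
           - (LBINT u=r..t. \<theta> \<bullet> (diffusion_matrix \<sigma> u (\<omega> u) *v \<theta>)) / 2))"
  using mp by (auto simp: martingale_problem_def)

lemma space_Q [simp]: "space Q = \<Omega>"
  using sets_eq_imp_space_eq[OF sets_Q] by (simp add: space_path_algebra)

lemma prob_C: "prob_space C"
  by (rule prob_space.prob_space_completion[OF prob_Q])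

sublocale C: prob_space C by (rule prob_C)

lemma sets_F0_Q: "sets (F0 s) \<subseteq> sets Q"
  unfolding sets_Q sets_path_algebra sets_F0 by (rule sigma_sets_mono') auto

lemma sets_F0_mono: "s \<le> t \<Longrightarrow> sets (F0 s) \<subseteq> sets (F0 t)"
  unfolding sets_F0 by (rule sigma_sets_mono') (use order_trans in blast)

lemma null_sets_C: "N \<in> null_sets C \<Longrightarrow> N \<subseteq> \<Omega>"
  using sets.sets_into_space[of N C] by auto

lemma sets_F: "sets (F s) = sigma_sets \<Omega> (sets (F0 s) \<union> null_sets C)"
  and space_F [simp]: "space (F s) = \<Omega>"
proof -
  have "sets (F0 s) \<union> null_sets C \<subseteq> Pow \<Omega>"
    using sets.sets_into_space[of _ "F0 s"] null_sets_C by auto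
  then show "sets (F s) = sigma_sets \<Omega> (sets (F0 s) \<union> null_sets C)" "space (F s) = \<Omega>"
    unfolding completed_filtration_def by (auto simp: sets_measure_of space_measure_of)
qed

lemma sets_F_C: "sets (F s) \<subseteq> sets C"
proof -
  have "sets (F0 s) \<union> null_sets C \<subseteq> sets C" using sets_F0_Q by (auto simp: sets_completionI_sets)
  then show ?thesis unfolding sets_F using sets.sigma_sets_subset[of "sets (F0 s) \<union> null_sets C" C] by simp
qed

lemma sets_F_mono: "s \<le> t \<Longrightarrow> sets (F s) \<subseteq> sets (F t)"
  unfolding sets_F using sets_F0_mono[of s t] by (intro sigma_sets_mono') auto

lemma subalgebra_F: "subalgebra C (F s)"
  using sets_F_C by (simp add: subalgebra_def)

lemma subalgebra_F_mono: "s \<le> t \<Longrightarrow> subalgebra (F t) (F s)"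
  using sets_F_mono by (simp add: subalgebra_def)

lemma null_sets_F: "N \<in> null_sets C \<Longrightarrow> N \<in> sets (F s)"
  unfolding sets_F by auto

lemma F0_F: "sets (F0 s) \<subseteq> sets (F s)" unfolding sets_F by auto

lemma measurable_F_C: "f \<in> measurable (F s) N \<Longrightarrow> f \<in> measurable C N"
  by (rule measurable_from_subalg[OF subalgebra_F])

lemma measurable_F_mono: "f \<in> measurable (F s) N \<Longrightarrow> s \<le> t \<Longrightarrow> f \<in> measurable (F t) N"
  by (rule measurable_from_subalg[OF subalgebra_F_mono])

lemma measurable_F0_F: "f \<in> measurable (F0 s) N \<Longrightarrow> f \<in> measurable (F s) N"
  by (erule measurable_from_subalg[rotated]) (use F0_F in \<open>simp add: subalgebra_def\<close>)

text \<open>The sets having a version in \<open>F0 s\<close> form a \<sigma>-algebra that contains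
  the generators. This is how the martingale property, given for the raw filtration, reaches the
  completed one in \<open>cond_unit_F\<close>.\<close>

lemma sets_F_approx:
  assumes "A \<in> sets (F s)"
  shows "\<exists>B\<in>sets (F0 s). AE \<omega> in C. \<omega> \<in> A \<longleftrightarrow> \<omega> \<in> B"
  using assms unfolding sets_F
proof (induction rule: sigma_sets.induct)
  case (Basic A)
  then show ?case
  proof
    assume "A \<in> null_sets C"
    then have "AE \<omega> in C. \<omega> \<in> A \<longleftrightarrow> \<omega> \<in> {}" by (intro AE_I'[of A]) auto
    then show ?thesis by blast
  qed (auto intro!: bexI[of _ A])
next
  case Empty then show ?case by (intro bexI[of _ "{}"]) auto
next
  case (Compl A)
  then obtain B where B: "B \<in> sets (F0 s)" "AE \<omega> in C. \<omega> \<in> A \<longleftrightarrow> \<omega> \<in> B" by blast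
  have "AE \<omega> in C. \<omega> \<in> \<Omega> - A \<longleftrightarrow> \<omega> \<in> \<Omega> - B" using B(2) by eventually_elim auto
  moreover have "\<Omega> - B \<in> sets (F0 s)" using B(1) by (metis sets.compl_sets space_F0)
  ultimately show ?case by blast
next
  case (Union A)
  then obtain B where B: "\<And>i. B i \<in> sets (F0 s)" "\<And>i. AE \<omega> in C. \<omega> \<in> A i \<longleftrightarrow> \<omega> \<in> B i" by metis
  have "AE \<omega> in C. \<forall>i. \<omega> \<in> A i \<longleftrightarrow> \<omega> \<in> B i" using B(2) by (simp add: AE_all_countable)
  then have "AE \<omega> in C. \<omega> \<in> (\<Union>i. A i) \<longleftrightarrow> \<omega> \<in> (\<Union>i. B i)" by eventually_elim auto
  with B(1) show ?case by (intro bexI[of _ "\<Union>i. B i"]) auto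
qed

lemma cond_unit_F:
  assumes "cond_unit C (F0 s) D"
  shows "cond_unit C (F s) D"
  unfolding cond_unit_def
proof (intro conjI ballI)
  show D: "D \<in> borel_measurable C" using assms by (simp add: cond_unit_def)
  fix A assume A: "A \<in> sets (F s)"
  obtain B where B: "B \<in> sets (F0 s)" "AE \<omega> in C. \<omega> \<in> A \<longleftrightarrow> \<omega> \<in> B" using sets_F_approx[OF A] by blast
  have [measurable]: "A \<in> sets C" "B \<in> sets C"
    using A sets_F_C F0_F B(1) by blast+
  have "(\<integral>\<^sup>+\<omega>\<in>A. D \<omega> \<partial>C) = (\<integral>\<^sup>+\<omega>\<in>B. D \<omega> \<partial>C)"
    by (rule nn_integral_cong_AE, use B(2) in eventually_elim) (auto simp: indicator_def)
  also have "\<dots> = emeasure C B" using assms B(1) by (simp add: cond_unit_def)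
  also have "\<dots> = emeasure C A" by (rule emeasure_eq_AE) (use B(2) in auto)
  finally show "(\<integral>\<^sup>+\<omega>\<in>A. D \<omega> \<partial>C) = emeasure C A" .
qed

subsection \<open>Coordinates and coefficients\<close>

lemma path_continuous: "\<omega> \<in> \<Omega> \<Longrightarrow> continuous_on {r..} \<omega>"
  by (simp add: path_space_def)

lemma coordinate_measurable_F0: "r \<le> u \<Longrightarrow> u \<le> s \<Longrightarrow> (\<lambda>\<omega>. \<omega> u) \<in> borel_measurable (F0 s)"
proof (rule measurableI)
  fix A :: "(real ^ 'n) set" assume "r \<le> u" "u \<le> s" "A \<in> sets borel"
  then show "(\<lambda>\<omega>. \<omega> u) -` A \<inter> space (F0 s) \<in> sets (F0 s)"
    unfolding sets_F0 space_F0 by (intro sigma_sets.Basic) blast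
qed simp

lemma coordinate_measurable: "r \<le> u \<Longrightarrow> u \<le> s \<Longrightarrow> (\<lambda>\<omega>. \<omega> u) \<in> borel_measurable (F s)"
  by (intro measurable_F0_F coordinate_measurable_F0)

text \<open>Times are clamped to \<open>[r, b]\<close>, which makes the stopped path continuous on the whole line.\<close>

definition clamp_time :: "real \<Rightarrow> real \<Rightarrow> real" where "clamp_time b u = max r (min u b)"

lemma clamp_time_bounds: "r \<le> b \<Longrightarrow> r \<le> clamp_time b u \<and> clamp_time b u \<le> b"
  by (auto simp: clamp_time_def)

lemma clamp_time_eq: "r \<le> u \<Longrightarrow> u \<le> b \<Longrightarrow> clamp_time b u = u"
  by (auto simp: clamp_time_def)

lemma clamp_time_ge: "r \<le> clamp_time b u" by (simp add: clamp_time_def)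

lemma stopped_path_continuous: "\<omega> \<in> \<Omega> \<Longrightarrow> continuous_on A (\<lambda>u. \<omega> (clamp_time b u))"
  by (rule continuous_on_compose2[OF path_continuous])
    (auto simp: clamp_time_def intro!: continuous_intros)

lemma stopped_path_measurable:
  "r \<le> b \<Longrightarrow> (\<lambda>(u, \<omega>). \<omega> (clamp_time b u)) \<in> borel_measurable (borel \<Otimes>\<^sub>M F b)"
  by (intro borel_measurable_pair_continuous coordinate_measurable stopped_path_continuous)
    (auto simp: clamp_time_bounds)

lemma continuous_along_path:
  fixes f :: "real \<Rightarrow> real ^ 'n \<Rightarrow> 'b::topological_space"
  assumes "continuous_on ({0..} \<times> UNIV) (\<lambda>(t, x). f t x)" "\<omega> \<in> \<Omega>"
  shows "continuous_on {r..} (\<lambda>u. f u (\<omega> u))"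
proof -
  have "continuous_on {r..} (\<lambda>u. (\<lambda>(t, x). f t x) (u, \<omega> u))"
    by (rule continuous_on_compose2[OF assms(1)])
      (use r_nonneg in \<open>auto intro!: continuous_intros path_continuous assms(2)\<close>)
  then show ?thesis by simp
qed

lemma continuous_along_stopped_path:
  fixes f :: "real \<Rightarrow> real ^ 'n \<Rightarrow> 'b::topological_space"
  assumes "continuous_on ({0..} \<times> UNIV) (\<lambda>(t, x). f t x)" "\<omega> \<in> \<Omega>"
  shows "continuous_on A (\<lambda>u. f (clamp_time b u) (\<omega> (clamp_time b u)))"
  by (rule continuous_on_compose2[OF continuous_along_path[OF assms]])
    (auto simp: clamp_time_def intro!: continuous_intros)

lemma measurable_along_path:
  fixes f :: "real \<Rightarrow> real ^ 'n \<Rightarrow> 'b::{second_countable_topology, metric_space}"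
  assumes f: "continuous_on ({0..} \<times> UNIV) (\<lambda>(t, x). f t x)" and u: "r \<le> u" "u \<le> s"
  shows "(\<lambda>\<omega>. f u (\<omega> u)) \<in> borel_measurable (F s)"
proof -
  have "continuous_on UNIV (\<lambda>x. (\<lambda>(t, x). f t x) (u, x))"
    by (rule continuous_on_compose2[OF f]) (use u r_nonneg in \<open>auto intro!: continuous_intros\<close>)
  then have "(\<lambda>x. f u x) \<in> borel_measurable borel" by (simp add: borel_measurable_continuous_onI)
  then show ?thesis by (rule measurable_compose[OF coordinate_measurable[OF u]])
qed

lemma stopped_coefficient_measurable:
  fixes f :: "real \<Rightarrow> real ^ 'n \<Rightarrow> 'b::{second_countable_topology, metric_space}"
  assumes "continuous_on ({0..} \<times> UNIV) (\<lambda>(t, x). f t x)" "r \<le> b"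
  shows "(\<lambda>(u, \<omega>). f (clamp_time b u) (\<omega> (clamp_time b u))) \<in> borel_measurable (borel \<Otimes>\<^sub>M F b)"
  using assms
  by (intro borel_measurable_pair_continuous measurable_along_path continuous_along_stopped_path)
    (auto simp: clamp_time_bounds)

text \<open>Since a is \<sigma> times its transpose, its quadratic form at v is the squared length
  of the row v \<sigma>. All quadratic variations are written with that row.\<close>

lemma quadratic_form: "v \<bullet> (diffusion_matrix \<sigma> u x *v v) = (norm (v v* \<sigma> u x))\<^sup>2"
  unfolding diffusion_matrix_def
  by (simp add: matrix_vector_mul_assoc[symmetric] dot_lmul_matrix[symmetric] power2_norm_eq_inner)

lemma \<sigma>_bound: "\<exists>K>0. \<forall>u\<ge>0. \<forall>x v. norm (v v* \<sigma> u x) \<le> K * norm v"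
proof -
  obtain B where B: "\<And>t x. 0 \<le> t \<Longrightarrow> norm (\<sigma> t x) \<le> B" "B > 0"
    using \<sigma>_bdd unfolding bounded_pos by fastforce
  \<comment> \<open>Entrywise estimates lose one factor n for the coordinates of the row and one for
    the sum defining each of them; later only finiteness of the constant is used.\<close>
  have "norm (v v* \<sigma> u x) \<le> (real CARD('n) * (real CARD('n) * B)) * norm v" if "0 \<le> u" for u x v
  proof -
    have "norm (v v* \<sigma> u x) \<le> (\<Sum>j\<in>UNIV. \<bar>(v v* \<sigma> u x) $ j\<bar>)" by (rule norm_le_l1_cart)
    also have "\<dots> \<le> (\<Sum>j\<in>(UNIV::'n set). real CARD('n) * (B * norm v))"
    proof (rule sum_mono)
      fix j
      have "\<bar>(v v* \<sigma> u x) $ j\<bar> \<le> (\<Sum>i\<in>UNIV. \<bar>v $ i * \<sigma> u x $ i $ j\<bar>)"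
        unfolding vector_matrix_mult_def by simp
      also have "\<dots> \<le> (\<Sum>i\<in>(UNIV::'n set). norm v * B)"
      proof (rule sum_mono)
        fix i
        have "\<bar>\<sigma> u x $ i $ j\<bar> \<le> norm (\<sigma> u x $ i)" by (rule component_le_norm_cart)
        also have "\<dots> \<le> norm (\<sigma> u x)" by (rule Finite_Cartesian_Product.norm_nth_le)
        finally have "\<bar>\<sigma> u x $ i $ j\<bar> \<le> B" using B(1)[OF that, of x] by simp
        then show "\<bar>v $ i * \<sigma> u x $ i $ j\<bar> \<le> norm v * B"
          using component_le_norm_cart[of v i] by (auto simp: abs_mult intro!: mult_mono)
      qed
      finally show "\<bar>(v v* \<sigma> u x) $ j\<bar> \<le> real CARD('n) * (B * norm v)" by (simp add: mult.commute)
    qed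
    finally show ?thesis by (simp add: mult_ac)
  qed
  with B(2) show ?thesis by (intro exI[of _ "real CARD('n) * (real CARD('n) * B)"]) auto
qed

definition K\<sigma> :: real where "K\<sigma> = (SOME K. K > 0 \<and> (\<forall>u\<ge>0. \<forall>x v. norm (v v* \<sigma> u x) \<le> K * norm v))"

lemma K\<sigma>_pos: "0 < K\<sigma>" and K\<sigma>: "0 \<le> u \<Longrightarrow> norm (v v* \<sigma> u x) \<le> K\<sigma> * norm v"
proof -
  have "K\<sigma> > 0 \<and> (\<forall>u\<ge>0. \<forall>x v. norm (v v* \<sigma> u x) \<le> K\<sigma> * norm v)"
    unfolding K\<sigma>_def by (rule someI_ex) (use \<sigma>_bound in blast)
  then show "0 < K\<sigma>" "0 \<le> u \<Longrightarrow> norm (v v* \<sigma> u x) \<le> K\<sigma> * norm v" by auto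
qed

lemma continuous_on_vector_matrix_mult [continuous_intros]:
  fixes f :: "'c::topological_space \<Rightarrow> real ^ 'n" and g :: "'c \<Rightarrow> real ^ 'n ^ 'n"
  assumes "continuous_on S f" "continuous_on S g"
  shows "continuous_on S (\<lambda>x. f x v* g x)"
  unfolding vector_matrix_mult_def using assms by (intro continuous_intros)

lemma borel_measurable_vector_matrix_mult [measurable]:
  fixes f :: "'c \<Rightarrow> real ^ 'n" and g :: "'c \<Rightarrow> real ^ 'n ^ 'n"
  assumes [measurable]: "f \<in> borel_measurable M" "g \<in> borel_measurable M"
  shows "(\<lambda>x. f x v* g x) \<in> borel_measurable M"
  by (rule borel_measurable_continuous_Pair[OF assms]) (intro continuous_intros)


subsection \<open>Quadratic variation\<close>

text \<open>For X driven through \<sigma> by a Brownian motion W, the integral of H against X is the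
  integral of H \<sigma> against W; this row is the integrand seen by W. The cutoff to (a, b] is
  built in so that time integrals run over the whole line.\<close>

definition scaled :: "real \<Rightarrow> real \<Rightarrow> (real \<Rightarrow> 'n path \<Rightarrow> real ^ 'n) \<Rightarrow> real \<Rightarrow> 'n path \<Rightarrow> real ^ 'n" where
  "scaled a b H u \<omega> = indicator {a<..b} u *\<^sub>R (H u \<omega> v* \<sigma> u (\<omega> u))"

definition qvar :: "real \<Rightarrow> real \<Rightarrow> (real \<Rightarrow> 'n path \<Rightarrow> real ^ 'n) \<Rightarrow> 'n path \<Rightarrow> real" where
  "qvar a b H \<omega> = (\<integral>u. (norm (scaled a b H u \<omega>))\<^sup>2 \<partial>lborel)"

text \<open>The squared norm of an integrand in L^2(d<X> dQ), taken as a nonnegative integral so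
  that it is meaningful, possibly infinite, before any integrability is known.\<close>

definition msq :: "real \<Rightarrow> real \<Rightarrow> (real \<Rightarrow> 'n path \<Rightarrow> real ^ 'n) \<Rightarrow> ennreal" where
  "msq a b H = (\<integral>\<^sup>+\<omega>. \<integral>\<^sup>+u. ennreal ((norm (scaled a b H u \<omega>))\<^sup>2) \<partial>lborel \<partial>C)"

text \<open>Weaker than progressive measurability: only the \<sigma>-algebra at the right end b is
  imposed. Adaptedness inside the interval enters through the elementary processes that approximate
  an integrand.\<close>

definition progressive :: "real \<Rightarrow> real \<Rightarrow> (real \<Rightarrow> 'n path \<Rightarrow> real ^ 'n) \<Rightarrow> bool" where
  "progressive a b H \<longleftrightarrow> (\<lambda>(u, \<omega>). indicator {a<..b} u *\<^sub>R H u \<omega>) \<in> borel_measurable (borel \<Otimes>\<^sub>M F b)"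

text \<open>The bound concerns H \<sigma> and is uniform over paths. For a Girsanov integrand H
  \<sigma> is the control, whereas H itself can be unbounded.\<close>

definition scaled_bound :: "real \<Rightarrow> real \<Rightarrow> real \<Rightarrow> (real \<Rightarrow> 'n path \<Rightarrow> real ^ 'n) \<Rightarrow> bool" where
  "scaled_bound c a b H \<longleftrightarrow> 0 \<le> c \<and> (\<forall>\<omega>\<in>\<Omega>. \<forall>u. a < u \<and> u \<le> b \<longrightarrow> norm (H u \<omega> v* \<sigma> u (\<omega> u)) \<le> c)"

lemma scaled_diff: "scaled a b (\<lambda>u \<omega>. H u \<omega> - H' u \<omega>) u \<omega> = scaled a b H u \<omega> - scaled a b H' u \<omega>"
  by (simp add: scaled_def vector_matrix_mult_diff_distrib algebra_simps)

lemma scaled_cmult: "scaled a b (\<lambda>u \<omega>. k \<omega> *\<^sub>R H u \<omega>) u \<omega> = k \<omega> *\<^sub>R scaled a b H u \<omega>"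
  by (simp add: scaled_def scaleR_vector_matrix_assoc)

lemma scaled_cong: "(a < u \<Longrightarrow> u \<le> b \<Longrightarrow> H u \<omega> = H' u \<omega>) \<Longrightarrow> scaled a b H u \<omega> = scaled a b H' u \<omega>"
  by (auto simp: scaled_def indicator_def)

lemma scaled_split: "a \<le> b \<Longrightarrow> b \<le> c \<Longrightarrow>
  (norm (scaled a c H u \<omega>))\<^sup>2 = (norm (scaled a b H u \<omega>))\<^sup>2 + (norm (scaled b c H u \<omega>))\<^sup>2"
  by (auto simp: scaled_def indicator_def)

lemma scaled_measurable:
  assumes "r \<le> a" "a \<le> b" "progressive a b H"
  shows "(\<lambda>(u, \<omega>). scaled a b H u \<omega>) \<in> borel_measurable (borel \<Otimes>\<^sub>M F b)"
proof -
  have [measurable]: "(\<lambda>(u, \<omega>). indicator {a<..b} u *\<^sub>R H u \<omega>) \<in> borel_measurable (borel \<Otimes>\<^sub>M F b)"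
    using assms(3) by (simp add: progressive_def)
  have [measurable]: "(\<lambda>(u, \<omega>). \<sigma> (clamp_time b u) (\<omega> (clamp_time b u))) \<in> borel_measurable (borel \<Otimes>\<^sub>M F b)"
    using stopped_coefficient_measurable[OF \<sigma>_cont] assms by simp
  have "(\<lambda>x. (case x of (u, \<omega>) \<Rightarrow> indicator {a<..b} u *\<^sub>R H u \<omega>) v* (case x of (u, \<omega>) \<Rightarrow> \<sigma> (clamp_time b u) (\<omega> (clamp_time b u))))
     \<in> borel_measurable (borel \<Otimes>\<^sub>M F b)" by measurable
  also have "(\<lambda>x. (case x of (u, \<omega>) \<Rightarrow> indicator {a<..b} u *\<^sub>R H u \<omega>) v* (case x of (u, \<omega>) \<Rightarrow> \<sigma> (clamp_time b u) (\<omega> (clamp_time b u))))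
     = (\<lambda>(u, \<omega>). scaled a b H u \<omega>)"
    using assms by (auto simp: fun_eq_iff scaled_def indicator_def clamp_time_eq)
  finally show ?thesis .
qed

lemma scaled_measurable_path:
  assumes "r \<le> a" "a \<le> b" "progressive a b H" "\<omega> \<in> \<Omega>"
  shows "(\<lambda>u. scaled a b H u \<omega>) \<in> borel_measurable borel"
  using measurable_compose[OF measurable_Pair2'[of \<omega> "F b" borel] scaled_measurable[OF assms(1-3)]] assms(4) by simp

lemma scaled_nn_measurable:
  assumes "r \<le> a" "a \<le> b" "progressive a b H"
  shows "(\<lambda>\<omega>. \<integral>\<^sup>+u. ennreal ((norm (scaled a b H u \<omega>))\<^sup>2) \<partial>lborel) \<in> borel_measurable (F b)"
proof (rule lborel.borel_measurable_nn_integral)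
  have [measurable]: "(\<lambda>(u, \<omega>). scaled a b H u \<omega>) \<in> borel_measurable (lborel \<Otimes>\<^sub>M F b)"
    using scaled_measurable[OF assms] by (simp cong: measurable_cong_sets sets_pair_measure_cong)
  have "(\<lambda>(\<omega>, u). scaled a b H u \<omega>) \<in> borel_measurable (F b \<Otimes>\<^sub>M lborel)"
    using measurable_pair_swap[OF \<open>(\<lambda>(u, \<omega>). scaled a b H u \<omega>) \<in> _\<close>] by simp
  then show "(\<lambda>(\<omega>, u). ennreal ((norm (scaled a b H u \<omega>))\<^sup>2)) \<in> borel_measurable (F b \<Otimes>\<^sub>M lborel)"
    by (simp add: split_beta')
qed

lemma qvar_measurable:
  assumes "r \<le> a" "a \<le> b" "progressive a b H"
  shows "qvar a b H \<in> borel_measurable (F b)"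
  unfolding qvar_def[abs_def]
proof (rule lborel.borel_measurable_lebesgue_integral)
  have [measurable]: "(\<lambda>(u, \<omega>). scaled a b H u \<omega>) \<in> borel_measurable (lborel \<Otimes>\<^sub>M F b)"
    using scaled_measurable[OF assms] by (simp cong: measurable_cong_sets sets_pair_measure_cong)
  have "(\<lambda>(\<omega>, u). scaled a b H u \<omega>) \<in> borel_measurable (F b \<Otimes>\<^sub>M lborel)"
    using measurable_pair_swap[OF \<open>(\<lambda>(u, \<omega>). scaled a b H u \<omega>) \<in> _\<close>] by simp
  then show "(\<lambda>(\<omega>, u). (norm (scaled a b H u \<omega>))\<^sup>2) \<in> borel_measurable (F b \<Otimes>\<^sub>M lborel)"
    by (simp add: split_beta')
qed

lemma scaled_bound_sq: "scaled_bound c a b H \<Longrightarrow> \<omega> \<in> \<Omega> \<Longrightarrow> (norm (scaled a b H u \<omega>))\<^sup>2 \<le> c\<^sup>2 * indicator {a<..b} u"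
  by (auto simp: scaled_bound_def scaled_def indicator_def intro!: power_mono)

lemma scaled_integrable:
  assumes "r \<le> a" "a \<le> b" "progressive a b H" "scaled_bound c a b H" "\<omega> \<in> \<Omega>"
  shows "integrable lborel (\<lambda>u. (norm (scaled a b H u \<omega>))\<^sup>2)"
proof (rule Bochner_Integration.integrable_bound)
  show "integrable lborel (\<lambda>u. c\<^sup>2 * indicator {a<..b} u :: real)" using assms(2) by simp
  show "(\<lambda>u. (norm (scaled a b H u \<omega>))\<^sup>2) \<in> borel_measurable lborel"
    using scaled_measurable_path[OF assms(1-3,5)] by simp
  show "AE u in lborel. norm ((norm (scaled a b H u \<omega>))\<^sup>2) \<le> norm (c\<^sup>2 * indicator {a<..b} u :: real)"
    using scaled_bound_sq[OF assms(4,5)] by (intro always_eventually allI) (simp add: abs_mult)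
qed

lemma ennreal_qvar:
  assumes "r \<le> a" "a \<le> b" "progressive a b H" "scaled_bound c a b H" "\<omega> \<in> \<Omega>"
  shows "ennreal (qvar a b H \<omega>) = (\<integral>\<^sup>+u. ennreal ((norm (scaled a b H u \<omega>))\<^sup>2) \<partial>lborel)"
  unfolding qvar_def by (intro nn_integral_eq_integral[symmetric] scaled_integrable[OF assms]) simp

lemma qvar_nonneg: "0 \<le> qvar a b H \<omega>"
  unfolding qvar_def by simp

lemma qvar_le:
  assumes "r \<le> a" "a \<le> b" "progressive a b H" "scaled_bound c a b H" "\<omega> \<in> \<Omega>"
  shows "qvar a b H \<omega> \<le> c\<^sup>2 * (b - a)"
proof -
  have "qvar a b H \<omega> \<le> (\<integral>u. c\<^sup>2 * indicator {a<..b} u \<partial>lborel)"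
    unfolding qvar_def by (intro integral_mono scaled_integrable[OF assms] scaled_bound_sq[OF assms(4,5)])
      (use assms(2) in simp)
  then show ?thesis using assms(2) by simp
qed

lemma qvar_split:
  assumes "r \<le> a" "a \<le> b" "b \<le> c" "progressive a b H" "progressive b c H" "scaled_bound k a b H" "scaled_bound k' b c H" "\<omega> \<in> \<Omega>"
  shows "qvar a c H \<omega> = qvar a b H \<omega> + qvar b c H \<omega>"
  unfolding qvar_def scaled_split[OF assms(2,3)]
  using assms by (intro Bochner_Integration.integral_add scaled_integrable[of _ _ _ k] scaled_integrable[of _ _ _ k']) auto

lemma qvar_cong: "(\<And>u. a < u \<Longrightarrow> u \<le> b \<Longrightarrow> H u \<omega> = H' u \<omega>) \<Longrightarrow> qvar a b H \<omega> = qvar a b H' \<omega>"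
  unfolding qvar_def using scaled_cong[of a _ b H \<omega> H'] by (metis (no_types, lifting))

lemma msq_cong: "(\<And>u \<omega>. a < u \<Longrightarrow> u \<le> b \<Longrightarrow> \<omega> \<in> \<Omega> \<Longrightarrow> H u \<omega> = H' u \<omega>) \<Longrightarrow> msq a b H = msq a b H'"
  unfolding msq_def using scaled_cong[of a _ b H _ H'] by (intro nn_integral_cong) simp

lemma qvar_cmult: "qvar a b (\<lambda>u \<omega>. k \<omega> *\<^sub>R H u \<omega>) \<omega> = (k \<omega>)\<^sup>2 * qvar a b H \<omega>"
  unfolding qvar_def scaled_cmult by (simp add: power_mult_distrib)

lemma progressive_const: "r \<le> a \<Longrightarrow> a \<le> b \<Longrightarrow> h \<in> borel_measurable (F a) \<Longrightarrow> progressive a b (\<lambda>_. h)"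
proof -
  assume "r \<le> a" "a \<le> b" "h \<in> borel_measurable (F a)"
  then have [measurable]: "h \<in> borel_measurable (F b)" using measurable_F_mono by blast
  show ?thesis unfolding progressive_def by measurable
qed

lemma scaled_bound_norm:
  assumes "r \<le> a" "\<And>\<omega> u. \<omega> \<in> \<Omega> \<Longrightarrow> a < u \<Longrightarrow> u \<le> b \<Longrightarrow> norm (H u \<omega>) \<le> B" "0 \<le> B"
  shows "scaled_bound (K\<sigma> * B) a b H"
  unfolding scaled_bound_def
proof (intro conjI ballI allI impI)
  fix \<omega> u assume "\<omega> \<in> \<Omega>" "a < u \<and> u \<le> b"
  then show "norm (H u \<omega> v* \<sigma> u (\<omega> u)) \<le> K\<sigma> * B"
    using assms r_nonneg K\<sigma>_pos by (intro order_trans[OF K\<sigma>] mult_left_mono) auto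
qed (use K\<sigma>_pos assms in simp)

end

context driftless_diffusion begin

subsection \<open>Exponential martingales of elementary integrals\<close>

lemma qvar_const:
  assumes "r \<le> t" "\<omega> \<in> \<Omega>"
  shows "(LBINT u=r..t. \<theta> \<bullet> (diffusion_matrix \<sigma> u (\<omega> u) *v \<theta>)) = qvar r t (\<lambda>_ _. \<theta>) \<omega>"
  using assms
  by (simp add: interval_integral_Ioc set_lebesgue_integral_def qvar_def quadratic_form scaled_def power_mult_distrib)
    (intro Bochner_Integration.integral_cong, auto simp: indicator_def)

text \<open>The exponential martingale factors as Z t = Z s * E, so its martingale property says
  that E has unit conditional expectation under the measure with density Z s. Testing there with 1 /
  Z s, which is known at time s, removes the weight.\<close>

lemma exp_increment_const:
  assumes st: "r \<le> s" "s \<le> t"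
  shows "cond_unit C (F s) (\<lambda>\<omega>. ennreal (exp (\<theta> \<bullet> (\<omega> t - \<omega> s) - qvar s t (\<lambda>_ _. \<theta>) \<omega> / 2)))"
proof (rule cond_unit_F)
  interpret Q: prob_space Q by (rule prob_Q)
  define Z where "Z t \<omega> = exp (\<theta> \<bullet> (\<omega> t - y) - (LBINT u=r..t. \<theta> \<bullet> (\<sigma> u (\<omega> u) *v 0))
           - (LBINT u=r..t. \<theta> \<bullet> (diffusion_matrix \<sigma> u (\<omega> u) *v \<theta>)) / 2)" for t and \<omega> :: "'n path"
  define E where "E \<omega> = exp (\<theta> \<bullet> (\<omega> t - \<omega> s) - qvar s t (\<lambda>_ _. \<theta>) \<omega> / 2)" for \<omega> :: "'n path"
  have subQ: "subalgebra Q (F0 s)" using sets_F0_Q by (simp add: subalgebra_def)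
  interpret finite_measure_subalgebra Q "F0 s" by unfold_locales (rule subQ)
  have mart: "is_martingale Q F0 r Z" using exp_martingale[of \<theta>] unfolding Z_def .
  have Zs: "Z s \<in> borel_measurable (F0 s)" "integrable Q (Z s)" and Zt: "integrable Q (Z t)"
    and ce: "AE \<omega> in Q. real_cond_exp Q (F0 s) (Z t) \<omega> = Z s \<omega>"
    using mart st by (auto simp: is_martingale_def)
  have [measurable]: "Z s \<in> borel_measurable Q" "Z t \<in> borel_measurable Q" using Zs Zt by auto
  have bnd: "scaled_bound (K\<sigma> * norm \<theta>) a b (\<lambda>_ _. \<theta>)" if "r \<le> a" for a b
    using that by (intro scaled_bound_norm) auto
  have Epos: "0 < E \<omega>" for \<omega> by (simp add: E_def)
  have Zpos: "0 < Z v \<omega>" for v \<omega> by (simp add: Z_def)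
  have Zq: "Z v \<omega> = exp (\<theta> \<bullet> (\<omega> v - y) - qvar r v (\<lambda>_ _. \<theta>) \<omega> / 2)" if "r \<le> v" "\<omega> \<in> \<Omega>" for v \<omega>
    unfolding Z_def qvar_const[OF that] by simp
  have ZE: "Z t \<omega> = Z s \<omega> * E \<omega>" if "\<omega> \<in> \<Omega>" for \<omega>
  proof -
    have "qvar r t (\<lambda>_ _. \<theta>) \<omega> = qvar r s (\<lambda>_ _. \<theta>) \<omega> + qvar s t (\<lambda>_ _. \<theta>) \<omega>"
      using st that by (intro qvar_split[OF _ _ _ _ _ bnd bnd]) (auto intro: progressive_const)
    then have "\<theta> \<bullet> (\<omega> t - y) - qvar r t (\<lambda>_ _. \<theta>) \<omega> / 2
        = (\<theta> \<bullet> (\<omega> s - y) - qvar r s (\<lambda>_ _. \<theta>) \<omega> / 2) + (\<theta> \<bullet> (\<omega> t - \<omega> s) - qvar s t (\<lambda>_ _. \<theta>) \<omega> / 2)"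
      by (simp add: inner_diff_right field_simps)
    then show ?thesis
      unfolding E_def using st that by (simp only: Zq exp_add order_trans[OF st])
  qed
  have Em: "E \<in> borel_measurable Q"
  proof -
    have "(\<lambda>\<omega>. Z t \<omega> / Z s \<omega>) \<in> borel_measurable Q" by measurable
    moreover have "Z t \<omega> / Z s \<omega> = E \<omega>" if "\<omega> \<in> space Q" for \<omega>
      using ZE[of \<omega>] that Zpos[of s \<omega>] by simp
    ultimately show ?thesis by (subst (asm) measurable_cong) auto
  qed
  have int: "(\<integral>\<^sup>+\<omega>\<in>A. ennreal (Z v \<omega>) \<partial>Q) = ennreal (\<integral>\<omega>\<in>A. Z v \<omega> \<partial>Q)" if "integrable Q (Z v)" "A \<in> sets Q" for v A
  proof -
    have "(\<integral>\<^sup>+\<omega>\<in>A. ennreal (Z v \<omega>) \<partial>Q) = (\<integral>\<^sup>+\<omega>. ennreal (indicator A \<omega> *\<^sub>R Z v \<omega>) \<partial>Q)"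
      by (intro nn_integral_cong) (simp split: split_indicator)
    also have "\<dots> = ennreal (\<integral>\<omega>. indicator A \<omega> *\<^sub>R Z v \<omega> \<partial>Q)"
      using that less_imp_le[OF Zpos] by (intro nn_integral_eq_integral integrable_mult_indicator) simp_all
    finally show ?thesis by (simp add: set_lebesgue_integral_def)
  qed
  have eq: "(\<integral>\<^sup>+\<omega>\<in>A. ennreal (Z t \<omega>) \<partial>Q) = (\<integral>\<^sup>+\<omega>\<in>A. ennreal (Z s \<omega>) \<partial>Q)" if A: "A \<in> sets (F0 s)" for A
  proof -
    have A': "A \<in> sets Q" using A sets_F0_Q by auto
    have "(\<integral>\<omega>\<in>A. Z t \<omega> \<partial>Q) = (\<integral>\<omega>\<in>A. real_cond_exp Q (F0 s) (Z t) \<omega> \<partial>Q)"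
      by (rule real_cond_exp_intA[OF Zt A])
    also have "\<dots> = (\<integral>\<omega>\<in>A. Z s \<omega> \<partial>Q)"
      unfolding set_lebesgue_integral_def using ce A'
      by (intro integral_cong_AE) (auto simp: measurable_from_subalg[OF subQ])
    finally show ?thesis using int[OF Zt A'] int[OF Zs(2) A'] by simp
  qed
  let ?D = "density Q (\<lambda>\<omega>. ennreal (Z s \<omega>))"
  have subD: "subalgebra ?D (F0 s)" using sets_F0_Q by (simp add: subalgebra_def)
  have "cond_unit ?D (F0 s) (\<lambda>\<omega>. ennreal (E \<omega>))"
    unfolding cond_unit_def
  proof (intro conjI ballI)
    fix A assume A: "A \<in> sets (F0 s)"
    then have [measurable]: "A \<in> sets Q" using sets_F0_Q by auto
    have "(\<integral>\<^sup>+\<omega>\<in>A. ennreal (E \<omega>) \<partial>?D) = (\<integral>\<^sup>+\<omega>\<in>A. ennreal (Z t \<omega>) \<partial>Q)"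
      using Em by (subst nn_integral_density)
        (simp_all add: ZE ennreal_mult less_imp_le[OF Zpos] less_imp_le[OF Epos] mult_ac cong: nn_integral_cong_simp)
    also have "\<dots> = emeasure ?D A" unfolding eq[OF A] by (simp add: emeasure_density)
    finally show "(\<integral>\<^sup>+\<omega>\<in>A. ennreal (E \<omega>) \<partial>?D) = emeasure ?D A" .
  qed (use Em in simp)
  note cu = cond_unit_nn_integral[OF subD this]
  have "cond_unit Q (F0 s) (\<lambda>\<omega>. ennreal (E \<omega>))"
    unfolding cond_unit_def
  proof (intro conjI ballI)
    fix A assume A: "A \<in> sets (F0 s)"
    then have [measurable]: "A \<in> sets Q" using sets_F0_Q by auto
    have inv: "ennreal (Z s \<omega>) * (ennreal (inverse (Z s \<omega>)) * x) = x" for \<omega> x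
      using Zpos[of s \<omega>] by (simp add: mult.assoc[symmetric] ennreal_mult[symmetric])
    have "(\<integral>\<^sup>+\<omega>. (ennreal (inverse (Z s \<omega>)) * indicator A \<omega>) * ennreal (E \<omega>) \<partial>?D) = (\<integral>\<^sup>+\<omega>. ennreal (inverse (Z s \<omega>)) * indicator A \<omega> \<partial>?D)"
      by (rule cu) (use Zs A in measurable)
    then have "(\<integral>\<^sup>+\<omega>. indicator A \<omega> * ennreal (E \<omega>) \<partial>Q) = (\<integral>\<^sup>+\<omega>. indicator A \<omega> \<partial>Q)"
      using Em by (simp add: nn_integral_density inv mult.assoc)
    then show "(\<integral>\<^sup>+\<omega>\<in>A. ennreal (E \<omega>) \<partial>Q) = emeasure Q A" by (simp add: mult.commute)
  qed (use Em in simp)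
  then have "cond_unit C (F0 s) (\<lambda>\<omega>. ennreal (E \<omega>))"
    unfolding cond_unit_def using subsetD[OF sets_F0_Q] Em
    by (simp add: measurable_completion nn_integral_completion emeasure_completion main_part)
  then show "cond_unit C (F0 s) (\<lambda>\<omega>. ennreal (exp (\<theta> \<bullet> (\<omega> t - \<omega> s) - qvar s t (\<lambda>_ _. \<theta>) \<omega> / 2)))"
    by (simp add: E_def)
qed

lemma tendsto_vector_matrix_mult:
  fixes f :: "'c \<Rightarrow> real ^ 'n" and M :: "real ^ 'n ^ 'n"
  assumes "(f \<longlongrightarrow> l) net"
  shows "((\<lambda>x. f x v* M) \<longlongrightarrow> l v* M) net"
proof -
  have "continuous_on UNIV (\<lambda>v::real ^ 'n. v v* M)" by (intro continuous_intros)
  then have "isCont (\<lambda>v::real ^ 'n. v v* M) l" by (simp add: continuous_on_eq_continuous_at)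
  then show ?thesis by (rule isCont_tendsto_compose[OF _ assms])
qed

lemma borel_measurable_exp_inner:
  fixes f g h :: "'c \<Rightarrow> real ^ 'n"
  assumes "f \<in> borel_measurable M" "g \<in> borel_measurable M" "h \<in> borel_measurable M" "q \<in> borel_measurable M"
  shows "(\<lambda>\<omega>. exp (h \<omega> \<bullet> (f \<omega> - g \<omega>) - q \<omega> / 2)) \<in> borel_measurable M"
  using assms by measurable

lemma exp_increment_measurable:
  assumes st: "r \<le> s" "s \<le> t" and h: "h \<in> borel_measurable (F s)"
  shows "(\<lambda>\<omega>. exp (h \<omega> \<bullet> (\<omega> t - \<omega> s) - qvar s t (\<lambda>_. h) \<omega> / 2)) \<in> borel_measurable (F t)"
proof -
  have "(\<lambda>\<omega>. \<omega> t) \<in> borel_measurable (F t)" "(\<lambda>\<omega>. \<omega> s) \<in> borel_measurable (F t)"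
    by (rule coordinate_measurable; use st in simp)+
  then show ?thesis
    by (rule borel_measurable_exp_inner[OF _ _ measurable_F_mono[OF h st(2)] qvar_measurable[OF st progressive_const[OF st h]]])
qed

text \<open>Doubling h doubles the linear term p but quadruples the quadratic variation q: exp (2 p
  - q) = exp q * exp (2 p - 2 q). Since q is bounded, the second moment is controlled by the mean of
  another exponential of the same kind.\<close>

lemma exp_increment_sq:
  assumes st: "r \<le> s" "s \<le> t" and h: "h \<in> borel_measurable (F s)" and B: "\<And>\<omega>. \<omega> \<in> \<Omega> \<Longrightarrow> norm (h \<omega>) \<le> B" "0 \<le> B"
    and \<omega>: "\<omega> \<in> \<Omega>"
  shows "(exp (h \<omega> \<bullet> (\<omega> t - \<omega> s) - qvar s t (\<lambda>_. h) \<omega> / 2))\<^sup>2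
     \<le> exp ((K\<sigma> * B)\<^sup>2 * (t - s)) * exp ((2 *\<^sub>R h \<omega>) \<bullet> (\<omega> t - \<omega> s) - qvar s t (\<lambda>_ \<omega>. 2 *\<^sub>R h \<omega>) \<omega> / 2)"
proof -
  have aux: "2 * (p - q / 2) \<le> c + (2 * p - 4 * q / 2)" if "q \<le> c" for p q c :: real
    using that by simp
  have sb: "scaled_bound (K\<sigma> * B) s t (\<lambda>_. h)"
    by (rule scaled_bound_norm[OF st(1) B(1) B(2)])
  have 1: "qvar s t (\<lambda>_. h) \<omega> \<le> (K\<sigma> * B)\<^sup>2 * (t - s)"
    by (rule qvar_le[OF st progressive_const[OF st h] sb \<omega>])
  have 2: "qvar s t (\<lambda>_ \<omega>. 2 *\<^sub>R h \<omega>) \<omega> = 4 * qvar s t (\<lambda>_. h) \<omega>"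
    using qvar_cmult[of s t "\<lambda>_. 2" "\<lambda>_. h" \<omega>] by simp
  have "2 * (h \<omega> \<bullet> (\<omega> t - \<omega> s) - qvar s t (\<lambda>_. h) \<omega> / 2)
    \<le> (K\<sigma> * B)\<^sup>2 * (t - s) + ((2 *\<^sub>R h \<omega>) \<bullet> (\<omega> t - \<omega> s) - qvar s t (\<lambda>_ \<omega>. 2 *\<^sub>R h \<omega>) \<omega> / 2)"
    unfolding 2 inner_scaleR_left by (rule aux[OF 1])
  then show ?thesis
    unfolding exp_add[symmetric] exp_double[symmetric] exp_le_cancel_iff .
qed

text \<open>On each level set of h the exponent is a constant vector, and the level set is known at
  time s; the constant case is summed over the finitely many levels.\<close>

lemma exp_increment_simple:
  assumes st: "r \<le> s" "s \<le> t" and h: "simple_function (F s) h"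
  shows "cond_unit C (F s) (\<lambda>\<omega>. ennreal (exp (h \<omega> \<bullet> (\<omega> t - \<omega> s) - qvar s t (\<lambda>_. h) \<omega> / 2)))"
  unfolding cond_unit_def
proof (intro conjI ballI)
  have hm: "h \<in> borel_measurable (F s)" by (rule borel_measurable_simple_function[OF h])
  show m: "(\<lambda>\<omega>. ennreal (exp (h \<omega> \<bullet> (\<omega> t - \<omega> s) - qvar s t (\<lambda>_. h) \<omega> / 2))) \<in> borel_measurable C"
    using measurable_F_C[OF exp_increment_measurable[OF st hm]] by simp
  fix A assume A: "A \<in> sets (F s)"
  define D where "D \<theta> \<omega> = exp (\<theta> \<bullet> (\<omega> t - \<omega> s) - qvar s t (\<lambda>_ _. \<theta>) \<omega> / 2)" for \<theta> and \<omega> :: "'n path"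
  have [measurable]: "D \<theta> \<in> borel_measurable C" for \<theta>
    unfolding D_def[abs_def] using measurable_F_C[OF exp_increment_measurable[OF st, of "\<lambda>_. \<theta>"]] by simp
  define B where "B \<theta> = A \<inter> (h -` {\<theta>} \<inter> \<Omega>)" for \<theta>
  have fin: "finite (h ` \<Omega>)" using simple_functionD(1)[OF h] by simp
  have B: "B \<theta> \<in> sets (F s)" for \<theta>
    using A simple_functionD(2)[OF h, of "{\<theta>}"] unfolding B_def by auto
  then have BC [measurable]: "B \<theta> \<in> sets C" for \<theta> using sets_F_C by blast
  have A\<Omega>: "A \<subseteq> \<Omega>" using sets.sets_into_space[OF A] by simp
  have "(\<integral>\<^sup>+\<omega>\<in>A. ennreal (exp (h \<omega> \<bullet> (\<omega> t - \<omega> s) - qvar s t (\<lambda>_. h) \<omega> / 2)) \<partial>C)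
    = (\<integral>\<^sup>+\<omega>. (\<Sum>\<theta>\<in>h`\<Omega>. ennreal (D \<theta> \<omega>) * indicator (B \<theta>) \<omega>) \<partial>C)"
  proof (rule nn_integral_cong)
    fix \<omega> assume "\<omega> \<in> space C"
    then have \<omega>: "\<omega> \<in> \<Omega>" by simp
    have "(\<Sum>\<theta>\<in>h`\<Omega>. ennreal (D \<theta> \<omega>) * indicator (B \<theta>) \<omega>) = (\<Sum>\<theta>\<in>h`\<Omega>. if \<theta> = h \<omega> then ennreal (D (h \<omega>) \<omega>) * indicator A \<omega> else 0)"
      using \<omega> by (intro sum.cong) (auto simp: B_def indicator_def)
    also have "\<dots> = ennreal (D (h \<omega>) \<omega>) * indicator A \<omega>" using fin \<omega> by simp
    also have "D (h \<omega>) \<omega> = exp (h \<omega> \<bullet> (\<omega> t - \<omega> s) - qvar s t (\<lambda>_. h) \<omega> / 2)"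
      unfolding D_def using qvar_cong[of s t "\<lambda>_. h" \<omega> "\<lambda>_ _. h \<omega>"] by simp
    finally show "ennreal (exp (h \<omega> \<bullet> (\<omega> t - \<omega> s) - qvar s t (\<lambda>_. h) \<omega> / 2)) * indicator A \<omega>
      = (\<Sum>\<theta>\<in>h`\<Omega>. ennreal (D \<theta> \<omega>) * indicator (B \<theta>) \<omega>)" by simp
  qed
  also have "\<dots> = (\<Sum>\<theta>\<in>h`\<Omega>. \<integral>\<^sup>+\<omega>\<in>B \<theta>. ennreal (D \<theta> \<omega>) \<partial>C)"
    by (rule nn_integral_sum) measurable
  also have "\<dots> = (\<Sum>\<theta>\<in>h`\<Omega>. emeasure C (B \<theta>))"
    using exp_increment_const[OF st] B unfolding cond_unit_def D_def by (intro sum.cong) auto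
  also have "\<dots> = emeasure C (\<Union>\<theta>\<in>h`\<Omega>. B \<theta>)"
    by (rule sum_emeasure[OF _ _ fin], use BC in blast) (auto simp: disjoint_family_on_def B_def)
  also have "(\<Union>\<theta>\<in>h`\<Omega>. B \<theta>) = A" using A\<Omega> by (auto simp: B_def)
  finally show "(\<integral>\<^sup>+\<omega>\<in>A. ennreal (exp (h \<omega> \<bullet> (\<omega> t - \<omega> s) - qvar s t (\<lambda>_. h) \<omega> / 2)) \<partial>C) = emeasure C A" .
qed

lemma exp_increment:
  assumes st: "r \<le> s" "s \<le> t" and h: "h \<in> borel_measurable (F s)" and bd: "bounded (h ` \<Omega>)"
  shows "cond_unit C (F s) (\<lambda>\<omega>. ennreal (exp (h \<omega> \<bullet> (\<omega> t - \<omega> s) - qvar s t (\<lambda>_. h) \<omega> / 2)))"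
proof -
  obtain B where B: "\<And>\<omega>. \<omega> \<in> \<Omega> \<Longrightarrow> norm (h \<omega>) \<le> B" "0 < B" using bd unfolding bounded_pos by auto
  obtain k where "\<forall>i. simple_function (F s) (k i)" "\<forall>\<omega>\<in>space (F s). (\<lambda>i. k i \<omega>) \<longlonglongrightarrow> h \<omega>"
    "\<forall>i. \<forall>\<omega>\<in>space (F s). dist (k i \<omega>) 0 \<le> 2 * dist (h \<omega>) 0"
    using borel_measurable_implies_sequence_metric[OF h, of 0] by blast
  then have k: "\<And>i. simple_function (F s) (k i)" "\<And>\<omega>. \<omega> \<in> \<Omega> \<Longrightarrow> (\<lambda>i. k i \<omega>) \<longlonglongrightarrow> h \<omega>"
    "\<And>i \<omega>. \<omega> \<in> \<Omega> \<Longrightarrow> dist (k i \<omega>) 0 \<le> 2 * dist (h \<omega>) 0" by auto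
  have km: "k i \<in> borel_measurable (F s)" for i by (rule borel_measurable_simple_function[OF k(1)])
  have kB: "norm (k i \<omega>) \<le> 2 * B" if "\<omega> \<in> \<Omega>" for i \<omega> using k(3)[OF that, of i] B(1)[OF that] by simp
  let ?D = "\<lambda>h \<omega>. exp (h \<omega> \<bullet> (\<omega> t - \<omega> s) - qvar s t (\<lambda>_. h) \<omega> / 2)"
  \<comment> \<open>The factor 2 comes from the approximating simple functions, whose norm is at
    most twice that of h.\<close>
  let ?c = "exp ((K\<sigma> * (2 * B))\<^sup>2 * (t - s))"
  show ?thesis
  proof (rule cond_unit_limit[OF C.finite_measure_axioms subalgebra_F])
    show "cond_unit C (F s) (\<lambda>\<omega>. ennreal (?D (k i) \<omega>))" for i by (rule exp_increment_simple[OF st k(1)])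
    show "?D (k i) \<in> borel_measurable C" for i by (rule measurable_F_C[OF exp_increment_measurable[OF st km]])
    show "?D h \<in> borel_measurable C" by (rule measurable_F_C[OF exp_increment_measurable[OF st h]])
    show "(\<integral>\<^sup>+\<omega>. ennreal ((?D (k i) \<omega>)\<^sup>2) \<partial>C) \<le> ennreal ?c" for i
    proof -
      have k2: "simple_function (F s) (\<lambda>\<omega>. 2 *\<^sub>R k i \<omega>)" using k(1) by (rule simple_function_compose1)
      then have m2: "?D (\<lambda>\<omega>. 2 *\<^sub>R k i \<omega>) \<in> borel_measurable C"
        by (intro measurable_F_C[OF exp_increment_measurable[OF st]] borel_measurable_simple_function)
      have "(\<integral>\<^sup>+\<omega>. ennreal ((?D (k i) \<omega>)\<^sup>2) \<partial>C) \<le> (\<integral>\<^sup>+\<omega>. ennreal ?c * ennreal (?D (\<lambda>\<omega>. 2 *\<^sub>R k i \<omega>) \<omega>) \<partial>C)"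
      proof (rule nn_integral_mono)
        fix \<omega> assume "\<omega> \<in> space C"
        then have \<omega>: "\<omega> \<in> \<Omega>" by simp
        have "0 \<le> 2 * B" using B(2) by simp
        from exp_increment_sq[OF st km kB this \<omega>, of i]
        show "ennreal ((?D (k i) \<omega>)\<^sup>2) \<le> ennreal ?c * ennreal (?D (\<lambda>\<omega>. 2 *\<^sub>R k i \<omega>) \<omega>)"
          by (subst ennreal_mult[symmetric]) (simp_all only: ennreal_leI exp_ge_zero)
      qed
      also have "\<dots> = ennreal ?c * (\<integral>\<^sup>+\<omega>. ennreal (?D (\<lambda>\<omega>. 2 *\<^sub>R k i \<omega>) \<omega>) \<partial>C)"
        using m2 by (intro nn_integral_cmult) simp
      also have "(\<integral>\<^sup>+\<omega>. ennreal (?D (\<lambda>\<omega>. 2 *\<^sub>R k i \<omega>) \<omega>) \<partial>C) = 1"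
        using cond_unit_nn_integral[OF subalgebra_F exp_increment_simple[OF st k2], of "\<lambda>_. 1"] C.emeasure_space_1 by simp
      finally show ?thesis by simp
    qed
    show "AE \<omega> in C. (\<lambda>i. ?D (k i) \<omega>) \<longlonglongrightarrow> ?D h \<omega>"
    proof (rule AE_I2)
      fix \<omega> assume "\<omega> \<in> space C"
      then have \<omega>: "\<omega> \<in> \<Omega>" by simp
      have "(\<lambda>i. qvar s t (\<lambda>_. k i) \<omega>) \<longlonglongrightarrow> qvar s t (\<lambda>_. h) \<omega>"
        unfolding qvar_def
      proof (rule integral_dominated_convergence)
        show "(\<lambda>u. (norm (scaled s t (\<lambda>_. k i) u \<omega>))\<^sup>2) \<in> borel_measurable lborel" for i
          using scaled_measurable_path[OF st progressive_const[OF st km] \<omega>] by simp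
        show "(\<lambda>u. (norm (scaled s t (\<lambda>_. h) u \<omega>))\<^sup>2) \<in> borel_measurable lborel"
          using scaled_measurable_path[OF st progressive_const[OF st h] \<omega>] by simp
        show "integrable lborel (\<lambda>u. (K\<sigma> * (2 * B))\<^sup>2 * indicator {s<..t} u :: real)" using st by simp
        have "scaled_bound (K\<sigma> * (2 * B)) s t (\<lambda>_. k i)" for i
          by (rule scaled_bound_norm[OF st(1) kB]) (use B(2) in simp_all)
        then show "AE u in lborel. norm ((norm (scaled s t (\<lambda>_. k i) u \<omega>))\<^sup>2) \<le> (K\<sigma> * (2 * B))\<^sup>2 * indicator {s<..t} u" for i
          using scaled_bound_sq[OF _ \<omega>] by (intro AE_I2) simp
        show "AE u in lborel. (\<lambda>i. (norm (scaled s t (\<lambda>_. k i) u \<omega>))\<^sup>2) \<longlonglongrightarrow> (norm (scaled s t (\<lambda>_. h) u \<omega>))\<^sup>2"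
          unfolding scaled_def
          by (intro AE_I2 tendsto_power tendsto_norm tendsto_scaleR tendsto_const tendsto_vector_matrix_mult k(2)[OF \<omega>])
      qed
      then show "(\<lambda>i. ?D (k i) \<omega>) \<longlonglongrightarrow> ?D h \<omega>"
        by (intro tendsto_exp tendsto_diff tendsto_inner tendsto_const tendsto_divide k(2)[OF \<omega>]) auto
    qed
  qed simp
qed

end

context driftless_diffusion begin

subsection \<open>Elementary integrals\<close>

text \<open>\<open>elem a b K J\<close>: on \<open>(a, b]\<close> the process \<open>K\<close> is piecewise constant, and \<open>J\<close> is its
  stochastic integral. Subdivisions are left implicit, so that splitting and subtracting elementary
  processes requires no common refinement.\<close>

inductive elementary :: "real \<Rightarrow> (real \<Rightarrow> 'n path \<Rightarrow> real ^ 'n) \<Rightarrow> real \<Rightarrow> ('n path \<Rightarrow> real) \<Rightarrow> bool"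
  for a :: real and K :: "real \<Rightarrow> 'n path \<Rightarrow> real ^ 'n" where
  Nil: "elementary a K a (\<lambda>_. 0)"
| Step: "elementary a K b J \<Longrightarrow> b < c \<Longrightarrow> h \<in> borel_measurable (F b) \<Longrightarrow> bounded (h ` \<Omega>) \<Longrightarrow>
    (\<And>u \<omega>. b < u \<Longrightarrow> u \<le> c \<Longrightarrow> \<omega> \<in> \<Omega> \<Longrightarrow> K u \<omega> = h \<omega>) \<Longrightarrow>
    elementary a K c (\<lambda>\<omega>. J \<omega> + h \<omega> \<bullet> (\<omega> c - \<omega> b))"

abbreviation elem :: "real \<Rightarrow> real \<Rightarrow> (real \<Rightarrow> 'n path \<Rightarrow> real ^ 'n) \<Rightarrow> ('n path \<Rightarrow> real) \<Rightarrow> bool" where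
  "elem a b K J \<equiv> elementary a K b J"

lemma elem_le: "elem a b K J \<Longrightarrow> a \<le> b"
  by (induction rule: elementary.induct) auto

lemma elem_single:
  assumes "a \<le> b" "h \<in> borel_measurable (F a)" "bounded (h ` \<Omega>)"
    "\<And>u \<omega>. a < u \<Longrightarrow> u \<le> b \<Longrightarrow> \<omega> \<in> \<Omega> \<Longrightarrow> K u \<omega> = h \<omega>"
  shows "elem a b K (\<lambda>\<omega>. h \<omega> \<bullet> (\<omega> b - \<omega> a))"
proof (cases "a = b")
  case True then show ?thesis using elementary.Nil[of b K] by simp
next
  case False
  then show ?thesis using elementary.Step[OF elementary.Nil, of a b h K] assms by simp
qed

lemma elem_cong:
  assumes "elem a b K J" "\<And>u \<omega>. a < u \<Longrightarrow> u \<le> b \<Longrightarrow> \<omega> \<in> \<Omega> \<Longrightarrow> K u \<omega> = K' u \<omega>"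
  shows "elem a b K' J"
  using assms
proof (induction rule: elementary.induct)
  case Nil show ?case by (rule elementary.Nil)
next
  case (Step b J c h)
  have "a \<le> b" using elem_le[OF Step(1)] .
  show ?case
  proof (rule elementary.Step[OF Step(6) Step(2-4)])
    show "K u \<omega> = K' u \<omega>" if "a < u" "u \<le> b" "\<omega> \<in> \<Omega>" for u \<omega>
      using Step(2,7) that by simp
    show "K' u \<omega> = h \<omega>" if "b < u" "u \<le> c" "\<omega> \<in> \<Omega>" for u \<omega>
      using Step(5)[OF that] Step(7)[of u \<omega>] that \<open>a \<le> b\<close> by simp
  qed
qed

text \<open>If b falls inside a step, the step is cut there: its value h is known at the earlier
  breakpoint, hence also at b, and the increment of the path splits additively.\<close>

lemma elem_split:
  assumes "elem a c K J" "a \<le> b" "b \<le> c"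
  shows "\<exists>J1 J2. elem a b K J1 \<and> elem b c K J2 \<and> J = (\<lambda>\<omega>. J1 \<omega> + J2 \<omega>)"
  using assms
proof (induction rule: elementary.induct)
  case Nil
  then have "b = a" by simp
  then show ?case using elementary.Nil[of a K] by (intro exI[of _ "\<lambda>_. 0"]) auto
next
  case (Step b' J c h)
  show ?case
  proof (cases "b \<le> b'")
    case True
    then obtain J1 J2 where J: "elem a b K J1" "elem b b' K J2" "J = (\<lambda>\<omega>. J1 \<omega> + J2 \<omega>)" using Step by blast
    have "elem b c K (\<lambda>\<omega>. J2 \<omega> + h \<omega> \<bullet> (\<omega> c - \<omega> b'))" by (rule elementary.Step[OF J(2) Step(2-5)])
    with J show ?thesis by (intro exI[of _ J1] exI[of _ "\<lambda>\<omega>. J2 \<omega> + h \<omega> \<bullet> (\<omega> c - \<omega> b')"]) auto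
  next
    case False
    then have b': "b' < b" by simp
    have "elem a b K (\<lambda>\<omega>. J \<omega> + h \<omega> \<bullet> (\<omega> b - \<omega> b'))"
      by (rule elementary.Step[OF Step(1) b' Step(3,4)]) (use Step(5,8) in auto)
    moreover have "elem b c K (\<lambda>\<omega>. h \<omega> \<bullet> (\<omega> c - \<omega> b))"
      by (rule elem_single) (use Step(4,5,8) b' measurable_F_mono[OF Step(3)] in auto)
    ultimately show ?thesis
      by (intro exI[of _ "\<lambda>\<omega>. J \<omega> + h \<omega> \<bullet> (\<omega> b - \<omega> b')"] exI[of _ "\<lambda>\<omega>. h \<omega> \<bullet> (\<omega> c - \<omega> b)"])
        (auto simp: inner_diff_right)
  qed
qed

lemma elem_concat:
  assumes "elem b c K J2" "elem a b K J1"
  shows "elem a c K (\<lambda>\<omega>. J1 \<omega> + J2 \<omega>)"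
  using assms
proof (induction rule: elementary.induct)
  case Nil then show ?case by simp
next
  case (Step b' J c h)
  from elementary.Step[OF Step(6)[OF Step(7)] Step(2-5)] show ?case by (simp add: add.assoc)
qed

lemma elem_const_diff:
  assumes "elem b c K J" "h \<in> borel_measurable (F b)" "bounded (h ` \<Omega>)"
  shows "elem b c (\<lambda>u \<omega>. h \<omega> - K u \<omega>) (\<lambda>\<omega>. h \<omega> \<bullet> (\<omega> c - \<omega> b) - J \<omega>)"
  using assms
proof (induction rule: elementary.induct)
  case Nil then show ?case using elementary.Nil by simp
next
  case (Step b' J c h')
  have "b \<le> b'" using elem_le[OF Step(1)] .
  then have [measurable]: "h \<in> borel_measurable (F b')" "h' \<in> borel_measurable (F b')"
    using measurable_F_mono[OF Step(7)] Step(3) by auto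
  have "elem b c (\<lambda>u \<omega>. h \<omega> - K u \<omega>) (\<lambda>\<omega>. (h \<omega> \<bullet> (\<omega> b' - \<omega> b) - J \<omega>) + (h \<omega> - h' \<omega>) \<bullet> (\<omega> c - \<omega> b'))"
    by (rule elementary.Step[OF Step(6)[OF Step(7,8)] Step(2)])
      (use Step(4,5,8) in \<open>auto intro!: bounded_minus_comp\<close>)
  moreover have "(\<lambda>\<omega>. (h \<omega> \<bullet> (\<omega> b' - \<omega> b) - J \<omega>) + (h \<omega> - h' \<omega>) \<bullet> (\<omega> c - \<omega> b'))
     = (\<lambda>\<omega>. h \<omega> \<bullet> (\<omega> c - \<omega> b) - (J \<omega> + h' \<omega> \<bullet> (\<omega> c - \<omega> b')))"
    by (auto simp: fun_eq_iff inner_diff_right inner_diff_left)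
  ultimately show ?case by simp
qed

text \<open>The second process is split at the last breakpoint of the first. On the piece that
  remains the first process is constant in time, which is the case of
  \<open>elem_const_diff\<close>; the earlier part is the induction hypothesis.\<close>

lemma elem_diff:
  assumes "elem a c K J" "elem a c K' J'"
  shows "elem a c (\<lambda>u \<omega>. K u \<omega> - K' u \<omega>) (\<lambda>\<omega>. J \<omega> - J' \<omega>)"
  using assms
proof (induction arbitrary: J' rule: elementary.induct)
  case Nil
  from this(1) show ?case
  proof cases
    case Nil then show ?thesis using elementary.Nil by simp
  next
    case (Step b J h) then show ?thesis using elem_le by fastforce
  qed
next
  case (Step b J c h)
  obtain J1 J2 where J': "elem a b K' J1" "elem b c K' J2" "J' = (\<lambda>\<omega>. J1 \<omega> + J2 \<omega>)"
    using elem_split[OF Step(7), of b] elem_le[OF Step(1)] Step(2) by auto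
  have "elem b c (\<lambda>u \<omega>. K u \<omega> - K' u \<omega>) (\<lambda>\<omega>. h \<omega> \<bullet> (\<omega> c - \<omega> b) - J2 \<omega>)"
    using elem_cong[OF elem_const_diff[OF J'(2) Step(3,4)], of "\<lambda>u \<omega>. K u \<omega> - K' u \<omega>"] Step(5) by simp
  from elem_concat[OF this Step(6)[OF J'(1)]] show ?case
    unfolding J'(3) by (simp add: algebra_simps)
qed

text \<open>A factor known at time a is known at every later breakpoint, so it can be absorbed into
  the values of the process. Applied to indicators, this is the source of locality.\<close>

lemma elem_scale:
  assumes "elem a c K J" and k: "k \<in> borel_measurable (F a)" and bd: "bounded (k ` \<Omega>)"
  shows "elem a c (\<lambda>u \<omega>. k \<omega> *\<^sub>R K u \<omega>) (\<lambda>\<omega>. k \<omega> * J \<omega>)"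
  using assms(1)
proof (induction rule: elementary.induct)
  case Nil then show ?case using elementary.Nil by simp
next
  case (Step b J c h)
  have [measurable]: "k \<in> borel_measurable (F b)" "h \<in> borel_measurable (F b)"
    using measurable_F_mono[OF k elem_le[OF Step(1)]] Step(3) by auto
  have "bounded ((\<lambda>\<omega>. k \<omega> *\<^sub>R h \<omega>) ` \<Omega>)"
  proof -
    obtain B B' where "\<forall>\<omega>\<in>\<Omega>. norm (k \<omega>) \<le> B" "\<forall>\<omega>\<in>\<Omega>. norm (h \<omega>) \<le> B'"
      using bd Step(4) unfolding bounded_iff by auto
    then have "norm (k \<omega> *\<^sub>R h \<omega>) \<le> B * B'" if "\<omega> \<in> \<Omega>" for \<omega>
      unfolding norm_scaleR real_norm_def[symmetric]
      by (intro mult_mono) (use that in \<open>auto intro: order_trans[OF norm_ge_zero]\<close>)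
    then show ?thesis unfolding bounded_iff by auto
  qed
  from elementary.Step[OF Step(6) Step(2) _ this] show ?case using Step(5) by (simp add: distrib_left)
qed

lemma measurable_pair_F_mono:
  assumes f: "f \<in> measurable (N \<Otimes>\<^sub>M F b) L" and "b \<le> c"
  shows "f \<in> measurable (N \<Otimes>\<^sub>M F c) L"
proof -
  have "(\<lambda>\<omega>. \<omega>) \<in> measurable (F c) (F b)"
  proof (rule measurableI)
    fix A assume A: "A \<in> sets (F b)"
    then have "A \<inter> \<Omega> = A" using sets.sets_into_space[OF A] by auto
    then show "(\<lambda>\<omega>. \<omega>) -` A \<inter> space (F c) \<in> sets (F c)" using A sets_F_mono[OF assms(2)] by auto
  qed simp
  then have "(\<lambda>x. (fst x, snd x)) \<in> measurable (N \<Otimes>\<^sub>M F c) (N \<Otimes>\<^sub>M F b)"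
    by (intro measurable_Pair measurable_fst measurable_compose[OF measurable_snd])
  from measurable_compose[OF this f] show ?thesis by simp
qed

lemma elem_props:
  assumes "elem a b K J" "r \<le> a"
  shows "J \<in> borel_measurable (F b)" "progressive a b K"
    "\<exists>B\<ge>0. \<forall>u \<omega>. a < u \<and> u \<le> b \<and> \<omega> \<in> \<Omega> \<longrightarrow> norm (K u \<omega>) \<le> B"
  using assms
proof (induction rule: elementary.induct)
  case Nil
  { case 1 show ?case by simp }
  { case 2 show ?case by (simp add: progressive_def) }
  { case 3 show ?case by (intro exI[of _ 0]) auto }
next
  case (Step b J c h)
  have ab: "a \<le> b" using elem_le[OF Step(1)] .
  have [measurable]: "h \<in> borel_measurable (F c)" using measurable_F_mono[OF Step(3)] Step(2) by auto
  { case 1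
    then have [measurable]: "J \<in> borel_measurable (F c)" using measurable_F_mono[OF Step(6)] Step(2) by auto
    have *: "(\<lambda>\<omega>. \<omega> c) \<in> borel_measurable (F c)" "(\<lambda>\<omega>. \<omega> b) \<in> borel_measurable (F c)"
      by (rule coordinate_measurable; use 1 ab Step(2) in simp)+
    have "(\<lambda>\<omega>. h \<omega> \<bullet> (\<omega> c - \<omega> b)) \<in> borel_measurable (F c)"
      by (rule borel_measurable_inner[OF _ borel_measurable_diff[OF *]]) measurable
    then show ?case by (rule borel_measurable_add[rotated]) measurable }
  { case 2
    then have P: "(\<lambda>(u, \<omega>). indicator {a<..b} u *\<^sub>R K u \<omega>) \<in> borel_measurable (borel \<Otimes>\<^sub>M F b)"
      using Step(7) by (simp add: progressive_def)
    have [measurable]: "(\<lambda>(u, \<omega>). indicator {a<..b} u *\<^sub>R K u \<omega>) \<in> borel_measurable (borel \<Otimes>\<^sub>M F c)"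
      by (rule measurable_pair_F_mono[OF P]) (use Step(2) in simp)
    have "(\<lambda>x. (case x of (u, \<omega>) \<Rightarrow> indicator {a<..b} u *\<^sub>R K u \<omega>) + indicator {b<..c} (fst x) *\<^sub>R h (snd x)) \<in> borel_measurable (borel \<Otimes>\<^sub>M F c)"
      by measurable
    then show ?case unfolding progressive_def
      by (rule measurable_cong[THEN iffD1, rotated])
        (use ab Step(2,5) in \<open>auto simp: space_pair_measure split: split_indicator\<close>) }
  { case 3
    then obtain B where B: "0 \<le> B" "\<And>u \<omega>. a < u \<Longrightarrow> u \<le> b \<Longrightarrow> \<omega> \<in> \<Omega> \<Longrightarrow> norm (K u \<omega>) \<le> B" using Step(8) by blast
    obtain B' where B': "\<And>\<omega>. \<omega> \<in> \<Omega> \<Longrightarrow> norm (h \<omega>) \<le> B'" using Step(4) unfolding bounded_iff by auto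
    have "norm (K u \<omega>) \<le> max B B'" if "a < u" "u \<le> c" "\<omega> \<in> \<Omega>" for u \<omega>
    proof (cases "u \<le> b")
      case True then show ?thesis using B(2)[OF that(1) True that(3)] by simp
    next
      case False then show ?thesis using Step(5)[of u \<omega>] that B'[OF that(3)] by simp
    qed
    then show ?case using B(1) by (intro exI[of _ "max B B'"]) auto }
qed

lemma elem_bound:
  assumes "elem a b K J" "r \<le> a"
  shows "\<exists>c. scaled_bound c a b K"
  using elem_props(3)[OF assms] scaled_bound_norm[OF assms(2), of b K] by blast

text \<open>One step contributes \<open>exp_increment\<close>; \<open>cond_unit_mult\<close>
  attaches it to the integral up to b, because the quadratic variation is additive over the two
  intervals.\<close>

lemma elem_exp:
  assumes "elem a b K J" "r \<le> a"
  shows "cond_unit C (F a) (\<lambda>\<omega>. ennreal (exp (J \<omega> - qvar a b K \<omega> / 2)))"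
  using assms
proof (induction rule: elementary.induct)
  case Nil
  have "qvar a a K \<omega> = 0" for \<omega> by (simp add: qvar_def scaled_def)
  then show ?case using subsetD[OF sets_F_C] by (simp add: cond_unit_def)
next
  case (Step b J c h)
  have ab: "a \<le> b" using elem_le[OF Step(1)] .
  have bc: "b \<le> c" and rb: "r \<le> b" using Step(2,7) ab by auto
  have "elem b c K (\<lambda>\<omega>. h \<omega> \<bullet> (\<omega> c - \<omega> b))" by (rule elem_single[OF bc Step(3-5)])
  note el = this
  obtain k k' where k: "scaled_bound k a b K" "scaled_bound k' b c K"
    using elem_bound[OF Step(1,7)] elem_bound[OF el rb] by blast
  have eq: "exp ((J \<omega> + h \<omega> \<bullet> (\<omega> c - \<omega> b)) - qvar a c K \<omega> / 2) =
     exp (J \<omega> - qvar a b K \<omega> / 2) * exp (h \<omega> \<bullet> (\<omega> c - \<omega> b) - qvar b c (\<lambda>_. h) \<omega> / 2)" if "\<omega> \<in> \<Omega>" for \<omega>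
  proof -
    have "qvar a c K \<omega> = qvar a b K \<omega> + qvar b c K \<omega>"
      by (rule qvar_split[OF Step(7) ab bc elem_props(2)[OF Step(1,7)] elem_props(2)[OF el rb] k that])
    also have "qvar b c K \<omega> = qvar b c (\<lambda>_. h) \<omega>" using Step(5) that by (intro qvar_cong) auto
    finally show ?thesis by (simp add: exp_add[symmetric] add_divide_distrib)
  qed
  have m: "(\<lambda>\<omega>. exp (J \<omega> - qvar a b K \<omega> / 2)) \<in> borel_measurable (F b)"
    using elem_props(1)[OF Step(1,7)] qvar_measurable[OF Step(7) ab elem_props(2)[OF Step(1,7)]] by measurable
  have "cond_unit C (F a) (\<lambda>\<omega>. ennreal (exp (J \<omega> - qvar a b K \<omega> / 2)) * ennreal (exp (h \<omega> \<bullet> (\<omega> c - \<omega> b) - qvar b c (\<lambda>_. h) \<omega> / 2)))"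
    using m by (intro cond_unit_mult[OF subalgebra_F subalgebra_F sets_F_mono[OF ab] Step(6)[OF Step(7)] _ exp_increment[OF rb bc Step(3,4)]]) simp
  then have "cond_unit C (F a) (\<lambda>\<omega>. ennreal (exp (J \<omega> - qvar a b K \<omega> / 2) * exp (h \<omega> \<bullet> (\<omega> c - \<omega> b) - qvar b c (\<lambda>_. h) \<omega> / 2)))"
    by (simp add: ennreal_mult)
  moreover have "(\<lambda>\<omega>. ennreal (exp ((J \<omega> + h \<omega> \<bullet> (\<omega> c - \<omega> b)) - qvar a c K \<omega> / 2))) \<in> borel_measurable C"
  proof -
    have E: "elem a c K (\<lambda>\<omega>. J \<omega> + h \<omega> \<bullet> (\<omega> c - \<omega> b))" by (rule elementary.Step[OF Step(1-5)])
    from elem_props(1)[OF E Step(7)] qvar_measurable[OF Step(7) elem_le[OF E] elem_props(2)[OF E Step(7)]]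
    have "(\<lambda>\<omega>. ennreal (exp ((J \<omega> + h \<omega> \<bullet> (\<omega> c - \<omega> b)) - qvar a c K \<omega> / 2))) \<in> borel_measurable (F c)"
      by measurable
    then show ?thesis by (rule measurable_F_C)
  qed
  ultimately show ?case
    by (rule cond_unit_cong_AE) (use eq in auto)
qed

end

section \<open>Inequalities for squares and their integrals\<close>

lemma norm_add3_sq:
  fixes x y z :: "'a::real_normed_vector"
  shows "(norm (x + y + z))\<^sup>2 \<le> 3 * ((norm x)\<^sup>2 + (norm y)\<^sup>2 + (norm z)\<^sup>2)"
proof -
  have "norm (x + y + z) \<le> norm x + norm y + norm z"
    by (meson add_right_mono norm_triangle_ineq order_trans)
  then have "(norm (x + y + z))\<^sup>2 \<le> (norm x + norm y + norm z)\<^sup>2" by (rule power_mono) simp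
  moreover have "0 \<le> (norm x - norm y)\<^sup>2 + (norm y - norm z)\<^sup>2 + (norm x - norm z)\<^sup>2" by simp
  ultimately show ?thesis by (simp add: power2_eq_square algebra_simps)
qed

lemma ennreal_numeral_mult: "0 \<le> x \<Longrightarrow> ennreal (numeral n * x) = numeral n * ennreal x"
  by (simp add: ennreal_mult)

lemma nn_integral_cmult_add3:
  fixes f g h :: "'a \<Rightarrow> ennreal"
  assumes "f \<in> borel_measurable M" "g \<in> borel_measurable M" "h \<in> borel_measurable M"
  shows "(\<integral>\<^sup>+x. k * (f x + g x + h x) \<partial>M) = k * ((\<integral>\<^sup>+x. f x \<partial>M) + (\<integral>\<^sup>+x. g x \<partial>M) + (\<integral>\<^sup>+x. h x \<partial>M))"
  using assms by (simp only: nn_integral_cmult nn_integral_add borel_measurable_add)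

context driftless_diffusion begin

subsection \<open>The stochastic integral\<close>

lemma elem_cmult:
  assumes "elem a b K J"
  shows "elem a b (\<lambda>u \<omega>. x *\<^sub>R K u \<omega>) (\<lambda>\<omega>. x * J \<omega>)"
  by (rule elem_scale[OF assms]) (auto intro!: boundedI[of _ "\<bar>x\<bar>"])

lemma msq_alt:
  assumes "r \<le> a" "a \<le> b" "progressive a b H" "scaled_bound c a b H"
  shows "msq a b H = (\<integral>\<^sup>+\<omega>. ennreal (qvar a b H \<omega>) \<partial>C)"
  unfolding msq_def by (intro nn_integral_cong) (simp add: ennreal_qvar[OF assms])

text \<open>Comparing \<open>exp (\<epsilon> J) + exp (- \<epsilon> J)\<close> with its second order expansion turns the exponential
  martingale property into one half of Ito's isometry, up to a constant.\<close>

lemma elem_square: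
  assumes el: "elem a b K J" and ra: "r \<le> a"
  shows "(\<integral>\<^sup>+\<omega>. ennreal ((J \<omega>)\<^sup>2) \<partial>C) \<le> 4 * msq a b K"
proof -
  have ab: "a \<le> b" using elem_le[OF el] .
  note P = elem_props(2)[OF el ra]
  obtain c where c: "scaled_bound c a b K" using elem_bound[OF el ra] by blast
  define q where "q = qvar a b K"
  \<comment> \<open>Small enough that e q is at most 1 on every path, so that the damping factor exp
    (- e q / 2) costs no more than half of the quadratic term.\<close>
  define e where "e = 1 / (c\<^sup>2 * (b - a) + 1)"
  have pos: "0 < c\<^sup>2 * (b - a) + 1" using ab by (simp add: add_nonneg_pos)
  have e: "0 < e" "e * (c\<^sup>2 * (b - a)) \<le> 1" using pos by (auto simp: e_def field_simps)
  have [measurable]: "J \<in> borel_measurable C" "q \<in> borel_measurable C"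
    unfolding q_def using measurable_F_C[OF elem_props(1)[OF el ra]] measurable_F_C[OF qvar_measurable[OF ra ab P]] .
  have unit: "(\<integral>\<^sup>+\<omega>. ennreal (exp (x * J \<omega> - x\<^sup>2 * q \<omega> / 2)) \<partial>C) = 1" for x
  proof -
    have "elem a b (\<lambda>u \<omega>. x *\<^sub>R K u \<omega>) (\<lambda>\<omega>. x * J \<omega>)"
      by (rule elem_cmult[OF el])
    from elem_exp[OF this ra] have "cond_unit C (F a) (\<lambda>\<omega>. ennreal (exp (x * J \<omega> - x\<^sup>2 * q \<omega> / 2)))"
      using qvar_cmult[of a b "\<lambda>_. x" K] by (simp add: q_def)
    from cond_unit_nn_integral[OF subalgebra_F this, of "\<lambda>_. 1"] C.emeasure_space_1 show ?thesis by simp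
  qed
  have pt: "2 + e / 4 * (J \<omega>)\<^sup>2 \<le> exp (sqrt e * J \<omega> - (sqrt e)\<^sup>2 * q \<omega> / 2) + exp ((- sqrt e) * J \<omega> - (- sqrt e)\<^sup>2 * q \<omega> / 2) + e * q \<omega>"
    if \<omega>: "\<omega> \<in> \<Omega>" for \<omega>
  proof -
    have q: "0 \<le> q \<omega>" "q \<omega> \<le> c\<^sup>2 * (b - a)" unfolding q_def using qvar_nonneg qvar_le[OF ra ab P c \<omega>] by auto
    define z where "z = e * q \<omega> / 2"
    define x where "x = sqrt e * J \<omega>"
    have z: "0 \<le> z" "z \<le> 1 / 2"
    proof -
      have "e * q \<omega> \<le> e * (c\<^sup>2 * (b - a))" using q e(1) by (intro mult_left_mono) auto
      from order_trans[OF this e(2)] show "z \<le> 1 / 2" unfolding z_def by simp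
      show "0 \<le> z" using e(1) q(1) unfolding z_def by simp
    qed
    have x2: "x\<^sup>2 = e * (J \<omega>)\<^sup>2" using e(1) by (simp add: x_def power_mult_distrib)
    have 1: "1 - z \<le> exp (- z)" using exp_ge_add_one_self[of "- z"] by simp
    \<comment> \<open>The quadratic Taylor bound holds on the nonnegative side only; on the other
      side the tangent line suffices, since the linear terms cancel in the sum.\<close>
    have "exp \<bar>x\<bar> + exp (- \<bar>x\<bar>) \<ge> 2 + x\<^sup>2 / 2"
      using exp_lower_Taylor_quadratic[of "\<bar>x\<bar>"] exp_ge_add_one_self[of "- \<bar>x\<bar>"] by simp
    then have "2 + x\<^sup>2 / 2 \<le> exp x + exp (- x)" by (cases "0 \<le> x") auto
    then have A: "(2 + x\<^sup>2 / 2) * exp (- z) \<le> (exp x + exp (- x)) * exp (- z)" by (rule mult_right_mono) simp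
    have B: "2 - 2 * z + x\<^sup>2 / 2 * (1 - z) \<le> (2 + x\<^sup>2 / 2) * exp (- z)"
      using mult_left_mono[OF 1, of "2 + x\<^sup>2 / 2"] by (simp add: algebra_simps)
    have D: "x\<^sup>2 / 2 * (1 / 2) \<le> x\<^sup>2 / 2 * (1 - z)" using z by (intro mult_left_mono) auto
    have aux: "2 + s / 4 \<le> Y + 2 * z" if "X \<le> Y" "2 - 2 * z + p \<le> X" "s / 2 * (1 / 2) \<le> p" for X Y p s :: real
      using that by simp
    have "2 + x\<^sup>2 / 4 \<le> (exp x + exp (- x)) * exp (- z) + 2 * z" by (rule aux[OF A B D])
    also have "(exp x + exp (- x)) * exp (- z) = exp (x - z) + exp (- x - z)"
      by (simp add: distrib_right exp_add[symmetric])
    finally show ?thesis using e(1) x2 by (simp add: x_def z_def)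
  qed
  have "2 + ennreal (e / 4) * (\<integral>\<^sup>+\<omega>. ennreal ((J \<omega>)\<^sup>2) \<partial>C) = (\<integral>\<^sup>+\<omega>. 2 + ennreal (e / 4) * ennreal ((J \<omega>)\<^sup>2) \<partial>C)"
    by (simp add: nn_integral_add nn_integral_cmult C.emeasure_space_1[simplified])
  also have "\<dots> = (\<integral>\<^sup>+\<omega>. ennreal (2 + e / 4 * (J \<omega>)\<^sup>2) \<partial>C)"
    using e(1) by (intro nn_integral_cong) (subst ennreal_plus, simp, simp, subst ennreal_mult, simp, simp, simp)
  also have "\<dots> \<le> (\<integral>\<^sup>+\<omega>. ennreal (exp (sqrt e * J \<omega> - (sqrt e)\<^sup>2 * q \<omega> / 2)) + ennreal (exp ((- sqrt e) * J \<omega> - (- sqrt e)\<^sup>2 * q \<omega> / 2)) + ennreal e * ennreal (q \<omega>) \<partial>C)"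
  proof (rule nn_integral_mono)
    fix \<omega> assume "\<omega> \<in> space C"
    then have \<omega>: "\<omega> \<in> \<Omega>" by simp
    have "0 \<le> q \<omega>" unfolding q_def by (rule qvar_nonneg)
    then show "ennreal (2 + e / 4 * (J \<omega>)\<^sup>2) \<le> ennreal (exp (sqrt e * J \<omega> - (sqrt e)\<^sup>2 * q \<omega> / 2)) + ennreal (exp ((- sqrt e) * J \<omega> - (- sqrt e)\<^sup>2 * q \<omega> / 2)) + ennreal e * ennreal (q \<omega>)"
      using ennreal_leI[OF pt[OF \<omega>]] e(1) by (simp only: ennreal_plus ennreal_mult add_nonneg_nonneg exp_ge_zero mult_nonneg_nonneg less_imp_le)
  qed
  also have "\<dots> = 1 + 1 + ennreal e * (\<integral>\<^sup>+\<omega>. ennreal (q \<omega>) \<partial>C)"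
  proof -
    have m: "(\<lambda>\<omega>. ennreal (exp (x * J \<omega> - x\<^sup>2 * q \<omega> / 2))) \<in> borel_measurable C" for x by measurable
    have mq: "(\<lambda>\<omega>. ennreal (q \<omega>)) \<in> borel_measurable C" by measurable
    have mq': "(\<lambda>\<omega>. ennreal e * ennreal (q \<omega>)) \<in> borel_measurable C" by measurable
    show ?thesis
      unfolding nn_integral_add[OF borel_measurable_add[OF m[of "sqrt e"] m[of "- sqrt e"]] mq']
        nn_integral_add[OF m[of "sqrt e"] m[of "- sqrt e"]] unit nn_integral_cmult[OF mq] by (rule refl)
  qed
  finally have "2 + ennreal (e / 4) * (\<integral>\<^sup>+\<omega>. ennreal ((J \<omega>)\<^sup>2) \<partial>C) \<le> 2 + ennreal e * msq a b K"
    unfolding msq_alt[OF ra ab P c] q_def by simp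
  then have "ennreal (e / 4) * (\<integral>\<^sup>+\<omega>. ennreal ((J \<omega>)\<^sup>2) \<partial>C) \<le> ennreal e * msq a b K" by simp
  \<comment> \<open>The auxiliary e cancels, so the constant 4 does not depend on the bound c of the
    process.\<close>
  then have "ennreal (4 / e) * (ennreal (e / 4) * (\<integral>\<^sup>+\<omega>. ennreal ((J \<omega>)\<^sup>2) \<partial>C)) \<le> ennreal (4 / e) * (ennreal e * msq a b K)"
    by (rule mult_left_mono) simp
  then show ?thesis using e(1) by (simp add: mult.assoc[symmetric] ennreal_mult[symmetric])
qed

text \<open>The integral in terms of one approximating pair (K, J) for each tolerance instead of
  sequences, and on an arbitrary interval (a, b]. From r to T it coincides with the notion of the
  statement, see \<open>is_ito_integral_iff\<close>.\<close>

definition is_ito :: "real \<Rightarrow> real \<Rightarrow> (real \<Rightarrow> 'n path \<Rightarrow> real ^ 'n) \<Rightarrow> ('n path \<Rightarrow> real) \<Rightarrow> bool" where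
  "is_ito a b H I \<longleftrightarrow> I \<in> borel_measurable (F b) \<and>
     (\<forall>e>0. \<exists>K J. elem a b K J \<and> msq a b (\<lambda>u \<omega>. H u \<omega> - K u \<omega>) < ennreal e \<and>
        (\<integral>\<^sup>+\<omega>. ennreal ((I \<omega> - J \<omega>)\<^sup>2) \<partial>C) < ennreal e)"

lemma is_ito_elem:
  assumes "elem a b K J" "r \<le> a"
  shows "is_ito a b K J"
  unfolding is_ito_def
proof (intro conjI allI impI exI)
  show "msq a b (\<lambda>u \<omega>. K u \<omega> - K u \<omega>) < ennreal e" if "0 < e" for e
    using that by (simp add: msq_def scaled_def)
qed (use assms elem_props in auto)

lemma is_ito_cong:
  assumes "is_ito a b H I" "\<And>u \<omega>. a < u \<Longrightarrow> u \<le> b \<Longrightarrow> \<omega> \<in> \<Omega> \<Longrightarrow> H u \<omega> = H' u \<omega>"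
  shows "is_ito a b H' I"
proof -
  have "msq a b (\<lambda>u \<omega>. H u \<omega> - K u \<omega>) = msq a b (\<lambda>u \<omega>. H' u \<omega> - K u \<omega>)" for K
    by (rule msq_cong) (simp add: assms(2))
  with assms(1) show ?thesis by (simp add: is_ito_def)
qed

lemma progressive_cong:
  assumes "progressive a b H" "\<And>u \<omega>. a < u \<Longrightarrow> u \<le> b \<Longrightarrow> \<omega> \<in> \<Omega> \<Longrightarrow> H u \<omega> = H' u \<omega>"
  shows "progressive a b H'"
  using assms(1) unfolding progressive_def
  by (rule measurable_cong[THEN iffD1, rotated])
    (use assms(2) in \<open>auto simp: space_pair_measure split: split_indicator\<close>)

lemma progressive_diff:
  assumes "progressive a b H" "progressive a b H'"
  shows "progressive a b (\<lambda>u \<omega>. H u \<omega> - H' u \<omega>)"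
proof -
  have "(\<lambda>x. (case x of (u, \<omega>) \<Rightarrow> indicator {a<..b} u *\<^sub>R H u \<omega>) - (case x of (u, \<omega>) \<Rightarrow> indicator {a<..b} u *\<^sub>R H' u \<omega>)) \<in> borel_measurable (borel \<Otimes>\<^sub>M F b)"
    using assms unfolding progressive_def by (rule borel_measurable_diff)
  then show ?thesis unfolding progressive_def
    by (rule measurable_cong[THEN iffD1, rotated]) (auto simp: algebra_simps)
qed

lemma progressive_scale:
  assumes "progressive a b H" "k \<in> borel_measurable (F b)"
  shows "progressive a b (\<lambda>u \<omega>. k \<omega> *\<^sub>R H u \<omega>)"
proof -
  have "(\<lambda>x. k (snd x) *\<^sub>R (case x of (u, \<omega>) \<Rightarrow> indicator {a<..b} u *\<^sub>R H u \<omega>)) \<in> borel_measurable (borel \<Otimes>\<^sub>M F b)"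
    using measurable_compose[OF measurable_snd assms(2)] assms(1) unfolding progressive_def
    by (rule borel_measurable_scaleR)
  then show ?thesis unfolding progressive_def
    by (rule measurable_cong[THEN iffD1, rotated]) (auto simp: algebra_simps)
qed

lemma scaled_nn_measurable_path:
  assumes "r \<le> a" "a \<le> b" "progressive a b H" "\<omega> \<in> \<Omega>"
  shows "(\<lambda>u. ennreal ((norm (scaled a b H u \<omega>))\<^sup>2)) \<in> borel_measurable lborel"
  using scaled_measurable_path[OF assms] by simp

text \<open>The middle term is where the distance of the two limits enters.\<close>

lemma msq_triangle:
  assumes ra: "r \<le> a" "a \<le> b"
    and P: "progressive a b H1" "progressive a b H2" "progressive a b H3" "progressive a b H4"
  shows "msq a b (\<lambda>u \<omega>. H1 u \<omega> - H4 u \<omega>) \<le> 3 * (msq a b (\<lambda>u \<omega>. H1 u \<omega> - H2 u \<omega>)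
     + msq a b (\<lambda>u \<omega>. H2 u \<omega> - H3 u \<omega>) + msq a b (\<lambda>u \<omega>. H3 u \<omega> - H4 u \<omega>))"
proof -
  let ?n = "\<lambda>H H' u \<omega>. ennreal ((norm (scaled a b (\<lambda>u \<omega>. H u \<omega> - H' u \<omega>) u \<omega>))\<^sup>2)"
  have "msq a b (\<lambda>u \<omega>. H1 u \<omega> - H4 u \<omega>) \<le> (\<integral>\<^sup>+\<omega>. \<integral>\<^sup>+u. 3 * (?n H1 H2 u \<omega> + ?n H2 H3 u \<omega> + ?n H3 H4 u \<omega>) \<partial>lborel \<partial>C)"
    unfolding msq_def
  proof (intro nn_integral_mono)
    fix u \<omega>
    have "scaled a b (\<lambda>u \<omega>. H1 u \<omega> - H4 u \<omega>) u \<omega> = scaled a b (\<lambda>u \<omega>. H1 u \<omega> - H2 u \<omega>) u \<omega>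
      + scaled a b (\<lambda>u \<omega>. H2 u \<omega> - H3 u \<omega>) u \<omega> + scaled a b (\<lambda>u \<omega>. H3 u \<omega> - H4 u \<omega>) u \<omega>"
      by (simp add: scaled_diff)
    from norm_add3_sq[of "scaled a b (\<lambda>u \<omega>. H1 u \<omega> - H2 u \<omega>) u \<omega>" "scaled a b (\<lambda>u \<omega>. H2 u \<omega> - H3 u \<omega>) u \<omega>"
        "scaled a b (\<lambda>u \<omega>. H3 u \<omega> - H4 u \<omega>) u \<omega>", folded this]
    have "?n H1 H4 u \<omega> \<le> ennreal (3 * ((norm (scaled a b (\<lambda>u \<omega>. H1 u \<omega> - H2 u \<omega>) u \<omega>))\<^sup>2
        + (norm (scaled a b (\<lambda>u \<omega>. H2 u \<omega> - H3 u \<omega>) u \<omega>))\<^sup>2 + (norm (scaled a b (\<lambda>u \<omega>. H3 u \<omega> - H4 u \<omega>) u \<omega>))\<^sup>2))"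
      by (rule ennreal_leI)
    then show "?n H1 H4 u \<omega> \<le> 3 * (?n H1 H2 u \<omega> + ?n H2 H3 u \<omega> + ?n H3 H4 u \<omega>)"
      by (simp add: ennreal_mult)
  qed
  also have "\<dots> = (\<integral>\<^sup>+\<omega>. 3 * ((\<integral>\<^sup>+u. ?n H1 H2 u \<omega> \<partial>lborel) + (\<integral>\<^sup>+u. ?n H2 H3 u \<omega> \<partial>lborel) + (\<integral>\<^sup>+u. ?n H3 H4 u \<omega> \<partial>lborel)) \<partial>C)"
  proof (rule nn_integral_cong)
    fix \<omega> assume "\<omega> \<in> space C"
    then have \<omega>: "\<omega> \<in> \<Omega>" by simp
    have m: "(\<lambda>u. ?n H1 H2 u \<omega>) \<in> borel_measurable lborel" "(\<lambda>u. ?n H2 H3 u \<omega>) \<in> borel_measurable lborel"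
      "(\<lambda>u. ?n H3 H4 u \<omega>) \<in> borel_measurable lborel"
      by (rule scaled_nn_measurable_path[OF ra progressive_diff \<omega>], fact, fact)+
    show "(\<integral>\<^sup>+u. 3 * (?n H1 H2 u \<omega> + ?n H2 H3 u \<omega> + ?n H3 H4 u \<omega>) \<partial>lborel) =
      3 * ((\<integral>\<^sup>+u. ?n H1 H2 u \<omega> \<partial>lborel) + (\<integral>\<^sup>+u. ?n H2 H3 u \<omega> \<partial>lborel) + (\<integral>\<^sup>+u. ?n H3 H4 u \<omega> \<partial>lborel))"
      by (rule nn_integral_cmult_add3[OF m])
  qed
  also have "\<dots> = 3 * (msq a b (\<lambda>u \<omega>. H1 u \<omega> - H2 u \<omega>)
     + msq a b (\<lambda>u \<omega>. H2 u \<omega> - H3 u \<omega>) + msq a b (\<lambda>u \<omega>. H3 u \<omega> - H4 u \<omega>))"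
  proof -
    have m: "(\<lambda>\<omega>. \<integral>\<^sup>+u. ?n H1 H2 u \<omega> \<partial>lborel) \<in> borel_measurable C" "(\<lambda>\<omega>. \<integral>\<^sup>+u. ?n H2 H3 u \<omega> \<partial>lborel) \<in> borel_measurable C"
      "(\<lambda>\<omega>. \<integral>\<^sup>+u. ?n H3 H4 u \<omega> \<partial>lborel) \<in> borel_measurable C"
      by (rule measurable_F_C[OF scaled_nn_measurable[OF ra progressive_diff]], fact, fact)+
    show ?thesis unfolding msq_def by (rule nn_integral_cmult_add3[OF m])
  qed
  finally show ?thesis .
qed

lemma msq_zero [simp]: "msq a b (\<lambda>u \<omega>. 0) = 0"
  by (simp add: msq_def scaled_def)

lemma msq_commute: "msq a b (\<lambda>u \<omega>. H u \<omega> - H' u \<omega>) = msq a b (\<lambda>u \<omega>. H' u \<omega> - H u \<omega>)"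
  unfolding msq_def scaled_diff by (simp add: norm_minus_commute)

text \<open>Both integrals are compared with elementary ones. The triangle inequality for squares
  costs a factor 3 for the integrals and again for the integrands, and \<open>elem_square\<close>
  costs 4, hence 36. Any finite constant would do: the bound serves uniqueness and
  completeness.\<close>

lemma is_ito_bound:
  assumes ra: "r \<le> a" "a \<le> b" and P: "progressive a b H" "progressive a b H'"
    and I: "is_ito a b H I" "is_ito a b H' I'"
  shows "(\<integral>\<^sup>+\<omega>. ennreal ((I \<omega> - I' \<omega>)\<^sup>2) \<partial>C) \<le> 36 * msq a b (\<lambda>u \<omega>. H u \<omega> - H' u \<omega>)"
proof (rule ennreal_le_epsilon)
  fix e :: real assume "0 < e"
  \<comment> \<open>The error terms add up to 3 * (d + 4 * 3 * 2 d + d) = 78 d.\<close>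
  define d where "d = e / 78"
  have d: "0 < d" using \<open>0 < e\<close> by (simp add: d_def)
  obtain K J where K: "elem a b K J" "msq a b (\<lambda>u \<omega>. H u \<omega> - K u \<omega>) < ennreal d"
    "(\<integral>\<^sup>+\<omega>. ennreal ((I \<omega> - J \<omega>)\<^sup>2) \<partial>C) < ennreal d" using I(1) d unfolding is_ito_def by blast
  obtain K' J' where K': "elem a b K' J'" "msq a b (\<lambda>u \<omega>. H' u \<omega> - K' u \<omega>) < ennreal d"
    "(\<integral>\<^sup>+\<omega>. ennreal ((I' \<omega> - J' \<omega>)\<^sup>2) \<partial>C) < ennreal d" using I(2) d unfolding is_ito_def by blast
  let ?m = "msq a b (\<lambda>u \<omega>. H u \<omega> - H' u \<omega>)"
  have [measurable]: "I \<in> borel_measurable C" "I' \<in> borel_measurable C" "J \<in> borel_measurable C" "J' \<in> borel_measurable C"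
    using I measurable_F_C elem_props(1)[OF K(1) ra(1)] elem_props(1)[OF K'(1) ra(1)] unfolding is_ito_def by blast+
  have JJ: "(\<integral>\<^sup>+\<omega>. ennreal ((J \<omega> - J' \<omega>)\<^sup>2) \<partial>C) \<le> 4 * (3 * (ennreal d + ?m + ennreal d))"
  proof -
    have "(\<integral>\<^sup>+\<omega>. ennreal ((J \<omega> - J' \<omega>)\<^sup>2) \<partial>C) \<le> 4 * msq a b (\<lambda>u \<omega>. K u \<omega> - K' u \<omega>)"
      by (rule elem_square[OF elem_diff[OF K(1) K'(1)] ra(1)])
    also have "\<dots> \<le> 4 * (3 * (msq a b (\<lambda>u \<omega>. K u \<omega> - H u \<omega>) + ?m + msq a b (\<lambda>u \<omega>. H' u \<omega> - K' u \<omega>)))"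
      by (intro mult_left_mono msq_triangle ra P elem_props(2)[OF K(1)] elem_props(2)[OF K'(1)]) auto
    also have "\<dots> \<le> 4 * (3 * (ennreal d + ?m + ennreal d))"
      using K(2) K'(2) by (intro mult_left_mono add_mono order_refl) (auto simp: msq_commute[of a b K])
    finally show ?thesis .
  qed
  have "(\<integral>\<^sup>+\<omega>. ennreal ((I \<omega> - I' \<omega>)\<^sup>2) \<partial>C) \<le>
    (\<integral>\<^sup>+\<omega>. 3 * (ennreal ((I \<omega> - J \<omega>)\<^sup>2) + ennreal ((J \<omega> - J' \<omega>)\<^sup>2) + ennreal ((I' \<omega> - J' \<omega>)\<^sup>2)) \<partial>C)"
  proof (rule nn_integral_mono)
    fix \<omega>
    have "(I \<omega> - I' \<omega>)\<^sup>2 \<le> 3 * ((I \<omega> - J \<omega>)\<^sup>2 + (J \<omega> - J' \<omega>)\<^sup>2 + (I' \<omega> - J' \<omega>)\<^sup>2)"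
      using norm_add3_sq[of "I \<omega> - J \<omega>" "J \<omega> - J' \<omega>" "J' \<omega> - I' \<omega>"] by (simp add: power2_commute[of "J' \<omega>"])
    from ennreal_leI[OF this] show "ennreal ((I \<omega> - I' \<omega>)\<^sup>2) \<le> 3 * (ennreal ((I \<omega> - J \<omega>)\<^sup>2) + ennreal ((J \<omega> - J' \<omega>)\<^sup>2) + ennreal ((I' \<omega> - J' \<omega>)\<^sup>2))"
      by (simp add: ennreal_mult)
  qed
  also have "\<dots> = 3 * ((\<integral>\<^sup>+\<omega>. ennreal ((I \<omega> - J \<omega>)\<^sup>2) \<partial>C) + (\<integral>\<^sup>+\<omega>. ennreal ((J \<omega> - J' \<omega>)\<^sup>2) \<partial>C) + (\<integral>\<^sup>+\<omega>. ennreal ((I' \<omega> - J' \<omega>)\<^sup>2) \<partial>C))"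
    by (rule nn_integral_cmult_add3) measurable
  also have "\<dots> \<le> 3 * (ennreal d + 4 * (3 * (ennreal d + ?m + ennreal d)) + ennreal d)"
    using K(3) K'(3) JJ by (intro mult_left_mono add_mono) auto
  also have "\<dots> = 36 * ?m + ennreal (78 * d)"
  proof (cases ?m)
    case (real \<mu>)
    have "3 * (d + 4 * (3 * (d + \<mu> + d)) + d) = 36 * \<mu> + 78 * d" by simp
    from arg_cong[OF this, of ennreal] show ?thesis
      using d real by (simp only: ennreal_plus ennreal_numeral_mult add_nonneg_nonneg mult_nonneg_nonneg less_imp_le zero_le_numeral)
  qed (simp add: ennreal_mult_top)
  finally show "(\<integral>\<^sup>+\<omega>. ennreal ((I \<omega> - I' \<omega>)\<^sup>2) \<partial>C) \<le> 36 * ?m + ennreal e" by (simp add: d_def)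
qed

lemma is_ito_unique:
  assumes "r \<le> a" "a \<le> b" "progressive a b H" "is_ito a b H I" "is_ito a b H I'"
  shows "AE \<omega> in C. I \<omega> = I' \<omega>"
proof -
  have [measurable]: "I \<in> borel_measurable C" "I' \<in> borel_measurable C"
    using assms measurable_F_C unfolding is_ito_def by blast+
  have "(\<integral>\<^sup>+\<omega>. ennreal ((I \<omega> - I' \<omega>)\<^sup>2) \<partial>C) = 0"
    using is_ito_bound[OF assms(1-3,3-5)] by simp
  then show ?thesis by (simp add: nn_integral_0_iff_AE)
qed

lemma is_ito_indicator:
  assumes I: "is_ito a b H I" and A: "A \<in> sets (F a)" and ab: "a \<le> b"
  shows "is_ito a b (\<lambda>u \<omega>. indicator A \<omega> *\<^sub>R H u \<omega>) (\<lambda>\<omega>. indicator A \<omega> * I \<omega>)"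
  unfolding is_ito_def
proof (intro conjI allI impI)
  have [measurable]: "A \<in> sets (F b)" using A sets_F_mono[OF ab] by auto
  have [measurable]: "I \<in> borel_measurable (F b)" using I by (simp add: is_ito_def)
  show "(\<lambda>\<omega>. indicator A \<omega> * I \<omega>) \<in> borel_measurable (F b)" by measurable
  fix e :: real assume "0 < e"
  then obtain K J where K: "elem a b K J" "msq a b (\<lambda>u \<omega>. H u \<omega> - K u \<omega>) < ennreal e"
    "(\<integral>\<^sup>+\<omega>. ennreal ((I \<omega> - J \<omega>)\<^sup>2) \<partial>C) < ennreal e" using I unfolding is_ito_def by blast
  have "elem a b (\<lambda>u \<omega>. indicator A \<omega> *\<^sub>R K u \<omega>) (\<lambda>\<omega>. indicator A \<omega> * J \<omega>)"
    by (rule elem_scale[OF K(1)]) (use A in \<open>auto intro!: boundedI[of _ 1] split: split_indicator\<close>)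
  moreover have "msq a b (\<lambda>u \<omega>. indicator A \<omega> *\<^sub>R H u \<omega> - indicator A \<omega> *\<^sub>R K u \<omega>) \<le> msq a b (\<lambda>u \<omega>. H u \<omega> - K u \<omega>)"
    unfolding msq_def scaled_diff scaled_cmult
    by (intro nn_integral_mono ennreal_leI) (auto split: split_indicator)
  moreover have "(\<integral>\<^sup>+\<omega>. ennreal ((indicator A \<omega> * I \<omega> - indicator A \<omega> * J \<omega>)\<^sup>2) \<partial>C) \<le> (\<integral>\<^sup>+\<omega>. ennreal ((I \<omega> - J \<omega>)\<^sup>2) \<partial>C)"
    by (intro nn_integral_mono ennreal_leI) (auto split: split_indicator)
  ultimately show "\<exists>K J. elem a b K J \<and> msq a b (\<lambda>u \<omega>. indicator A \<omega> *\<^sub>R H u \<omega> - K u \<omega>) < ennreal e \<and>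
      (\<integral>\<^sup>+\<omega>. ennreal ((indicator A \<omega> * I \<omega> - J \<omega>)\<^sup>2) \<partial>C) < ennreal e"
    using K(2,3) by (meson le_less_trans)
qed

text \<open>Multiplying by the indicator of A, which is known at time a, turns both integrands into
  the same process; uniqueness of its integral then compares I and I' on A.\<close>

lemma is_ito_local:
  assumes ra: "r \<le> a" "a \<le> b" and P: "progressive a b H" and A: "A \<in> sets (F a)"
    and I: "is_ito a b H I" "is_ito a b H' I'"
    and eq: "\<And>u \<omega>. a < u \<Longrightarrow> u \<le> b \<Longrightarrow> \<omega> \<in> A \<Longrightarrow> H u \<omega> = H' u \<omega>"
  shows "AE \<omega> in C. \<omega> \<in> A \<longrightarrow> I \<omega> = I' \<omega>"
proof -
  have "is_ito a b (\<lambda>u \<omega>. indicator A \<omega> *\<^sub>R H u \<omega>) (\<lambda>\<omega>. indicator A \<omega> * I' \<omega>)"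
    by (rule is_ito_cong[OF is_ito_indicator[OF I(2) A ra(2)]]) (auto simp: eq split: split_indicator)
  moreover have "progressive a b (\<lambda>u \<omega>. indicator A \<omega> *\<^sub>R H u \<omega>)"
    by (rule progressive_scale[OF P]) (use A sets_F_mono[OF ra(2)] in auto)
  ultimately have "AE \<omega> in C. indicator A \<omega> * I \<omega> = indicator A \<omega> * I' \<omega>"
    using is_ito_unique[OF ra _ is_ito_indicator[OF I(1) A ra(2)]] by blast
  then show ?thesis by eventually_elim auto
qed

lemma progressive_concat:
  assumes "progressive a b H" "progressive b c H" "a \<le> b" "b \<le> c"
  shows "progressive a c H"
proof -
  have [measurable]: "(\<lambda>(u, \<omega>). indicator {a<..b} u *\<^sub>R H u \<omega>) \<in> borel_measurable (borel \<Otimes>\<^sub>M F c)"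
    using measurable_pair_F_mono[OF assms(1)[unfolded progressive_def] assms(4)] .
  have [measurable]: "(\<lambda>(u, \<omega>). indicator {b<..c} u *\<^sub>R H u \<omega>) \<in> borel_measurable (borel \<Otimes>\<^sub>M F c)"
    using assms(2) unfolding progressive_def .
  have "(\<lambda>x. (case x of (u, \<omega>) \<Rightarrow> indicator {a<..b} u *\<^sub>R H u \<omega>) + (case x of (u, \<omega>) \<Rightarrow> indicator {b<..c} u *\<^sub>R H u \<omega>)) \<in> borel_measurable (borel \<Otimes>\<^sub>M F c)"
    by measurable
  then show ?thesis unfolding progressive_def
    by (rule measurable_cong[THEN iffD1, rotated]) (use assms(3,4) in \<open>auto split: split_indicator\<close>)
qed

lemma msq_split:
  assumes "r \<le> a" "a \<le> b" "b \<le> c" "progressive a b H" "progressive b c H"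
  shows "msq a c H = msq a b H + msq b c H"
proof -
  have "msq a c H = (\<integral>\<^sup>+\<omega>. (\<integral>\<^sup>+u. ennreal ((norm (scaled a b H u \<omega>))\<^sup>2) \<partial>lborel) + (\<integral>\<^sup>+u. ennreal ((norm (scaled b c H u \<omega>))\<^sup>2) \<partial>lborel) \<partial>C)"
    unfolding msq_def
  proof (rule nn_integral_cong)
    fix \<omega> assume "\<omega> \<in> space C"
    then have \<omega>: "\<omega> \<in> \<Omega>" by simp
    have rb: "r \<le> b" using assms by simp
    note m = scaled_nn_measurable_path[OF assms(1,2,4) \<omega>] scaled_nn_measurable_path[OF rb assms(3,5) \<omega>]
    show "(\<integral>\<^sup>+u. ennreal ((norm (scaled a c H u \<omega>))\<^sup>2) \<partial>lborel) =
      (\<integral>\<^sup>+u. ennreal ((norm (scaled a b H u \<omega>))\<^sup>2) \<partial>lborel) + (\<integral>\<^sup>+u. ennreal ((norm (scaled b c H u \<omega>))\<^sup>2) \<partial>lborel)"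
      unfolding scaled_split[OF assms(2,3)] nn_integral_add[OF m, symmetric]
      by (simp only: ennreal_plus zero_le_power2)
  qed
  also have "\<dots> = msq a b H + msq b c H"
    unfolding msq_def using assms
    by (intro nn_integral_add measurable_F_C[OF scaled_nn_measurable]) simp_all
  finally show ?thesis .
qed

lemma is_ito_concat:
  assumes ra: "r \<le> a" "a \<le> b" "b \<le> c" and P: "progressive a b H" "progressive b c H"
    and I: "is_ito a b H I1" "is_ito b c H I2"
  shows "is_ito a c H (\<lambda>\<omega>. I1 \<omega> + I2 \<omega>)"
  unfolding is_ito_def
proof (intro conjI allI impI)
  have m: "I1 \<in> borel_measurable (F b)" "I2 \<in> borel_measurable (F c)" using I by (auto simp: is_ito_def)
  from borel_measurable_add[OF measurable_F_mono[OF m(1) ra(3)] m(2)]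
  show "(\<lambda>\<omega>. I1 \<omega> + I2 \<omega>) \<in> borel_measurable (F c)" .
  fix e :: real assume "0 < e"
  \<comment> \<open>The square of a sum is at most twice the sum of the squares, which makes four
    error terms.\<close>
  then have e: "0 < e / 4" by simp
  obtain K1 J1 where K1: "elem a b K1 J1" "msq a b (\<lambda>u \<omega>. H u \<omega> - K1 u \<omega>) < ennreal (e/4)"
    "(\<integral>\<^sup>+\<omega>. ennreal ((I1 \<omega> - J1 \<omega>)\<^sup>2) \<partial>C) < ennreal (e/4)" using I(1) e unfolding is_ito_def by blast
  obtain K2 J2 where K2: "elem b c K2 J2" "msq b c (\<lambda>u \<omega>. H u \<omega> - K2 u \<omega>) < ennreal (e/4)"
    "(\<integral>\<^sup>+\<omega>. ennreal ((I2 \<omega> - J2 \<omega>)\<^sup>2) \<partial>C) < ennreal (e/4)" using I(2) e unfolding is_ito_def by blast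
  define K where "K u \<omega> = (if u \<le> b then K1 u \<omega> else K2 u \<omega>)" for u \<omega>
  have E1: "elem a b K J1" by (rule elem_cong[OF K1(1)]) (simp add: K_def)
  have E2: "elem b c K J2" by (rule elem_cong[OF K2(1)]) (simp add: K_def)
  have rb: "r \<le> b" using ra by simp
  have [measurable]: "I1 \<in> borel_measurable C" "I2 \<in> borel_measurable C" "J1 \<in> borel_measurable C" "J2 \<in> borel_measurable C"
    using m measurable_F_C elem_props(1)[OF E1 ra(1)] elem_props(1)[OF E2 rb] by blast+
  have "msq a c (\<lambda>u \<omega>. H u \<omega> - K u \<omega>) = msq a b (\<lambda>u \<omega>. H u \<omega> - K u \<omega>) + msq b c (\<lambda>u \<omega>. H u \<omega> - K u \<omega>)"
    by (intro msq_split ra progressive_diff P elem_props(2)[OF E1] elem_props(2)[OF E2] rb)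
  also have "msq a b (\<lambda>u \<omega>. H u \<omega> - K u \<omega>) = msq a b (\<lambda>u \<omega>. H u \<omega> - K1 u \<omega>)" by (rule msq_cong) (simp add: K_def)
  also have "msq b c (\<lambda>u \<omega>. H u \<omega> - K u \<omega>) = msq b c (\<lambda>u \<omega>. H u \<omega> - K2 u \<omega>)" by (rule msq_cong) (simp add: K_def)
  also have "msq a b (\<lambda>u \<omega>. H u \<omega> - K1 u \<omega>) + msq b c (\<lambda>u \<omega>. H u \<omega> - K2 u \<omega>) \<le> ennreal (e/4) + ennreal (e/4)"
    using K1(2) K2(2) by (intro add_mono) auto
  also have "\<dots> < ennreal e" using \<open>0 < e\<close> by (simp add: ennreal_plus[symmetric] ennreal_less_iff del: ennreal_plus)
  finally have 1: "msq a c (\<lambda>u \<omega>. H u \<omega> - K u \<omega>) < ennreal e" .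
  have "(\<integral>\<^sup>+\<omega>. ennreal ((I1 \<omega> + I2 \<omega> - (J1 \<omega> + J2 \<omega>))\<^sup>2) \<partial>C) \<le> (\<integral>\<^sup>+\<omega>. (ennreal ((I1 \<omega> - J1 \<omega>)\<^sup>2) + ennreal ((I1 \<omega> - J1 \<omega>)\<^sup>2)) + (ennreal ((I2 \<omega> - J2 \<omega>)\<^sup>2) + ennreal ((I2 \<omega> - J2 \<omega>)\<^sup>2)) \<partial>C)"
  proof (rule nn_integral_mono)
    fix \<omega>
    have "0 \<le> ((I1 \<omega> - J1 \<omega>) - (I2 \<omega> - J2 \<omega>))\<^sup>2" by simp
    then have "(I1 \<omega> + I2 \<omega> - (J1 \<omega> + J2 \<omega>))\<^sup>2 \<le> ((I1 \<omega> - J1 \<omega>)\<^sup>2 + (I1 \<omega> - J1 \<omega>)\<^sup>2) + ((I2 \<omega> - J2 \<omega>)\<^sup>2 + (I2 \<omega> - J2 \<omega>)\<^sup>2)"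
      by (simp add: power2_eq_square algebra_simps)
    from ennreal_leI[OF this] show "ennreal ((I1 \<omega> + I2 \<omega> - (J1 \<omega> + J2 \<omega>))\<^sup>2) \<le> (ennreal ((I1 \<omega> - J1 \<omega>)\<^sup>2) + ennreal ((I1 \<omega> - J1 \<omega>)\<^sup>2)) + (ennreal ((I2 \<omega> - J2 \<omega>)\<^sup>2) + ennreal ((I2 \<omega> - J2 \<omega>)\<^sup>2))"
      by (simp only: ennreal_plus add_nonneg_nonneg zero_le_power2)
  qed
  also have "\<dots> = ((\<integral>\<^sup>+\<omega>. ennreal ((I1 \<omega> - J1 \<omega>)\<^sup>2) \<partial>C) + (\<integral>\<^sup>+\<omega>. ennreal ((I1 \<omega> - J1 \<omega>)\<^sup>2) \<partial>C)) + ((\<integral>\<^sup>+\<omega>. ennreal ((I2 \<omega> - J2 \<omega>)\<^sup>2) \<partial>C) + (\<integral>\<^sup>+\<omega>. ennreal ((I2 \<omega> - J2 \<omega>)\<^sup>2) \<partial>C))"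
    by (simp add: nn_integral_add)
  also have "\<dots> < (ennreal (e/4) + ennreal (e/4)) + (ennreal (e/4) + ennreal (e/4))"
    using K1(3) K2(3) by (intro add_strict_mono)
  also have "\<dots> = ennreal e" using \<open>0 < e\<close> by (simp add: ennreal_plus[symmetric] del: ennreal_plus)
  finally show "\<exists>K J. elem a c K J \<and> msq a c (\<lambda>u \<omega>. H u \<omega> - K u \<omega>) < ennreal e \<and>
      (\<integral>\<^sup>+\<omega>. ennreal ((I1 \<omega> + I2 \<omega> - J \<omega>)\<^sup>2) \<partial>C) < ennreal e"
    using 1 elem_concat[OF E2 E1] by blast
qed

end

context driftless_diffusion begin

subsection \<open>Integrals with an exponential martingale\<close>

text \<open>The exponential property is demanded for every real multiple x. The value x = 1 gives
  Girsanov densities, and the exponential at 2 x bounds the second moment of the one at x, which is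
  what keeps the class closed under mean square limits.\<close>

definition good :: "real \<Rightarrow> real \<Rightarrow> (real \<Rightarrow> 'n path \<Rightarrow> real ^ 'n) \<Rightarrow> ('n path \<Rightarrow> real) \<Rightarrow> bool" where
  "good a b H I \<longleftrightarrow> progressive a b H \<and> (\<exists>c. scaled_bound c a b H) \<and> is_ito a b H I \<and>
     (\<forall>x. cond_unit C (F a) (\<lambda>\<omega>. ennreal (exp (x * I \<omega> - x\<^sup>2 * qvar a b H \<omega> / 2))))"

lemma good_elem:
  assumes el: "elem a b K J" and ra: "r \<le> a"
  shows "good a b K J"
  unfolding good_def
proof (intro conjI allI)
  fix x :: real
  have "elem a b (\<lambda>u \<omega>. x *\<^sub>R K u \<omega>) (\<lambda>\<omega>. x * J \<omega>)"
    using elem_cmult[OF el] .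
  from elem_exp[OF this ra] show "cond_unit C (F a) (\<lambda>\<omega>. ennreal (exp (x * J \<omega> - x\<^sup>2 * qvar a b K \<omega> / 2)))"
    using qvar_cmult[of a b "\<lambda>_. x" K] by simp
qed (use assms elem_props(2) elem_bound is_ito_elem in blast)+

lemma good_cong:
  assumes g: "good a b H I" and eq: "\<And>u \<omega>. a < u \<Longrightarrow> u \<le> b \<Longrightarrow> \<omega> \<in> \<Omega> \<Longrightarrow> H u \<omega> = H' u \<omega>"
  shows "good a b H' I"
proof -
  have q: "qvar a b H \<omega> = qvar a b H' \<omega>" if "\<omega> \<in> \<Omega>" for \<omega>
    by (rule qvar_cong) (simp add: eq that)
  have "cond_unit C (F a) (\<lambda>\<omega>. ennreal (exp (x * I \<omega> - x\<^sup>2 * qvar a b H' \<omega> / 2)))" for x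
  proof -
    have c: "cond_unit C (F a) (\<lambda>\<omega>. ennreal (exp (x * I \<omega> - x\<^sup>2 * qvar a b H \<omega> / 2)))"
      using g by (simp add: good_def)
    moreover have "(\<lambda>\<omega>. ennreal (exp (x * I \<omega> - x\<^sup>2 * qvar a b H' \<omega> / 2))) \<in> borel_measurable C"
      using c unfolding cond_unit_def by (subst measurable_cong[where g = "\<lambda>\<omega>. ennreal (exp (x * I \<omega> - x\<^sup>2 * qvar a b H \<omega> / 2))"]) (auto simp: q)
    ultimately show ?thesis by (rule cond_unit_cong_AE) (auto simp: q)
  qed
  moreover have "\<exists>c. scaled_bound c a b H'" using g eq by (auto simp: good_def scaled_bound_def)
  ultimately show ?thesis using g progressive_cong[OF _ eq] is_ito_cong[OF _ eq] by (auto simp: good_def)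
qed

lemma scaled_bound_concat:
  assumes "scaled_bound k a b H" "scaled_bound k' b c H"
  shows "scaled_bound (max k k') a c H"
  unfolding scaled_bound_def
proof (intro conjI ballI allI impI)
  fix \<omega> u assume "\<omega> \<in> \<Omega>" "a < u \<and> u \<le> c"
  then show "norm (H u \<omega> v* \<sigma> u (\<omega> u)) \<le> max k k'"
    using assms unfolding scaled_bound_def by (cases "u \<le> b") (auto simp: le_max_iff_disj)
qed (use assms in \<open>auto simp: scaled_bound_def\<close>)

lemma good_concat:
  assumes ra: "r \<le> a" "a \<le> b" "b \<le> c" and g: "good a b H I1" "good b c H I2"
  shows "good a c H (\<lambda>\<omega>. I1 \<omega> + I2 \<omega>)"
proof -
  have rb: "r \<le> b" using ra by simp
  obtain k k' where k: "scaled_bound k a b H" "scaled_bound k' b c H" using g by (auto simp: good_def)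
  have P: "progressive a b H" "progressive b c H" and I: "is_ito a b H I1" "is_ito b c H I2" using g by (auto simp: good_def)
  have P': "progressive a c H" by (rule progressive_concat[OF P ra(2,3)])
  have I': "is_ito a c H (\<lambda>\<omega>. I1 \<omega> + I2 \<omega>)" by (rule is_ito_concat[OF ra P I])
  have "cond_unit C (F a) (\<lambda>\<omega>. ennreal (exp (x * (I1 \<omega> + I2 \<omega>) - x\<^sup>2 * qvar a c H \<omega> / 2)))" for x
  proof -
    have m1: "(\<lambda>\<omega>. ennreal (exp (x * I1 \<omega> - x\<^sup>2 * qvar a b H \<omega> / 2))) \<in> borel_measurable (F b)"
    proof -
      have [measurable]: "I1 \<in> borel_measurable (F b)" "qvar a b H \<in> borel_measurable (F b)"
        using I(1) qvar_measurable[OF ra(1,2) P(1)] by (auto simp: is_ito_def)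
      show ?thesis by measurable
    qed
    have c: "cond_unit C (F a) (\<lambda>\<omega>. ennreal (exp (x * I1 \<omega> - x\<^sup>2 * qvar a b H \<omega> / 2)) * ennreal (exp (x * I2 \<omega> - x\<^sup>2 * qvar b c H \<omega> / 2)))"
      using g by (intro cond_unit_mult[OF subalgebra_F subalgebra_F sets_F_mono[OF ra(2)] _ m1]) (auto simp: good_def)
    have m: "(\<lambda>\<omega>. ennreal (exp (x * (I1 \<omega> + I2 \<omega>) - x\<^sup>2 * qvar a c H \<omega> / 2))) \<in> borel_measurable C"
    proof -
      have [measurable]: "(\<lambda>\<omega>. I1 \<omega> + I2 \<omega>) \<in> borel_measurable C"  "qvar a c H \<in> borel_measurable C"
        using I' qvar_measurable[OF ra(1) order_trans[OF ra(2,3)] P'] measurable_F_C unfolding is_ito_def by blast+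
      show ?thesis by measurable
    qed
    have eq: "exp (x * I1 \<omega> - x\<^sup>2 * qvar a b H \<omega> / 2) * exp (x * I2 \<omega> - x\<^sup>2 * qvar b c H \<omega> / 2)
        = exp (x * (I1 \<omega> + I2 \<omega>) - x\<^sup>2 * qvar a c H \<omega> / 2)" if "\<omega> \<in> \<Omega>" for \<omega>
      unfolding qvar_split[OF ra P k that] exp_add[symmetric] by (simp add: field_simps)
    show ?thesis
      by (rule cond_unit_cong_AE[OF c m], rule AE_I2) (simp add: ennreal_mult[symmetric] eq)
  qed
  then show ?thesis using P' I' scaled_bound_concat[OF k] unfolding good_def by blast
qed

text \<open>The difference of the squared lengths is at most 2 c times the length of the difference,
  and Young's inequality with weight d bounds this by d plus c^2 / d times the squared difference.
  The natural weight is sqrt W; a small multiple of e is added so that d stays positive when W =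
  0.\<close>

lemma qvar_diff_le:
  assumes ra: "r \<le> a" "a \<le> b" and P: "progressive a b H" "progressive a b H'"
    and c: "scaled_bound c a b H" "scaled_bound c a b H'" and \<omega>: "\<omega> \<in> \<Omega>"
  shows "\<bar>qvar a b H \<omega> - qvar a b H' \<omega>\<bar> \<le> sqrt (qvar a b (\<lambda>u \<omega>. H u \<omega> - H' u \<omega>) \<omega>) * (b - a + c\<^sup>2)"
proof (rule field_le_epsilon)
  fix e :: real assume "0 < e"
  define D where "D = (\<lambda>u \<omega>. H u \<omega> - H' u \<omega>)"
  define W where "W = qvar a b D \<omega>"
  have W0: "0 \<le> W" by (simp add: W_def qvar_nonneg)
  define d where "d = sqrt W + e / (b - a + 1)"
  have d: "0 < d" "sqrt W \<le> d" using \<open>0 < e\<close> ra W0 by (auto simp: d_def add_nonneg_pos)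
  have c0: "0 \<le> c" using c by (simp add: scaled_bound_def)
  have PD: "progressive a b D" unfolding D_def by (rule progressive_diff[OF P])
  have cD: "scaled_bound (2 * c) a b D"
    unfolding scaled_bound_def
  proof (intro conjI ballI allI impI)
    fix \<omega> u assume "\<omega> \<in> \<Omega>" "a < u \<and> u \<le> b"
    then have "norm (H u \<omega> v* \<sigma> u (\<omega> u)) \<le> c" "norm (H' u \<omega> v* \<sigma> u (\<omega> u)) \<le> c" using c by (auto simp: scaled_bound_def)
    then show "norm (D u \<omega> v* \<sigma> u (\<omega> u)) \<le> 2 * c"
      unfolding D_def vector_matrix_mult_diff_distrib using norm_triangle_ineq4[of "H u \<omega> v* \<sigma> u (\<omega> u)" "H' u \<omega> v* \<sigma> u (\<omega> u)"] by linarith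
  qed (use c0 in simp)
  note int = scaled_integrable[OF ra P(1) c(1) \<omega>] scaled_integrable[OF ra P(2) c(2) \<omega>] scaled_integrable[OF ra PD cD \<omega>]
  have pt: "\<bar>(norm (scaled a b H u \<omega>))\<^sup>2 - (norm (scaled a b H' u \<omega>))\<^sup>2\<bar> \<le> d * indicator {a<..b} u + c\<^sup>2 / d * (norm (scaled a b D u \<omega>))\<^sup>2" for u
  proof (cases "u \<in> {a<..b}")
    case True
    define x where "x = scaled a b H u \<omega>"
    define y where "y = scaled a b H' u \<omega>"
    have n: "norm x \<le> c" "norm y \<le> c" using c \<omega> True unfolding x_def y_def scaled_def scaled_bound_def by auto
    have "\<bar>(norm x)\<^sup>2 - (norm y)\<^sup>2\<bar> = \<bar>norm x - norm y\<bar> * (norm x + norm y)"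
      by (simp add: power2_eq_square square_diff_square_factored abs_mult mult.commute)
    also have "\<dots> \<le> norm (x - y) * (2 * c)"
      using n by (intro mult_mono norm_triangle_ineq3) auto
    also have "\<dots> \<le> d + c\<^sup>2 / d * (norm (x - y))\<^sup>2"
    proof -
      have "0 \<le> (d - c * norm (x - y))\<^sup>2" by simp
      then have "2 * c * norm (x - y) * d \<le> d\<^sup>2 + c\<^sup>2 * (norm (x - y))\<^sup>2"
        by (simp add: power2_eq_square algebra_simps)
      then show ?thesis using d by (simp add: field_simps power2_eq_square)
    qed
    finally show ?thesis using True by (simp add: x_def y_def D_def scaled_diff)
  next
    case False then show ?thesis by (simp add: scaled_def)
  qed
  have "\<bar>qvar a b H \<omega> - qvar a b H' \<omega>\<bar> = \<bar>\<integral>u. (norm (scaled a b H u \<omega>))\<^sup>2 - (norm (scaled a b H' u \<omega>))\<^sup>2 \<partial>lborel\<bar>"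
    unfolding qvar_def using int by simp
  also have "\<dots> \<le> (\<integral>u. \<bar>(norm (scaled a b H u \<omega>))\<^sup>2 - (norm (scaled a b H' u \<omega>))\<^sup>2\<bar> \<partial>lborel)"
    by (rule integral_abs_bound)
  also have "\<dots> \<le> (\<integral>u. d * indicator {a<..b} u + c\<^sup>2 / d * (norm (scaled a b D u \<omega>))\<^sup>2 \<partial>lborel)"
    by (rule integral_mono) (use int pt ra in auto)
  also have "\<dots> = d * (b - a) + c\<^sup>2 / d * W"
    unfolding W_def qvar_def using int ra by simp
  also have "c\<^sup>2 / d * W \<le> c\<^sup>2 * sqrt W"
  proof -
    have "W = sqrt W * sqrt W" using W0 by simp
    also have "\<dots> \<le> d * sqrt W" using d W0 by (intro mult_right_mono) auto
    finally have "c\<^sup>2 * W \<le> c\<^sup>2 * (d * sqrt W)" by (rule mult_left_mono) simp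
    then show ?thesis using d by (simp add: field_simps)
  qed
  also have "d * (b - a) + c\<^sup>2 * sqrt W \<le> sqrt W * (b - a + c\<^sup>2) + e"
  proof -
    have "e / (b - a + 1) * (b - a) \<le> e" using \<open>0 < e\<close> ra by (simp add: field_simps)
    then show ?thesis unfolding d_def by (simp add: algebra_simps)
  qed
  finally show "\<bar>qvar a b H \<omega> - qvar a b H' \<omega>\<bar> \<le> sqrt (qvar a b (\<lambda>u \<omega>. H u \<omega> - H' u \<omega>) \<omega>) * (b - a + c\<^sup>2) + e"
    by (simp add: W_def D_def)
qed

text \<open>The integrals are Cauchy in mean square by \<open>is_ito_bound\<close>. The exponential
  property passes to the limit because along a subsequence both the integrals and their quadratic
  variations converge almost everywhere, while the second moments of the exponentials stay
  bounded.\<close>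

lemma good_limit:
  assumes ra: "r \<le> a" "a \<le> b" and g: "\<And>k. good a b (H k) (I k)" and P: "progressive a b G"
    and c: "\<And>k. scaled_bound c a b (H k)" "scaled_bound c a b G"
    and lim: "(\<lambda>k::nat. msq a b (\<lambda>u \<omega>. H k u \<omega> - G u \<omega>)) \<longlonglongrightarrow> 0"
  shows "\<exists>I. good a b G I"
proof -
  have PH: "progressive a b (H k)" and IH: "is_ito a b (H k) (I k)"
    and uH: "cond_unit C (F a) (\<lambda>\<omega>. ennreal (exp (x * I k \<omega> - x\<^sup>2 * qvar a b (H k) \<omega> / 2)))" for k x
    using g[of k] by (auto simp: good_def)
  have IF: "I k \<in> borel_measurable (F b)" for k using IH[of k] by (simp add: is_ito_def)
  have ev: "\<exists>N. \<forall>k\<ge>N. msq a b (\<lambda>u \<omega>. H k u \<omega> - G u \<omega>) < ennreal e" if "0 < e" for e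
    using order_tendstoD(2)[OF lim, of "ennreal e"] that by (simp add: eventually_sequentially)
  have "\<exists>J\<in>borel_measurable (F b). (\<lambda>n. \<integral>\<^sup>+\<omega>. ennreal ((J \<omega> - I n \<omega>)\<^sup>2) \<partial>C) \<longlonglongrightarrow> 0"
  proof (rule L2_complete[OF C.finite_measure_axioms subalgebra_F IF])
    fix e :: real assume "0 < e"
    \<comment> \<open>The constants multiply to 36 * 3 * 2 = 216, so this tolerance leaves e /
      2.\<close>
    then have e: "0 < e / 432" by simp
    obtain N where N: "\<And>k. N \<le> k \<Longrightarrow> msq a b (\<lambda>u \<omega>. H k u \<omega> - G u \<omega>) < ennreal (e / 432)" using ev[OF e] by blast
    have "(\<integral>\<^sup>+\<omega>. ennreal ((I m \<omega> - I n \<omega>)\<^sup>2) \<partial>C) < ennreal e" if mn: "N \<le> m" "N \<le> n" for m n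
    proof -
      have "(\<integral>\<^sup>+\<omega>. ennreal ((I m \<omega> - I n \<omega>)\<^sup>2) \<partial>C) \<le> 36 * msq a b (\<lambda>u \<omega>. H m u \<omega> - H n u \<omega>)"
        by (rule is_ito_bound[OF ra PH PH IH IH])
      also have "\<dots> \<le> 36 * (3 * (msq a b (\<lambda>u \<omega>. H m u \<omega> - G u \<omega>) + msq a b (\<lambda>u \<omega>. G u \<omega> - G u \<omega>) + msq a b (\<lambda>u \<omega>. G u \<omega> - H n u \<omega>)))"
        by (intro mult_left_mono msq_triangle ra PH P) auto
      also have "\<dots> \<le> 36 * (3 * (ennreal (e / 432) + 0 + ennreal (e / 432)))"
        using N[OF mn(1)] N[OF mn(2)] by (intro mult_left_mono add_mono) (auto simp: msq_commute[of a b G])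
      also have "\<dots> = ennreal (36 * (3 * (e / 432 + e / 432)))"
        using e by (simp only: add_0_right ennreal_plus ennreal_numeral_mult add_nonneg_nonneg mult_nonneg_nonneg less_imp_le zero_le_numeral)
      also have "\<dots> < ennreal e" using \<open>0 < e\<close> by (intro ennreal_lessI) auto
      finally show ?thesis .
    qed
    then show "\<exists>N. \<forall>m\<ge>N. \<forall>n\<ge>N. (\<integral>\<^sup>+\<omega>. ennreal ((I m \<omega> - I n \<omega>)\<^sup>2) \<partial>C) < ennreal e" by blast
  qed
  then obtain J where J: "J \<in> borel_measurable (F b)" and Jlim: "(\<lambda>n. \<integral>\<^sup>+\<omega>. ennreal ((J \<omega> - I n \<omega>)\<^sup>2) \<partial>C) \<longlonglongrightarrow> 0" by blast
  have [measurable]: "J \<in> borel_measurable C" "I k \<in> borel_measurable C" for k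
    using measurable_F_C[OF J] measurable_F_C[OF IF] .
  have [measurable]: "qvar a b G \<in> borel_measurable C" "qvar a b (H k) \<in> borel_measurable C" for k
    using measurable_F_C[OF qvar_measurable[OF ra P]] measurable_F_C[OF qvar_measurable[OF ra PH]] .
  have ito: "is_ito a b G J"
    unfolding is_ito_def
  proof (intro conjI allI impI J)
    fix e :: real assume "0 < e"
    then have e: "0 < e / 12" by simp
    obtain N where N: "\<And>k. N \<le> k \<Longrightarrow> msq a b (\<lambda>u \<omega>. H k u \<omega> - G u \<omega>) < ennreal (e / 12)" using ev[OF e] by blast
    obtain N' where N': "\<And>k. N' \<le> k \<Longrightarrow> (\<integral>\<^sup>+\<omega>. ennreal ((J \<omega> - I k \<omega>)\<^sup>2) \<partial>C) < ennreal (e / 12)"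
      using order_tendstoD(2)[OF Jlim, of "ennreal (e / 12)"] e by (auto simp: eventually_sequentially)
    define k where "k = max N N'"
    obtain K L where K: "elem a b K L" "msq a b (\<lambda>u \<omega>. H k u \<omega> - K u \<omega>) < ennreal (e / 12)"
      "(\<integral>\<^sup>+\<omega>. ennreal ((I k \<omega> - L \<omega>)\<^sup>2) \<partial>C) < ennreal (e / 12)" using IH[of k] e unfolding is_ito_def by blast
    have [measurable]: "L \<in> borel_measurable C" using measurable_F_C[OF elem_props(1)[OF K(1) ra(1)]] .
    have lt: "3 * (ennreal (e / 12) + 0 + ennreal (e / 12)) < ennreal e"
    proof -
      have "3 * (ennreal (e / 12) + 0 + ennreal (e / 12)) = ennreal (3 * (e / 12 + e / 12))"
        using e by (simp only: add_0_right ennreal_plus ennreal_numeral_mult add_nonneg_nonneg mult_nonneg_nonneg less_imp_le zero_le_numeral)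
      also have "\<dots> < ennreal e" using \<open>0 < e\<close> by (intro ennreal_lessI) auto
      finally show ?thesis .
    qed
    have "msq a b (\<lambda>u \<omega>. G u \<omega> - K u \<omega>) \<le> 3 * (msq a b (\<lambda>u \<omega>. G u \<omega> - H k u \<omega>) + msq a b (\<lambda>u \<omega>. H k u \<omega> - H k u \<omega>) + msq a b (\<lambda>u \<omega>. H k u \<omega> - K u \<omega>))"
      by (rule msq_triangle[OF ra P PH PH elem_props(2)[OF K(1) ra(1)]])
    also have "\<dots> \<le> 3 * (ennreal (e / 12) + 0 + ennreal (e / 12))"
      using N[of k] K(2) by (intro mult_left_mono add_mono) (auto simp: msq_commute[of a b G] k_def)
    finally have 1: "msq a b (\<lambda>u \<omega>. G u \<omega> - K u \<omega>) < ennreal e" using lt by (rule le_less_trans)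
    have "(\<integral>\<^sup>+\<omega>. ennreal ((J \<omega> - L \<omega>)\<^sup>2) \<partial>C) \<le> (\<integral>\<^sup>+\<omega>. 3 * (ennreal ((J \<omega> - I k \<omega>)\<^sup>2) + 0 + ennreal ((I k \<omega> - L \<omega>)\<^sup>2)) \<partial>C)"
    proof (rule nn_integral_mono)
      fix \<omega>
      have "(J \<omega> - L \<omega>)\<^sup>2 \<le> 3 * ((J \<omega> - I k \<omega>)\<^sup>2 + (I k \<omega> - L \<omega>)\<^sup>2)"
        using norm_add3_sq[of "J \<omega> - I k \<omega>" "I k \<omega> - L \<omega>" 0] by simp
      from ennreal_leI[OF this] show "ennreal ((J \<omega> - L \<omega>)\<^sup>2) \<le> 3 * (ennreal ((J \<omega> - I k \<omega>)\<^sup>2) + 0 + ennreal ((I k \<omega> - L \<omega>)\<^sup>2))"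
        by (simp add: ennreal_numeral_mult)
    qed
    also have "\<dots> = 3 * ((\<integral>\<^sup>+\<omega>. ennreal ((J \<omega> - I k \<omega>)\<^sup>2) \<partial>C) + (\<integral>\<^sup>+\<omega>. 0 \<partial>C) + (\<integral>\<^sup>+\<omega>. ennreal ((I k \<omega> - L \<omega>)\<^sup>2) \<partial>C))"
      by (rule nn_integral_cmult_add3) measurable
    also have "\<dots> \<le> 3 * (ennreal (e / 12) + 0 + ennreal (e / 12))"
      using N'[of k] K(3) by (intro mult_left_mono add_mono) (auto simp: k_def)
    finally have "(\<integral>\<^sup>+\<omega>. ennreal ((J \<omega> - L \<omega>)\<^sup>2) \<partial>C) < ennreal e" using lt by (rule le_less_trans)
    with K(1) 1 show "\<exists>K L. elem a b K L \<and> msq a b (\<lambda>u \<omega>. G u \<omega> - K u \<omega>) < ennreal e \<and>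
        (\<integral>\<^sup>+\<omega>. ennreal ((J \<omega> - L \<omega>)\<^sup>2) \<partial>C) < ennreal e" by blast
  qed
  define W where "W k = qvar a b (\<lambda>u \<omega>. H k u \<omega> - G u \<omega>)" for k
  have PD: "progressive a b (\<lambda>u \<omega>. H k u \<omega> - G u \<omega>)" for k by (rule progressive_diff[OF PH P])
  have cD: "scaled_bound (2 * c) a b (\<lambda>u \<omega>. H k u \<omega> - G u \<omega>)" for k
    unfolding scaled_bound_def
  proof (intro conjI ballI allI impI)
    fix \<omega> u assume "\<omega> \<in> \<Omega>" "a < u \<and> u \<le> b"
    then have "norm (H k u \<omega> v* \<sigma> u (\<omega> u)) \<le> c" "norm (G u \<omega> v* \<sigma> u (\<omega> u)) \<le> c" using c by (auto simp: scaled_bound_def)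
    then show "norm ((H k u \<omega> - G u \<omega>) v* \<sigma> u (\<omega> u)) \<le> 2 * c"
      unfolding vector_matrix_mult_diff_distrib using norm_triangle_ineq4[of "H k u \<omega> v* \<sigma> u (\<omega> u)" "G u \<omega> v* \<sigma> u (\<omega> u)"] by linarith
  qed (use c(2) in \<open>simp add: scaled_bound_def\<close>)
  have [measurable]: "W k \<in> borel_measurable C" for k
    unfolding W_def by (rule measurable_F_C[OF qvar_measurable[OF ra PD]])
  have W0: "0 \<le> W k \<omega>" for k \<omega> by (simp add: W_def qvar_nonneg)
  \<comment> \<open>One sequence carries both quantities, so that a single subsequence serves for
    the integrals and for the quadratic variations.\<close>
  have "(\<lambda>k. \<integral>\<^sup>+\<omega>. ennreal ((J \<omega> - I k \<omega>)\<^sup>2 + W k \<omega>) \<partial>C) \<longlonglongrightarrow> 0"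
  proof -
    have "(\<integral>\<^sup>+\<omega>. ennreal ((J \<omega> - I k \<omega>)\<^sup>2 + W k \<omega>) \<partial>C) = (\<integral>\<^sup>+\<omega>. ennreal ((J \<omega> - I k \<omega>)\<^sup>2) \<partial>C) + msq a b (\<lambda>u \<omega>. H k u \<omega> - G u \<omega>)" for k
      unfolding msq_alt[OF ra PD cD] W_def[symmetric] using W0 by (simp add: nn_integral_add)
    then show ?thesis using tendsto_add[OF Jlim lim] by simp
  qed
  from AE_subseq_of_nn_integral[OF _ _ this] W0
  obtain s :: "nat \<Rightarrow> nat" where s: "AE \<omega> in C. (\<lambda>k. (J \<omega> - I (s k) \<omega>)\<^sup>2 + W (s k) \<omega>) \<longlonglongrightarrow> 0" by auto
  have conv: "AE \<omega> in C. (\<lambda>k. I (s k) \<omega>) \<longlonglongrightarrow> J \<omega> \<and> (\<lambda>k. qvar a b (H (s k)) \<omega>) \<longlonglongrightarrow> qvar a b G \<omega>"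
    using s AE_space
  proof eventually_elim
    fix \<omega> assume l: "(\<lambda>k. (J \<omega> - I (s k) \<omega>)\<^sup>2 + W (s k) \<omega>) \<longlonglongrightarrow> 0" and "\<omega> \<in> space C"
    then have \<omega>: "\<omega> \<in> \<Omega>" by simp
    have "(\<lambda>k. (J \<omega> - I (s k) \<omega>)\<^sup>2) \<longlonglongrightarrow> 0"
      by (rule tendsto_sandwich[OF _ _ tendsto_const l]) (auto simp: W0)
    then have "(\<lambda>k. sqrt ((J \<omega> - I (s k) \<omega>)\<^sup>2)) \<longlonglongrightarrow> sqrt 0" by (rule tendsto_real_sqrt)
    then have "(\<lambda>k. \<bar>I (s k) \<omega> - J \<omega>\<bar>) \<longlonglongrightarrow> 0" by (simp add: abs_minus_commute)
    then have 1: "(\<lambda>k. I (s k) \<omega>) \<longlonglongrightarrow> J \<omega>" by (simp add: tendsto_rabs_zero_iff LIM_zero_iff)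
    have "(\<lambda>k. W (s k) \<omega>) \<longlonglongrightarrow> 0"
      by (rule tendsto_sandwich[OF _ _ tendsto_const l]) (auto simp: W0)
    then have "(\<lambda>k. sqrt (W (s k) \<omega>) * (b - a + c\<^sup>2)) \<longlonglongrightarrow> sqrt 0 * (b - a + c\<^sup>2)"
      by (intro tendsto_mult tendsto_real_sqrt tendsto_const)
    then have l2: "(\<lambda>k. sqrt (W (s k) \<omega>) * (b - a + c\<^sup>2)) \<longlonglongrightarrow> 0" by simp
    have "(\<lambda>k. \<bar>qvar a b (H (s k)) \<omega> - qvar a b G \<omega>\<bar>) \<longlonglongrightarrow> 0"
      by (rule tendsto_sandwich[OF _ _ tendsto_const l2])
        (use qvar_diff_le[OF ra PH P c(1,2) \<omega>] in \<open>auto simp: W_def\<close>)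
    then have "(\<lambda>k. qvar a b (H (s k)) \<omega>) \<longlonglongrightarrow> qvar a b G \<omega>" by (simp add: tendsto_rabs_zero_iff LIM_zero_iff)
    with 1 show "(\<lambda>k. I (s k) \<omega>) \<longlonglongrightarrow> J \<omega> \<and> (\<lambda>k. qvar a b (H (s k)) \<omega>) \<longlonglongrightarrow> qvar a b G \<omega>" by simp
  qed
  have "cond_unit C (F a) (\<lambda>\<omega>. ennreal (exp (x * J \<omega> - x\<^sup>2 * qvar a b G \<omega> / 2)))" for x
  proof (rule cond_unit_limit[OF C.finite_measure_axioms subalgebra_F])
    show "cond_unit C (F a) (\<lambda>\<omega>. ennreal (exp (x * I (s k) \<omega> - x\<^sup>2 * qvar a b (H (s k)) \<omega> / 2)))" for k by (rule uH)
    show "AE \<omega> in C. (\<lambda>k. exp (x * I (s k) \<omega> - x\<^sup>2 * qvar a b (H (s k)) \<omega> / 2)) \<longlonglongrightarrow> exp (x * J \<omega> - x\<^sup>2 * qvar a b G \<omega> / 2)"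
      using conv by eventually_elim (intro tendsto_exp tendsto_diff tendsto_mult tendsto_divide tendsto_const; simp)
    show "(\<integral>\<^sup>+\<omega>. ennreal ((exp (x * I (s k) \<omega> - x\<^sup>2 * qvar a b (H (s k)) \<omega> / 2))\<^sup>2) \<partial>C) \<le> ennreal (exp (x\<^sup>2 * (c\<^sup>2 * (b - a))))" for k
    proof -
      \<comment> \<open>The square exp (2 x I - x^2 q) is exp (x^2 q) times the exponential with
        parameter 2 x, and q is at most c^2 (b - a).\<close>
      let ?e = "exp (x\<^sup>2 * (c\<^sup>2 * (b - a)))"
      have "(\<integral>\<^sup>+\<omega>. ennreal ((exp (x * I (s k) \<omega> - x\<^sup>2 * qvar a b (H (s k)) \<omega> / 2))\<^sup>2) \<partial>C)
        \<le> (\<integral>\<^sup>+\<omega>. ennreal ?e * ennreal (exp ((2 * x) * I (s k) \<omega> - (2 * x)\<^sup>2 * qvar a b (H (s k)) \<omega> / 2)) \<partial>C)"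
      proof (rule nn_integral_mono)
        fix \<omega> assume "\<omega> \<in> space C"
        then have "qvar a b (H (s k)) \<omega> \<le> c\<^sup>2 * (b - a)" by (intro qvar_le[OF ra PH c(1)]) simp
        then have "x\<^sup>2 * qvar a b (H (s k)) \<omega> \<le> x\<^sup>2 * (c\<^sup>2 * (b - a))" by (rule mult_left_mono) simp
        then have "2 * (x * I (s k) \<omega> - x\<^sup>2 * qvar a b (H (s k)) \<omega> / 2) \<le> x\<^sup>2 * (c\<^sup>2 * (b - a)) + ((2 * x) * I (s k) \<omega> - (2 * x)\<^sup>2 * qvar a b (H (s k)) \<omega> / 2)"
          by (simp add: power_mult_distrib)
        then have "(exp (x * I (s k) \<omega> - x\<^sup>2 * qvar a b (H (s k)) \<omega> / 2))\<^sup>2 \<le> ?e * exp ((2 * x) * I (s k) \<omega> - (2 * x)\<^sup>2 * qvar a b (H (s k)) \<omega> / 2)"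
          unfolding exp_add[symmetric] exp_double[symmetric] exp_le_cancel_iff .
        from ennreal_leI[OF this]
        show "ennreal ((exp (x * I (s k) \<omega> - x\<^sup>2 * qvar a b (H (s k)) \<omega> / 2))\<^sup>2) \<le> ennreal ?e * ennreal (exp ((2 * x) * I (s k) \<omega> - (2 * x)\<^sup>2 * qvar a b (H (s k)) \<omega> / 2))"
          by (simp only: ennreal_mult exp_ge_zero)
      qed
      also have "\<dots> = ennreal ?e * (\<integral>\<^sup>+\<omega>. ennreal (exp ((2 * x) * I (s k) \<omega> - (2 * x)\<^sup>2 * qvar a b (H (s k)) \<omega> / 2)) \<partial>C)"
        by (rule nn_integral_cmult) measurable
      also have "(\<integral>\<^sup>+\<omega>. ennreal (exp ((2 * x) * I (s k) \<omega> - (2 * x)\<^sup>2 * qvar a b (H (s k)) \<omega> / 2)) \<partial>C) = 1"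
        using cond_unit_nn_integral[OF subalgebra_F uH[of "2 * x" "s k"], of "\<lambda>_. 1"] C.emeasure_space_1 by simp
      finally show ?thesis by simp
    qed
    show "(\<lambda>\<omega>. exp (x * I (s k) \<omega> - x\<^sup>2 * qvar a b (H (s k)) \<omega> / 2)) \<in> borel_measurable C" for k by measurable
    show "(\<lambda>\<omega>. exp (x * J \<omega> - x\<^sup>2 * qvar a b G \<omega> / 2)) \<in> borel_measurable C" by measurable
  qed simp
  then show ?thesis using P c(2) ito unfolding good_def by blast
qed

end

context driftless_diffusion begin

subsection \<open>Integrals of continuous adapted processes\<close>

lemma progressive_continuous:
  assumes ra: "r \<le> a" "a \<le> b"
    and cont: "\<And>\<omega>. \<omega> \<in> \<Omega> \<Longrightarrow> continuous_on {a..b} (\<lambda>u. G u \<omega>)"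
    and ad: "\<And>u. a \<le> u \<Longrightarrow> u \<le> b \<Longrightarrow> G u \<in> borel_measurable (F u)"
  shows "progressive a b G"
proof -
  define g where "g u \<omega> = G (max a (min u b)) \<omega>" for u \<omega>
  have "(\<lambda>(u, \<omega>). g u \<omega>) \<in> borel_measurable (borel \<Otimes>\<^sub>M F b)"
  proof (rule borel_measurable_pair_continuous)
    fix u
    show "g u \<in> borel_measurable (F b)"
      unfolding g_def[abs_def] using ra by (intro measurable_F_mono[OF ad]) auto
  next
    fix \<omega> assume "\<omega> \<in> space (F b)"
    then have "\<omega> \<in> \<Omega>" by simp
    show "continuous_on UNIV (\<lambda>u. g u \<omega>)"
      unfolding g_def by (rule continuous_on_compose2[OF cont[OF \<open>\<omega> \<in> \<Omega>\<close>]]) (use ra in \<open>auto intro!: continuous_intros\<close>)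
  qed
  then have [measurable]: "(\<lambda>x. g (fst x) (snd x)) \<in> borel_measurable (borel \<Otimes>\<^sub>M F b)" by (simp add: split_beta')
  have "(\<lambda>x. indicator {a<..b} (fst x) *\<^sub>R g (fst x) (snd x)) \<in> borel_measurable (borel \<Otimes>\<^sub>M F b)"
    by measurable
  then show ?thesis unfolding progressive_def
    by (rule measurable_cong[THEN iffD1, rotated]) (auto simp: g_def split: split_indicator)
qed

text \<open>Dominated convergence is applied twice, in time along each path and then over paths; the
  uniform bound on H \<sigma> supplies both majorants.\<close>

lemma msq_dominated_convergence:
  assumes ra: "r \<le> a" "a \<le> b"
    and P: "\<And>k. progressive a b (H k)" and c: "\<And>k. scaled_bound c a b (H k)"
    and lim: "\<And>u \<omega>. a < u \<Longrightarrow> u \<le> b \<Longrightarrow> \<omega> \<in> \<Omega> \<Longrightarrow> (\<lambda>k. H k u \<omega> v* \<sigma> u (\<omega> u)) \<longlonglongrightarrow> 0"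
  shows "(\<lambda>k. msq a b (H k)) \<longlonglongrightarrow> 0"
proof -
  have "(\<lambda>k. msq a b (H k)) \<longlonglongrightarrow> (\<integral>\<^sup>+\<omega>. 0 \<partial>C)"
    unfolding msq_def
  proof (rule nn_integral_dominated_convergence[where w = "\<lambda>_. ennreal (c\<^sup>2 * (b - a))"])
    show "(\<lambda>\<omega>. \<integral>\<^sup>+u. ennreal ((norm (scaled a b (H k) u \<omega>))\<^sup>2) \<partial>lborel) \<in> borel_measurable C" for k
      by (rule measurable_F_C[OF scaled_nn_measurable[OF ra P]])
    show "AE \<omega> in C. (\<integral>\<^sup>+u. ennreal ((norm (scaled a b (H k) u \<omega>))\<^sup>2) \<partial>lborel) \<le> ennreal (c\<^sup>2 * (b - a))" for k
    proof (rule AE_I2)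
      fix \<omega> assume "\<omega> \<in> space C"
      then have \<omega>: "\<omega> \<in> \<Omega>" by simp
      show "(\<integral>\<^sup>+u. ennreal ((norm (scaled a b (H k) u \<omega>))\<^sup>2) \<partial>lborel) \<le> ennreal (c\<^sup>2 * (b - a))"
        unfolding ennreal_qvar[OF ra P c \<omega>, symmetric] by (rule ennreal_leI[OF qvar_le[OF ra P c \<omega>]])
    qed
    show "(\<integral>\<^sup>+\<omega>. ennreal (c\<^sup>2 * (b - a)) \<partial>C) < \<infinity>"
      using C.emeasure_space_1 by simp
    show "AE \<omega> in C. (\<lambda>k. \<integral>\<^sup>+u. ennreal ((norm (scaled a b (H k) u \<omega>))\<^sup>2) \<partial>lborel) \<longlonglongrightarrow> 0"
    proof (rule AE_I2)
      fix \<omega> assume "\<omega> \<in> space C"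
      then have \<omega>: "\<omega> \<in> \<Omega>" by simp
      have "(\<lambda>k. \<integral>\<^sup>+u. ennreal ((norm (scaled a b (H k) u \<omega>))\<^sup>2) \<partial>lborel) \<longlonglongrightarrow> (\<integral>\<^sup>+u. 0 \<partial>(lborel :: real measure))"
      proof (rule nn_integral_dominated_convergence[where w = "\<lambda>u. ennreal (c\<^sup>2) * indicator {a<..b} u"])
        show "(\<lambda>u. ennreal ((norm (scaled a b (H k) u \<omega>))\<^sup>2)) \<in> borel_measurable lborel" for k
          by (rule scaled_nn_measurable_path[OF ra P \<omega>])
        show "AE u in lborel. ennreal ((norm (scaled a b (H k) u \<omega>))\<^sup>2) \<le> ennreal (c\<^sup>2) * indicator {a<..b} u" for k
        proof (rule AE_I2)
          fix u
          show "ennreal ((norm (scaled a b (H k) u \<omega>))\<^sup>2) \<le> ennreal (c\<^sup>2) * indicator {a<..b} u"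
            using scaled_bound_sq[OF c \<omega>, of k u] by (cases "u \<in> {a<..b}") (auto intro!: ennreal_leI)
        qed
        show "(\<integral>\<^sup>+u. ennreal (c\<^sup>2) * indicator {a<..b} u \<partial>lborel) < \<infinity>"
          using ra by (simp add: nn_integral_cmult_indicator ennreal_mult_less_top)
        show "AE u in lborel. (\<lambda>k. ennreal ((norm (scaled a b (H k) u \<omega>))\<^sup>2)) \<longlonglongrightarrow> 0"
        proof (rule AE_I2)
          fix u
          have "(\<lambda>k. scaled a b (H k) u \<omega>) \<longlonglongrightarrow> 0"
            using lim[OF _ _ \<omega>, of u] unfolding scaled_def by (cases "u \<in> {a<..b}") auto
          then have "(\<lambda>k. ennreal ((norm (scaled a b (H k) u \<omega>))\<^sup>2)) \<longlonglongrightarrow> ennreal ((norm (0 :: real ^ 'n))\<^sup>2)"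
            by (intro tendsto_ennrealI tendsto_power tendsto_norm)
          then show "(\<lambda>k. ennreal ((norm (scaled a b (H k) u \<omega>))\<^sup>2)) \<longlonglongrightarrow> 0" by simp
        qed
      qed auto
      then show "(\<lambda>k. \<integral>\<^sup>+u. ennreal ((norm (scaled a b (H k) u \<omega>))\<^sup>2) \<partial>lborel) \<longlonglongrightarrow> 0" by simp
    qed
  qed auto
  then show ?thesis by simp
qed

lemma scaled_bound_diff:
  assumes "scaled_bound c a b H" "scaled_bound c' a b H'"
  shows "scaled_bound (c + c') a b (\<lambda>u \<omega>. H u \<omega> - H' u \<omega>)"
  unfolding scaled_bound_def
proof (intro conjI ballI allI impI)
  fix \<omega> u assume "\<omega> \<in> \<Omega>" "a < u \<and> u \<le> b"
  then have "norm (H u \<omega> v* \<sigma> u (\<omega> u)) \<le> c" "norm (H' u \<omega> v* \<sigma> u (\<omega> u)) \<le> c'" using assms by (auto simp: scaled_bound_def)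
  then show "norm ((H u \<omega> - H' u \<omega>) v* \<sigma> u (\<omega> u)) \<le> c + c'"
    unfolding vector_matrix_mult_diff_distrib using norm_triangle_ineq4[of "H u \<omega> v* \<sigma> u (\<omega> u)" "H' u \<omega> v* \<sigma> u (\<omega> u)"] by linarith
qed (use assms in \<open>simp add: scaled_bound_def\<close>)

text \<open>The process is frozen at the left end of each cell of a uniform grid. Frozen processes
  are elementary, and by continuity they converge pointwise and boundedly, so
  \<open>good_limit\<close> applies.\<close>

lemma good_bounded_continuous:
  assumes ra: "r \<le> a" "a < b"
    and cont: "\<And>\<omega>. \<omega> \<in> \<Omega> \<Longrightarrow> continuous_on {a..b} (\<lambda>u. G u \<omega>)"
    and ad: "\<And>u. a \<le> u \<Longrightarrow> u \<le> b \<Longrightarrow> G u \<in> borel_measurable (F u)"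
    and B: "\<And>u \<omega>. a \<le> u \<Longrightarrow> u \<le> b \<Longrightarrow> \<omega> \<in> \<Omega> \<Longrightarrow> norm (G u \<omega>) \<le> B"
  shows "\<exists>I. good a b G I"
proof -
  have ab: "a \<le> b" using ra by simp
  define \<delta> where "\<delta> n = (b - a) / real (Suc n)" for n
  have \<delta>: "0 < \<delta> n" for n using ra by (simp add: \<delta>_def)
  \<comment> \<open>The left end of the grid cell containing u. It is the ceiling minus one and not
    the floor, because elementary processes are constant on cells that are open on the left and
    closed on the right.\<close>
  define \<rho> where "\<rho> n u = a + \<delta> n * (of_int \<lceil>(u - a) / \<delta> n\<rceil> - 1)" for n u
  define K where "K n u \<omega> = G (\<rho> n u) \<omega>" for n u \<omega>
  have \<rho>: "u - \<delta> n \<le> \<rho> n u" "\<rho> n u \<le> u" for n u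
  proof -
    define w where "w = (u - a) / \<delta> n"
    have w: "\<delta> n * w = u - a" using \<delta>[of n] by (simp add: w_def)
    have "of_int \<lceil>w\<rceil> - 1 \<le> w" "w - 1 \<le> of_int \<lceil>w\<rceil> - 1" by linarith+
    then have "\<delta> n * (of_int \<lceil>w\<rceil> - 1) \<le> \<delta> n * w" "\<delta> n * (w - 1) \<le> \<delta> n * (of_int \<lceil>w\<rceil> - 1)"
      using less_imp_le[OF \<delta>[of n]] by (simp_all only: mult_left_mono)
    then show "u - \<delta> n \<le> \<rho> n u" "\<rho> n u \<le> u"
      unfolding \<rho>_def w_def[symmetric] right_diff_distrib[of _ w] w by simp_all
  qed
  have \<rho>a: "a \<le> \<rho> n u" if "a < u" for n u
  proof -
    have "0 < (u - a) / \<delta> n" using that \<delta> by simp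
    then have "0 < \<lceil>(u - a) / \<delta> n\<rceil>" by simp
    then have "0 \<le> real_of_int \<lceil>(u - a) / \<delta> n\<rceil> - 1" by linarith
    then show ?thesis unfolding \<rho>_def using \<delta>[of n] by simp
  qed
  have \<rho>_grid: "\<rho> n u = a + \<delta> n * real i" if "a + \<delta> n * real i < u" "u \<le> a + \<delta> n * real (Suc i)" for n u i
  proof -
    have "real i < (u - a) / \<delta> n" "(u - a) / \<delta> n \<le> real (Suc i)"
      using that \<delta>[of n] by (auto simp: pos_less_divide_eq pos_divide_le_eq mult.commute)
    then have "\<lceil>(u - a) / \<delta> n\<rceil> = int i + 1" by (intro ceiling_unique) auto
    then show ?thesis by (simp add: \<rho>_def)
  qed
  have el: "\<exists>J. elem a (a + \<delta> n * real i) (K n) J" if "i \<le> Suc n" for n i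
    using that
  proof (induction i)
    case 0 show ?case using elementary.Nil[of a "K n"] by (intro exI[of _ "\<lambda>_. 0"]) simp
  next
    case (Suc i)
    then obtain J where J: "elem a (a + \<delta> n * real i) (K n) J" by auto
    have le: "a \<le> a + \<delta> n * real i" using \<delta>[of n] by simp
    have "\<delta> n * real i \<le> \<delta> n * real (Suc n)" using \<delta>[of n] Suc by (intro mult_left_mono) auto
    then have le': "a + \<delta> n * real i \<le> b" by (simp add: \<delta>_def)
    have "elem a (a + \<delta> n * real (Suc i)) (K n) (\<lambda>\<omega>. J \<omega> + G (a + \<delta> n * real i) \<omega> \<bullet> (\<omega> (a + \<delta> n * real (Suc i)) - \<omega> (a + \<delta> n * real i)))"
    proof (rule elementary.Step[OF J])
      show "a + \<delta> n * real i < a + \<delta> n * real (Suc i)" using \<delta>[of n] by simp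
      show "G (a + \<delta> n * real i) \<in> borel_measurable (F (a + \<delta> n * real i))" by (rule ad[OF le le'])
      show "bounded (G (a + \<delta> n * real i) ` \<Omega>)" using B[OF le le'] by (auto intro!: boundedI[of _ B])
      show "K n u \<omega> = G (a + \<delta> n * real i) \<omega>" if "a + \<delta> n * real i < u" "u \<le> a + \<delta> n * real (Suc i)" for u \<omega>
        unfolding K_def using \<rho>_grid[OF that] by simp
    qed
    then show ?case by blast
  qed
  have "a + \<delta> n * real (Suc n) = b" for n by (simp add: \<delta>_def)
  then have "\<exists>J. elem a b (K n) J" for n using el[of "Suc n" n] by simp
  then obtain J where J: "\<And>n. elem a b (K n) (J n)" by metis
  have B0: "0 \<le> B"
  proof -
    have "\<Omega> \<noteq> {}" using C.not_empty by simp
    then obtain \<omega> where "\<omega> \<in> \<Omega>" by auto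
    from B[OF order_refl ab this] show ?thesis using norm_ge_zero order_trans by blast
  qed
  have P: "progressive a b G" by (rule progressive_continuous[OF ra(1) ab cont ad])
  have PK: "progressive a b (K n)" for n by (rule elem_props(2)[OF J ra(1)])
  have cG: "scaled_bound (K\<sigma> * B) a b G" by (rule scaled_bound_norm[OF ra(1) B B0]) auto
  have cK: "scaled_bound (K\<sigma> * B) a b (K n)" for n
  proof (rule scaled_bound_norm[OF ra(1) _ B0])
    fix \<omega> u assume "\<omega> \<in> \<Omega>" "a < u" "u \<le> b"
    then show "norm (K n u \<omega>) \<le> B" unfolding K_def using \<rho>(1)[of u n] \<rho>(2)[of n u] \<rho>a[of u n] by (intro B) auto
  qed
  have "(\<lambda>k. msq a b (\<lambda>u \<omega>. K k u \<omega> - G u \<omega>)) \<longlonglongrightarrow> 0"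
  proof (rule msq_dominated_convergence[OF ra(1) ab])
    show "progressive a b (\<lambda>u \<omega>. K k u \<omega> - G u \<omega>)" for k by (rule progressive_diff[OF PK P])
    show "scaled_bound (K\<sigma> * B + K\<sigma> * B) a b (\<lambda>u \<omega>. K k u \<omega> - G u \<omega>)" for k by (rule scaled_bound_diff[OF cK cG])
    fix u \<omega> assume u: "a < u" "u \<le> b" "\<omega> \<in> \<Omega>"
    have "(\<lambda>n. \<delta> n) \<longlonglongrightarrow> 0" unfolding \<delta>_def by real_asymp
    then have l: "(\<lambda>n. u - \<delta> n) \<longlonglongrightarrow> u - 0" by (intro tendsto_diff tendsto_const)
    have "(\<lambda>n. \<rho> n u) \<longlonglongrightarrow> u"
      by (rule tendsto_sandwich[OF _ _ l[simplified] tendsto_const]) (auto simp: \<rho>)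
    moreover have "\<rho> n u \<in> {a..b}" for n using \<rho>(1)[of u n] \<rho>(2)[of n u] \<rho>a[of u n] u by auto
    ultimately have "(\<lambda>n. G (\<rho> n u) \<omega>) \<longlonglongrightarrow> G u \<omega>"
      using cont[OF u(3)] u by (intro continuous_on_tendsto_compose[OF cont[OF u(3)]]) auto
    then have "(\<lambda>n. K n u \<omega> - G u \<omega>) \<longlonglongrightarrow> 0" unfolding K_def by (simp add: LIM_zero_iff)
    from tendsto_vector_matrix_mult[OF this, of "\<sigma> u (\<omega> u)"]
    show "(\<lambda>k. (K k u \<omega> - G u \<omega>) v* \<sigma> u (\<omega> u)) \<longlonglongrightarrow> 0" by simp
  qed
  from good_limit[OF ra(1) ab good_elem[OF J ra(1)] P cK cG this] show ?thesis .
qed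

text \<open>The integrand itself need not be bounded, only its product with \<open>\<sigma>\<close>: truncate it.\<close>

lemma good_continuous:
  assumes ra: "r \<le> a" "a < b"
    and cont: "\<And>\<omega>. \<omega> \<in> \<Omega> \<Longrightarrow> continuous_on {a..b} (\<lambda>u. G u \<omega>)"
    and ad: "\<And>u. a \<le> u \<Longrightarrow> u \<le> b \<Longrightarrow> G u \<in> borel_measurable (F u)"
    and c: "scaled_bound c a b G"
  shows "\<exists>I. good a b G I"
proof -
  have ab: "a \<le> b" using ra by simp
  \<comment> \<open>Radial truncation at norm n + 1. It is continuous, it never lengthens a vector,
    so the bound on the product with \<sigma> survives, and at each point it is the identity for
    large n.\<close>
  define \<kappa> where "\<kappa> n v = real (Suc n) / max (real (Suc n)) (norm v)" for n and v :: "real ^ 'n"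
  define H where "H n u \<omega> = \<kappa> n (G u \<omega>) *\<^sub>R G u \<omega>" for n u \<omega>
  have m: "0 < max (real (Suc n)) (norm v)" for n and v :: "real ^ 'n" by (simp add: less_max_iff_disj)
  have \<kappa>: "0 \<le> \<kappa> n v" "\<kappa> n v \<le> 1" "\<kappa> n v * norm v \<le> real (Suc n)" for n v
  proof -
    have "real (Suc n) * norm v \<le> real (Suc n) * max (real (Suc n)) (norm v)" by (intro mult_left_mono) auto
    then show "\<kappa> n v * norm v \<le> real (Suc n)" unfolding \<kappa>_def using m[of n v] by (simp add: pos_divide_le_eq)
    show "0 \<le> \<kappa> n v" "\<kappa> n v \<le> 1" unfolding \<kappa>_def using m[of n v] by simp_all
  qed
  have \<kappa>_cont: "continuous_on UNIV (\<lambda>v. \<kappa> n v *\<^sub>R v)" for n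
    unfolding \<kappa>_def using m[of n] by (intro continuous_intros) (auto simp: less_imp_neq[symmetric] max_def)
  have HcF: "continuous_on {a..b} (\<lambda>u. H n u \<omega>)" if "\<omega> \<in> \<Omega>" for n \<omega>
    unfolding H_def by (rule continuous_on_compose2[OF \<kappa>_cont cont[OF that]]) auto
  have Had: "H n u \<in> borel_measurable (F u)" if "a \<le> u" "u \<le> b" for n u
    unfolding H_def[abs_def] using borel_measurable_continuous_onI[OF \<kappa>_cont[of n]]
    by (rule measurable_compose[OF ad[OF that]])
  have "norm (H n u \<omega>) \<le> real (Suc n)" for n u \<omega> unfolding H_def using \<kappa>[of n "G u \<omega>"] by simp
  then have "\<exists>I. good a b (H n) I" for n
    by (intro good_bounded_continuous[OF ra HcF Had]) auto
  then obtain I where I: "\<And>n. good a b (H n) (I n)" by metis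
  have P: "progressive a b G" by (rule progressive_continuous[OF ra(1) ab cont ad])
  have PH: "progressive a b (H n)" for n using I[of n] by (simp add: good_def)
  have cH: "scaled_bound c a b (H n)" for n
    unfolding scaled_bound_def
  proof (intro conjI ballI allI impI)
    fix \<omega> u assume "\<omega> \<in> \<Omega>" "a < u \<and> u \<le> b"
    then have "norm (G u \<omega> v* \<sigma> u (\<omega> u)) \<le> c" using c by (simp add: scaled_bound_def)
    moreover have "\<kappa> n (G u \<omega>) * norm (G u \<omega> v* \<sigma> u (\<omega> u)) \<le> 1 * norm (G u \<omega> v* \<sigma> u (\<omega> u))"
      by (intro mult_right_mono \<kappa>) auto
    ultimately show "norm (H n u \<omega> v* \<sigma> u (\<omega> u)) \<le> c"
      unfolding H_def scaleR_vector_matrix_assoc using \<kappa>(1)[of n "G u \<omega>"] by simp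
  qed (use c in \<open>simp add: scaled_bound_def\<close>)
  have "(\<lambda>k. msq a b (\<lambda>u \<omega>. H k u \<omega> - G u \<omega>)) \<longlonglongrightarrow> 0"
  proof (rule msq_dominated_convergence[OF ra(1) ab])
    show "progressive a b (\<lambda>u \<omega>. H k u \<omega> - G u \<omega>)" for k by (rule progressive_diff[OF PH P])
    show "scaled_bound (c + c) a b (\<lambda>u \<omega>. H k u \<omega> - G u \<omega>)" for k by (rule scaled_bound_diff[OF cH c])
    fix u \<omega> assume u: "a < u" "u \<le> b" "\<omega> \<in> \<Omega>"
    obtain N where N: "norm (G u \<omega>) \<le> real N" using real_arch_simple by blast
    have "eventually (\<lambda>n. (H n u \<omega> - G u \<omega>) v* \<sigma> u (\<omega> u) = 0) sequentially"
      using eventually_ge_at_top[of N]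
    proof eventually_elim
      fix n assume "N \<le> n"
      then have "norm (G u \<omega>) \<le> real (Suc n)" using N by linarith
      then have "\<kappa> n (G u \<omega>) = 1" unfolding \<kappa>_def by (simp add: max_def)
      then show "(H n u \<omega> - G u \<omega>) v* \<sigma> u (\<omega> u) = 0" by (simp add: H_def)
    qed
    then show "(\<lambda>k. (H k u \<omega> - G u \<omega>) v* \<sigma> u (\<omega> u)) \<longlonglongrightarrow> 0" by (rule tendsto_eventually)
  qed
  from good_limit[OF ra(1) ab I P cH c this] show ?thesis .
qed

end

section \<open>Inverses of continuous matrix functions\<close>

lemma continuous_on_det:
  fixes A :: "'a::topological_space \<Rightarrow> real ^ 'n ^ 'n"
  assumes "\<And>i j. continuous_on X (\<lambda>x. A x $ i $ j)"
  shows "continuous_on X (\<lambda>x. det (A x))"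
  unfolding det_def by (intro continuous_on_sum continuous_on_mult continuous_on_prod continuous_on_const assms)

lemma matrix_inv_invertible:
  fixes A :: "real ^ 'n ^ 'n"
  assumes "invertible A"
  shows "A ** matrix_inv A = mat 1" "matrix_inv A ** A = mat 1"
proof -
  have "A ** matrix_inv A = mat 1 \<and> matrix_inv A ** A = mat 1"
    unfolding matrix_inv_def using assms unfolding invertible_def by (rule someI_ex)
  then show "A ** matrix_inv A = mat 1" "matrix_inv A ** A = mat 1" by auto
qed

text \<open>Cramer's rule writes the coordinates as quotients of determinants, from which continuity
  in A and w can be read off; the choice inside \<open>matrix_inv\<close> hides it.\<close>

lemma vector_matrix_inv:
  fixes A :: "real ^ 'n ^ 'n"
  assumes "invertible A"
  shows "w v* matrix_inv A = (\<chi> k. det (\<chi> i j. if j = k then w $ i else A $ j $ i) / det A)"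
proof -
  have "transpose A *v (w v* matrix_inv A) = w"
    by (simp add: vector_matrix_mul_assoc matrix_inv_invertible[OF assms])
  moreover have "det (transpose A) \<noteq> 0" using assms by (simp add: det_transpose invertible_det_nz)
  ultimately show ?thesis
    using cramer[of "transpose A" "w v* matrix_inv A" w] by (simp add: det_transpose) (simp add: transpose_def cong: if_cong)
qed

lemma continuous_on_vector_matrix_inv:
  fixes A :: "'a::topological_space \<Rightarrow> real ^ 'n ^ 'n" and w :: "'a \<Rightarrow> real ^ 'n"
  assumes A: "continuous_on X A" and w: "continuous_on X w" and inv: "\<And>x. x \<in> X \<Longrightarrow> invertible (A x)"
  shows "continuous_on X (\<lambda>x. w x v* matrix_inv (A x))"
proof -
  have "continuous_on X (\<lambda>x. \<chi> k. det (\<chi> i j. if j = k then w x $ i else A x $ j $ i) / det (A x))"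
  proof (intro continuous_on_vec_lambda continuous_on_divide continuous_on_det)
    show "continuous_on X (\<lambda>x. (\<chi> i j. if j = k then w x $ i else A x $ j $ i) $ i $ j)" for k i j
      using A w by (cases "j = k") (auto intro!: continuous_intros)
    show "continuous_on X (\<lambda>x. A x $ i $ j)" for i j using A by (intro continuous_intros)
    show "\<forall>x\<in>X. det (A x) \<noteq> 0" using inv by (simp add: invertible_det_nz)
  qed
  then show ?thesis using inv by (simp add: vector_matrix_inv cong: continuous_on_cong)
qed

context driftless_diffusion begin

text \<open>A nonzero vector in the kernel of the transpose of \<sigma> would have vanishing
  quadratic form, against ellipticity. The argument is pointwise and gives no bound on the
  inverse.\<close>

lemma invertible_\<sigma>: "0 \<le> u \<Longrightarrow> invertible (\<sigma> u x)"
proof -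
  assume u: "0 \<le> u"
  have "v = 0" if "transpose (\<sigma> u x) *v v = 0" for v
  proof (rule ccontr)
    assume "v \<noteq> 0"
    then have "0 < v \<bullet> (diffusion_matrix \<sigma> u x *v v)" using elliptic u by (simp add: strictly_elliptic_def)
    with that show False by (simp add: quadratic_form)
  qed
  then have "\<exists>B. B ** transpose (\<sigma> u x) = mat 1" by (simp only: matrix_left_invertible_ker) blast
  then have "invertible (transpose (\<sigma> u x))" by (simp add: invertible_left_inverse)
  then show ?thesis by (simp add: invertible_det_nz det_transpose)
qed

section \<open>Comparison with the Ito integral of the statement\<close>

lemma elementary_integrand_elem:
  assumes "elementary_integrand r T Q N t h"
  shows "elem r T (elementary_process N t h) (elementary_integral N t h)"
proof -
  have t: "t 0 = r" "t N = T" "\<And>i. i < N \<Longrightarrow> t i < t (Suc i)"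
    "\<And>i. i < N \<Longrightarrow> h i \<in> borel_measurable (F (t i))" "\<And>i. i < N \<Longrightarrow> bounded (h i ` \<Omega>)"
    using assms by (auto simp: elementary_integrand_def)
  have mono: "t i \<le> t j" if "i \<le> j" "j \<le> N" for i j
    using that
  proof (induction rule: dec_induct)
    case (step n)
    then show ?case using t(3)[of n] by simp
  qed simp
  \<comment> \<open>The process keeps all N terms while the integral grows one term at a time: on a
    given cell of the subdivision only one indicator is nonzero.\<close>
  have "elem r (t n) (elementary_process N t h) (elementary_integral n t h)" if "n \<le> N" for n
    using that
  proof (induction n)
    case 0 show ?case using elementary.Nil[of r "elementary_process N t h"] by (simp add: t elementary_integral_def[abs_def])
  next
    case (Suc n)
    have "elem r (t (Suc n)) (elementary_process N t h) (\<lambda>\<omega>. elementary_integral n t h \<omega> + h n \<omega> \<bullet> (\<omega> (t (Suc n)) - \<omega> (t n)))"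
    proof (rule elementary.Step)
      show "elem r (t n) (elementary_process N t h) (elementary_integral n t h)" using Suc by simp
      show "t n < t (Suc n)" "h n \<in> borel_measurable (F (t n))" "bounded (h n ` \<Omega>)" using t Suc by auto
      show "elementary_process N t h u \<omega> = h n \<omega>" if u: "t n < u" "u \<le> t (Suc n)" for u \<omega>
      proof -
        have "(indicator {t i<..t (Suc i)} u :: real) = (if i = n then 1 else 0)" if "i < N" for i
        proof (cases i n rule: linorder_cases)
          case less
          then show ?thesis using mono[of "Suc i" n] u Suc by (auto simp: indicator_def)
        next
          case greater
          then show ?thesis using mono[of "Suc n" i] u that by (auto simp: indicator_def)
        qed (use u in \<open>simp add: indicator_def\<close>)
        then have "elementary_process N t h u \<omega> = (\<Sum>i<N. (if i = n then 1 else 0) *\<^sub>R h i \<omega>)"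
          unfolding elementary_process_def by (intro sum.cong) auto
        also have "\<dots> = (\<Sum>i<N. if i = n then h n \<omega> else 0)" by (intro sum.cong) auto
        also have "\<dots> = h n \<omega>" using Suc by simp
        finally show ?thesis .
      qed
    qed
    then show ?case by (simp add: elementary_integral_def[abs_def])
  qed
  from this[of N] show ?thesis using t by simp
qed

lemma elem_elementary_integrand:
  assumes "elem r b K J"
  shows "\<exists>N t h. elementary_integrand r b Q N t h \<and> J = elementary_integral N t h \<and>
    (\<forall>u \<omega>. r < u \<and> u \<le> b \<and> \<omega> \<in> \<Omega> \<longrightarrow> K u \<omega> = elementary_process N t h u \<omega>)"
  using assms
proof (induction rule: elementary.induct)
  case Nil
  show ?case
    by (intro exI[of _ 0] exI[of _ "\<lambda>_. r"] exI[of _ "\<lambda>_ _. 0"])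
      (auto simp: elementary_integrand_def elementary_integral_def[abs_def])
next
  case (Step b J c k)
  then obtain N t h where IH: "elementary_integrand r b Q N t h" "J = elementary_integral N t h"
    "\<And>u \<omega>. r < u \<Longrightarrow> u \<le> b \<Longrightarrow> \<omega> \<in> \<Omega> \<Longrightarrow> K u \<omega> = elementary_process N t h u \<omega>" by blast
  have t: "t 0 = r" "t N = b" "\<And>i. i < N \<Longrightarrow> t i < t (Suc i)"
    using IH(1) by (auto simp: elementary_integrand_def)
  have mono: "t i \<le> b" if "i \<le> N" for i
    using that
  proof (induction rule: inc_induct)
    case base then show ?case using t by simp
  next
    case (step n)
    then show ?case using t(3)[of n] by simp
  qed
  define t' where "t' = t(Suc N := c)"
  define h' where "h' = h(N := k)"
  have "elementary_integrand r c Q (Suc N) t' h'"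
    using IH(1) Step(2-4) t unfolding elementary_integrand_def t'_def h'_def by (auto simp: less_Suc_eq)
  moreover have "(\<lambda>\<omega>. J \<omega> + k \<omega> \<bullet> (\<omega> c - \<omega> b)) = elementary_integral (Suc N) t' h'"
    unfolding IH(2) elementary_integral_def[abs_def] using t by (auto simp: t'_def h'_def)
  moreover have "K u \<omega> = elementary_process (Suc N) t' h' u \<omega>" if u: "r < u" "u \<le> c" "\<omega> \<in> \<Omega>" for u \<omega>
  proof -
    have eq: "elementary_process (Suc N) t' h' u \<omega> = elementary_process N t h u \<omega> + indicator {b<..c} u *\<^sub>R k \<omega>"
      unfolding elementary_process_def using t by (auto simp: t'_def h'_def)
    show ?thesis
    proof (cases "u \<le> b")
      case True then show ?thesis using IH(3) u unfolding eq by simp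
    next
      case False
      then have "elementary_process N t h u \<omega> = 0"
        unfolding elementary_process_def
      proof (intro sum.neutral ballI)
        fix i assume "i \<in> {..<N}"
        then have "t (Suc i) \<le> b" by (intro mono) simp
        then show "indicator {t i<..t (Suc i)} u *\<^sub>R h i \<omega> = 0" using \<open>\<not> u \<le> b\<close> by (simp add: indicator_def)
      qed
      then show ?thesis using Step(5)[of u \<omega>] u False unfolding eq by simp
    qed
  qed
  ultimately show ?case by blast
qed

lemma ito_error:
  "(\<integral>\<^sup>+\<omega>. (\<integral>\<^sup>+u\<in>{r<..T}. (let d = H u \<omega> - K u \<omega> in ennreal (d \<bullet> (diffusion_matrix \<sigma> u (\<omega> u) *v d))) \<partial>lborel) \<partial>C)
   = msq r T (\<lambda>u \<omega>. H u \<omega> - K u \<omega>)"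
  unfolding msq_def Let_def quadratic_form
  by (intro nn_integral_cong) (auto simp: scaled_def split: split_indicator)

text \<open>Existence and uniqueness thereby become available for the predicate under the
  \<open>SOME\<close> of \<open>ito_integral\<close>. Sequences arise from the tolerances 1 / (k +
  1), and \<open>elem_elementary_integrand\<close> makes the subdivisions explicit.\<close>

lemma is_ito_integral_iff: "is_ito_integral \<sigma> r T Q H I \<longleftrightarrow> is_ito r T H I"
proof
  assume A: "is_ito_integral \<sigma> r T Q H I"
  then obtain N t h where el: "\<And>k. elementary_integrand r T Q (N k) (t k) (h k)"
    and l: "(\<lambda>k. msq r T (\<lambda>u \<omega>. H u \<omega> - elementary_process (N k) (t k) (h k) u \<omega>)) \<longlonglongrightarrow> 0"
      "(\<lambda>k. \<integral>\<^sup>+\<omega>. ennreal ((I \<omega> - elementary_integral (N k) (t k) (h k) \<omega>)\<^sup>2) \<partial>C) \<longlonglongrightarrow> 0"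
    unfolding is_ito_integral_def ito_error by blast
  show "is_ito r T H I"
    unfolding is_ito_def
  proof (intro conjI allI impI)
    show "I \<in> borel_measurable (F T)" using A by (simp add: is_ito_integral_def)
    fix e :: real assume "0 < e"
    then have e: "0 < ennreal e" by simp
    from eventually_happens'[OF sequentially_bot eventually_conj[OF order_tendstoD(2)[OF l(1) e] order_tendstoD(2)[OF l(2) e]]]
    obtain k where "msq r T (\<lambda>u \<omega>. H u \<omega> - elementary_process (N k) (t k) (h k) u \<omega>) < ennreal e"
      "(\<integral>\<^sup>+\<omega>. ennreal ((I \<omega> - elementary_integral (N k) (t k) (h k) \<omega>)\<^sup>2) \<partial>C) < ennreal e" by blast
    with elementary_integrand_elem[OF el[of k]]
    show "\<exists>K J. elem r T K J \<and> msq r T (\<lambda>u \<omega>. H u \<omega> - K u \<omega>) < ennreal e \<and> (\<integral>\<^sup>+\<omega>. ennreal ((I \<omega> - J \<omega>)\<^sup>2) \<partial>C) < ennreal e"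
      by blast
  qed
next
  assume A: "is_ito r T H I"
  define R where "R k N t h \<longleftrightarrow> elementary_integrand r T Q N t h \<and>
      msq r T (\<lambda>u \<omega>. H u \<omega> - elementary_process N t h u \<omega>) < ennreal (1 / real (Suc k)) \<and>
      (\<integral>\<^sup>+\<omega>. ennreal ((I \<omega> - elementary_integral N t h \<omega>)\<^sup>2) \<partial>C) < ennreal (1 / real (Suc k))" for k N t h
  have R: "\<exists>N t h. R k N t h" for k
  proof -
    have "0 < 1 / real (Suc k)" by simp
    with A obtain K J where K: "elem r T K J" "msq r T (\<lambda>u \<omega>. H u \<omega> - K u \<omega>) < ennreal (1 / real (Suc k))"
      "(\<integral>\<^sup>+\<omega>. ennreal ((I \<omega> - J \<omega>)\<^sup>2) \<partial>C) < ennreal (1 / real (Suc k))"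
      unfolding is_ito_def by blast
    from elem_elementary_integrand[OF K(1)] obtain N t h where
      e: "elementary_integrand r T Q N t h" "J = elementary_integral N t h"
      "\<And>u \<omega>. r < u \<Longrightarrow> u \<le> T \<Longrightarrow> \<omega> \<in> \<Omega> \<Longrightarrow> K u \<omega> = elementary_process N t h u \<omega>" by blast
    have "msq r T (\<lambda>u \<omega>. H u \<omega> - K u \<omega>) = msq r T (\<lambda>u \<omega>. H u \<omega> - elementary_process N t h u \<omega>)"
      by (rule msq_cong) (simp add: e(3))
    with K(2,3) e(1,2) have "R k N t h" unfolding R_def by (simp only: simp_thms)
    then show ?thesis by blast
  qed
  from choice[OF allI, OF R] obtain N where "\<forall>k. \<exists>t h. R k (N k) t h" ..
  from choice[OF this] obtain t where "\<forall>k. \<exists>h. R k (N k) (t k) h" ..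
  from choice[OF this] obtain h where R': "\<forall>k. R k (N k) (t k) (h k)" ..
  have e: "elementary_integrand r T Q (N k) (t k) (h k)"
    "msq r T (\<lambda>u \<omega>. H u \<omega> - elementary_process (N k) (t k) (h k) u \<omega>) < ennreal (1 / real (Suc k))"
    "(\<integral>\<^sup>+\<omega>. ennreal ((I \<omega> - elementary_integral (N k) (t k) (h k) \<omega>)\<^sup>2) \<partial>C) < ennreal (1 / real (Suc k))" for k
    using R'[rule_format, of k] by (simp_all only: R_def)
  have "(\<lambda>k. 1 / real (Suc k)) \<longlonglongrightarrow> 0" by real_asymp
  from tendsto_ennrealI[OF this] have l: "(\<lambda>k. ennreal (1 / real (Suc k))) \<longlonglongrightarrow> 0" by simp
  have "(\<lambda>k. msq r T (\<lambda>u \<omega>. H u \<omega> - elementary_process (N k) (t k) (h k) u \<omega>)) \<longlonglongrightarrow> 0"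
    by (rule tendsto_sandwich[OF _ _ tendsto_const l]) (use less_imp_le[OF e(2)] in auto)
  moreover have "(\<lambda>k. \<integral>\<^sup>+\<omega>. ennreal ((I \<omega> - elementary_integral (N k) (t k) (h k) \<omega>)\<^sup>2) \<partial>C) \<longlonglongrightarrow> 0"
    by (rule tendsto_sandwich[OF _ _ tendsto_const l]) (use less_imp_le[OF e(3)] in auto)
  ultimately show "is_ito_integral \<sigma> r T Q H I"
    unfolding is_ito_integral_def ito_error using A e(1) by (auto simp: is_ito_def)
qed

end

section \<open>Controls\<close>

locale control_problem = driftless_diffusion \<sigma> r y Q
  for \<sigma> :: "real \<Rightarrow> real ^ 'n \<Rightarrow> real ^ 'n ^ ('n::finite)" and r y Q +
  fixes \<Lambda> :: "real \<Rightarrow> real ^ 'n \<Rightarrow> (real ^ 'n) set" and g :: "real \<Rightarrow> real ^ 'n \<Rightarrow> real ^ 'n \<Rightarrow> ereal" and T :: real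
  assumes zero_\<Lambda>: "0 \<le> u \<Longrightarrow> 0 \<in> \<Lambda> u x"
    and g_measurable: "(\<lambda>(u, x, l). g u x l) \<in> borel_measurable (restrict_space borel ({0..} \<times> UNIV))"
    and g_not_MInf: "0 \<le> u \<Longrightarrow> g u x l \<noteq> - \<infinity>"
    and g_growth: "polynomial_growth_on \<Lambda> g"
    and g_zero: "\<exists>c::real. \<forall>u\<ge>0. \<forall>x. g u x 0 \<le> ereal c"
    and rT: "r \<le> T"
begin

abbreviation controls :: "(real \<Rightarrow> 'n path \<Rightarrow> real ^ 'n) set" where "controls \<equiv> simple_controls \<Lambda> r T Q"

definition feedbacks :: "(real \<Rightarrow> real ^ 'n \<Rightarrow> real ^ 'n) set" where
  "feedbacks = {l \<in> selections \<Lambda>. continuous_on ({0..} \<times> UNIV) (\<lambda>(t, x). l t x)}"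

text \<open>The finite partition of the definition is encoded by a choice c of one feedback for each
  path, whose levels are known at time a. Index sets disappear, and pieces carrying the same
  feedback are merged.\<close>

definition simple_on :: "real \<Rightarrow> real \<Rightarrow> (real \<Rightarrow> 'n path \<Rightarrow> real ^ 'n) \<Rightarrow> bool" where
  "simple_on a b \<mu> \<longleftrightarrow> (\<exists>L c. finite L \<and> L \<subseteq> feedbacks \<and> c ` \<Omega> \<subseteq> L \<and>
     (\<forall>l\<in>L. {\<omega> \<in> \<Omega>. c \<omega> = l} \<in> sets (F a)) \<and>
     (\<forall>u \<omega>. a < u \<and> u \<le> b \<and> \<omega> \<in> \<Omega> \<longrightarrow> \<mu> u \<omega> = c \<omega> u (\<omega> u)))"

text \<open>P contains the times at which a new decision may be taken; extra points are harmless.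
  Several controls are therefore handled with the union of their sets, in place of a common
  refinement of subdivisions.\<close>

definition simple_off :: "real set \<Rightarrow> (real \<Rightarrow> 'n path \<Rightarrow> real ^ 'n) \<Rightarrow> bool" where
  "simple_off P \<mu> \<longleftrightarrow> finite P \<and> (\<forall>a b. r \<le> a \<and> a < b \<and> b \<le> T \<and> {a<..<b} \<inter> P = {} \<longrightarrow> simple_on a b \<mu>)"

lemma simple_on_mono: "simple_on a b \<mu> \<Longrightarrow> a \<le> a' \<Longrightarrow> b' \<le> b \<Longrightarrow> simple_on a' b' \<mu>"
proof -
  assume s: "simple_on a b \<mu>" and le: "a \<le> a'" "b' \<le> b"
  from s obtain L c where "finite L" "L \<subseteq> feedbacks" "c ` \<Omega> \<subseteq> L" "\<forall>l\<in>L. {\<omega> \<in> \<Omega>. c \<omega> = l} \<in> sets (F a)"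
    "\<forall>u \<omega>. a < u \<and> u \<le> b \<and> \<omega> \<in> \<Omega> \<longrightarrow> \<mu> u \<omega> = c \<omega> u (\<omega> u)" unfolding simple_on_def by blast
  then show "simple_on a' b' \<mu>"
    unfolding simple_on_def using sets_F_mono[OF le(1)] le by (intro exI[of _ L] exI[of _ c]) auto
qed

lemma simple_controls_simple_off:
  assumes "\<mu> \<in> controls"
  shows "\<exists>P. simple_off P \<mu>"
proof -
  define R where "R N s J A lam \<longleftrightarrow> s 0 = r \<and> s N = T \<and> (\<forall>i<N. s i < s (Suc i)) \<and>
     (\<forall>i<N. finite (J i) \<and> disjoint_family_on (A i) (J i) \<and> (\<Union>j\<in>J i. A i j) = \<Omega> \<and>
        (\<forall>j\<in>J i. A i j \<in> sets (F (s i)) \<and> lam i j \<in> selections \<Lambda> \<and>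
           continuous_on ({0..} \<times> UNIV) (\<lambda>(t, x). lam i j t x)) \<and>
        (\<forall>u \<omega>. s i < u \<and> u \<le> s (Suc i) \<and> \<omega> \<in> \<Omega> \<longrightarrow>
           \<mu> u \<omega> = (\<Sum>j\<in>J i. indicator (A i j) \<omega> *\<^sub>R lam i j u (\<omega> u))))"
    for N :: nat and s :: "nat \<Rightarrow> real" and J :: "nat \<Rightarrow> nat set" and A lam
  have "\<exists>N s J A lam. R N s J A lam"
    using assms unfolding simple_controls_def mem_Collect_eq R_def .
  then obtain N s J A lam where "R N s J A lam" by blast
  note R = this[unfolded R_def]
  note s = R[THEN conjunct1] R[THEN conjunct2, THEN conjunct1] R[THEN conjunct2, THEN conjunct2, THEN conjunct1, rule_format]
  note all' = R[THEN conjunct2, THEN conjunct2, THEN conjunct2, rule_format]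
  have J: "finite (J i)" "disjoint_family_on (A i) (J i)" "(\<Union>j\<in>J i. A i j) = \<Omega>" if "i < N" for i
    using all'[OF that] by simp_all
  have J4: "A i j \<in> sets (F (s i))" and lam: "lam i j \<in> feedbacks" if "i < N" "j \<in> J i" for i j
    using all'[OF that(1)] that(2) by (simp_all add: feedbacks_def)
  have eq: "\<mu> u \<omega> = (\<Sum>j\<in>J i. indicator (A i j) \<omega> *\<^sub>R lam i j u (\<omega> u))"
    if "i < N" "s i < u" "u \<le> s (Suc i)" "\<omega> \<in> \<Omega>" for i u \<omega>
    using all'[OF that(1)] that(2-4) by simp
  have piece: "simple_on (s i) (s (Suc i)) \<mu>" if i: "i < N" for i
  proof -
    define c where "c \<omega> = lam i (THE j. j \<in> J i \<and> \<omega> \<in> A i j)" for \<omega>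
    have cj: "c \<omega> = lam i j" if "j \<in> J i" "\<omega> \<in> A i j" for j \<omega>
    proof -
      have "(THE j. j \<in> J i \<and> \<omega> \<in> A i j) = j"
        by (rule the_equality) (use that J(2)[OF i] in \<open>auto simp: disjoint_family_on_def\<close>)
      then show ?thesis by (simp add: c_def)
    qed
    have ex: "\<exists>j\<in>J i. \<omega> \<in> A i j" if "\<omega> \<in> \<Omega>" for \<omega> using J(3)[OF i] that by blast
    show ?thesis
      unfolding simple_on_def
    proof (intro exI conjI ballI allI impI)
      show "finite (lam i ` J i)" using J(1)[OF i] by simp
      show "lam i ` J i \<subseteq> feedbacks" using lam[OF i] by auto
      show "c ` \<Omega> \<subseteq> lam i ` J i"
      proof safe
        fix \<omega> assume "\<omega> \<in> \<Omega>"
        from ex[OF this] obtain j where "j \<in> J i" "\<omega> \<in> A i j" by blast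
        then show "c \<omega> \<in> lam i ` J i" using cj by auto
      qed
      fix l assume "l \<in> lam i ` J i"
      have "{\<omega> \<in> \<Omega>. c \<omega> = l} = (\<Union>j\<in>{j\<in>J i. lam i j = l}. A i j)"
      proof (intro set_eqI iffI)
        fix \<omega> assume \<omega>: "\<omega> \<in> {\<omega> \<in> \<Omega>. c \<omega> = l}"
        then obtain j where "j \<in> J i" "\<omega> \<in> A i j" using ex by blast
        with \<omega> cj[OF this] show "\<omega> \<in> (\<Union>j\<in>{j\<in>J i. lam i j = l}. A i j)" by auto
      next
        fix \<omega> assume "\<omega> \<in> (\<Union>j\<in>{j\<in>J i. lam i j = l}. A i j)"
        then obtain j where j: "j \<in> J i" "lam i j = l" "\<omega> \<in> A i j" by blast
        then have "\<omega> \<in> \<Omega>" using J(3)[OF i] by blast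
        with cj[OF j(1,3)] j(2) show "\<omega> \<in> {\<omega> \<in> \<Omega>. c \<omega> = l}" by auto
      qed
      also have "\<dots> \<in> sets (F (s i))" using J(1)[OF i] J4[OF i] by (intro sets.finite_UN) auto
      finally show "{\<omega> \<in> \<Omega>. c \<omega> = l} \<in> sets (F (s i))" .
    next
      fix u \<omega> assume u: "s i < u \<and> u \<le> s (Suc i) \<and> \<omega> \<in> \<Omega>"
      then obtain j where j: "j \<in> J i" "\<omega> \<in> A i j" using ex by blast
      have "indicator (A i k) \<omega> *\<^sub>R lam i k u (\<omega> u) = (if k = j then lam i j u (\<omega> u) else 0)" if "k \<in> J i" for k
        using that j J(2)[OF i] by (auto simp: disjoint_family_on_def indicator_def)
      then have "\<mu> u \<omega> = (\<Sum>k\<in>J i. if k = j then lam i j u (\<omega> u) else 0)"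
        using eq[OF i] u by (auto intro!: sum.cong)
      then show "\<mu> u \<omega> = c \<omega> u (\<omega> u)" using J(1)[OF i] j cj[OF j] by simp
    qed
  qed
  have "simple_off (s ` {..N}) \<mu>"
    unfolding simple_off_def
  proof (intro conjI allI impI)
    fix a b assume ab: "r \<le> a \<and> a < b \<and> b \<le> T \<and> {a<..<b} \<inter> s ` {..N} = {}"
    \<comment> \<open>The cell of the subdivision that contains (a, b]: it begins at the last
      subdivision point not after a, and none lies strictly between a and b.\<close>
    define i where "i = Max {i. i \<le> N \<and> s i \<le> a}"
    have fin: "finite {i. i \<le> N \<and> s i \<le> a}" by simp
    have ne: "{i. i \<le> N \<and> s i \<le> a} \<noteq> {}" using ab s(1) by (auto intro!: exI[of _ 0])
    from Max_in[OF fin ne] have i: "i \<le> N" "s i \<le> a" unfolding i_def by auto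
    have "i \<noteq> N" using i ab s(2) by auto
    with i have iN: "i < N" by simp
    have "\<not> s (Suc i) \<le> a"
    proof
      assume "s (Suc i) \<le> a"
      then have "Suc i \<le> i" unfolding i_def using iN by (intro Max_ge[OF fin]) (auto simp: i_def)
      then show False by simp
    qed
    moreover have "s (Suc i) \<notin> {a<..<b}" using ab iN by auto
    ultimately have "b \<le> s (Suc i)" by auto
    with piece[OF iN] i(2) show "simple_on a b \<mu>" by (rule simple_on_mono)
  qed simp
  then show ?thesis by blast
qed

lemma simple_off_simple_controls:
  assumes P: "simple_off P \<mu>"
  shows "\<mu> \<in> controls"
proof -
  \<comment> \<open>The end points are added and everything outside [r, T] is dropped. For r = T a
    single point remains, and the subdivision is the empty one with N = 0.\<close>
  define X where "X = insert r (insert T (P \<inter> {r..T}))"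
  have X: "finite X" "X \<subseteq> {r..T}" "r \<in> X" "T \<in> X" using P rT by (auto simp: X_def simple_off_def)
  define xs where "xs = sorted_list_of_set X"
  have xs: "set xs = X" "sorted_wrt (<) xs" using X(1) by (auto simp: xs_def)
  define N where "N = length xs - 1"
  have ne: "xs \<noteq> []" using xs X by auto
  have len: "length xs = Suc N" using ne by (simp add: N_def)
  have lt: "xs ! i < xs ! j" if "i < j" "j \<le> N" for i j
    using sorted_wrt_nth_less[OF xs(2) that(1)] that len by simp
  have inX: "xs ! i \<in> X" if "i \<le> N" for i using nth_mem[of i xs] that len xs(1) by simp
  have idx: "\<exists>i\<le>N. xs ! i = x" if "x \<in> X" for x using that xs(1) len by (metis in_set_conv_nth less_Suc_eq_le)
  have s0: "xs ! 0 = r"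
  proof -
    obtain i where i: "i \<le> N" "xs ! i = r" using idx[OF X(3)] by blast
    have "i = 0" using lt[of 0 i] i inX[of 0] X(2) by (cases "i = 0") auto
    with i show ?thesis by simp
  qed
  have sN: "xs ! N = T"
  proof -
    obtain i where i: "i \<le> N" "xs ! i = T" using idx[OF X(4)] by blast
    have "i = N" using lt[of i N] i inX[of N] X(2) by (cases "i = N") auto
    with i show ?thesis by simp
  qed
  have piece: "\<exists>(J :: nat set) A lam. finite J \<and> disjoint_family_on A J \<and> (\<Union>j\<in>J. A j) = \<Omega> \<and>
      (\<forall>j\<in>J. A j \<in> sets (F (xs ! i)) \<and> lam j \<in> feedbacks) \<and>
      (\<forall>u \<omega>. xs ! i < u \<and> u \<le> xs ! Suc i \<and> \<omega> \<in> \<Omega> \<longrightarrow> \<mu> u \<omega> = (\<Sum>j\<in>J. indicator (A j) \<omega> *\<^sub>R lam j u (\<omega> u)))" if i: "i < N" for i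
  proof -
    have "{xs ! i <..< xs ! Suc i} \<inter> P = {}"
    proof (rule ccontr)
      assume "\<not> ?thesis"
      then obtain p where p: "xs ! i < p" "p < xs ! Suc i" "p \<in> P" by auto
      have "p \<in> X" using p inX[of i] inX[of "Suc i"] i X(2) by (auto simp: X_def)
      then obtain k where k: "k \<le> N" "xs ! k = p" using idx by blast
      have "\<not> k \<le> i" using lt[of k i] i k p by (cases "k = i") auto
      moreover have "\<not> Suc i \<le> k" using lt[of "Suc i" k] i k p by (cases "k = Suc i") auto
      ultimately show False by simp
    qed
    moreover have "r \<le> xs ! i" "xs ! Suc i \<le> T" "xs ! i < xs ! Suc i"
      using inX[of i] inX[of "Suc i"] i X(2) lt[of i "Suc i"] by auto
    ultimately have "simple_on (xs ! i) (xs ! Suc i) \<mu>" using P by (auto simp: simple_off_def)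
    then obtain L c where L: "finite L" "L \<subseteq> feedbacks" "c ` \<Omega> \<subseteq> L" "\<And>l. l \<in> L \<Longrightarrow> {\<omega> \<in> \<Omega>. c \<omega> = l} \<in> sets (F (xs ! i))"
      "\<And>u \<omega>. xs ! i < u \<Longrightarrow> u \<le> xs ! Suc i \<Longrightarrow> \<omega> \<in> \<Omega> \<Longrightarrow> \<mu> u \<omega> = c \<omega> u (\<omega> u)"
      unfolding simple_on_def by blast
    \<comment> \<open>\<open>simple_controls\<close> indexes its partition by natural numbers, so
      the feedbacks are numbered.\<close>
    obtain f where f: "bij_betw f {0..<card L} L" using ex_bij_betw_nat_finite[OF L(1)] by blast
    have inj: "inj_on f {0..<card L}" and im: "f ` {0..<card L} = L" using f by (auto simp: bij_betw_def)
    have sum: "\<mu> u \<omega> = (\<Sum>j\<in>{0..<card L}. indicator {\<omega> \<in> \<Omega>. c \<omega> = f j} \<omega> *\<^sub>R f j u (\<omega> u))"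
      if u: "xs ! i < u" "u \<le> xs ! Suc i" "\<omega> \<in> \<Omega>" for u \<omega>
    proof -
      have "(\<Sum>j\<in>{0..<card L}. indicator {\<omega> \<in> \<Omega>. c \<omega> = f j} \<omega> *\<^sub>R f j u (\<omega> u))
          = (\<Sum>l\<in>L. indicator {\<omega> \<in> \<Omega>. c \<omega> = l} \<omega> *\<^sub>R l u (\<omega> u))"
        by (rule sum.reindex_bij_betw[OF f])
      also have "\<dots> = (\<Sum>l\<in>L. if l = c \<omega> then c \<omega> u (\<omega> u) else 0)"
        using u(3) by (intro sum.cong) (auto simp: indicator_def)
      also have "\<dots> = c \<omega> u (\<omega> u)"
      proof -
        have "c \<omega> \<in> L" using L(3) u(3) by blast
        then show ?thesis using L(1) by simp
      qed
      also have "\<dots> = \<mu> u \<omega>" by (rule L(5)[OF u, symmetric])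
      finally show ?thesis by simp
    qed
    show ?thesis
    proof (intro exI conjI ballI allI impI)
      show "finite {0..<card L}" by simp
      show "disjoint_family_on (\<lambda>j. {\<omega> \<in> \<Omega>. c \<omega> = f j}) {0..<card L}"
        using inj by (auto simp: disjoint_family_on_def inj_on_def)
      show "(\<Union>j\<in>{0..<card L}. {\<omega> \<in> \<Omega>. c \<omega> = f j}) = \<Omega>"
      proof safe
        fix \<omega> assume \<omega>: "\<omega> \<in> \<Omega>"
        then have "c \<omega> \<in> f ` {0..<card L}" using L(3) im by auto
        then show "\<omega> \<in> (\<Union>j\<in>{0..<card L}. {\<omega> \<in> \<Omega>. c \<omega> = f j})" using \<omega> by auto
      qed
      fix j assume "j \<in> {0..<card L}"
      then have "f j \<in> L" using im by auto
      then show "{\<omega> \<in> \<Omega>. c \<omega> = f j} \<in> sets (F (xs ! i))" "f j \<in> feedbacks" using L by auto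
    next
      fix u \<omega> assume "xs ! i < u \<and> u \<le> xs ! Suc i \<and> \<omega> \<in> \<Omega>"
      then show "\<mu> u \<omega> = (\<Sum>j\<in>{0..<card L}. indicator {\<omega> \<in> \<Omega>. c \<omega> = f j} \<omega> *\<^sub>R f j u (\<omega> u))"
        by (intro sum) simp_all
    qed
  qed
  define R where "R i J A lam \<longleftrightarrow> finite J \<and> disjoint_family_on A J \<and> (\<Union>j\<in>J. A j) = \<Omega> \<and>
      (\<forall>j\<in>J. A j \<in> sets (F (xs ! i)) \<and> lam j \<in> feedbacks) \<and>
      (\<forall>u \<omega>. xs ! i < u \<and> u \<le> xs ! Suc i \<and> \<omega> \<in> \<Omega> \<longrightarrow> \<mu> u \<omega> = (\<Sum>j\<in>J. indicator (A j) \<omega> *\<^sub>R lam j u (\<omega> u)))"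
    for i and J :: "nat set" and A lam
  have "\<exists>J A lam. i < N \<longrightarrow> R i J A lam" for i
    using piece[of i] unfolding R_def[symmetric] by blast
  from choice[OF allI, OF this] obtain J where "\<forall>i. \<exists>A lam. i < N \<longrightarrow> R i (J i) A lam" ..
  from choice[OF this] obtain A where "\<forall>i. \<exists>lam. i < N \<longrightarrow> R i (J i) (A i) lam" ..
  from choice[OF this] obtain lam where R: "\<forall>i. i < N \<longrightarrow> R i (J i) (A i) (lam i)" ..
  show ?thesis
    unfolding simple_controls_def mem_Collect_eq
  proof (intro exI[of _ N] exI[of _ "\<lambda>i. xs ! i"] exI[of _ J] exI[of _ A] exI[of _ lam] conjI)
    show "\<forall>i<N. xs ! i < xs ! Suc i" using lt by simp
    show "\<forall>i<N. finite (J i) \<and> disjoint_family_on (A i) (J i) \<and> (\<Union>j\<in>J i. A i j) = \<Omega> \<and>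
        (\<forall>j\<in>J i. A i j \<in> sets (F (xs ! i)) \<and> lam i j \<in> selections \<Lambda> \<and>
           continuous_on ({0..} \<times> UNIV) (\<lambda>(t, x). lam i j t x)) \<and>
        (\<forall>u \<omega>. xs ! i < u \<and> u \<le> xs ! Suc i \<and> \<omega> \<in> \<Omega> \<longrightarrow>
           \<mu> u \<omega> = (\<Sum>j\<in>J i. indicator (A i j) \<omega> *\<^sub>R lam i j u (\<omega> u)))"
    proof (intro allI impI)
      fix i assume "i < N"
      with R have "R i (J i) (A i) (lam i)" by blast
      then show "finite (J i) \<and> disjoint_family_on (A i) (J i) \<and> (\<Union>j\<in>J i. A i j) = \<Omega> \<and>
        (\<forall>j\<in>J i. A i j \<in> sets (F (xs ! i)) \<and> lam i j \<in> selections \<Lambda> \<and>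
           continuous_on ({0..} \<times> UNIV) (\<lambda>(t, x). lam i j t x)) \<and>
        (\<forall>u \<omega>. xs ! i < u \<and> u \<le> xs ! Suc i \<and> \<omega> \<in> \<Omega> \<longrightarrow>
           \<mu> u \<omega> = (\<Sum>j\<in>J i. indicator (A i j) \<omega> *\<^sub>R lam i j u (\<omega> u)))"
        unfolding R_def feedbacks_def mem_Collect_eq .
    qed
  qed (rule s0, rule sN)
qed

end

context control_problem begin

section \<open>Girsanov densities of controls\<close>

definition integrand :: "(real \<Rightarrow> 'n path \<Rightarrow> real ^ 'n) \<Rightarrow> real \<Rightarrow> 'n path \<Rightarrow> real ^ 'n" where
  "integrand \<mu> = (\<lambda>u \<omega>. \<mu> u \<omega> v* matrix_inv (\<sigma> u (\<omega> u)))"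

text \<open>Multiplication by \<sigma> undoes the inverse: the integrand may be large, but its
  \<open>scaled\<close> version is \<mu>, so its quadratic variation is the time integral of the
  squared norm of the control.\<close>

lemma integrand_\<sigma>: "0 \<le> u \<Longrightarrow> integrand \<mu> u \<omega> v* \<sigma> u (\<omega> u) = \<mu> u \<omega>"
  by (simp add: integrand_def vector_matrix_mul_assoc matrix_inv_invertible[OF invertible_\<sigma>])

lemma feedback_bounded:
  assumes "finite L" "L \<subseteq> feedbacks"
  shows "\<exists>M\<ge>0. \<forall>l\<in>L. \<forall>u\<ge>0. \<forall>x. norm (l u x) \<le> M"
  using assms
proof (induction L)
  case empty show ?case by (intro exI[of _ 0]) simp
next
  case (insert l L)
  then obtain M where M: "M \<ge> 0" "\<forall>l\<in>L. \<forall>u\<ge>0. \<forall>x. norm (l u x) \<le> M" by auto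
  have "bounded ((\<lambda>(t, x). l t x) ` ({0..} \<times> UNIV))" using insert by (auto simp: feedbacks_def selections_def)
  then obtain M' where M': "\<forall>z\<in>(\<lambda>(t, x). l t x) ` ({0..} \<times> UNIV). norm z \<le> M'" unfolding bounded_iff by blast
  have "norm (l u x) \<le> M'" if "0 \<le> u" for u x using M' that by auto
  with M show ?case by (intro exI[of _ "max M M'"]) (auto simp: le_max_iff_disj)
qed

text \<open>The feedback in force is already chosen at time a, so along a fixed path the integrand
  is continuous in time, and its product with \<sigma> is a value of one of finitely many bounded
  feedbacks. This is the situation of \<open>good_continuous\<close>.\<close>

lemma simple_on_good:
  assumes ra: "r \<le> a" "a < b" and s: "simple_on a b \<mu>"
  shows "\<exists>I. good a b (integrand \<mu>) I"
proof -
  obtain L c where L: "finite L" "L \<subseteq> feedbacks" "c ` \<Omega> \<subseteq> L" "\<forall>l\<in>L. {\<omega> \<in> \<Omega>. c \<omega> = l} \<in> sets (F a)"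
    and eq: "\<forall>u \<omega>. a < u \<and> u \<le> b \<and> \<omega> \<in> \<Omega> \<longrightarrow> \<mu> u \<omega> = c \<omega> u (\<omega> u)"
    using s unfolding simple_on_def by blast
  have a0: "0 \<le> a" using ra r_nonneg by simp
  obtain M where M: "0 \<le> M" "\<forall>l\<in>L. \<forall>u\<ge>0. \<forall>x. norm (l u x) \<le> M" using feedback_bounded[OF L(1,2)] by blast
  have cL: "c \<omega> \<in> L" if "\<omega> \<in> \<Omega>" for \<omega> using L(3) that by blast
  have fc: "continuous_on ({0..} \<times> UNIV) (\<lambda>(t, x). l t x)" if "l \<in> L" for l
    using L(2) that by (auto simp: feedbacks_def)
  \<comment> \<open>Defined through the choice c also at u = a, where \<mu> is not prescribed:
    \<open>good_continuous\<close> asks for continuity on the closed interval.\<close>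
  define G where "G u \<omega> = c \<omega> u (\<omega> u) v* matrix_inv (\<sigma> u (\<omega> u))" for u \<omega>
  have "\<exists>I. good a b G I"
  proof (rule good_continuous[OF ra])
    show "continuous_on {a..b} (\<lambda>u. G u \<omega>)" if \<omega>: "\<omega> \<in> \<Omega>" for \<omega>
      unfolding G_def
    proof (rule continuous_on_vector_matrix_inv)
      show "continuous_on {a..b} (\<lambda>u. \<sigma> u (\<omega> u))"
        by (rule continuous_on_subset[OF continuous_along_path[OF \<sigma>_cont \<omega>]]) (use ra in auto)
      show "continuous_on {a..b} (\<lambda>u. c \<omega> u (\<omega> u))"
        by (rule continuous_on_subset[OF continuous_along_path[OF fc[OF cL[OF \<omega>]] \<omega>]]) (use ra in auto)
      show "invertible (\<sigma> u (\<omega> u))" if "u \<in> {a..b}" for u using that a0 by (intro invertible_\<sigma>) simp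
    qed
    show "G u \<in> borel_measurable (F u)" if u: "a \<le> u" "u \<le> b" for u
    proof -
      have m: "(\<lambda>\<omega>. l u (\<omega> u) v* matrix_inv (\<sigma> u (\<omega> u))) \<in> borel_measurable (F u)" if l: "l \<in> L" for l
      proof (rule measurable_along_path[of "\<lambda>t x. l t x v* matrix_inv (\<sigma> t x)"])
        have "continuous_on ({0..} \<times> UNIV) (\<lambda>z. (case z of (t, x) \<Rightarrow> l t x) v* matrix_inv (case z of (t, x) \<Rightarrow> \<sigma> t x))"
          by (rule continuous_on_vector_matrix_inv[OF \<sigma>_cont fc[OF l]]) (auto intro!: invertible_\<sigma>)
        then show "continuous_on ({0..} \<times> UNIV) (\<lambda>(t, x). l t x v* matrix_inv (\<sigma> t x))" by (simp add: split_beta')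
      qed (use ra u in auto)
      have i: "(\<lambda>\<omega>. indicator {\<omega> \<in> \<Omega>. c \<omega> = l} \<omega> :: real) \<in> borel_measurable (F u)" if l: "l \<in> L" for l
        using L(4) l sets_F_mono[OF u(1)] by (intro borel_measurable_indicator) auto
      have "(\<lambda>\<omega>. \<Sum>l\<in>L. indicator {\<omega> \<in> \<Omega>. c \<omega> = l} \<omega> *\<^sub>R (l u (\<omega> u) v* matrix_inv (\<sigma> u (\<omega> u)))) \<in> borel_measurable (F u)"
        by (intro borel_measurable_sum borel_measurable_scaleR i m)
      then show ?thesis
      proof (rule measurable_cong[THEN iffD1, rotated])
        fix \<omega> assume "\<omega> \<in> space (F u)"
        then have \<omega>: "\<omega> \<in> \<Omega>" by simp
        have "(\<Sum>l\<in>L. indicator {\<omega> \<in> \<Omega>. c \<omega> = l} \<omega> *\<^sub>R (l u (\<omega> u) v* matrix_inv (\<sigma> u (\<omega> u))))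
          = (\<Sum>l\<in>L. if l = c \<omega> then G u \<omega> else 0)"
          using \<omega> by (intro sum.cong) (auto simp: indicator_def G_def)
        then show "(\<Sum>l\<in>L. indicator {\<omega> \<in> \<Omega>. c \<omega> = l} \<omega> *\<^sub>R (l u (\<omega> u) v* matrix_inv (\<sigma> u (\<omega> u)))) = G u \<omega>"
          using L(1) cL[OF \<omega>] by simp
      qed
    qed
    show "scaled_bound M a b G"
      unfolding scaled_bound_def
    proof (intro conjI ballI allI impI M(1))
      fix \<omega> u assume \<omega>: "\<omega> \<in> \<Omega>" and u: "a < u \<and> u \<le> b"
      have "G u \<omega> v* \<sigma> u (\<omega> u) = c \<omega> u (\<omega> u)"
        unfolding G_def using u a0 by (simp add: vector_matrix_mul_assoc matrix_inv_invertible[OF invertible_\<sigma>])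
      then show "norm (G u \<omega> v* \<sigma> u (\<omega> u)) \<le> M" using M(2) cL[OF \<omega>] u a0 by simp
    qed
  qed
  then obtain I where I: "good a b G I" by blast
  have "good a b (integrand \<mu>) I" by (rule good_cong[OF I]) (use eq in \<open>simp add: G_def integrand_def\<close>)
  then show ?thesis by blast
qed

text \<open>Induction on the number of decision times strictly inside the interval: without any,
  \<open>simple_on_good\<close> applies, and otherwise the interval is cut at one of them and the
  two integrals are concatenated.\<close>

lemma control_good:
  assumes \<mu>: "\<mu> \<in> controls" and "r \<le> a" "a \<le> b" "b \<le> T"
  shows "\<exists>I. good a b (integrand \<mu>) I"
proof -
  obtain P where P: "simple_off P \<mu>" using simple_controls_simple_off[OF \<mu>] by blast
  then have fin: "finite P" by (simp add: simple_off_def)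
  show ?thesis
    using assms(2-4)
  proof (induction "card (P \<inter> {a<..<b})" arbitrary: a b rule: less_induct)
    case less
    show ?case
    proof (cases "a = b")
      case True
      have "elem b b (integrand \<mu>) (\<lambda>_. 0)" by (rule elementary.Nil)
      then show ?thesis using good_elem True less.prems(1) by blast
    next
      case ab: False
      show ?thesis
      proof (cases "P \<inter> {a<..<b} = {}")
        case True
        have "simple_on a b \<mu>" using P True ab less.prems unfolding simple_off_def by (auto simp: Int_commute)
        then show ?thesis using ab less.prems by (intro simple_on_good) auto
      next
        case False
        then obtain p where p: "p \<in> P" "a < p" "p < b" by auto
        have "P \<inter> {a<..<p} \<subset> P \<inter> {a<..<b}" "P \<inter> {p<..<b} \<subset> P \<inter> {a<..<b}" using p by auto
        then have lt: "card (P \<inter> {a<..<p}) < card (P \<inter> {a<..<b})" "card (P \<inter> {p<..<b}) < card (P \<inter> {a<..<b})"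
          using fin by (auto intro: psubset_card_mono)
        have "\<exists>I. good a p (integrand \<mu>) I" "\<exists>I. good p b (integrand \<mu>) I"
          using less.hyps[OF lt(1)] less.hyps[OF lt(2)] p less.prems by auto
        then obtain I1 I2 where "good a p (integrand \<mu>) I1" "good p b (integrand \<mu>) I2" by blast
        from good_concat[OF less.prems(1) _ _ this] show ?thesis using p by auto
      qed
    qed
  qed
qed

definition stoch :: "(real \<Rightarrow> 'n path \<Rightarrow> real ^ 'n) \<Rightarrow> real \<Rightarrow> real \<Rightarrow> 'n path \<Rightarrow> real" where
  "stoch \<mu> a b = (SOME I. good a b (integrand \<mu>) I)"

definition dens :: "(real \<Rightarrow> 'n path \<Rightarrow> real ^ 'n) \<Rightarrow> real \<Rightarrow> real \<Rightarrow> 'n path \<Rightarrow> real" where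
  "dens \<mu> a b \<omega> = exp (stoch \<mu> a b \<omega> - qvar a b (integrand \<mu>) \<omega> / 2)"

lemma good_stoch: "\<mu> \<in> controls \<Longrightarrow> r \<le> a \<Longrightarrow> a \<le> b \<Longrightarrow> b \<le> T \<Longrightarrow> good a b (integrand \<mu>) (stoch \<mu> a b)"
  unfolding stoch_def by (rule someI_ex[OF control_good])

lemma dens_pos: "0 < dens \<mu> a b \<omega>" and dens_nonneg: "0 \<le> dens \<mu> a b \<omega>"
  by (simp_all add: dens_def)

lemma dens_measurable:
  assumes "\<mu> \<in> controls" "r \<le> a" "a \<le> b" "b \<le> T"
  shows "dens \<mu> a b \<in> borel_measurable (F b)"
proof -
  note g = good_stoch[OF assms, unfolded good_def is_ito_def]
  have "stoch \<mu> a b \<in> borel_measurable (F b)" "qvar a b (integrand \<mu>) \<in> borel_measurable (F b)"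
    using g qvar_measurable[OF assms(2,3)] by blast+
  then show ?thesis unfolding dens_def[abs_def] by measurable
qed

lemma dens_unit:
  assumes "\<mu> \<in> controls" "r \<le> a" "a \<le> b" "b \<le> T"
  shows "cond_unit C (F a) (\<lambda>\<omega>. ennreal (dens \<mu> a b \<omega>))"
proof -
  have "cond_unit C (F a) (\<lambda>\<omega>. ennreal (exp (1 * stoch \<mu> a b \<omega> - 1\<^sup>2 * qvar a b (integrand \<mu>) \<omega> / 2)))"
    using good_stoch[OF assms] unfolding good_def by blast
  then show ?thesis by (simp add: dens_def)
qed

text \<open>The square is exp (2 I - q) = exp q * exp (2 I - 2 q). Here q is bounded, and the second
  factor is the exponential with parameter x = 2, of mean one.\<close>

lemma dens_square:
  assumes "\<mu> \<in> controls" "r \<le> a" "a \<le> b" "b \<le> T"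
  shows "\<exists>k. (\<integral>\<^sup>+\<omega>. ennreal ((dens \<mu> a b \<omega>)\<^sup>2) \<partial>C) \<le> ennreal k"
proof -
  let ?I = "stoch \<mu> a b" and ?q = "qvar a b (integrand \<mu>)"
  obtain c where c: "scaled_bound c a b (integrand \<mu>)" and P: "progressive a b (integrand \<mu>)"
    and u: "cond_unit C (F a) (\<lambda>\<omega>. ennreal (exp (2 * ?I \<omega> - 2\<^sup>2 * ?q \<omega> / 2)))"
    using good_stoch[OF assms] unfolding good_def by blast
  have m: "(\<lambda>\<omega>. ennreal (exp (2 * ?I \<omega> - 2\<^sup>2 * ?q \<omega> / 2))) \<in> borel_measurable C" using u by (simp add: cond_unit_def)
  let ?e = "exp (c\<^sup>2 * (b - a))"
  have "(\<integral>\<^sup>+\<omega>. ennreal ((dens \<mu> a b \<omega>)\<^sup>2) \<partial>C) \<le> (\<integral>\<^sup>+\<omega>. ennreal ?e * ennreal (exp (2 * ?I \<omega> - 2\<^sup>2 * ?q \<omega> / 2)) \<partial>C)"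
  proof (rule nn_integral_mono)
    fix \<omega> assume "\<omega> \<in> space C"
    then have q: "?q \<omega> \<le> c\<^sup>2 * (b - a)" by (intro qvar_le[OF assms(2,3) P c]) simp
    have aux: "2 * (p - q / 2) \<le> k + (2 * p - 2\<^sup>2 * q / 2)" if "q \<le> k" for p q k :: real
      using that by simp
    have "(dens \<mu> a b \<omega>)\<^sup>2 \<le> ?e * exp (2 * ?I \<omega> - 2\<^sup>2 * ?q \<omega> / 2)"
      unfolding dens_def exp_add[symmetric] exp_double[symmetric] exp_le_cancel_iff by (rule aux[OF q])
    from ennreal_leI[OF this] show "ennreal ((dens \<mu> a b \<omega>)\<^sup>2) \<le> ennreal ?e * ennreal (exp (2 * ?I \<omega> - 2\<^sup>2 * ?q \<omega> / 2))"
      by (simp only: ennreal_mult exp_ge_zero)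
  qed
  also have "\<dots> = ennreal ?e * (\<integral>\<^sup>+\<omega>. ennreal (exp (2 * ?I \<omega> - 2\<^sup>2 * ?q \<omega> / 2)) \<partial>C)"
    by (rule nn_integral_cmult[OF m])
  also have "(\<integral>\<^sup>+\<omega>. ennreal (exp (2 * ?I \<omega> - 2\<^sup>2 * ?q \<omega> / 2)) \<partial>C) = 1"
    using cond_unit_nn_integral[OF subalgebra_F u, of "\<lambda>_. 1"] C.emeasure_space_1 by simp
  finally show ?thesis by auto
qed

text \<open>The stochastic integrals over the three intervals are chosen independently of each
  other, so the equality comes from uniqueness and holds almost everywhere only.\<close>

lemma dens_split:
  assumes \<mu>: "\<mu> \<in> controls" and le: "r \<le> a" "a \<le> b" "b \<le> c" "c \<le> T"
  shows "AE \<omega> in C. dens \<mu> a c \<omega> = dens \<mu> a b \<omega> * dens \<mu> b c \<omega>"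
proof -
  have rb: "r \<le> b" "a \<le> c" "b \<le> T" using le by auto
  note g1 = good_stoch[OF \<mu> le(1,2) rb(3)] and g2 = good_stoch[OF \<mu> rb(1) le(3,4)]
  note g = good_concat[OF le(1-3) g1 g2] and g' = good_stoch[OF \<mu> le(1) rb(2) le(4)]
  have st: "AE \<omega> in C. stoch \<mu> a c \<omega> = stoch \<mu> a b \<omega> + stoch \<mu> b c \<omega>"
    by (rule is_ito_unique[OF le(1) rb(2) g'[unfolded good_def, THEN conjunct1]
          g'[unfolded good_def, THEN conjunct2, THEN conjunct2, THEN conjunct1]
          g[unfolded good_def, THEN conjunct2, THEN conjunct2, THEN conjunct1]])
  obtain k k' where k: "scaled_bound k a b (integrand \<mu>)" "scaled_bound k' b c (integrand \<mu>)"
    and P: "progressive a b (integrand \<mu>)" "progressive b c (integrand \<mu>)"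
    using g1 g2 unfolding good_def by blast
  have "AE \<omega> in C. \<omega> \<in> \<Omega>" by (rule AE_I2) simp
  with st show ?thesis
  proof eventually_elim
    fix \<omega> assume I: "stoch \<mu> a c \<omega> = stoch \<mu> a b \<omega> + stoch \<mu> b c \<omega>" and \<omega>: "\<omega> \<in> \<Omega>"
    show "dens \<mu> a c \<omega> = dens \<mu> a b \<omega> * dens \<mu> b c \<omega>"
      unfolding dens_def I qvar_split[OF le(1-3) P k \<omega>] exp_add[symmetric] by (simp add: field_simps)
  qed
qed

lemma dens_local:
  assumes c: "\<mu> \<in> controls" "\<nu> \<in> controls" and le: "r \<le> a" "a \<le> b" "b \<le> T" and A: "A \<in> sets (F a)"
    and eq: "\<And>u \<omega>. a < u \<Longrightarrow> u \<le> b \<Longrightarrow> \<omega> \<in> A \<Longrightarrow> \<mu> u \<omega> = \<nu> u \<omega>"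
  shows "AE \<omega> in C. \<omega> \<in> A \<longrightarrow> dens \<mu> a b \<omega> = dens \<nu> a b \<omega>"
proof -
  have eq': "integrand \<mu> u \<omega> = integrand \<nu> u \<omega>" if "a < u" "u \<le> b" "\<omega> \<in> A" for u \<omega>
    using eq[OF that] by (simp add: integrand_def)
  have "AE \<omega> in C. \<omega> \<in> A \<longrightarrow> stoch \<mu> a b \<omega> = stoch \<nu> a b \<omega>"
    using good_stoch[OF c(1) le] good_stoch[OF c(2) le] unfolding good_def
    by (intro is_ito_local[OF le(1,2) _ A _ _ eq']) auto
  then show ?thesis
  proof eventually_elim
    fix \<omega> assume I: "\<omega> \<in> A \<longrightarrow> stoch \<mu> a b \<omega> = stoch \<nu> a b \<omega>"
    show "\<omega> \<in> A \<longrightarrow> dens \<mu> a b \<omega> = dens \<nu> a b \<omega>"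
      unfolding dens_def using I qvar_cong[of a b "integrand \<mu>" \<omega> "integrand \<nu>"] eq' by simp
  qed
qed

lemma zero_feedback: "(\<lambda>_ _. 0) \<in> feedbacks"
proof -
  have "(\<lambda>(t::real, x::real^'n). 0::real^'n) = (\<lambda>_. 0)" by auto
  then show ?thesis using zero_\<Lambda> by (auto simp: feedbacks_def selections_def bounded_iff)
qed

lemma zero_control: "(\<lambda>_ _. 0) \<in> controls"
proof (rule simple_off_simple_controls[of "{}"])
  show "simple_off {} (\<lambda>_ _. 0)"
    unfolding simple_off_def simple_on_def using zero_feedback
    by (intro conjI allI impI finite.emptyI exI[of _ "{\<lambda>_ _. 0}"] exI[of _ "\<lambda>_ _ _. 0"]) (auto simp: sets.top[of "F _", simplified])
qed

subsection \<open>The controlled measures\<close>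

abbreviation M :: "(real \<Rightarrow> 'n path \<Rightarrow> real ^ 'n) \<Rightarrow> 'n path measure" where
  "M \<mu> \<equiv> controlled_measure \<sigma> r T Q \<mu>"

text \<open>Null sets of the completion belong to every \<open>F t\<close>, so passing to this
  subalgebra does not change which statements hold almost everywhere.\<close>

lemma AE_restr_F: "(AE \<omega> in restr_to_subalg C (F t). P \<omega>) \<longleftrightarrow> (AE \<omega> in C. P \<omega>)"
proof
  assume "AE \<omega> in C. P \<omega>"
  then obtain N where N: "N \<in> null_sets C" "\<And>\<omega>. \<omega> \<in> space C - N \<Longrightarrow> P \<omega>" by (auto elim: AE_E3)
  have "N \<in> null_sets (restr_to_subalg C (F t))"
    using N(1) null_sets_F by (simp add: null_sets_restr_to_subalg[OF subalgebra_F])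
  then show "AE \<omega> in restr_to_subalg C (F t). P \<omega>"
    by (rule AE_I') (use N(2) in \<open>auto simp: space_restr_to_subalg\<close>)
qed (rule AE_restr_to_subalg[OF subalgebra_F])

lemma qvar_control:
  assumes "\<omega> \<in> \<Omega>"
  shows "(LBINT u=r..T. (norm (\<mu> u \<omega>))\<^sup>2) = qvar r T (integrand \<mu>) \<omega>"
proof -
  have "(LBINT u=r..T. (norm (\<mu> u \<omega>))\<^sup>2) = (\<integral>u. indicator {r<..T} u *\<^sub>R (norm (\<mu> u \<omega>))\<^sup>2 \<partial>lborel)"
    using rT by (simp add: interval_integral_Ioc set_lebesgue_integral_def)
  also have "\<dots> = qvar r T (integrand \<mu>) \<omega>"
    unfolding qvar_def scaled_def using r_nonneg
    by (intro Bochner_Integration.integral_cong) (auto simp: integrand_\<sigma> split: split_indicator)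
  finally show ?thesis .
qed

text \<open>The integral selected in \<open>ito_integral\<close> exists and agrees with
  \<open>stoch\<close> almost everywhere. Densities that agree almost everywhere define the same
  measure, hence an equality of measures without exception.\<close>

lemma controlled_measure_eq:
  assumes \<mu>: "\<mu> \<in> controls"
  shows "M \<mu> = density (restr_to_subalg C (F T)) (\<lambda>\<omega>. ennreal (dens \<mu> r T \<omega>))"
proof -
  let ?I = "ito_integral \<sigma> r T Q (integrand \<mu>)"
  note g = good_stoch[OF \<mu> order_refl rT order_refl]
  have "is_ito r T (integrand \<mu>) (stoch \<mu> r T)" using g by (simp add: good_def)
  then have "\<exists>I. is_ito_integral \<sigma> r T Q (integrand \<mu>) I" unfolding is_ito_integral_iff by blast
  then have I: "is_ito r T (integrand \<mu>) ?I"
    unfolding ito_integral_def is_ito_integral_iff[symmetric] by (rule someI_ex)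
  have eq: "AE \<omega> in C. ?I \<omega> = stoch \<mu> r T \<omega>"
    by (rule is_ito_unique[OF order_refl rT _ I]) (use g in \<open>auto simp: good_def\<close>)
  have Im: "?I \<in> borel_measurable (F T)" using I by (simp add: is_ito_def)
  have q: "qvar r T (integrand \<mu>) \<in> borel_measurable (F T)"
    using g by (intro qvar_measurable[OF order_refl rT]) (simp add: good_def)
  have q': "(\<lambda>\<omega>. LBINT u=r..T. (norm (\<mu> u \<omega>))\<^sup>2) \<in> borel_measurable (F T)"
    using q by (rule measurable_cong[THEN iffD1, rotated]) (simp add: qvar_control)
  have "(\<lambda>\<omega>. ?I \<omega> - (LBINT u=r..T. (norm (\<mu> u \<omega>))\<^sup>2) / 2) \<in> borel_measurable (F T)"
    by (intro borel_measurable_diff borel_measurable_divide Im q' borel_measurable_const)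
  then have m: "(\<lambda>\<omega>. ennreal (exp (?I \<omega> - (LBINT u=r..T. (norm (\<mu> u \<omega>))\<^sup>2) / 2))) \<in> borel_measurable (F T)"
    by simp
  have m': "(\<lambda>\<omega>. ennreal (dens \<mu> r T \<omega>)) \<in> borel_measurable (F T)"
    using dens_measurable[OF \<mu> order_refl rT order_refl] by simp
  have "AE \<omega> in C. ennreal (exp (?I \<omega> - (LBINT u=r..T. (norm (\<mu> u \<omega>))\<^sup>2) / 2)) = ennreal (dens \<mu> r T \<omega>)"
    using eq AE_space by eventually_elim (simp add: dens_def qvar_control)
  then show ?thesis
    unfolding controlled_measure_def integrand_def[symmetric]
    by (intro density_cong measurable_in_subalg[OF subalgebra_F] m m') (simp add: AE_restr_F)
qed

lemma sets_M [simp]: "sets (M \<mu>) = sets (F T)" and space_M [simp]: "space (M \<mu>) = \<Omega>"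
  by (simp_all add: controlled_measure_def sets_restr_to_subalg[OF subalgebra_F] space_restr_to_subalg)

lemma nn_integral_M:
  assumes \<mu>: "\<mu> \<in> controls" and W: "W \<in> borel_measurable (F T)"
  shows "(\<integral>\<^sup>+\<omega>. W \<omega> \<partial>M \<mu>) = (\<integral>\<^sup>+\<omega>. W \<omega> * ennreal (dens \<mu> r T \<omega>) \<partial>C)"
proof -
  have m': "(\<lambda>\<omega>. ennreal (dens \<mu> r T \<omega>)) \<in> borel_measurable (F T)"
    using dens_measurable[OF \<mu> order_refl rT order_refl] by simp
  have "(\<integral>\<^sup>+\<omega>. W \<omega> \<partial>M \<mu>) = (\<integral>\<^sup>+\<omega>. ennreal (dens \<mu> r T \<omega>) * W \<omega> \<partial>restr_to_subalg C (F T))"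
    unfolding controlled_measure_eq[OF \<mu>]
    by (intro nn_integral_density measurable_in_subalg[OF subalgebra_F] m' W)
  also have "\<dots> = (\<integral>\<^sup>+\<omega>. ennreal (dens \<mu> r T \<omega>) * W \<omega> \<partial>C)"
    by (intro nn_integral_subalgebra2[OF subalgebra_F] borel_measurable_times_ennreal m' W)
  finally show ?thesis by (simp add: mult.commute)
qed

text \<open>The density is an exponential and thus positive at every path, so no null sets are
  gained or lost. From here on almost sure statements move freely between the controlled
  measures.\<close>

lemma AE_M:
  assumes \<mu>: "\<mu> \<in> controls"
  shows "(AE \<omega> in M \<mu>. P \<omega>) \<longleftrightarrow> (AE \<omega> in C. P \<omega>)"
proof -
  have m': "(\<lambda>\<omega>. ennreal (dens \<mu> r T \<omega>)) \<in> borel_measurable (restr_to_subalg C (F T))"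
    using dens_measurable[OF \<mu> order_refl rT order_refl] by (intro measurable_in_subalg[OF subalgebra_F]) simp
  show ?thesis
    unfolding controlled_measure_eq[OF \<mu>] AE_density[OF m'] AE_restr_F by (simp add: dens_pos)
qed

lemma prob_M: "\<mu> \<in> controls \<Longrightarrow> prob_space (M \<mu>)"
proof -
  assume \<mu>: "\<mu> \<in> controls"
  have "emeasure (M \<mu>) \<Omega> = (\<integral>\<^sup>+\<omega>. 1 \<partial>M \<mu>)" by simp
  also have "\<dots> = (\<integral>\<^sup>+\<omega>. 1 * ennreal (dens \<mu> r T \<omega>) \<partial>C)" by (rule nn_integral_M[OF \<mu>]) simp
  also have "\<dots> = 1"
    using cond_unit_nn_integral[OF subalgebra_F dens_unit[OF \<mu> order_refl rT order_refl], of "\<lambda>_. 1"] C.emeasure_space_1 by simp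
  finally show ?thesis by (intro prob_spaceI) simp
qed

end

context control_problem begin

section \<open>Stopping times with finitely many values\<close>

abbreviation times :: "('n path \<Rightarrow> real) set" where "times \<equiv> simple_stopping_times r T Q"
abbreviation S :: "('n path \<Rightarrow> real) \<Rightarrow> 'n path measure" where "S s \<equiv> stopped_algebra r Q s"

lemma filtration_F: "filtration \<Omega> F"
  by unfold_locales (auto simp: sets_F_mono[THEN subsetD])

interpretation Fil: filtration \<Omega> F by (rule filtration_F)

lemma timesD:
  assumes "s \<in> times"
  shows "stopping_time F s" "\<omega> \<in> \<Omega> \<Longrightarrow> r \<le> s \<omega>" "\<omega> \<in> \<Omega> \<Longrightarrow> s \<omega> \<le> T" "finite (s ` \<Omega>)"
  using assms by (auto simp: simple_stopping_times_def)

lemma times_values: "s \<in> times \<Longrightarrow> v \<in> s ` \<Omega> \<Longrightarrow> r \<le> v \<and> v \<le> T"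
  using timesD by auto

lemma space_S [simp]: "space (S s) = \<Omega>"
  by (rule Fil.space_pre_sigma)

lemma level_F: "s \<in> times \<Longrightarrow> {\<omega> \<in> \<Omega>. s \<omega> = v} \<in> sets (F v)"
  using Fil.stopping_time_eq_const[OF timesD(1), of s v] by (simp add: pred_def)

lemma above_F: "s \<in> times \<Longrightarrow> {\<omega> \<in> \<Omega>. v < s \<omega>} \<in> sets (F v)"
  using stopping_timeD2[OF timesD(1), of s v] by (simp add: pred_def)

lemma below_F: "s \<in> times \<Longrightarrow> A \<in> sets (S s) \<Longrightarrow> {\<omega> \<in> A. s \<omega> \<le> v} \<in> sets (F v)"
  using Fil.sets_pre_sigmaD[OF timesD(1)] by blast

lemma S_subset: "A \<in> sets (S s) \<Longrightarrow> A \<subseteq> \<Omega>"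
  using sets.sets_into_space[of A "S s"] by simp

lemma S_level:
  assumes s: "s \<in> times" and A: "A \<in> sets (S s)"
  shows "A \<inter> {\<omega> \<in> \<Omega>. s \<omega> = v} \<in> sets (F v)"
proof -
  have "A \<inter> {\<omega> \<in> \<Omega>. s \<omega> = v} = {\<omega> \<in> A. s \<omega> \<le> v} \<inter> {\<omega> \<in> \<Omega>. s \<omega> = v}" by auto
  then show ?thesis using below_F[OF s A, of v] level_F[OF s, of v] by simp
qed

text \<open>With finitely many values, the set where s \<le> t is a finite union of levels, and what
  is known at a value v \<le> t is known at t.\<close>

lemma S_I:
  assumes s: "s \<in> times" and A: "A \<subseteq> \<Omega>" "\<And>v. v \<in> s ` \<Omega> \<Longrightarrow> A \<inter> {\<omega> \<in> \<Omega>. s \<omega> = v} \<in> sets (F v)"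
  shows "A \<in> sets (S s)"
proof (rule Fil.sets_pre_sigmaI[OF timesD(1)[OF s]])
  fix t
  have "{\<omega> \<in> A. s \<omega> \<le> t} = (\<Union>v\<in>{v\<in>s ` \<Omega>. v \<le> t}. A \<inter> {\<omega> \<in> \<Omega>. s \<omega> = v})" using A(1) by auto
  also have "\<dots> \<in> sets (F t)"
    using timesD(4)[OF s] A(2) sets_F_mono[of _ t] by (intro sets.finite_UN) auto
  finally show "{\<omega> \<in> A. s \<omega> \<le> t} \<in> sets (F t)" .
qed

lemma sets_S_F: "s \<in> times \<Longrightarrow> sets (S s) \<subseteq> sets (F T)"
proof
  fix A assume s: "s \<in> times" and A: "A \<in> sets (S s)"
  have "{\<omega> \<in> A. s \<omega> \<le> T} = A" using timesD(3)[OF s] S_subset[OF A] by auto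
  then show "A \<in> sets (F T)" using below_F[OF s A, of T] by simp
qed

lemma subalgebra_FS: "s \<in> times \<Longrightarrow> subalgebra (F T) (S s)"
  using sets_S_F by (simp add: subalgebra_def)

lemma subalgebra_CS: "s \<in> times \<Longrightarrow> subalgebra C (S s)"
  using sets_S_F[of s] sets_F_C[of T] by (simp add: subalgebra_def)

lemma subalgebra_MS: "s \<in> times \<Longrightarrow> subalgebra (M \<mu>) (S s)"
  using sets_S_F by (simp add: subalgebra_def)

lemma sets_S_mono:
  assumes "s \<in> times" "t \<in> times" "\<And>\<omega>. \<omega> \<in> \<Omega> \<Longrightarrow> s \<omega> \<le> t \<omega>"
  shows "sets (S s) \<subseteq> sets (S t)"
  by (rule Fil.mono_pre_sigma[OF timesD(1)[OF assms(1)] timesD(1)[OF assms(2)] assms(3)])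

lemma subalgebra_SS:
  assumes "s \<in> times" "t \<in> times" "\<And>\<omega>. \<omega> \<in> \<Omega> \<Longrightarrow> s \<omega> \<le> t \<omega>"
  shows "subalgebra (S t) (S s)"
  using sets_S_mono[OF assms] by (simp add: subalgebra_def)

lemma measurable_pieces:
  assumes sp: "space G = \<Omega>" and V: "finite (s ` \<Omega>)"
    and f: "\<And>v B. v \<in> s ` \<Omega> \<Longrightarrow> B \<in> sets N \<Longrightarrow> f v -` B \<inter> {\<omega> \<in> \<Omega>. s \<omega> = v} \<in> sets G"
    and N: "\<And>v \<omega>. v \<in> s ` \<Omega> \<Longrightarrow> \<omega> \<in> \<Omega> \<Longrightarrow> f v \<omega> \<in> space N"
  shows "(\<lambda>\<omega>. f (s \<omega>) \<omega>) \<in> measurable G N"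
proof (rule measurableI)
  fix B assume B: "B \<in> sets N"
  have "(\<lambda>\<omega>. f (s \<omega>) \<omega>) -` B \<inter> space G = (\<Union>v\<in>s ` \<Omega>. f v -` B \<inter> {\<omega> \<in> \<Omega>. s \<omega> = v})" using sp by auto
  also have "\<dots> \<in> sets G" using V f B by (intro sets.finite_UN) auto
  finally show "(\<lambda>\<omega>. f (s \<omega>) \<omega>) -` B \<inter> space G \<in> sets G" .
qed (use sp N in auto)

text \<open>On the level s = v only the piece f v matters, and it is known at time v. This covers
  densities and costs accumulated up to a stopping time.\<close>

lemma measurable_S_pieces:
  assumes s: "s \<in> times" and f: "\<And>v. v \<in> s ` \<Omega> \<Longrightarrow> f v \<in> measurable (F v) N"
  shows "(\<lambda>\<omega>. f (s \<omega>) \<omega>) \<in> measurable (S s) N"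
proof (rule measurable_pieces[OF space_S timesD(4)[OF s]])
  fix v B assume v: "v \<in> s ` \<Omega>" and B: "B \<in> sets N"
  have FB: "f v -` B \<inter> \<Omega> \<in> sets (F v)" using measurable_sets[OF f[OF v] B] by simp
  show "f v -` B \<inter> {\<omega> \<in> \<Omega>. s \<omega> = v} \<in> sets (S s)"
  proof (rule S_I[OF s])
    fix w assume "w \<in> s ` \<Omega>"
    show "f v -` B \<inter> {\<omega> \<in> \<Omega>. s \<omega> = v} \<inter> {\<omega> \<in> \<Omega>. s \<omega> = w} \<in> sets (F w)"
    proof (cases "w = v")
      case True
      then have "f v -` B \<inter> {\<omega> \<in> \<Omega>. s \<omega> = v} \<inter> {\<omega> \<in> \<Omega>. s \<omega> = w} = (f v -` B \<inter> \<Omega>) \<inter> {\<omega> \<in> \<Omega>. s \<omega> = v}" by auto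
      then show ?thesis using FB level_F[OF s, of v] True by simp
    next
      case False
      then have "f v -` B \<inter> {\<omega> \<in> \<Omega>. s \<omega> = v} \<inter> {\<omega> \<in> \<Omega>. s \<omega> = w} = {}" by auto
      then show ?thesis by simp
    qed
  qed auto
next
  show "f v \<omega> \<in> space N" if "v \<in> s ` \<Omega>" "\<omega> \<in> \<Omega>" for v \<omega>
    using measurable_space[OF f[OF that(1)], of \<omega>] that(2) by simp
qed

lemma measurable_F_pieces:
  assumes s: "s \<in> times" and f: "\<And>v. v \<in> s ` \<Omega> \<Longrightarrow> f v \<in> measurable (F T) N"
  shows "(\<lambda>\<omega>. f (s \<omega>) \<omega>) \<in> measurable (F T) N"
proof (rule measurable_pieces[OF space_F timesD(4)[OF s]])
  fix v B assume v: "v \<in> s ` \<Omega>" and B: "B \<in> sets N"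
  have "f v -` B \<inter> \<Omega> \<in> sets (F T)" using measurable_sets[OF f[OF v] B] by simp
  moreover have "{\<omega> \<in> \<Omega>. s \<omega> = v} \<in> sets (F T)"
    using level_F[OF s, of v] sets_F_mono[of v T] times_values[OF s v] by auto
  moreover have "f v -` B \<inter> {\<omega> \<in> \<Omega>. s \<omega> = v} = (f v -` B \<inter> \<Omega>) \<inter> {\<omega> \<in> \<Omega>. s \<omega> = v}" by auto
  ultimately show "f v -` B \<inter> {\<omega> \<in> \<Omega>. s \<omega> = v} \<in> sets (F T)" by simp
next
  show "f v \<omega> \<in> space N" if "v \<in> s ` \<Omega>" "\<omega> \<in> \<Omega>" for v \<omega>
    using measurable_space[OF f[OF that(1)], of \<omega>] that(2) by simp
qed

lemma null_sets_S: "s \<in> times \<Longrightarrow> N \<in> null_sets C \<Longrightarrow> N \<in> sets (S s)"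
proof (rule S_I)
  fix v assume s: "s \<in> times" and N: "N \<in> null_sets C"
  show "N \<inter> {\<omega> \<in> \<Omega>. s \<omega> = v} \<in> sets (F v)" using null_sets_F[OF N, of v] level_F[OF s, of v] by simp
qed (auto dest: null_sets_C)

text \<open>The stopped algebra contains all null sets. Objects picked by \<open>SOME\<close>, such
  as the dynamic process, can therefore inherit measurability from a better version.\<close>

lemma measurable_S_cong_AE:
  assumes s: "s \<in> times" and f: "f \<in> measurable (S s) N" and eq: "AE \<omega> in C. f \<omega> = h \<omega>"
    and h: "\<And>\<omega>. \<omega> \<in> \<Omega> \<Longrightarrow> h \<omega> \<in> space N"
  shows "h \<in> measurable (S s) N"
proof (rule measurableI)
  obtain Z where Z: "Z \<in> null_sets C" "\<And>\<omega>. \<omega> \<in> space C - Z \<Longrightarrow> f \<omega> = h \<omega>" using eq by (auto elim: AE_E3)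
  fix B assume B: "B \<in> sets N"
  have fB: "f -` B \<inter> \<Omega> \<in> sets (S s)" using measurable_sets[OF f B] by simp
  have hZ: "h -` B \<inter> Z \<in> null_sets C"
    by (rule null_sets_completion_subset[OF _ Z(1)]) auto
  have "h -` B \<inter> space (S s) = (f -` B \<inter> \<Omega> - Z) \<union> (h -` B \<inter> Z)"
    using Z(2) null_sets_C[OF Z(1)] by auto
  then show "h -` B \<inter> space (S s) \<in> sets (S s)"
    using fB null_sets_S[OF s Z(1)] null_sets_S[OF s hZ] by auto
qed (use h in simp)

text \<open>Each deterministic time has its own exceptional null set; a stopping time meets only
  finitely many of them.\<close>

lemma AE_levels:
  assumes s: "s \<in> times" and "\<And>v. v \<in> s ` \<Omega> \<Longrightarrow> AE \<omega> in C. s \<omega> = v \<longrightarrow> P v \<omega>"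
  shows "AE \<omega> in C. P (s \<omega>) \<omega>"
proof -
  have "AE \<omega> in C. \<forall>v\<in>s ` \<Omega>. s \<omega> = v \<longrightarrow> P v \<omega>"
    using assms(2) by (intro AE_finite_allI timesD(4)[OF s]) auto
  with AE_space show ?thesis by eventually_elim auto
qed

subsection \<open>Densities before and after a stopping time\<close>

definition before :: "(real \<Rightarrow> 'n path \<Rightarrow> real ^ 'n) \<Rightarrow> ('n path \<Rightarrow> real) \<Rightarrow> 'n path \<Rightarrow> real" where
  "before \<mu> s \<omega> = dens \<mu> r (s \<omega>) \<omega>"

definition after :: "(real \<Rightarrow> 'n path \<Rightarrow> real ^ 'n) \<Rightarrow> ('n path \<Rightarrow> real) \<Rightarrow> 'n path \<Rightarrow> real" where
  "after \<mu> s \<omega> = dens \<mu> (s \<omega>) T \<omega>"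

lemma before_measurable: "\<mu> \<in> controls \<Longrightarrow> s \<in> times \<Longrightarrow> before \<mu> s \<in> borel_measurable (S s)"
  unfolding before_def[abs_def] using times_values
  by (intro measurable_S_pieces[of s "\<lambda>v. dens \<mu> r v"] dens_measurable) blast+

lemma after_measurable: "\<mu> \<in> controls \<Longrightarrow> s \<in> times \<Longrightarrow> after \<mu> s \<in> borel_measurable (F T)"
  unfolding after_def[abs_def] using times_values
  by (intro measurable_F_pieces[of s "\<lambda>v. dens \<mu> v T"] dens_measurable) blast+

lemma before_pos: "0 < before \<mu> s \<omega>" and after_pos: "0 < after \<mu> s \<omega>"
  by (simp_all add: before_def after_def dens_pos)

lemma dens_before_after:
  assumes "\<mu> \<in> controls" "s \<in> times"
  shows "AE \<omega> in C. dens \<mu> r T \<omega> = before \<mu> s \<omega> * after \<mu> s \<omega>"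
proof -
  have "AE \<omega> in C. dens \<mu> r T \<omega> = dens \<mu> r (s \<omega>) \<omega> * dens \<mu> (s \<omega>) T \<omega>"
  proof (rule AE_levels[OF assms(2)])
    fix v assume "v \<in> s ` \<Omega>"
    then have "r \<le> v" "v \<le> T" using times_values[OF assms(2)] by auto
    from dens_split[OF assms(1) order_refl this order_refl]
    show "AE \<omega> in C. s \<omega> = v \<longrightarrow> dens \<mu> r T \<omega> = dens \<mu> r v \<omega> * dens \<mu> v T \<omega>" by auto
  qed
  then show ?thesis by (simp add: before_def after_def)
qed

text \<open>A set of the stopped algebra splits along the values v of s into sets known at time v,
  and on each of them the deterministic statement \<open>dens_unit\<close> applies.\<close>

lemma after_unit:
  assumes \<mu>: "\<mu> \<in> controls" and s: "s \<in> times"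
  shows "cond_unit C (S s) (\<lambda>\<omega>. ennreal (after \<mu> s \<omega>))"
  unfolding cond_unit_def
proof (intro conjI ballI)
  show "(\<lambda>\<omega>. ennreal (after \<mu> s \<omega>)) \<in> borel_measurable C"
    using measurable_F_C[OF after_measurable[OF \<mu> s]] by simp
  fix A assume A: "A \<in> sets (S s)"
  let ?B = "\<lambda>v. A \<inter> {\<omega> \<in> \<Omega>. s \<omega> = v}"
  have fin: "finite (s ` \<Omega>)" by (rule timesD(4)[OF s])
  have BF: "?B v \<in> sets (F v)" for v by (rule S_level[OF s A])
  then have BC: "?B v \<in> sets C" for v using sets_F_C by blast
  have rv: "r \<le> v" "v \<le> T" if "v \<in> s ` \<Omega>" for v using times_values[OF s that] by auto
  have dm: "(\<lambda>\<omega>. ennreal (dens \<mu> v T \<omega>)) \<in> borel_measurable C" if "v \<in> s ` \<Omega>" for v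
    using measurable_F_C[OF dens_measurable[OF \<mu> rv[OF that] order_refl]] by simp
  have "(\<integral>\<^sup>+\<omega>\<in>A. ennreal (after \<mu> s \<omega>) \<partial>C) = (\<integral>\<^sup>+\<omega>. (\<Sum>v\<in>s ` \<Omega>. ennreal (dens \<mu> v T \<omega>) * indicator (?B v) \<omega>) \<partial>C)"
  proof (rule nn_integral_cong)
    fix \<omega> assume "\<omega> \<in> space C"
    then have \<omega>: "\<omega> \<in> \<Omega>" by simp
    have "(\<Sum>v\<in>s ` \<Omega>. ennreal (dens \<mu> v T \<omega>) * indicator (?B v) \<omega>) = (\<Sum>v\<in>s ` \<Omega>. if v = s \<omega> then ennreal (after \<mu> s \<omega>) * indicator A \<omega> else 0)"
      using \<omega> by (intro sum.cong) (auto simp: indicator_def after_def)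
    also have "\<dots> = ennreal (after \<mu> s \<omega>) * indicator A \<omega>" using fin \<omega> by simp
    finally show "ennreal (after \<mu> s \<omega>) * indicator A \<omega> = (\<Sum>v\<in>s ` \<Omega>. ennreal (dens \<mu> v T \<omega>) * indicator (?B v) \<omega>)" by simp
  qed
  also have "\<dots> = (\<Sum>v\<in>s ` \<Omega>. \<integral>\<^sup>+\<omega>. ennreal (dens \<mu> v T \<omega>) * indicator (?B v) \<omega> \<partial>C)"
    by (intro nn_integral_sum borel_measurable_times_ennreal dm borel_measurable_indicator BC)
  also have "\<dots> = (\<Sum>v\<in>s ` \<Omega>. emeasure C (?B v))"
    using dens_unit[OF \<mu> rv order_refl] BF unfolding cond_unit_def by (intro sum.cong) auto
  also have "\<dots> = emeasure C (\<Union>v\<in>s ` \<Omega>. ?B v)"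
    by (rule sum_emeasure[OF _ _ fin], use BC in blast) (auto simp: disjoint_family_on_def)
  also have "(\<Union>v\<in>s ` \<Omega>. ?B v) = A" using S_subset[OF A] by auto
  finally show "(\<integral>\<^sup>+\<omega>\<in>A. ennreal (after \<mu> s \<omega>) \<partial>C) = emeasure C A" .
qed

text \<open>Locality needs a set known at the left end of the interval, and the set where v \<le> s
  is in general not known at r. The induction therefore climbs through the values of s: if p is the
  last value of s before v, or r, then v \<le> s amounts to p < s at every path with s > p, and that
  set is known at time p.\<close>

lemma before_cong:
  assumes c: "\<kappa> \<in> controls" "\<mu> \<in> controls" and s: "s \<in> times"
    and eq: "\<And>u \<omega>. r < u \<Longrightarrow> u \<le> s \<omega> \<Longrightarrow> \<omega> \<in> \<Omega> \<Longrightarrow> \<kappa> u \<omega> = \<mu> u \<omega>"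
  shows "AE \<omega> in C. before \<kappa> s \<omega> = before \<mu> s \<omega>"
proof -
  have fin: "finite (s ` \<Omega>)" by (rule timesD(4)[OF s])
  have "AE \<omega> in C. v \<le> s \<omega> \<longrightarrow> dens \<kappa> r v \<omega> = dens \<mu> r v \<omega>" if "r \<le> v" "v \<le> T" for v
    using that
  proof (induction "card (s ` \<Omega> \<inter> {r<..<v})" arbitrary: v rule: less_induct)
    case less
    define p where "p = Max (insert r (s ` \<Omega> \<inter> {r<..<v}))"
    have finp: "finite (insert r (s ` \<Omega> \<inter> {r<..<v}))" using fin by simp
    have pin: "p \<in> insert r (s ` \<Omega> \<inter> {r<..<v})" unfolding p_def by (rule Max_in[OF finp]) simp
    have pmax: "w \<le> p" if "w \<in> s ` \<Omega>" "r < w" "w < v" for w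
      unfolding p_def by (rule Max_ge[OF finp]) (use that in simp)
    have p: "r \<le> p" "p \<le> v" "p \<le> T" using pin less.prems by auto
    have IH: "AE \<omega> in C. p \<le> s \<omega> \<longrightarrow> dens \<kappa> r p \<omega> = dens \<mu> r p \<omega>"
    proof (cases "p = r")
      case True
      have "AE \<omega> in C. \<omega> \<in> \<Omega> \<longrightarrow> dens \<kappa> r r \<omega> = dens \<mu> r r \<omega>"
        by (rule dens_local[OF c order_refl order_refl rT]) (use sets.top[of "F r"] in auto)
      with AE_space show ?thesis unfolding True by eventually_elim simp
    next
      case False
      then have pV: "p \<in> s ` \<Omega> \<inter> {r<..<v}" using pin by simp
      have "s ` \<Omega> \<inter> {r<..<p} \<subset> s ` \<Omega> \<inter> {r<..<v}" using pV by auto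
      then have "card (s ` \<Omega> \<inter> {r<..<p}) < card (s ` \<Omega> \<inter> {r<..<v})" using fin by (intro psubset_card_mono) auto
      from less.hyps[OF this p(1,3)] show ?thesis .
    qed
    have "AE \<omega> in C. \<omega> \<in> {\<omega> \<in> \<Omega>. p < s \<omega>} \<longrightarrow> dens \<kappa> p v \<omega> = dens \<mu> p v \<omega>"
    proof (rule dens_local[OF c p(1,2) less.prems(2) above_F[OF s]])
      fix u \<omega> assume u: "p < u" "u \<le> v" and \<omega>: "\<omega> \<in> {\<omega> \<in> \<Omega>. p < s \<omega>}"
      have "v \<le> s \<omega>" using pmax[of "s \<omega>"] \<omega> p(1) by force
      then show "\<kappa> u \<omega> = \<mu> u \<omega>" using eq[of u \<omega>] u \<omega> p(1) by auto
    qed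
    moreover have "AE \<omega> in C. dens \<kappa> r v \<omega> = dens \<kappa> r p \<omega> * dens \<kappa> p v \<omega>" "AE \<omega> in C. dens \<mu> r v \<omega> = dens \<mu> r p \<omega> * dens \<mu> p v \<omega>"
      by (rule dens_split[OF _ order_refl p(1,2) less.prems(2)], fact)+
    moreover have "AE \<omega> in C. v \<le> s \<omega> \<longrightarrow> p < s \<omega> \<or> p = v"
      using p(2) by auto
    ultimately show ?case using IH AE_space
    proof eventually_elim
      fix \<omega>
      assume 1: "\<omega> \<in> {\<omega> \<in> \<Omega>. p < s \<omega>} \<longrightarrow> dens \<kappa> p v \<omega> = dens \<mu> p v \<omega>"
        and 2: "dens \<kappa> r v \<omega> = dens \<kappa> r p \<omega> * dens \<kappa> p v \<omega>" "dens \<mu> r v \<omega> = dens \<mu> r p \<omega> * dens \<mu> p v \<omega>"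
        and 3: "v \<le> s \<omega> \<longrightarrow> p < s \<omega> \<or> p = v" "p \<le> s \<omega> \<longrightarrow> dens \<kappa> r p \<omega> = dens \<mu> r p \<omega>" and \<omega>: "\<omega> \<in> space C"
      show "v \<le> s \<omega> \<longrightarrow> dens \<kappa> r v \<omega> = dens \<mu> r v \<omega>"
      proof
        assume v: "v \<le> s \<omega>"
        have eqp: "dens \<kappa> r p \<omega> = dens \<mu> r p \<omega>" using 3(2) order_trans[OF p(2) v] by blast
        show "dens \<kappa> r v \<omega> = dens \<mu> r v \<omega>"
        proof (cases "p = v")
          case True
          show ?thesis by (rule eqp[unfolded True])
        next
          case False
          have "\<omega> \<in> \<Omega>" using \<omega> by simp
          then have "\<omega> \<in> {\<omega> \<in> \<Omega>. p < s \<omega>}" using 3(1) v False by blast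
          from 1[rule_format, OF this] show ?thesis unfolding 2 eqp by (rule arg_cong)
        qed
      qed
    qed
  qed
  note main = this
  have "AE \<omega> in C. dens \<kappa> r (s \<omega>) \<omega> = dens \<mu> r (s \<omega>) \<omega>"
  proof (rule AE_levels[OF s])
    fix v assume "v \<in> s ` \<Omega>"
    then have "r \<le> v" "v \<le> T" using times_values[OF s] by auto
    from main[OF this] show "AE \<omega> in C. s \<omega> = v \<longrightarrow> dens \<kappa> r v \<omega> = dens \<mu> r v \<omega>"
      by eventually_elim simp
  qed
  then show ?thesis by (simp add: before_def)
qed

lemma after_cong:
  assumes c: "\<kappa> \<in> controls" "\<nu> \<in> controls" and s: "s \<in> times" and A: "A \<in> sets (S s)"
    and eq: "\<And>u \<omega>. s \<omega> < u \<Longrightarrow> u \<le> T \<Longrightarrow> \<omega> \<in> A \<Longrightarrow> \<kappa> u \<omega> = \<nu> u \<omega>"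
  shows "AE \<omega> in C. \<omega> \<in> A \<longrightarrow> after \<kappa> s \<omega> = after \<nu> s \<omega>"
proof -
  have "AE \<omega> in C. \<omega> \<in> A \<longrightarrow> dens \<kappa> (s \<omega>) T \<omega> = dens \<nu> (s \<omega>) T \<omega>"
  proof (rule AE_levels[OF s])
    fix v assume "v \<in> s ` \<Omega>"
    then have v: "r \<le> v" "v \<le> T" using times_values[OF s] by auto
    have "AE \<omega> in C. \<omega> \<in> A \<inter> {\<omega> \<in> \<Omega>. s \<omega> = v} \<longrightarrow> dens \<kappa> v T \<omega> = dens \<nu> v T \<omega>"
      by (rule dens_local[OF c v order_refl S_level[OF s A]]) (use eq in auto)
    with AE_space show "AE \<omega> in C. s \<omega> = v \<longrightarrow> \<omega> \<in> A \<longrightarrow> dens \<kappa> v T \<omega> = dens \<nu> v T \<omega>"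
      by eventually_elim auto
  qed
  then show ?thesis by (simp add: after_def)
qed

subsection \<open>Pasting\<close>

text \<open>The strict inequality leaves time s itself to \<mu>, in accordance with intervals that
  are open on the left. With A the whole space this is composition at s; a smaller A gives
  bifurcation.\<close>

definition paste :: "('n path \<Rightarrow> real) \<Rightarrow> 'n path set \<Rightarrow> (real \<Rightarrow> 'n path \<Rightarrow> real ^ 'n) \<Rightarrow> (real \<Rightarrow> 'n path \<Rightarrow> real ^ 'n) \<Rightarrow> real \<Rightarrow> 'n path \<Rightarrow> real ^ 'n" where
  "paste s A \<mu> \<nu> u \<omega> = (if s \<omega> < u \<and> \<omega> \<in> A then \<nu> u \<omega> else \<mu> u \<omega>)"

text \<open>The decision times of both controls and the values of s are put together. If none of
  them lies strictly between a and b, then s < u for u in (a, b] means s \<le> a, so whether \<mu>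
  or \<nu> is followed is an event known at a.\<close>

lemma paste_control:
  assumes c: "\<mu> \<in> controls" "\<nu> \<in> controls" and s: "s \<in> times" and A: "A \<in> sets (S s)"
  shows "paste s A \<mu> \<nu> \<in> controls"
proof -
  obtain P1 P2 where P: "simple_off P1 \<mu>" "simple_off P2 \<nu>" using simple_controls_simple_off c by blast
  let ?P = "P1 \<union> P2 \<union> s ` \<Omega>"
  have fin: "finite ?P" using P timesD(4)[OF s] by (simp add: simple_off_def)
  have "simple_off ?P (paste s A \<mu> \<nu>)"
    unfolding simple_off_def
  proof (intro conjI allI impI fin)
    fix a b assume ab: "r \<le> a \<and> a < b \<and> b \<le> T \<and> {a<..<b} \<inter> ?P = {}"
    have "{a<..<b} \<inter> P1 = {}" "{a<..<b} \<inter> P2 = {}" using ab by auto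
    then have on: "simple_on a b \<mu>" "simple_on a b \<nu>" using P ab unfolding simple_off_def by simp_all
    obtain L1 c1 where
      1: "finite L1" "L1 \<subseteq> feedbacks" "c1 ` \<Omega> \<subseteq> L1" "\<forall>l\<in>L1. {\<omega> \<in> \<Omega>. c1 \<omega> = l} \<in> sets (F a)"
        "\<forall>u \<omega>. a < u \<and> u \<le> b \<and> \<omega> \<in> \<Omega> \<longrightarrow> \<mu> u \<omega> = c1 \<omega> u (\<omega> u)"
      using on(1) unfolding simple_on_def by blast
    obtain L2 c2 where
      2: "finite L2" "L2 \<subseteq> feedbacks" "c2 ` \<Omega> \<subseteq> L2" "\<forall>l\<in>L2. {\<omega> \<in> \<Omega>. c2 \<omega> = l} \<in> sets (F a)"
        "\<forall>u \<omega>. a < u \<and> u \<le> b \<and> \<omega> \<in> \<Omega> \<longrightarrow> \<nu> u \<omega> = c2 \<omega> u (\<omega> u)"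
      using on(2) unfolding simple_on_def by blast
    define B where "B = {\<omega> \<in> A. s \<omega> \<le> a}"
    have BF: "B \<in> sets (F a)" unfolding B_def by (rule below_F[OF s A])
    have B\<Omega>: "B \<subseteq> \<Omega>" using S_subset[OF A] by (auto simp: B_def)
    define c where "c \<omega> = (if \<omega> \<in> B then c2 \<omega> else c1 \<omega>)" for \<omega>
    have lev: "{\<omega> \<in> \<Omega>. ci \<omega> = l} \<in> sets (F a)" if "ci ` \<Omega> \<subseteq> L" "\<forall>l\<in>L. {\<omega> \<in> \<Omega>. ci \<omega> = l} \<in> sets (F a)" for ci l L
    proof (cases "l \<in> L")
      case False
      then have e: "{\<omega> \<in> \<Omega>. ci \<omega> = l} = {}" using that(1) by auto
      show ?thesis unfolding e by (rule sets.empty_sets)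
    qed (use that(2) in blast)
    show "simple_on a b (paste s A \<mu> \<nu>)"
      unfolding simple_on_def
    proof (intro exI[of _ "L1 \<union> L2"] exI[of _ c] conjI ballI allI impI)
      show "finite (L1 \<union> L2)" "L1 \<union> L2 \<subseteq> feedbacks" using 1 2 by auto
      show "c ` \<Omega> \<subseteq> L1 \<union> L2" using 1(3) 2(3) by (auto simp: c_def)
      fix l
      have "{\<omega> \<in> \<Omega>. c \<omega> = l} = (B \<inter> {\<omega> \<in> \<Omega>. c2 \<omega> = l}) \<union> ({\<omega> \<in> \<Omega>. c1 \<omega> = l} - B)"
        using B\<Omega> by (auto simp: c_def)
      then show "{\<omega> \<in> \<Omega>. c \<omega> = l} \<in> sets (F a)"
        using BF lev[OF 1(3,4), of l] lev[OF 2(3,4), of l] by simp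
    next
      fix u \<omega> assume u: "a < u \<and> u \<le> b \<and> \<omega> \<in> \<Omega>"
      have "s \<omega> \<notin> {a<..<b}" using ab u by auto
      then have "s \<omega> < u \<longleftrightarrow> s \<omega> \<le> a" using u by auto
      then show "paste s A \<mu> \<nu> u \<omega> = c \<omega> u (\<omega> u)"
        using 1(5) 2(5) u by (auto simp: paste_def c_def B_def)
    qed
  qed
  then show ?thesis by (rule simple_off_simple_controls)
qed

subsection \<open>Conditional expectations under pasted controls\<close>

text \<open>The density after s has unit conditional expectation given the past at s, so against a
  variable known at s only the factor before s is left.\<close>

lemma nn_integral_M_before:
  assumes \<mu>: "\<mu> \<in> controls" and s: "s \<in> times" and Z: "Z \<in> borel_measurable (S s)"
  shows "(\<integral>\<^sup>+\<omega>. Z \<omega> \<partial>M \<mu>) = (\<integral>\<^sup>+\<omega>. Z \<omega> * ennreal (before \<mu> s \<omega>) \<partial>C)"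
proof -
  have "(\<integral>\<^sup>+\<omega>. Z \<omega> \<partial>M \<mu>) = (\<integral>\<^sup>+\<omega>. Z \<omega> * ennreal (dens \<mu> r T \<omega>) \<partial>C)"
    by (rule nn_integral_M[OF \<mu> measurable_from_subalg[OF subalgebra_FS[OF s] Z]])
  also have "\<dots> = (\<integral>\<^sup>+\<omega>. (Z \<omega> * ennreal (before \<mu> s \<omega>)) * ennreal (after \<mu> s \<omega>) \<partial>C)"
    using dens_before_after[OF \<mu> s]
    by (intro nn_integral_cong_AE, eventually_elim) (simp add: ennreal_mult less_imp_le[OF before_pos] less_imp_le[OF after_pos] mult.assoc)
  also have "\<dots> = (\<integral>\<^sup>+\<omega>. Z \<omega> * ennreal (before \<mu> s \<omega>) \<partial>C)"
    using before_measurable[OF \<mu> s] Z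
    by (intro cond_unit_nn_integral[OF subalgebra_CS[OF s] after_unit[OF \<mu> s]] borel_measurable_times_ennreal) auto
  finally show ?thesis .
qed

lemma cond_subalgebra: "\<mu> \<in> controls \<Longrightarrow> s \<in> times \<Longrightarrow> sigma_finite_subalgebra (M \<mu>) (S s)"
proof -
  assume \<mu>: "\<mu> \<in> controls" and s: "s \<in> times"
  interpret prob_space "M \<mu>" by (rule prob_M[OF \<mu>])
  interpret finite_measure_subalgebra "M \<mu>" "S s" by unfold_locales (rule subalgebra_MS[OF s])
  show ?thesis by unfold_locales
qed

text \<open>By \<open>nn_integral_M_before\<close> the two measures coincide on \<open>S s\<close>,
  and both the variable and the conditioning sets live there.\<close>

lemma nn_cond_exp_before:
  assumes c: "\<kappa> \<in> controls" "\<mu> \<in> controls" and s: "s \<in> times" and s0: "s0 \<in> times" "\<And>\<omega>. \<omega> \<in> \<Omega> \<Longrightarrow> s0 \<omega> \<le> s \<omega>"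
    and eq: "\<And>u \<omega>. r < u \<Longrightarrow> u \<le> s \<omega> \<Longrightarrow> \<omega> \<in> \<Omega> \<Longrightarrow> \<kappa> u \<omega> = \<mu> u \<omega>" and Z: "Z \<in> borel_measurable (S s)"
  shows "AE \<omega> in C. nn_cond_exp (M \<kappa>) (S s0) Z \<omega> = nn_cond_exp (M \<mu>) (S s0) Z \<omega>"
proof -
  interpret K: sigma_finite_subalgebra "M \<kappa>" "S s0" by (rule cond_subalgebra[OF c(1) s0(1)])
  interpret L: sigma_finite_subalgebra "M \<mu>" "S s0" by (rule cond_subalgebra[OF c(2) s0(1)])
  have bc: "AE \<omega> in C. before \<kappa> s \<omega> = before \<mu> s \<omega>" by (rule before_cong[OF c s], rule eq)
  have same: "(\<integral>\<^sup>+\<omega>. W \<omega> \<partial>M \<kappa>) = (\<integral>\<^sup>+\<omega>. W \<omega> \<partial>M \<mu>)" if W: "W \<in> borel_measurable (S s)" for W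
    unfolding nn_integral_M_before[OF c(1) s W] nn_integral_M_before[OF c(2) s W]
    using bc by (intro nn_integral_cong_AE, eventually_elim) simp
  have sub: "subalgebra (S s) (S s0)" by (rule subalgebra_SS[OF s0(1) s s0(2)])
  have ZF: "Z \<in> borel_measurable (F T)" by (rule measurable_from_subalg[OF subalgebra_FS[OF s] Z])
  have n: "nn_cond_exp (M \<mu>) (S s0) Z \<in> borel_measurable (S s0)" by simp
  have "AE \<omega> in M \<kappa>. nn_cond_exp (M \<mu>) (S s0) Z \<omega> = nn_cond_exp (M \<kappa>) (S s0) Z \<omega>"
  proof (rule K.nn_cond_exp_charact)
    fix A assume A: "A \<in> sets (S s0)"
    then have A': "A \<in> sets (S s)" using sub by (auto simp: subalgebra_def)
    have "(\<integral>\<^sup>+\<omega>\<in>A. Z \<omega> \<partial>M \<kappa>) = (\<integral>\<^sup>+\<omega>\<in>A. Z \<omega> \<partial>M \<mu>)"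
      by (rule same) (use Z A' in auto)
    also have "\<dots> = (\<integral>\<^sup>+\<omega>. indicator A \<omega> * Z \<omega> \<partial>M \<mu>)" by (simp add: mult.commute)
    also have "\<dots> = (\<integral>\<^sup>+\<omega>. indicator A \<omega> * nn_cond_exp (M \<mu>) (S s0) Z \<omega> \<partial>M \<mu>)"
      by (rule L.nn_cond_exp_intg[symmetric]) (use A ZF in \<open>auto simp: measurable_cong_sets[OF sets_M refl]\<close>)
    also have "\<dots> = (\<integral>\<^sup>+\<omega>\<in>A. nn_cond_exp (M \<mu>) (S s0) Z \<omega> \<partial>M \<mu>)" by (simp add: mult.commute)
    also have "\<dots> = (\<integral>\<^sup>+\<omega>\<in>A. nn_cond_exp (M \<mu>) (S s0) Z \<omega> \<partial>M \<kappa>)"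
      by (rule same[symmetric]) (use measurable_from_subalg[OF sub n] A' in auto)
    finally show "(\<integral>\<^sup>+\<omega>\<in>A. Z \<omega> \<partial>M \<kappa>) = (\<integral>\<^sup>+\<omega>\<in>A. nn_cond_exp (M \<mu>) (S s0) Z \<omega> \<partial>M \<kappa>)" .
  qed (use ZF n in \<open>simp_all add: measurable_cong_sets[OF sets_M refl]\<close>)
  then show ?thesis unfolding AE_M[OF c(1)] by eventually_elim simp
qed

text \<open>Bayes' formula: only the density after \<open>s\<close> enters the conditional expectation given \<open>S s\<close>.\<close>

lemma nn_cond_exp_after:
  assumes c: "\<kappa> \<in> controls" "\<nu> \<in> controls" and s: "s \<in> times" and A: "A \<in> sets (S s)"
    and eq: "\<And>u \<omega>. s \<omega> < u \<Longrightarrow> u \<le> T \<Longrightarrow> \<omega> \<in> A \<Longrightarrow> \<kappa> u \<omega> = \<nu> u \<omega>" and W: "W \<in> borel_measurable (F T)"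
  shows "AE \<omega> in C. \<omega> \<in> A \<longrightarrow> nn_cond_exp (M \<kappa>) (S s) W \<omega> = nn_cond_exp (M \<nu>) (S s) W \<omega>"
proof -
  interpret K: sigma_finite_subalgebra "M \<kappa>" "S s" by (rule cond_subalgebra[OF c(1) s])
  interpret L: sigma_finite_subalgebra "M \<nu>" "S s" by (rule cond_subalgebra[OF c(2) s])
  let ?N = "nn_cond_exp (M \<nu>) (S s) W" and ?K = "nn_cond_exp (M \<kappa>) (S s) W"
  have N: "?N \<in> borel_measurable (S s)" and KM: "?K \<in> borel_measurable (S s)" by simp_all
  have WM: "W \<in> borel_measurable (M m)" for m using W by (simp add: measurable_cong_sets[OF sets_M refl])
  have ac: "AE \<omega> in C. \<omega> \<in> A \<longrightarrow> after \<kappa> s \<omega> = after \<nu> s \<omega>" by (rule after_cong[OF c s A], rule eq)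
  \<comment> \<open>The ratio of the densities before s is known at s, so it can be moved into the
    test function of the conditional expectation.\<close>
  define q where "q \<omega> = ennreal (before \<kappa> s \<omega> / before \<nu> s \<omega>)" for \<omega>
  have qm: "q \<in> borel_measurable (S s)"
    unfolding q_def[abs_def] using before_measurable[OF c(1) s] before_measurable[OF c(2) s] by simp
  have change: "(\<integral>\<^sup>+\<omega>. indicator B \<omega> * V \<omega> \<partial>M \<kappa>) = (\<integral>\<^sup>+\<omega>. (indicator B \<omega> * q \<omega>) * V \<omega> \<partial>M \<nu>)"
    if V: "V \<in> borel_measurable (F T)" and B: "B \<in> sets (S s)" "B \<subseteq> A" for V B
  proof -
    have Bm: "(indicator B :: _ \<Rightarrow> ennreal) \<in> borel_measurable (F T)" using B sets_S_F[OF s] by (intro borel_measurable_indicator) auto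
    have qF: "q \<in> borel_measurable (F T)" by (rule measurable_from_subalg[OF subalgebra_FS[OF s] qm])
    have "(\<integral>\<^sup>+\<omega>. indicator B \<omega> * V \<omega> \<partial>M \<kappa>) = (\<integral>\<^sup>+\<omega>. (indicator B \<omega> * V \<omega>) * ennreal (dens \<kappa> r T \<omega>) \<partial>C)"
      by (intro nn_integral_M[OF c(1)] borel_measurable_times_ennreal Bm V)
    also have "\<dots> = (\<integral>\<^sup>+\<omega>. ((indicator B \<omega> * q \<omega>) * V \<omega>) * ennreal (dens \<nu> r T \<omega>) \<partial>C)"
    proof (rule nn_integral_cong_AE, use dens_before_after[OF c(1) s] dens_before_after[OF c(2) s] ac in eventually_elim)
      fix \<omega> assume d: "dens \<kappa> r T \<omega> = before \<kappa> s \<omega> * after \<kappa> s \<omega>" "dens \<nu> r T \<omega> = before \<nu> s \<omega> * after \<nu> s \<omega>"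
        and a: "\<omega> \<in> A \<longrightarrow> after \<kappa> s \<omega> = after \<nu> s \<omega>"
      show "(indicator B \<omega> * V \<omega>) * ennreal (dens \<kappa> r T \<omega>) = ((indicator B \<omega> * q \<omega>) * V \<omega>) * ennreal (dens \<nu> r T \<omega>)"
      proof (cases "\<omega> \<in> B")
        case True
        then have "after \<kappa> s \<omega> = after \<nu> s \<omega>" using a B by auto
        then have "dens \<kappa> r T \<omega> = (before \<kappa> s \<omega> / before \<nu> s \<omega>) * dens \<nu> r T \<omega>"
          unfolding d using before_pos[of \<nu> s \<omega>] by simp
        then have "ennreal (dens \<kappa> r T \<omega>) = q \<omega> * ennreal (dens \<nu> r T \<omega>)"
          unfolding q_def using before_pos[of \<kappa> s \<omega>] before_pos[of \<nu> s \<omega>] dens_nonneg[of \<nu> r T \<omega>]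
          by (simp add: ennreal_mult[symmetric])
        then show ?thesis by (simp add: mult_ac)
      qed simp
    qed
    also have "\<dots> = (\<integral>\<^sup>+\<omega>. (indicator B \<omega> * q \<omega>) * V \<omega> \<partial>M \<nu>)"
      by (intro nn_integral_M[OF c(2), symmetric] borel_measurable_times_ennreal Bm V qF)
    finally show ?thesis .
  qed
  \<comment> \<open>Outside A the candidate is completed by the conditional expectation under
    \<kappa> itself, so that it can be tested against every set of the stopped algebra.\<close>
  define h where "h \<omega> = (if \<omega> \<in> A then ?N \<omega> else ?K \<omega>)" for \<omega>
  have "AE \<omega> in M \<kappa>. h \<omega> = ?K \<omega>"
  proof (rule K.nn_cond_exp_charact)
    show "h \<in> borel_measurable (S s)"
      unfolding h_def[abs_def] by (rule measurable_If_set[OF N KM]) (use A S_subset[OF A] in \<open>simp add: Int_absorb2\<close>)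
    fix B assume B: "B \<in> sets (S s)"
    have BA: "B \<inter> A \<in> sets (S s)" "B - A \<in> sets (S s)" using A B by auto
    have NF: "?N \<in> borel_measurable (F T)" by (rule measurable_from_subalg[OF subalgebra_FS[OF s] N])
    have 1: "(\<integral>\<^sup>+\<omega>. indicator (B \<inter> A) \<omega> * W \<omega> \<partial>M \<kappa>) = (\<integral>\<^sup>+\<omega>. indicator (B \<inter> A) \<omega> * ?N \<omega> \<partial>M \<kappa>)"
    proof -
      have bq: "(\<lambda>\<omega>. indicator (B \<inter> A) \<omega> * q \<omega>) \<in> borel_measurable (S s)"
        by (intro borel_measurable_times_ennreal borel_measurable_indicator BA qm)
      have "(\<integral>\<^sup>+\<omega>. indicator (B \<inter> A) \<omega> * W \<omega> \<partial>M \<kappa>) = (\<integral>\<^sup>+\<omega>. (indicator (B \<inter> A) \<omega> * q \<omega>) * W \<omega> \<partial>M \<nu>)"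
        by (rule change[OF W BA(1)]) simp
      also have "\<dots> = (\<integral>\<^sup>+\<omega>. (indicator (B \<inter> A) \<omega> * q \<omega>) * ?N \<omega> \<partial>M \<nu>)"
        by (rule L.nn_cond_exp_intg[OF bq WM, symmetric])
      also have "\<dots> = (\<integral>\<^sup>+\<omega>. indicator (B \<inter> A) \<omega> * ?N \<omega> \<partial>M \<kappa>)"
        by (rule change[OF NF BA(1), symmetric]) simp
      finally show ?thesis .
    qed
    have 2: "(\<integral>\<^sup>+\<omega>. indicator (B - A) \<omega> * W \<omega> \<partial>M \<kappa>) = (\<integral>\<^sup>+\<omega>. indicator (B - A) \<omega> * ?K \<omega> \<partial>M \<kappa>)"
      by (rule K.nn_cond_exp_intg[OF borel_measurable_indicator[OF BA(2)] WM, symmetric])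
    have iM: "(indicator D :: _ \<Rightarrow> ennreal) \<in> borel_measurable (M \<kappa>)" if "D \<in> sets (S s)" for D
      using that sets_S_F[OF s] by (intro borel_measurable_indicator) auto
    have NM: "?N \<in> borel_measurable (M \<kappa>)" using NF by (simp add: measurable_cong_sets[OF sets_M refl])
    have KMM: "?K \<in> borel_measurable (M \<kappa>)" by simp
    have "(\<integral>\<^sup>+\<omega>\<in>B. W \<omega> \<partial>M \<kappa>) = (\<integral>\<^sup>+\<omega>. indicator (B \<inter> A) \<omega> * W \<omega> + indicator (B - A) \<omega> * W \<omega> \<partial>M \<kappa>)"
      by (intro nn_integral_cong) (auto simp: indicator_def)
    also have "\<dots> = (\<integral>\<^sup>+\<omega>. indicator (B \<inter> A) \<omega> * W \<omega> \<partial>M \<kappa>) + (\<integral>\<^sup>+\<omega>. indicator (B - A) \<omega> * W \<omega> \<partial>M \<kappa>)"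
      by (intro nn_integral_add borel_measurable_times_ennreal iM BA WM)
    also have "\<dots> = (\<integral>\<^sup>+\<omega>. indicator (B \<inter> A) \<omega> * ?N \<omega> \<partial>M \<kappa>) + (\<integral>\<^sup>+\<omega>. indicator (B - A) \<omega> * ?K \<omega> \<partial>M \<kappa>)"
      unfolding 1 2 ..
    also have "\<dots> = (\<integral>\<^sup>+\<omega>. indicator (B \<inter> A) \<omega> * ?N \<omega> + indicator (B - A) \<omega> * ?K \<omega> \<partial>M \<kappa>)"
      by (intro nn_integral_add[symmetric] borel_measurable_times_ennreal iM BA NM KMM)
    also have "\<dots> = (\<integral>\<^sup>+\<omega>\<in>B. h \<omega> \<partial>M \<kappa>)"
      by (intro nn_integral_cong) (auto simp: indicator_def h_def)
    finally show "(\<integral>\<^sup>+\<omega>\<in>B. W \<omega> \<partial>M \<kappa>) = (\<integral>\<^sup>+\<omega>\<in>B. h \<omega> \<partial>M \<kappa>)" .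
  qed (rule WM)
  then show ?thesis unfolding AE_M[OF c(1)] by eventually_elim (auto simp: h_def)
qed

lemma ereal_cond_exp_before:
  assumes "\<kappa> \<in> controls" "\<mu> \<in> controls" "s \<in> times" "s0 \<in> times" "\<And>\<omega>. \<omega> \<in> \<Omega> \<Longrightarrow> s0 \<omega> \<le> s \<omega>"
    and "\<And>u \<omega>. r < u \<Longrightarrow> u \<le> s \<omega> \<Longrightarrow> \<omega> \<in> \<Omega> \<Longrightarrow> \<kappa> u \<omega> = \<mu> u \<omega>" and Z: "Z \<in> borel_measurable (S s)"
  shows "AE \<omega> in C. ereal_cond_exp (M \<kappa>) (S s0) Z \<omega> = ereal_cond_exp (M \<mu>) (S s0) Z \<omega>"
proof -
  have m: "(\<lambda>\<omega>. e2ennreal (Z \<omega>)) \<in> borel_measurable (S s)" "(\<lambda>\<omega>. e2ennreal (- Z \<omega>)) \<in> borel_measurable (S s)"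
    using Z by auto
  have "AE \<omega> in C. nn_cond_exp (M \<kappa>) (S s0) W \<omega> = nn_cond_exp (M \<mu>) (S s0) W \<omega>"
    if "W \<in> borel_measurable (S s)" for W
    by (rule nn_cond_exp_before[OF assms(1-4) _ _ that]) (fact assms(5), rule assms(6))
  from this[OF m(1)] this[OF m(2)]
  show ?thesis by eventually_elim (simp add: ereal_cond_exp_def)
qed

lemma ereal_cond_exp_after:
  assumes "\<kappa> \<in> controls" "\<nu> \<in> controls" "s \<in> times" "A \<in> sets (S s)"
    and "\<And>u \<omega>. s \<omega> < u \<Longrightarrow> u \<le> T \<Longrightarrow> \<omega> \<in> A \<Longrightarrow> \<kappa> u \<omega> = \<nu> u \<omega>" and Z: "Z \<in> borel_measurable (F T)"
  shows "AE \<omega> in C. \<omega> \<in> A \<longrightarrow> ereal_cond_exp (M \<kappa>) (S s) Z \<omega> = ereal_cond_exp (M \<nu>) (S s) Z \<omega>"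
proof -
  have m: "(\<lambda>\<omega>. e2ennreal (Z \<omega>)) \<in> borel_measurable (F T)" "(\<lambda>\<omega>. e2ennreal (- Z \<omega>)) \<in> borel_measurable (F T)"
    using Z by auto
  have "AE \<omega> in C. \<omega> \<in> A \<longrightarrow> nn_cond_exp (M \<kappa>) (S s) W \<omega> = nn_cond_exp (M \<nu>) (S s) W \<omega>"
    if "W \<in> borel_measurable (F T)" for W
    by (rule nn_cond_exp_after[OF assms(1-4) _ that]) (rule assms(5))
  from this[OF m(1)] this[OF m(2)]
  show ?thesis by eventually_elim (simp add: ereal_cond_exp_def)
qed

end

section \<open>Running costs\<close>

lemma abs_real_of_ereal_le: "\<bar>z\<bar> \<le> ereal k \<Longrightarrow> \<bar>real_of_ereal z\<bar> \<le> k"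
  by (cases z) auto

lemma mult_le_sum_squares: "0 \<le> a \<Longrightarrow> 0 \<le> b \<Longrightarrow> (a::real) * b \<le> a\<^sup>2 + b\<^sup>2"
  using sum_squares_bound[of a b] mult_nonneg_nonneg[of a b] by linarith

lemma square_one_plus_le: "(1 + a)\<^sup>2 \<le> 2 + 2 * (a::real)\<^sup>2"
  using sum_squares_bound[of 1 a] by (simp add: power2_sum)

lemma power_le_fact_exp:
  fixes x :: real
  assumes "0 \<le> x"
  shows "x ^ m \<le> fact m * exp x"
proof -
  have s: "(\<lambda>n. inverse (fact n) * x ^ n) sums exp x" using exp_converges[of x] by (simp add: scaleR_conv_of_real)
  have "(\<Sum>n\<in>{m}. inverse (fact n) * x ^ n) \<le> exp x"
    unfolding sums_unique[OF s] by (rule sum_le_suminf[OF sums_summable[OF s]]) (use assms in auto)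
  then show ?thesis by (simp add: field_simps)
qed

text \<open>The norm is at most n times the largest coordinate in absolute value, and the m-th power
  of that is at most m! times its exponential, which the sum dominates for either sign. Exponential
  moments along the axes thus control all polynomial moments.\<close>

lemma norm_power_le_sum_exp:
  fixes x :: "real ^ 'n"
  shows "norm x ^ m \<le> (real CARD('n)) ^ m * fact m * (\<Sum>i\<in>UNIV. exp (x $ i) + exp (- x $ i))"
proof -
  define b where "b = Max (range (\<lambda>i. \<bar>x $ i\<bar>))"
  have "b \<in> range (\<lambda>i. \<bar>x $ i\<bar>)" unfolding b_def by (rule Max_in) auto
  then obtain j where j: "b = \<bar>x $ j\<bar>" by auto
  have le: "\<bar>x $ i\<bar> \<le> b" for i unfolding b_def by (rule Max_ge) auto
  have "norm x \<le> (\<Sum>i\<in>UNIV. \<bar>x $ i\<bar>)" by (rule norm_le_l1_cart)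
  also have "\<dots> \<le> (\<Sum>i\<in>(UNIV::'n set). b)" by (intro sum_mono le)
  finally have "norm x \<le> real CARD('n) * b" by simp
  then have "norm x ^ m \<le> (real CARD('n) * b) ^ m" by (intro power_mono) auto
  also have "\<dots> = real CARD('n) ^ m * b ^ m" by (rule power_mult_distrib)
  also have "\<dots> \<le> real CARD('n) ^ m * (fact m * (\<Sum>i\<in>UNIV. exp (x $ i) + exp (- x $ i)))"
  proof (intro mult_left_mono)
    have "b ^ m \<le> fact m * exp b" by (rule power_le_fact_exp) (simp add: j)
    also have "exp b \<le> exp (x $ j) + exp (- x $ j)" unfolding j by (auto simp: abs_if add_increasing add_increasing2)
    also have "\<dots> \<le> (\<Sum>i\<in>UNIV. exp (x $ i) + exp (- x $ i))"
      by (rule member_le_sum) (auto intro: add_nonneg_nonneg)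
    finally show "b ^ m \<le> fact m * (\<Sum>i\<in>UNIV. exp (x $ i) + exp (- x $ i))" by simp
  qed simp
  finally show ?thesis by (simp add: mult.assoc)
qed

context driftless_diffusion begin

lemma AE_start: "AE \<omega> in C. \<omega> r = y"
proof -
  interpret Q: prob_space Q by (rule prob_Q)
  have m: "measure Q {\<omega> \<in> space Q. \<omega> r = y} = 1" using mp by (simp add: martingale_problem_def)
  have "AE \<omega> in Q. \<omega> \<in> {\<omega> \<in> space Q. \<omega> r = y}" by (rule Q.AE_prob_1[OF m])
  then have "AE \<omega> in Q. \<omega> r = y" by eventually_elim simp
  then show ?thesis by (rule AE_completion)
qed

text \<open>With the starting point y, the product of \<theta> and the position at u is the exponent
  of \<open>exp_increment_const\<close> plus a constant and half of a bounded quadratic variation;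
  the remaining exponential has mean one.\<close>

lemma exp_moment:
  assumes u: "r \<le> u"
  shows "(\<integral>\<^sup>+\<omega>. ennreal (exp (\<theta> \<bullet> \<omega> u)) \<partial>C) \<le> ennreal (exp (\<theta> \<bullet> y + (K\<sigma> * norm \<theta>)\<^sup>2 * (u - r)))"
proof -
  let ?e = "\<lambda>\<omega>. exp (\<theta> \<bullet> (\<omega> u - \<omega> r) - qvar r u (\<lambda>_ _. \<theta>) \<omega> / 2)"
  let ?k = "exp (\<theta> \<bullet> y + (K\<sigma> * norm \<theta>)\<^sup>2 * (u - r))"
  note e = exp_increment_const[OF order_refl u, of \<theta>]
  have em: "(\<lambda>\<omega>. ennreal (?e \<omega>)) \<in> borel_measurable C" using e by (simp add: cond_unit_def)
  have pr: "progressive r u (\<lambda>_ _. \<theta>)"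
    unfolding progressive_def by (simp add: split_beta')
  have sb: "scaled_bound (K\<sigma> * norm \<theta>) r u (\<lambda>_ _. \<theta>)" by (rule scaled_bound_norm) auto
  have "(\<integral>\<^sup>+\<omega>. ennreal (exp (\<theta> \<bullet> \<omega> u)) \<partial>C) \<le> (\<integral>\<^sup>+\<omega>. ennreal ?k * ennreal (?e \<omega>) \<partial>C)"
  proof (rule nn_integral_mono_AE, use AE_start AE_space in eventually_elim)
    fix \<omega> assume \<omega>: "\<omega> r = y" "\<omega> \<in> space C"
    have q: "qvar r u (\<lambda>_ _. \<theta>) \<omega> \<le> (K\<sigma> * norm \<theta>)\<^sup>2 * (u - r)" "0 \<le> qvar r u (\<lambda>_ _. \<theta>) \<omega>"
      using qvar_le[OF order_refl u pr sb] \<omega> by (auto simp: qvar_nonneg)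
    have "\<theta> \<bullet> \<omega> u \<le> (\<theta> \<bullet> y + (K\<sigma> * norm \<theta>)\<^sup>2 * (u - r)) + (\<theta> \<bullet> (\<omega> u - \<omega> r) - qvar r u (\<lambda>_ _. \<theta>) \<omega> / 2)"
      unfolding inner_diff_right \<omega>(1) using q by linarith
    then have "exp (\<theta> \<bullet> \<omega> u) \<le> ?k * ?e \<omega>" unfolding exp_add[symmetric] by (subst exp_le_cancel_iff)
    then show "ennreal (exp (\<theta> \<bullet> \<omega> u)) \<le> ennreal ?k * ennreal (?e \<omega>)"
      by (subst ennreal_mult[symmetric]) (auto intro: ennreal_leI)
  qed
  also have "\<dots> = ennreal ?k * (\<integral>\<^sup>+\<omega>. 1 * ennreal (?e \<omega>) \<partial>C)" by (simp add: nn_integral_cmult[OF em])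
  also have "(\<integral>\<^sup>+\<omega>. 1 * ennreal (?e \<omega>) \<partial>C) = 1"
    using cond_unit_nn_integral[OF subalgebra_F e, of "\<lambda>_. 1"] C.emeasure_space_1 by simp
  finally show ?thesis by simp
qed

lemma polynomial_moment:
  "\<exists>k. \<forall>u. r \<le> u \<and> u \<le> b \<longrightarrow> (\<integral>\<^sup>+\<omega>. ennreal (norm (\<omega> u) ^ m) \<partial>C) \<le> ennreal k"
proof -
  define c where "c = real CARD('n) ^ m * (fact m :: real)"
  \<comment> \<open>The bound of \<open>exp_moment\<close> taken at the last time b, where it is
    largest, so that one constant serves for all u.\<close>
  define e where "e \<theta> = exp (\<theta> \<bullet> y + (K\<sigma> * norm \<theta>)\<^sup>2 * (b - r))" for \<theta> :: "real ^ 'n"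
  have c0: "0 \<le> c" by (simp add: c_def)
  have "(\<integral>\<^sup>+\<omega>. ennreal (norm (\<omega> u) ^ m) \<partial>C) \<le> ennreal (c * (\<Sum>i\<in>UNIV. e (axis i 1) + e (- axis i 1)))"
    if u: "r \<le> u" "u \<le> b" for u
  proof -
    have [measurable]: "(\<lambda>\<omega>. \<omega> u) \<in> borel_measurable C" by (rule measurable_F_C[OF coordinate_measurable[OF u(1) order_refl]])
    have ee: "(\<integral>\<^sup>+\<omega>. ennreal (exp (\<theta> \<bullet> \<omega> u)) \<partial>C) \<le> ennreal (e \<theta>)" for \<theta>
      by (rule order_trans[OF exp_moment[OF u(1)]]) (use u in \<open>auto simp: e_def intro!: ennreal_leI mult_left_mono\<close>)
    have "(\<integral>\<^sup>+\<omega>. ennreal (norm (\<omega> u) ^ m) \<partial>C)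
        \<le> (\<integral>\<^sup>+\<omega>. ennreal c * (\<Sum>i\<in>UNIV. ennreal (exp (axis i 1 \<bullet> \<omega> u)) + ennreal (exp ((- axis i 1) \<bullet> \<omega> u))) \<partial>C)"
    proof (rule nn_integral_mono)
      fix \<omega> :: "'n path"
      have "norm (\<omega> u) ^ m \<le> c * (\<Sum>i\<in>UNIV. exp (axis i 1 \<bullet> \<omega> u) + exp ((- axis i 1) \<bullet> \<omega> u))"
        using norm_power_le_sum_exp[of "\<omega> u" m] by (simp add: c_def inner_axis')
      then have "ennreal (norm (\<omega> u) ^ m) \<le> ennreal (c * (\<Sum>i\<in>UNIV. exp (axis i 1 \<bullet> \<omega> u) + exp ((- axis i 1) \<bullet> \<omega> u)))"
        by (rule ennreal_leI)
      also have "\<dots> = ennreal c * (\<Sum>i\<in>UNIV. ennreal (exp (axis i 1 \<bullet> \<omega> u)) + ennreal (exp ((- axis i 1) \<bullet> \<omega> u)))"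
        by (subst ennreal_mult[OF c0]) (auto simp: sum_nonneg add_nonneg_nonneg ennreal_plus[symmetric] sum_ennreal simp del: ennreal_plus)
      finally show "ennreal (norm (\<omega> u) ^ m) \<le> \<dots>" .
    qed
    also have "\<dots> = ennreal c * (\<integral>\<^sup>+\<omega>. (\<Sum>i\<in>UNIV. ennreal (exp (axis i 1 \<bullet> \<omega> u)) + ennreal (exp ((- axis i 1) \<bullet> \<omega> u))) \<partial>C)"
      by (rule nn_integral_cmult) measurable
    also have "(\<integral>\<^sup>+\<omega>. (\<Sum>i\<in>UNIV. ennreal (exp (axis i 1 \<bullet> \<omega> u)) + ennreal (exp ((- axis i 1) \<bullet> \<omega> u))) \<partial>C)
        = (\<Sum>i\<in>UNIV. \<integral>\<^sup>+\<omega>. ennreal (exp (axis i 1 \<bullet> \<omega> u)) + ennreal (exp ((- axis i 1) \<bullet> \<omega> u)) \<partial>C)"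
      by (rule nn_integral_sum) measurable
    also have "\<dots> = (\<Sum>i\<in>UNIV. (\<integral>\<^sup>+\<omega>. ennreal (exp (axis i 1 \<bullet> \<omega> u)) \<partial>C) + (\<integral>\<^sup>+\<omega>. ennreal (exp ((- axis i 1) \<bullet> \<omega> u)) \<partial>C))"
      by (intro sum.cong refl nn_integral_add) measurable
    also have "\<dots> \<le> (\<Sum>i\<in>UNIV. ennreal (e (axis i 1)) + ennreal (e (- axis i 1)))" by (intro sum_mono add_mono ee)
    also have "ennreal c * \<dots> = ennreal (c * (\<Sum>i\<in>UNIV. e (axis i 1) + e (- axis i 1)))"
      by (subst ennreal_mult[OF c0]) (auto simp: e_def sum_nonneg add_nonneg_nonneg ennreal_plus[symmetric] sum_ennreal simp del: ennreal_plus)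
    finally show ?thesis by (simp add: mult_left_mono)
  qed
  then show ?thesis by blast
qed

end

context control_problem begin

section \<open>Cost along a control\<close>

lemma control_in_\<Lambda>:
  assumes \<mu>: "\<mu> \<in> controls" and u: "r < u" "u \<le> T" and \<omega>: "\<omega> \<in> \<Omega>"
  shows "\<mu> u \<omega> \<in> \<Lambda> u (\<omega> u)"
proof -
  obtain P where P: "simple_off P \<mu>" using simple_controls_simple_off[OF \<mu>] by blast
  then have fin: "finite (insert r (P \<inter> {r<..<u}))" by (simp add: simple_off_def)
  \<comment> \<open>The last decision time before u, or r: on (a, u] each path follows a single
    feedback, which is a selection of \<Lambda>.\<close>
  define a where "a = Max (insert r (P \<inter> {r<..<u}))"
  have "a \<in> insert r (P \<inter> {r<..<u})" unfolding a_def by (rule Max_in[OF fin]) simp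
  then have a: "r \<le> a" "a < u" using u by auto
  have "w \<le> a" if "w \<in> P" "r < w" "w < u" for w
    unfolding a_def by (rule Max_ge[OF fin]) (use that in simp)
  then have "{a<..<u} \<inter> P = {}" using a by force
  then have "simple_on a u \<mu>" using P a u unfolding simple_off_def by simp
  then obtain L c where L: "L \<subseteq> feedbacks" "c ` \<Omega> \<subseteq> L" "\<forall>v \<omega>. a < v \<and> v \<le> u \<and> \<omega> \<in> \<Omega> \<longrightarrow> \<mu> v \<omega> = c \<omega> v (\<omega> v)"
    unfolding simple_on_def by blast
  have "c \<omega> \<in> feedbacks" using L(1,2) \<omega> by blast
  then show ?thesis using L(3) a u \<omega> r_nonneg by (auto simp: feedbacks_def selections_def)
qed

definition rate :: "(real \<Rightarrow> 'n path \<Rightarrow> real ^ 'n) \<Rightarrow> real \<Rightarrow> 'n path \<Rightarrow> real" where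
  "rate \<mu> u \<omega> = real_of_ereal (g u (\<omega> u) (\<mu> u \<omega>))"

definition growth :: "real \<times> nat" where
  "growth = (SOME (K, m). 0 < K \<and> (\<forall>u\<ge>0. \<forall>x. (SUP l\<in>\<Lambda> u x. \<bar>g u x l\<bar>) \<le> ereal (K * (1 + norm x ^ m))))"

text \<open>A bound on the rate that does not involve the control, so that it can be estimated at
  each time from the position alone.\<close>

definition envelope :: "real \<Rightarrow> 'n path \<Rightarrow> real" where
  "envelope u \<omega> = fst growth * (1 + norm (\<omega> u) ^ snd growth)"

lemma growth: "0 < fst growth"
  "0 \<le> u \<Longrightarrow> (SUP l\<in>\<Lambda> u x. \<bar>g u x l\<bar>) \<le> ereal (fst growth * (1 + norm x ^ snd growth))"
proof -
  have "\<exists>z. case z of (K, m) \<Rightarrow> 0 < K \<and> (\<forall>u\<ge>0. \<forall>x. (SUP l\<in>\<Lambda> u x. \<bar>g u x l\<bar>) \<le> ereal (K * (1 + norm x ^ m)))"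
    using g_growth unfolding polynomial_growth_on_def by blast
  from someI_ex[OF this, folded growth_def]
  have "0 < fst growth \<and> (\<forall>u\<ge>0. \<forall>x. (SUP l\<in>\<Lambda> u x. \<bar>g u x l\<bar>) \<le> ereal (fst growth * (1 + norm x ^ snd growth)))"
    by (simp add: split_beta)
  then show "0 < fst growth"
    "0 \<le> u \<Longrightarrow> (SUP l\<in>\<Lambda> u x. \<bar>g u x l\<bar>) \<le> ereal (fst growth * (1 + norm x ^ snd growth))" by blast+
qed

lemma envelope_nonneg: "0 \<le> envelope u \<omega>"
  using growth(1) by (simp add: envelope_def)

lemma rate_bound:
  assumes "\<mu> \<in> controls" "r < u" "u \<le> T" "\<omega> \<in> \<Omega>"
  shows "\<bar>rate \<mu> u \<omega>\<bar> \<le> envelope u \<omega>"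
proof -
  have u: "0 \<le> u" using assms r_nonneg by simp
  have "\<bar>g u (\<omega> u) (\<mu> u \<omega>)\<bar> \<le> (SUP l\<in>\<Lambda> u (\<omega> u). \<bar>g u (\<omega> u) l\<bar>)"
    by (rule SUP_upper) (rule control_in_\<Lambda>[OF assms])
  from order_trans[OF this growth(2)[OF u]] show ?thesis
    unfolding rate_def envelope_def by (rule abs_real_of_ereal_le)
qed

lemma rate_measurable:
  assumes \<mu>: "\<mu> \<in> controls" and le: "r \<le> a" "a \<le> b" "b \<le> T"
  shows "(\<lambda>(u, \<omega>). indicator {a<..b} u *\<^sub>R rate \<mu> u \<omega>) \<in> borel_measurable (borel \<Otimes>\<^sub>M F b)"
proof -
  have rb: "r \<le> b" using le by simp
  have P: "progressive a b (integrand \<mu>)" using good_stoch[OF \<mu> le] by (simp add: good_def)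
  let ?N = "borel \<Otimes>\<^sub>M F b :: (real \<times> 'n path) measure"
  \<comment> \<open>Joint measurability of \<mu> is not part of its definition; on (a, b] it is
    recovered as the \<open>scaled\<close> integrand, which is jointly measurable. The clamped time
    stays nonnegative, where g is Borel.\<close>
  define V where "V z = (clamp_time b (fst z), snd z (clamp_time b (fst z)), scaled a b (integrand \<mu>) (fst z) (snd z))" for z :: "real \<times> 'n path"
  have 1: "(\<lambda>z. clamp_time b (fst z)) \<in> borel_measurable ?N" unfolding clamp_time_def by measurable
  have 2: "(\<lambda>z. snd z (clamp_time b (fst z))) \<in> borel_measurable ?N" using stopped_path_measurable[OF rb] by (simp add: split_beta')
  have 3: "(\<lambda>z. scaled a b (integrand \<mu>) (fst z) (snd z)) \<in> borel_measurable ?N"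
    using scaled_measurable[OF le(1,2) P] by (simp add: split_beta')
  have "V \<in> borel_measurable ?N" unfolding V_def[abs_def] by (intro borel_measurable_Pair 1 2 3)
  then have "V \<in> measurable ?N (restrict_space borel ({0..} \<times> UNIV))"
  proof (rule measurable_restrict_space2[rotated])
    show "V \<in> space ?N \<rightarrow> {0..} \<times> UNIV"
      using order_trans[OF r_nonneg clamp_time_ge] by (auto simp: V_def)
  qed
  from measurable_compose[OF this g_measurable]
  have "(\<lambda>z. indicator {a<..b} (fst z) *\<^sub>R real_of_ereal (case V z of (u, x, l) \<Rightarrow> g u x l)) \<in> borel_measurable ?N" by measurable
  also have "(\<lambda>z. indicator {a<..b} (fst z) *\<^sub>R real_of_ereal (case V z of (u, x, l) \<Rightarrow> g u x l))
      = (\<lambda>(u, \<omega>). indicator {a<..b} u *\<^sub>R rate \<mu> u \<omega>)"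
  proof (rule ext, clarify)
    fix u and \<omega> :: "'n path"
    show "indicator {a<..b} (fst (u, \<omega>)) *\<^sub>R real_of_ereal (case V (u, \<omega>) of (u, x, l) \<Rightarrow> g u x l) = indicator {a<..b} u *\<^sub>R rate \<mu> u \<omega>"
    proof (cases "u \<in> {a<..b}")
      case True
      then have "clamp_time b u = u" "scaled a b (integrand \<mu>) u \<omega> = \<mu> u \<omega>"
        using le r_nonneg by (auto simp: clamp_time_eq scaled_def integrand_\<sigma>)
      then show ?thesis by (simp add: V_def rate_def)
    qed simp
  qed
  finally show ?thesis .
qed

definition cost :: "(real \<Rightarrow> 'n path \<Rightarrow> real ^ 'n) \<Rightarrow> real \<Rightarrow> real \<Rightarrow> 'n path \<Rightarrow> real" where
  "cost \<mu> a b \<omega> = (\<integral>u. indicator {a<..b} u *\<^sub>R rate \<mu> u \<omega> \<partial>lborel)"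

lemma cost_measurable:
  assumes "\<mu> \<in> controls" "r \<le> a" "a \<le> b" "b \<le> T"
  shows "cost \<mu> a b \<in> borel_measurable (F b)"
  unfolding cost_def[abs_def]
proof (rule lborel.borel_measurable_lebesgue_integral)
  have "(\<lambda>(u, \<omega>). indicator {a<..b} u *\<^sub>R rate \<mu> u \<omega>) \<in> borel_measurable (lborel \<Otimes>\<^sub>M F b)"
    using rate_measurable[OF assms] by (simp cong: measurable_cong_sets sets_pair_measure_cong)
  from measurable_pair_swap[OF this]
  show "(\<lambda>(\<omega>, u). indicator {a<..b} u *\<^sub>R rate \<mu> u \<omega>) \<in> borel_measurable (F b \<Otimes>\<^sub>M lborel)" by simp
qed

text \<open>A continuous path is bounded on a compact interval, so the polynomial bound on the rate
  is finite for each path separately; no expectation is involved.\<close>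

lemma rate_integrable:
  assumes \<mu>: "\<mu> \<in> controls" and le: "r \<le> a" "a \<le> b" "b \<le> T" and \<omega>: "\<omega> \<in> \<Omega>"
  shows "integrable lborel (\<lambda>u. indicator {a<..b} u *\<^sub>R rate \<mu> u \<omega>)"
proof -
  have "continuous_on {a..b} \<omega>" using path_continuous[OF \<omega>] le by (auto intro: continuous_on_subset)
  then have "compact (\<omega> ` {a..b})" by (intro compact_continuous_image) auto
  then obtain B where B: "\<And>u. u \<in> {a..b} \<Longrightarrow> norm (\<omega> u) \<le> B" using compact_imp_bounded[of "\<omega> ` {a..b}"] unfolding bounded_iff by blast
  let ?k = "fst growth * (1 + B ^ snd growth)"
  have "integrable lborel (\<lambda>u. indicator {a<..b} u *\<^sub>R ?k)" using le by simp
  then show ?thesis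
  proof (rule Bochner_Integration.integrable_bound)
    have "(\<lambda>u. indicator {a<..b} u *\<^sub>R rate \<mu> u \<omega>) \<in> borel_measurable borel"
      using measurable_compose[OF measurable_Pair2'[of \<omega> "F b" borel] rate_measurable[OF \<mu> le]] \<omega> by simp
    then show "(\<lambda>u. indicator {a<..b} u *\<^sub>R rate \<mu> u \<omega>) \<in> borel_measurable lborel" by simp
    show "AE u in lborel. norm (indicator {a<..b} u *\<^sub>R rate \<mu> u \<omega>) \<le> norm (indicator {a<..b} u *\<^sub>R ?k)"
    proof (rule AE_I2)
      fix u
      show "norm (indicator {a<..b} u *\<^sub>R rate \<mu> u \<omega>) \<le> norm (indicator {a<..b} u *\<^sub>R ?k)"
      proof (cases "u \<in> {a<..b}")
        case True
        have "\<bar>rate \<mu> u \<omega>\<bar> \<le> envelope u \<omega>" using True le by (intro rate_bound[OF \<mu> _ _ \<omega>]) auto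
        also have "\<dots> \<le> ?k" unfolding envelope_def using growth(1) B[of u] True by (intro mult_left_mono add_left_mono power_mono) auto
        finally show ?thesis using True by simp
      qed simp
    qed
  qed
qed

lemma cost_split:
  assumes \<mu>: "\<mu> \<in> controls" and le: "r \<le> a" "a \<le> b" "b \<le> c" "c \<le> T" and \<omega>: "\<omega> \<in> \<Omega>"
  shows "cost \<mu> a c \<omega> = cost \<mu> a b \<omega> + cost \<mu> b c \<omega>"
proof -
  have "cost \<mu> a b \<omega> + cost \<mu> b c \<omega> = (\<integral>u. indicator {a<..b} u *\<^sub>R rate \<mu> u \<omega> + indicator {b<..c} u *\<^sub>R rate \<mu> u \<omega> \<partial>lborel)"
    unfolding cost_def using le \<omega> by (intro Bochner_Integration.integral_add[symmetric] rate_integrable[OF \<mu>]) auto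
  also have "\<dots> = cost \<mu> a c \<omega>"
    unfolding cost_def using le by (intro Bochner_Integration.integral_cong) (auto simp: indicator_def)
  finally show ?thesis ..
qed

definition gain :: "(real \<Rightarrow> 'n path \<Rightarrow> real ^ 'n) \<Rightarrow> ('n path \<Rightarrow> real) \<Rightarrow> ('n path \<Rightarrow> real) \<Rightarrow> 'n path \<Rightarrow> real" where
  "gain \<mu> s t \<omega> = (LBINT u=s \<omega>..t \<omega>. real_of_ereal (g u (\<omega> u) (\<mu> u \<omega>)))"

lemma gain_cost: "s \<omega> \<le> t \<omega> \<Longrightarrow> gain \<mu> s t \<omega> = cost \<mu> (s \<omega>) (t \<omega>) \<omega>"
  by (simp add: gain_def cost_def rate_def interval_integral_Ioc set_lebesgue_integral_def)

lemma gain_split: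
  assumes "\<mu> \<in> controls" "s0 \<in> times" "t \<in> times" "\<omega> \<in> \<Omega>" "s0 \<omega> \<le> s \<omega>" "s \<omega> \<le> t \<omega>"
  shows "gain \<mu> s0 t \<omega> = gain \<mu> s0 s \<omega> + gain \<mu> s t \<omega>"
  using cost_split[OF assms(1) timesD(2)[OF assms(2,4)] assms(5,6) timesD(3)[OF assms(3,4)] assms(4)] assms(5,6)
  by (simp add: gain_cost)

lemma gain_cong:
  assumes "s \<omega> \<le> t \<omega>" "\<And>u. s \<omega> < u \<Longrightarrow> u \<le> t \<omega> \<Longrightarrow> \<kappa> u \<omega> = \<mu> u \<omega>"
  shows "gain \<kappa> s t \<omega> = gain \<mu> s t \<omega>"
  unfolding gain_cost[of s \<omega> t \<kappa>, OF assms(1)] gain_cost[of s \<omega> t \<mu>, OF assms(1)] cost_def rate_def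
  by (intro Bochner_Integration.integral_cong) (auto simp: assms(2) indicator_def)

text \<open>The interval between s and t has two random ends. As a difference of costs started at r
  it involves one random end at a time, where \<open>measurable_S_pieces\<close> applies.\<close>

lemma gain_measurable:
  assumes \<mu>: "\<mu> \<in> controls" and s: "s \<in> times" and t: "t \<in> times" and st: "\<And>\<omega>. \<omega> \<in> \<Omega> \<Longrightarrow> s \<omega> \<le> t \<omega>"
  shows "gain \<mu> s t \<in> borel_measurable (S t)"
proof -
  have m: "(\<lambda>\<omega>. cost \<mu> r (s \<omega>) \<omega>) \<in> borel_measurable (S s)" if s: "s \<in> times" for s
  proof (rule measurable_S_pieces[OF s])
    fix v assume "v \<in> s ` \<Omega>"
    then have "r \<le> v" "v \<le> T" using times_values[OF s] by auto
    then show "cost \<mu> r v \<in> borel_measurable (F v)" by (intro cost_measurable[OF \<mu>]) auto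
  qed
  have "(\<lambda>\<omega>. cost \<mu> r (t \<omega>) \<omega> - cost \<mu> r (s \<omega>) \<omega>) \<in> borel_measurable (S t)"
    by (intro borel_measurable_diff m[OF t] measurable_from_subalg[OF subalgebra_SS[OF s t st] m[OF s]])
  then show ?thesis
  proof (rule measurable_cong[THEN iffD1, rotated])
    fix \<omega> assume "\<omega> \<in> space (S t)"
    then have \<omega>: "\<omega> \<in> \<Omega>" by simp
    have "cost \<mu> r (t \<omega>) \<omega> = cost \<mu> r (s \<omega>) \<omega> + cost \<mu> (s \<omega>) (t \<omega>) \<omega>"
      by (rule cost_split[OF \<mu> order_refl timesD(2)[OF s \<omega>] st[OF \<omega>] timesD(3)[OF t \<omega>] \<omega>])
    then show "cost \<mu> r (t \<omega>) \<omega> - cost \<mu> r (s \<omega>) \<omega> = gain \<mu> s t \<omega>" using gain_cost[of s \<omega> t, OF st[OF \<omega>]] by simp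
  qed
qed

lemma envelope_measurable: "(\<lambda>(u, \<omega>). indicator {r<..T} u * ennreal (envelope u \<omega>)) \<in> borel_measurable (borel \<Otimes>\<^sub>M F T)"
proof -
  have [measurable]: "(\<lambda>z. snd z (clamp_time T (fst z))) \<in> borel_measurable (borel \<Otimes>\<^sub>M F T)"
    using stopped_path_measurable[OF rT] by (simp add: split_beta')
  have "(\<lambda>z. indicator {r<..T} (fst z) * ennreal (fst growth * (1 + norm (snd z (clamp_time T (fst z))) ^ snd growth)))
      \<in> borel_measurable (borel \<Otimes>\<^sub>M F T)" by measurable
  also have "(\<lambda>z. indicator {r<..T} (fst z) * ennreal (fst growth * (1 + norm (snd z (clamp_time T (fst z))) ^ snd growth)))
      = (\<lambda>(u, \<omega>). indicator {r<..T} u * ennreal (envelope u \<omega>))"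
    by (auto simp: fun_eq_iff envelope_def clamp_time_eq indicator_def)
  finally show ?thesis .
qed

text \<open>Under the controlled measure the envelope is multiplied by the density; bounding the
  product by the sum of the squares separates them. The density has a second moment by
  \<open>dens_square\<close>, the squared envelope is a polynomial in the position, and both bounds
  are uniform in time, so Fubini concludes.\<close>

lemma envelope_finite:
  assumes \<mu>: "\<mu> \<in> controls"
  shows "(\<integral>\<^sup>+\<omega>. (\<integral>\<^sup>+u. indicator {r<..T} u * ennreal (envelope u \<omega>) \<partial>lborel) \<partial>M \<mu>) < \<infinity>"
proof -
  interpret M: prob_space "M \<mu>" by (rule prob_M[OF \<mu>])
  interpret pair_sigma_finite lborel "M \<mu>" ..
  let ?m = "snd growth" and ?K = "fst growth"
  obtain k where k: "\<And>u. r \<le> u \<Longrightarrow> u \<le> T \<Longrightarrow> (\<integral>\<^sup>+\<omega>. ennreal (norm (\<omega> u) ^ (2 * ?m)) \<partial>C) \<le> ennreal k"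
    using polynomial_moment[of T "2 * ?m"] by blast
  obtain d where d: "(\<integral>\<^sup>+\<omega>. ennreal ((dens \<mu> r T \<omega>)\<^sup>2) \<partial>C) \<le> ennreal d"
    using dens_square[OF \<mu> order_refl rT order_refl] by blast
  have dm: "dens \<mu> r T \<in> borel_measurable C" by (rule measurable_F_C[OF dens_measurable[OF \<mu> order_refl rT order_refl]])
  let ?D = "ennreal (2 * ?K\<^sup>2) + ennreal (2 * ?K\<^sup>2) * ennreal k + ennreal d"
  have slice: "(\<integral>\<^sup>+\<omega>. ennreal (envelope u \<omega>) \<partial>M \<mu>) \<le> ?D" if u: "r \<le> u" "u \<le> T" for u
  proof -
    have X: "(\<lambda>\<omega>. \<omega> u) \<in> borel_measurable (F T)" by (rule coordinate_measurable[OF u])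
    have E: "(\<lambda>\<omega>. ennreal (envelope u \<omega>)) \<in> borel_measurable (F T)"
    proof -
      note X[measurable]
      show ?thesis unfolding envelope_def by measurable
    qed
    have [measurable]: "(\<lambda>\<omega>. \<omega> u) \<in> borel_measurable C" by (rule measurable_F_C[OF X])
    have "(\<integral>\<^sup>+\<omega>. ennreal (envelope u \<omega>) \<partial>M \<mu>) = (\<integral>\<^sup>+\<omega>. ennreal (envelope u \<omega>) * ennreal (dens \<mu> r T \<omega>) \<partial>C)"
      by (rule nn_integral_M[OF \<mu> E])
    also have "\<dots> \<le> (\<integral>\<^sup>+\<omega>. ennreal (2 * ?K\<^sup>2) + ennreal (2 * ?K\<^sup>2) * ennreal (norm (\<omega> u) ^ (2 * ?m)) + ennreal ((dens \<mu> r T \<omega>)\<^sup>2) \<partial>C)"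
    proof (rule nn_integral_mono)
      fix \<omega> :: "'n path"
      let ?z = "norm (\<omega> u) ^ ?m"
      have "envelope u \<omega> * dens \<mu> r T \<omega> \<le> (envelope u \<omega>)\<^sup>2 + (dens \<mu> r T \<omega>)\<^sup>2"
        by (rule mult_le_sum_squares[OF envelope_nonneg dens_nonneg])
      also have "(envelope u \<omega>)\<^sup>2 \<le> ?K\<^sup>2 * (2 + 2 * ?z\<^sup>2)"
        unfolding envelope_def power_mult_distrib by (intro mult_left_mono square_one_plus_le) simp
      also have "?z\<^sup>2 = norm (\<omega> u) ^ (2 * ?m)" by (simp add: power_mult[symmetric] mult.commute)
      finally have "envelope u \<omega> * dens \<mu> r T \<omega> \<le> 2 * ?K\<^sup>2 + 2 * ?K\<^sup>2 * norm (\<omega> u) ^ (2 * ?m) + (dens \<mu> r T \<omega>)\<^sup>2"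
        by (simp add: algebra_simps)
      then have "ennreal (envelope u \<omega> * dens \<mu> r T \<omega>) \<le> ennreal (2 * ?K\<^sup>2 + 2 * ?K\<^sup>2 * norm (\<omega> u) ^ (2 * ?m) + (dens \<mu> r T \<omega>)\<^sup>2)"
        by (rule ennreal_leI)
      then show "ennreal (envelope u \<omega>) * ennreal (dens \<mu> r T \<omega>)
          \<le> ennreal (2 * ?K\<^sup>2) + ennreal (2 * ?K\<^sup>2) * ennreal (norm (\<omega> u) ^ (2 * ?m)) + ennreal ((dens \<mu> r T \<omega>)\<^sup>2)"
        by (simp add: ennreal_mult[OF envelope_nonneg dens_nonneg] ennreal_mult[of "2 * ?K\<^sup>2", symmetric])
    qed
    also have "\<dots> = (\<integral>\<^sup>+\<omega>. ennreal (2 * ?K\<^sup>2) + ennreal (2 * ?K\<^sup>2) * ennreal (norm (\<omega> u) ^ (2 * ?m)) \<partial>C) + (\<integral>\<^sup>+\<omega>. ennreal ((dens \<mu> r T \<omega>)\<^sup>2) \<partial>C)"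
      using dm by (intro nn_integral_add) measurable
    also have "(\<integral>\<^sup>+\<omega>. ennreal (2 * ?K\<^sup>2) + ennreal (2 * ?K\<^sup>2) * ennreal (norm (\<omega> u) ^ (2 * ?m)) \<partial>C)
        = (\<integral>\<^sup>+\<omega>. ennreal (2 * ?K\<^sup>2) \<partial>C) + (\<integral>\<^sup>+\<omega>. ennreal (2 * ?K\<^sup>2) * ennreal (norm (\<omega> u) ^ (2 * ?m)) \<partial>C)"
      by (intro nn_integral_add) measurable
    also have "(\<integral>\<^sup>+\<omega>. ennreal (2 * ?K\<^sup>2) * ennreal (norm (\<omega> u) ^ (2 * ?m)) \<partial>C) = ennreal (2 * ?K\<^sup>2) * (\<integral>\<^sup>+\<omega>. ennreal (norm (\<omega> u) ^ (2 * ?m)) \<partial>C)"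
      by (intro nn_integral_cmult) measurable
    also have "(\<integral>\<^sup>+\<omega>. ennreal (2 * ?K\<^sup>2) \<partial>C) = ennreal (2 * ?K\<^sup>2)" using C.emeasure_space_1 by simp
    also have "ennreal (2 * ?K\<^sup>2) + ennreal (2 * ?K\<^sup>2) * (\<integral>\<^sup>+\<omega>. ennreal (norm (\<omega> u) ^ (2 * ?m)) \<partial>C) + (\<integral>\<^sup>+\<omega>. ennreal ((dens \<mu> r T \<omega>)\<^sup>2) \<partial>C) \<le> ?D"
      by (rule add_mono[OF add_left_mono[OF mult_left_mono[OF k[OF u]]] d]) simp
    finally show ?thesis .
  qed
  have jm: "(\<lambda>(u, \<omega>). indicator {r<..T} u * ennreal (envelope u \<omega>)) \<in> borel_measurable (lborel \<Otimes>\<^sub>M M \<mu>)"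
    using envelope_measurable by (simp cong: measurable_cong_sets sets_pair_measure_cong)
  have X: "(\<lambda>\<omega>. ennreal (envelope u \<omega>)) \<in> borel_measurable (M \<mu>)" if "r \<le> u" "u \<le> T" for u
    using coordinate_measurable[OF that] unfolding envelope_def measurable_cong_sets[OF sets_M refl] by measurable
  have "(\<integral>\<^sup>+\<omega>. (\<integral>\<^sup>+u. indicator {r<..T} u * ennreal (envelope u \<omega>) \<partial>lborel) \<partial>M \<mu>)
      = (\<integral>\<^sup>+u. (\<integral>\<^sup>+\<omega>. indicator {r<..T} u * ennreal (envelope u \<omega>) \<partial>M \<mu>) \<partial>lborel)"
    by (rule Fubini'[OF jm])
  also have "\<dots> \<le> (\<integral>\<^sup>+u. ?D * indicator {r<..T} u \<partial>lborel)"
  proof (rule nn_integral_mono)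
    fix u :: real
    show "(\<integral>\<^sup>+\<omega>. indicator {r<..T} u * ennreal (envelope u \<omega>) \<partial>M \<mu>) \<le> ?D * indicator {r<..T} u"
      using slice[of u] by (cases "u \<in> {r<..T}") auto
  qed
  also have "\<dots> = ?D * ennreal (T - r)" using rT by (simp add: nn_integral_cmult_indicator)
  also have "\<dots> < \<infinity>" by (simp add: ennreal_mult_less_top)
  finally show ?thesis .
qed

text \<open>Whatever the stopping times, the absolute cost between them is at most the integral of
  the envelope over (r, T].\<close>

lemma gain_integrable:
  assumes \<mu>: "\<mu> \<in> controls" "\<nu> \<in> controls" and s: "s \<in> times" and t: "t \<in> times" and st: "\<And>\<omega>. \<omega> \<in> \<Omega> \<Longrightarrow> s \<omega> \<le> t \<omega>"
  shows "integrable (M \<nu>) (gain \<mu> s t)"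
proof (rule integrableI_bounded)
  have "gain \<mu> s t \<in> borel_measurable (F T)"
    by (rule measurable_from_subalg[OF subalgebra_FS[OF t] gain_measurable[OF \<mu>(1) s t st]])
  then show "gain \<mu> s t \<in> borel_measurable (M \<nu>)" by (simp add: measurable_cong_sets[OF sets_M refl])
  have "(\<integral>\<^sup>+\<omega>. ennreal (norm (gain \<mu> s t \<omega>)) \<partial>M \<nu>) \<le> (\<integral>\<^sup>+\<omega>. (\<integral>\<^sup>+u. indicator {r<..T} u * ennreal (envelope u \<omega>) \<partial>lborel) \<partial>M \<nu>)"
  proof (rule nn_integral_mono)
    fix \<omega> assume "\<omega> \<in> space (M \<nu>)"
    then have \<omega>: "\<omega> \<in> \<Omega>" by simp
    note b = timesD(2)[OF s \<omega>] st[OF \<omega>] timesD(3)[OF t \<omega>]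
    have "ennreal (norm (cost \<mu> (s \<omega>) (t \<omega>) \<omega>)) \<le> (\<integral>\<^sup>+u. ennreal (norm (indicator {s \<omega><..t \<omega>} u *\<^sub>R rate \<mu> u \<omega>)) \<partial>lborel)"
      unfolding cost_def by (rule integral_norm_bound_ennreal[OF rate_integrable[OF \<mu>(1) b \<omega>]])
    also have "\<dots> \<le> (\<integral>\<^sup>+u. indicator {r<..T} u * ennreal (envelope u \<omega>) \<partial>lborel)"
    proof (rule nn_integral_mono)
      fix u :: real
      show "ennreal (norm (indicator {s \<omega><..t \<omega>} u *\<^sub>R rate \<mu> u \<omega>)) \<le> indicator {r<..T} u * ennreal (envelope u \<omega>)"
      proof (cases "u \<in> {s \<omega><..t \<omega>}")
        case True
        then have u: "r < u" "u \<le> T" using b by auto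
        then show ?thesis using True ennreal_leI[OF rate_bound[OF \<mu>(1) u \<omega>]] by simp
      qed simp
    qed
    finally show "ennreal (norm (gain \<mu> s t \<omega>)) \<le> (\<integral>\<^sup>+u. indicator {r<..T} u * ennreal (envelope u \<omega>) \<partial>lborel)"
      by (simp add: gain_cost[of s \<omega> t, OF b(2)])
  qed
  also have "\<dots> < \<infinity>" by (rule envelope_finite[OF \<mu>(2)])
  finally show "(\<integral>\<^sup>+\<omega>. ennreal (norm (gain \<mu> s t \<omega>)) \<partial>M \<nu>) < \<infinity>" .
qed

lemma gain_zero_bounded: "\<exists>c. \<forall>s\<in>times. \<forall>t\<in>times. \<forall>\<omega>\<in>\<Omega>. s \<omega> \<le> t \<omega> \<longrightarrow> gain (\<lambda>_ _. 0) s t \<omega> \<le> c"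
proof -
  obtain c where c: "\<And>u x. 0 \<le> u \<Longrightarrow> g u x 0 \<le> ereal c" using g_zero by blast
  \<comment> \<open>Made nonnegative so that replacing t - s by the larger length T - r increases
    the bound.\<close>
  let ?c = "max c 0"
  have "gain (\<lambda>_ _. 0) s t \<omega> \<le> ?c * (T - r)" if s: "s \<in> times" and t: "t \<in> times" and \<omega>: "\<omega> \<in> \<Omega>" and st: "s \<omega> \<le> t \<omega>" for s t \<omega>
  proof -
    note b = timesD(2)[OF s \<omega>] st timesD(3)[OF t \<omega>]
    have "cost (\<lambda>_ _. 0) (s \<omega>) (t \<omega>) \<omega> \<le> (\<integral>u. indicator {s \<omega><..t \<omega>} u *\<^sub>R ?c \<partial>lborel)"
      unfolding cost_def
    proof (rule integral_mono[OF rate_integrable[OF zero_control b \<omega>]])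
      show "integrable lborel (\<lambda>u. indicator {s \<omega><..t \<omega>} u *\<^sub>R ?c)" using st by simp
      fix u :: real
      show "indicator {s \<omega><..t \<omega>} u *\<^sub>R rate (\<lambda>_ _. 0) u \<omega> \<le> indicator {s \<omega><..t \<omega>} u *\<^sub>R ?c"
      proof (cases "u \<in> {s \<omega><..t \<omega>}")
        case True
        then have u: "0 \<le> u" using b r_nonneg by auto
        \<comment> \<open>\<open>real_of_ereal\<close> sends infinite values to 0, which could
          exceed a negative c. Plus infinity is excluded by the bound c, minus infinity by
          \<open>g_not_MInf\<close>.\<close>
        have "rate (\<lambda>_ _. 0) u \<omega> \<le> c"
          using c[OF u, of "\<omega> u"] g_not_MInf[OF u, of "\<omega> u" 0] unfolding rate_def by (cases "g u (\<omega> u) 0") auto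
        then show ?thesis using True by simp
      qed simp
    qed
    also have "\<dots> = ?c * (t \<omega> - s \<omega>)" using st by simp
    also have "\<dots> \<le> ?c * (T - r)" using b by (intro mult_left_mono) auto
    finally show ?thesis by (simp add: gain_cost[of s \<omega> t, OF st])
  qed
  then show ?thesis by blast
qed

end

section \<open>The value of a control\<close>

context sigma_finite_subalgebra
begin

lemma ereal_cond_exp_local:
  assumes [measurable]: "Y \<in> borel_measurable M" "Z \<in> borel_measurable M" and A: "A \<in> sets F"
    and eq: "\<And>x. x \<in> A \<Longrightarrow> Y x = Z x"
  shows "AE x in M. x \<in> A \<longrightarrow> ereal_cond_exp M F Y x = ereal_cond_exp M F Z x"
proof -
  have n: "AE x in M. x \<in> A \<longrightarrow> nn_cond_exp M F f x = nn_cond_exp M F h x"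
    if [measurable]: "f \<in> borel_measurable M" "h \<in> borel_measurable M" and fh: "\<And>x. x \<in> A \<Longrightarrow> f x = h x" for f h
  proof -
    have i: "(indicator A :: _ \<Rightarrow> ennreal) \<in> borel_measurable F" by (rule borel_measurable_indicator[OF A])
    have "(\<lambda>x. indicator A x * f x) = (\<lambda>x. indicator A x * h x)" using fh by (auto simp: indicator_def fun_eq_iff)
    then have "AE x in M. indicator A x * nn_cond_exp M F f x = indicator A x * nn_cond_exp M F h x"
      using nn_cond_exp_prod[OF i that(1)] nn_cond_exp_prod[OF i that(2)] by auto
    then show ?thesis by eventually_elim (auto simp: indicator_def)
  qed
  have "AE x in M. x \<in> A \<longrightarrow> nn_cond_exp M F (\<lambda>x. e2ennreal (Y x)) x = nn_cond_exp M F (\<lambda>x. e2ennreal (Z x)) x"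
    by (rule n) (auto simp: eq)
  moreover have "AE x in M. x \<in> A \<longrightarrow> nn_cond_exp M F (\<lambda>x. e2ennreal (- Y x)) x = nn_cond_exp M F (\<lambda>x. e2ennreal (- Z x)) x"
    by (rule n) (auto simp: eq)
  ultimately show ?thesis by eventually_elim (auto simp: ereal_cond_exp_def)
qed

end

lemma quasi_integrable_measurable: "quasi_integrable M Y \<Longrightarrow> Y \<in> borel_measurable M"
  by (simp add: quasi_integrable_def)

context control_problem begin

lemma AE_Q: "(AE \<omega> in Q. P \<omega>) \<longleftrightarrow> (AE \<omega> in C. P \<omega>)"
  by (simp add: AE_completion_iff)

section \<open>Ordered stopping times and variables bounded below\<close>

definition precedes :: "('n path \<Rightarrow> real) \<Rightarrow> ('n path \<Rightarrow> real) \<Rightarrow> bool" where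
  "precedes s t \<longleftrightarrow> s \<in> times \<and> t \<in> times \<and> (\<forall>\<omega>\<in>\<Omega>. s \<omega> \<le> t \<omega>)"

lemma precedesD: "precedes s t \<Longrightarrow> s \<in> times" "precedes s t \<Longrightarrow> t \<in> times" "precedes s t \<Longrightarrow> \<omega> \<in> \<Omega> \<Longrightarrow> s \<omega> \<le> t \<omega>"
  by (auto simp: precedes_def)

lemma precedes_trans: "precedes s0 s \<Longrightarrow> precedes s t \<Longrightarrow> precedes s0 t"
  unfolding precedes_def by force

abbreviation BB :: "('n path \<Rightarrow> real) \<Rightarrow> ('n path \<Rightarrow> ereal) set" where "BB t \<equiv> bounded_below_rvs Q (S t)"

lemma BB_measurable: "Y \<in> BB t \<Longrightarrow> Y \<in> borel_measurable (S t)"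
  and BB_bound: "Y \<in> BB t \<Longrightarrow> \<exists>c. AE \<omega> in C. ereal c \<le> Y \<omega>"
  by (auto simp: bounded_below_rvs_def AE_Q)

lemma BB_I: "Y \<in> borel_measurable (S t) \<Longrightarrow> AE \<omega> in C. ereal c \<le> Y \<omega> \<Longrightarrow> Y \<in> BB t"
  by (auto simp: bounded_below_rvs_def AE_Q)

lemma BB_mono: "Y \<in> BB t \<Longrightarrow> Z \<in> borel_measurable (S t) \<Longrightarrow> AE \<omega> in C. Y \<omega> \<le> Z \<omega> \<Longrightarrow> Z \<in> BB t"
proof -
  assume Y: "Y \<in> BB t" and Z: "Z \<in> borel_measurable (S t)" and le: "AE \<omega> in C. Y \<omega> \<le> Z \<omega>"
  obtain c where "AE \<omega> in C. ereal c \<le> Y \<omega>" using BB_bound[OF Y] by blast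
  with le have "AE \<omega> in C. ereal c \<le> Z \<omega>" by eventually_elim (rule order_trans)
  then show ?thesis by (rule BB_I[OF Z])
qed

lemma S_measurable_M: "t \<in> times \<Longrightarrow> f \<in> borel_measurable (S t) \<Longrightarrow> f \<in> borel_measurable (M \<mu>)"
  by (rule measurable_from_subalg[OF subalgebra_MS])

lemma S_measurable_C: "t \<in> times \<Longrightarrow> f \<in> borel_measurable (S t) \<Longrightarrow> f \<in> borel_measurable C"
  by (rule measurable_from_subalg[OF subalgebra_CS])

lemma BB_quasi:
  assumes \<mu>: "\<mu> \<in> controls" and t: "t \<in> times" and Y: "Y \<in> BB t"
  shows "quasi_integrable (M \<mu>) Y"
proof -
  interpret prob_space "M \<mu>" by (rule prob_M[OF \<mu>])
  obtain c where "AE \<omega> in C. ereal c \<le> Y \<omega>" using BB_bound[OF Y] by blast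
  then have "AE \<omega> in M \<mu>. ereal c \<le> Y \<omega>" by (simp add: AE_M[OF \<mu>])
  then show ?thesis
    by (rule quasi_integrable_bounded_below[OF finite_measure_axioms S_measurable_M[OF t BB_measurable[OF Y]]])
qed

definition payoff :: "(real \<Rightarrow> 'n path \<Rightarrow> real ^ 'n) \<Rightarrow> ('n path \<Rightarrow> real) \<Rightarrow> ('n path \<Rightarrow> real) \<Rightarrow> ('n path \<Rightarrow> ereal) \<Rightarrow> 'n path \<Rightarrow> ereal" where
  "payoff \<mu> s t Y \<omega> = Y \<omega> + ereal (- gain \<mu> s t \<omega>)"

text \<open>The penalized expectation with the penalty moved under the conditional expectation. In
  this form the tower property and monotone convergence act on it directly.\<close>

definition val :: "(real \<Rightarrow> 'n path \<Rightarrow> real ^ 'n) \<Rightarrow> ('n path \<Rightarrow> real) \<Rightarrow> ('n path \<Rightarrow> real) \<Rightarrow> ('n path \<Rightarrow> ereal) \<Rightarrow> 'n path \<Rightarrow> ereal" where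
  "val \<mu> s t Y = ereal_cond_exp (M \<mu>) (S s) (payoff \<mu> s t Y)"

lemma val_measurable: "val \<mu> s t Y \<in> borel_measurable (S s)"
  unfolding val_def by (rule borel_measurable_ereal_cond_exp)

lemma payoff_measurable:
  assumes \<mu>: "\<mu> \<in> controls" and st: "precedes s t" and Y: "Y \<in> borel_measurable (S t)"
  shows "payoff \<mu> s t Y \<in> borel_measurable (S t)"
proof -
  have "gain \<mu> s t \<in> borel_measurable (S t)" using precedesD[OF st] by (intro gain_measurable[OF \<mu>])
  then show ?thesis unfolding payoff_def[abs_def] using Y by measurable
qed

lemma payoff_measurable_M:
  "\<mu> \<in> controls \<Longrightarrow> precedes s t \<Longrightarrow> Y \<in> borel_measurable (S t) \<Longrightarrow> payoff \<mu> s t Y \<in> borel_measurable (M \<nu>)"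
  by (rule S_measurable_M[OF precedesD(2) payoff_measurable])

lemma gain_quasi:
  assumes \<mu>: "\<mu> \<in> controls" "\<nu> \<in> controls" and st: "precedes s t"
  shows "quasi_integrable (M \<nu>) (\<lambda>\<omega>. ereal (- gain \<mu> s t \<omega>))"
  by (rule quasi_integrable_ereal[OF integrable_minus[OF gain_integrable[OF \<mu> precedesD(1,2)[OF st] precedesD(3)[OF st]]]])

lemma payoff_quasi:
  assumes "\<mu> \<in> controls" "\<nu> \<in> controls" "precedes s t" "quasi_integrable (M \<nu>) Y"
  shows "quasi_integrable (M \<nu>) (payoff \<mu> s t Y)"
  unfolding payoff_def[abs_def] by (rule quasi_integrable_add[OF assms(4) gain_quasi[OF assms(1-3)]])

text \<open>Additivity of the extended conditional expectation applies because Y is bounded below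
  and the running cost is integrable, so no difference of infinities arises.\<close>

lemma val_penalty:
  assumes \<mu>: "\<mu> \<in> controls" and st: "precedes s t" and Y: "Y \<in> BB t"
  shows "AE \<omega> in C. ereal_cond_exp (M \<mu>) (S s) Y \<omega> - ereal (penalty \<sigma> g r T Q s t \<mu> \<omega>) = val \<mu> s t Y \<omega>"
proof -
  interpret K: sigma_finite_subalgebra "M \<mu>" "S s" by (rule cond_subalgebra[OF \<mu> precedesD(1)[OF st]])
  have i: "integrable (M \<mu>) (gain \<mu> s t)"
    by (rule gain_integrable[OF \<mu> \<mu> precedesD(1,2)[OF st] precedesD(3)[OF st]])
  have pen: "penalty \<sigma> g r T Q s t \<mu> = real_cond_exp (M \<mu>) (S s) (gain \<mu> s t)"
    unfolding penalty_def gain_def[abs_def] ..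
  have "AE \<omega> in M \<mu>. val \<mu> s t Y \<omega> = ereal_cond_exp (M \<mu>) (S s) Y \<omega> + ereal_cond_exp (M \<mu>) (S s) (\<lambda>\<omega>. ereal (- gain \<mu> s t \<omega>)) \<omega>"
    unfolding val_def payoff_def[abs_def]
    by (rule K.ereal_cond_exp_add[OF BB_quasi[OF \<mu> precedesD(2)[OF st] Y] gain_quasi[OF \<mu> \<mu> st]])
  moreover have "AE \<omega> in M \<mu>. ereal_cond_exp (M \<mu>) (S s) (\<lambda>\<omega>. ereal (- gain \<mu> s t \<omega>)) \<omega> = ereal (real_cond_exp (M \<mu>) (S s) (\<lambda>\<omega>. - gain \<mu> s t \<omega>) \<omega>)"
    by (rule K.ereal_cond_exp_real[OF integrable_minus[OF i]])
  moreover have "AE \<omega> in M \<mu>. real_cond_exp (M \<mu>) (S s) (\<lambda>\<omega>. - 1 * gain \<mu> s t \<omega>) \<omega> = - 1 * real_cond_exp (M \<mu>) (S s) (gain \<mu> s t) \<omega>"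
    by (rule K.real_cond_exp_cmult[OF i])
  ultimately have "AE \<omega> in M \<mu>. ereal_cond_exp (M \<mu>) (S s) Y \<omega> - ereal (penalty \<sigma> g r T Q s t \<mu> \<omega>) = val \<mu> s t Y \<omega>"
    by eventually_elim (simp add: pen minus_ereal_def)
  then show ?thesis by (simp add: AE_M[OF \<mu>])
qed

lemma val_mono:
  assumes \<mu>: "\<mu> \<in> controls" and st: "precedes s t" and Y: "Y \<in> borel_measurable (S t)" "Z \<in> borel_measurable (S t)"
    and le: "AE \<omega> in C. Y \<omega> \<le> Z \<omega>"
  shows "AE \<omega> in C. val \<mu> s t Y \<omega> \<le> val \<mu> s t Z \<omega>"
proof -
  interpret K: sigma_finite_subalgebra "M \<mu>" "S s" by (rule cond_subalgebra[OF \<mu> precedesD(1)[OF st]])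
  have "AE \<omega> in M \<mu>. payoff \<mu> s t Y \<omega> \<le> payoff \<mu> s t Z \<omega>"
    unfolding AE_M[OF \<mu>] payoff_def using le by eventually_elim (rule add_right_mono)
  from K.ereal_cond_exp_mono[OF payoff_measurable_M[OF \<mu> st Y(1)] payoff_measurable_M[OF \<mu> st Y(2)] this]
  show ?thesis unfolding val_def AE_M[OF \<mu>] .
qed

lemma val_cong:
  assumes \<mu>: "\<mu> \<in> controls" and st: "precedes s t" and Y: "Y \<in> borel_measurable (S t)" "Z \<in> borel_measurable (S t)"
    and eq: "AE \<omega> in C. Y \<omega> = Z \<omega>"
  shows "AE \<omega> in C. val \<mu> s t Y \<omega> = val \<mu> s t Z \<omega>"
proof -
  have "AE \<omega> in C. Y \<omega> \<le> Z \<omega>" "AE \<omega> in C. Z \<omega> \<le> Y \<omega>" using eq by auto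
  from val_mono[OF \<mu> st Y this(1)] val_mono[OF \<mu> st Y(2,1) this(2)]
  show ?thesis by eventually_elim (rule antisym)
qed

text \<open>The running cost is a finite number on each path, so adding it preserves monotone
  convergence, and its integrability transfers the condition on the negative part from Y 0 to the
  first payoff.\<close>

lemma val_limit:
  assumes \<mu>: "\<mu> \<in> controls" and st: "precedes s t" and Y: "\<And>n. Y n \<in> borel_measurable (S t)" and Z: "Z \<in> borel_measurable (S t)"
    and inc: "AE \<omega> in C. incseq (\<lambda>n. Y n \<omega>)" and lim: "AE \<omega> in C. (\<lambda>n. Y n \<omega>) \<longlonglongrightarrow> Z \<omega>"
    and quasi: "quasi_integrable (M \<mu>) (Y 0)"
  shows "AE \<omega> in C. (\<lambda>n. val \<mu> s t (Y n) \<omega>) \<longlonglongrightarrow> val \<mu> s t Z \<omega>"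
proof -
  interpret K: sigma_finite_subalgebra "M \<mu>" "S s" by (rule cond_subalgebra[OF \<mu> precedesD(1)[OF st]])
  have "AE \<omega> in M \<mu>. incseq (\<lambda>n. payoff \<mu> s t (Y n) \<omega>)"
    unfolding AE_M[OF \<mu>] using inc by eventually_elim (auto simp: incseq_def payoff_def intro: add_right_mono)
  moreover have "AE \<omega> in M \<mu>. (\<lambda>n. payoff \<mu> s t (Y n) \<omega>) \<longlonglongrightarrow> payoff \<mu> s t Z \<omega>"
    unfolding AE_M[OF \<mu>] using lim
  proof eventually_elim
    fix \<omega> assume "(\<lambda>n. Y n \<omega>) \<longlonglongrightarrow> Z \<omega>"
    then show "(\<lambda>n. payoff \<mu> s t (Y n) \<omega>) \<longlonglongrightarrow> payoff \<mu> s t Z \<omega>"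
      unfolding payoff_def by (intro tendsto_add_ereal_general1 tendsto_const) auto
  qed
  ultimately show ?thesis
    unfolding val_def AE_M[OF \<mu>, symmetric]
    by (intro K.ereal_cond_exp_monotone_convergence payoff_measurable_M[OF \<mu> st] Y Z payoff_quasi[OF \<mu> \<mu> st quasi])
qed

lemma val_shift:
  assumes \<mu>: "\<mu> \<in> controls" and st: "precedes s t" and Y: "quasi_integrable (M \<mu>) Y"
    and W: "W \<in> borel_measurable (S s)" "quasi_integrable (M \<mu>) W"
  shows "AE \<omega> in C. val \<mu> s t (\<lambda>\<omega>. Y \<omega> + W \<omega>) \<omega> = val \<mu> s t Y \<omega> + W \<omega>"
proof -
  interpret K: sigma_finite_subalgebra "M \<mu>" "S s" by (rule cond_subalgebra[OF \<mu> precedesD(1)[OF st]])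
  have e: "payoff \<mu> s t (\<lambda>\<omega>. Y \<omega> + W \<omega>) = (\<lambda>\<omega>. payoff \<mu> s t Y \<omega> + W \<omega>)" by (auto simp: payoff_def ac_simps)
  from K.ereal_cond_exp_add[OF payoff_quasi[OF \<mu> \<mu> st Y] W(2)] K.ereal_cond_exp_F_meas[OF W(1)]
  show ?thesis unfolding val_def AE_M[OF \<mu>, symmetric] e by eventually_elim simp
qed

text \<open>The cost splits at s, and its part up to s is known at s. Conditioning first on
  \<open>S s\<close> therefore leaves the payoff of the inner value, for one and the same
  control.\<close>

lemma val_tower:
  assumes \<mu>: "\<mu> \<in> controls" and ord: "precedes s0 s" "precedes s t" and Y: "quasi_integrable (M \<mu>) Y"
  shows "AE \<omega> in C. val \<mu> s0 t Y \<omega> = val \<mu> s0 s (val \<mu> s t Y) \<omega>"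
proof -
  note s0 = precedesD(1)[OF ord(1)] and s = precedesD(2)[OF ord(1)] and t = precedesD(2)[OF ord(2)] and ot = precedes_trans[OF ord]
  interpret K: sigma_finite_subalgebra "M \<mu>" "S s0" by (rule cond_subalgebra[OF \<mu> s0])
  interpret L: sigma_finite_subalgebra "M \<mu>" "S s" by (rule cond_subalgebra[OF \<mu> s])
  let ?G = "\<lambda>\<omega>. ereal (- gain \<mu> s0 s \<omega>)"
  let ?Z = "payoff \<mu> s0 t Y" and ?Z' = "\<lambda>\<omega>. payoff \<mu> s t Y \<omega> + ?G \<omega>"
  have G: "?G \<in> borel_measurable (S s)"
    using gain_measurable[OF \<mu> s0 s precedesD(3)[OF ord(1)]] by measurable
  have qp: "quasi_integrable (M \<mu>) (payoff \<mu> s t Y)" by (rule payoff_quasi[OF \<mu> \<mu> ord(2) Y])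
  have qG: "quasi_integrable (M \<mu>) ?G" by (rule gain_quasi[OF \<mu> \<mu> ord(1)])
  have qZ: "quasi_integrable (M \<mu>) ?Z" by (rule payoff_quasi[OF \<mu> \<mu> ot Y])
  have qZ': "quasi_integrable (M \<mu>) ?Z'" by (rule quasi_integrable_add[OF qp qG])
  have "AE \<omega> in M \<mu>. ?Z \<omega> = ?Z' \<omega>"
  proof (rule AE_I2)
    fix \<omega> assume "\<omega> \<in> space (M \<mu>)"
    then have \<omega>: "\<omega> \<in> \<Omega>" by simp
    from gain_split[of \<mu> s0 t \<omega> s, OF \<mu> s0 t \<omega> precedesD(3)[OF ord(1) \<omega>] precedesD(3)[OF ord(2) \<omega>]]
    show "?Z \<omega> = ?Z' \<omega>" by (simp add: payoff_def add.assoc add.commute[of "gain \<mu> s0 s \<omega>"])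
  qed
  from K.ereal_cond_exp_cong[OF quasi_integrable_measurable[OF qZ] quasi_integrable_measurable[OF qZ'] this]
  have 1: "AE \<omega> in M \<mu>. val \<mu> s0 t Y \<omega> = ereal_cond_exp (M \<mu>) (S s0) ?Z' \<omega>" by (simp add: val_def)
  have 2: "AE \<omega> in M \<mu>. ereal_cond_exp (M \<mu>) (S s0) (ereal_cond_exp (M \<mu>) (S s) ?Z') \<omega> = ereal_cond_exp (M \<mu>) (S s0) ?Z' \<omega>"
    by (rule K.ereal_cond_exp_nested(1)[OF subalgebra_MS[OF s] subalgebra_SS[OF s0 s precedesD(3)[OF ord(1)]] qZ'])
  have "AE \<omega> in M \<mu>. ereal_cond_exp (M \<mu>) (S s) ?Z' \<omega> = payoff \<mu> s0 s (val \<mu> s t Y) \<omega>"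
    using L.ereal_cond_exp_add[OF qp qG] L.ereal_cond_exp_F_meas[OF G]
    by eventually_elim (simp add: payoff_def val_def)
  from K.ereal_cond_exp_cong[OF S_measurable_M[OF s borel_measurable_ereal_cond_exp] payoff_measurable_M[OF \<mu> ord(1) val_measurable] this]
  have 3: "AE \<omega> in M \<mu>. ereal_cond_exp (M \<mu>) (S s0) (ereal_cond_exp (M \<mu>) (S s) ?Z') \<omega> = val \<mu> s0 s (val \<mu> s t Y) \<omega>"
    by (simp add: val_def)
  from 1 2 3 show ?thesis unfolding AE_M[OF \<mu>, symmetric] by eventually_elim simp
qed

text \<open>On A the running costs agree path by path, and by Bayes' formula the conditional
  expectation on A depends only on the densities after s, which agree there.\<close>

lemma val_local:
  assumes c: "\<kappa> \<in> controls" "\<nu> \<in> controls" and st: "precedes s t" and A: "A \<in> sets (S s)"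
    and eq: "\<And>u \<omega>. s \<omega> < u \<Longrightarrow> u \<le> T \<Longrightarrow> \<omega> \<in> A \<Longrightarrow> \<kappa> u \<omega> = \<nu> u \<omega>" and Y: "Y \<in> borel_measurable (S t)"
  shows "AE \<omega> in C. \<omega> \<in> A \<longrightarrow> val \<kappa> s t Y \<omega> = val \<nu> s t Y \<omega>"
proof -
  note s = precedesD(1)[OF st] and t = precedesD(2)[OF st]
  interpret K: sigma_finite_subalgebra "M \<kappa>" "S s" by (rule cond_subalgebra[OF c(1) s])
  have "AE \<omega> in M \<kappa>. \<omega> \<in> A \<longrightarrow> ereal_cond_exp (M \<kappa>) (S s) (payoff \<kappa> s t Y) \<omega> = ereal_cond_exp (M \<kappa>) (S s) (payoff \<nu> s t Y) \<omega>"
  proof (rule K.ereal_cond_exp_local[OF payoff_measurable_M[OF c(1) st Y] payoff_measurable_M[OF c(2) st Y] A])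
    fix \<omega> assume \<omega>: "\<omega> \<in> A"
    then have \<omega>\<Omega>: "\<omega> \<in> \<Omega>" using S_subset[OF A] by blast
    have "gain \<kappa> s t \<omega> = gain \<nu> s t \<omega>"
    proof (rule gain_cong[of s \<omega> t \<kappa> \<nu>, OF precedesD(3)[OF st \<omega>\<Omega>]])
      fix u assume "s \<omega> < u" "u \<le> t \<omega>"
      then show "\<kappa> u \<omega> = \<nu> u \<omega>" using timesD(3)[OF t \<omega>\<Omega>] by (intro eq \<omega>) auto
    qed
    then show "payoff \<kappa> s t Y \<omega> = payoff \<nu> s t Y \<omega>" by (simp add: payoff_def)
  qed
  moreover have "AE \<omega> in C. \<omega> \<in> A \<longrightarrow> ereal_cond_exp (M \<kappa>) (S s) (payoff \<nu> s t Y) \<omega> = ereal_cond_exp (M \<nu>) (S s) (payoff \<nu> s t Y) \<omega>"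
    by (rule ereal_cond_exp_after[OF c s A _ measurable_from_subalg[OF subalgebra_FS[OF t] payoff_measurable[OF c(2) st Y]]], rule eq)
  ultimately show ?thesis unfolding AE_M[OF c(1)] val_def by eventually_elim simp
qed

text \<open>Neither the cost between s0 and s nor the restriction of the measure to
  \<open>S s\<close> sees what the control does after s.\<close>

lemma val_before:
  assumes c: "\<kappa> \<in> controls" "\<mu> \<in> controls" and ord: "precedes s0 s"
    and eq: "\<And>u \<omega>. r < u \<Longrightarrow> u \<le> s \<omega> \<Longrightarrow> \<omega> \<in> \<Omega> \<Longrightarrow> \<kappa> u \<omega> = \<mu> u \<omega>" and W: "W \<in> borel_measurable (S s)"
  shows "AE \<omega> in C. val \<kappa> s0 s W \<omega> = val \<mu> s0 s W \<omega>"
proof -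
  note s0 = precedesD(1)[OF ord] and s = precedesD(2)[OF ord]
  interpret K: sigma_finite_subalgebra "M \<kappa>" "S s0" by (rule cond_subalgebra[OF c(1) s0])
  have "AE \<omega> in M \<kappa>. payoff \<kappa> s0 s W \<omega> = payoff \<mu> s0 s W \<omega>"
  proof (rule AE_I2)
    fix \<omega> assume "\<omega> \<in> space (M \<kappa>)"
    then have \<omega>: "\<omega> \<in> \<Omega>" by simp
    have "gain \<kappa> s0 s \<omega> = gain \<mu> s0 s \<omega>"
    proof (rule gain_cong[of s0 \<omega> s \<kappa> \<mu>, OF precedesD(3)[OF ord \<omega>]])
      fix u assume "s0 \<omega> < u" "u \<le> s \<omega>"
      then show "\<kappa> u \<omega> = \<mu> u \<omega>" using timesD(2)[OF s0 \<omega>] by (intro eq \<omega>) auto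
    qed
    then show "payoff \<kappa> s0 s W \<omega> = payoff \<mu> s0 s W \<omega>" by (simp add: payoff_def)
  qed
  from K.ereal_cond_exp_cong[OF payoff_measurable_M[OF c(1) ord W] payoff_measurable_M[OF c(2) ord W] this]
  have "AE \<omega> in M \<kappa>. val \<kappa> s0 s W \<omega> = ereal_cond_exp (M \<kappa>) (S s0) (payoff \<mu> s0 s W) \<omega>" by (simp add: val_def)
  moreover have "AE \<omega> in C. ereal_cond_exp (M \<kappa>) (S s0) (payoff \<mu> s0 s W) \<omega> = ereal_cond_exp (M \<mu>) (S s0) (payoff \<mu> s0 s W) \<omega>"
    by (rule ereal_cond_exp_before[OF c s s0 _ _ payoff_measurable[OF c(2) ord W]]) (rule precedesD(3)[OF ord], assumption, rule eq)
  ultimately show ?thesis unfolding AE_M[OF c(1)] val_def by eventually_elim simp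
qed

text \<open>An upper bound on the cost of the zero control is a lower bound on its payoff, and
  constants survive conditional expectation. One member of the family is thus bounded below, and
  with it the essential supremum.\<close>

lemma val_zero_bounded:
  assumes st: "precedes s t" and Y: "Y \<in> BB t"
  shows "val (\<lambda>_ _. 0) s t Y \<in> BB s"
proof -
  let ?z = "\<lambda>_ _. 0 :: real ^ 'n"
  note s = precedesD(1)[OF st] and t = precedesD(2)[OF st]
  interpret K: sigma_finite_subalgebra "M ?z" "S s" by (rule cond_subalgebra[OF zero_control s])
  obtain k where k: "\<And>\<omega>. \<omega> \<in> \<Omega> \<Longrightarrow> gain ?z s t \<omega> \<le> k" using gain_zero_bounded s t precedesD(3)[OF st] by blast
  obtain c where c: "AE \<omega> in C. ereal c \<le> Y \<omega>" using BB_bound[OF Y] by blast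
  have "AE \<omega> in C. ereal (c - k) \<le> payoff ?z s t Y \<omega>"
    using c AE_space
  proof eventually_elim
    fix \<omega> assume 1: "ereal c \<le> Y \<omega>" "\<omega> \<in> space C"
    then have "ereal c + ereal (- k) \<le> Y \<omega> + ereal (- gain ?z s t \<omega>)" using k[of \<omega>] by (intro add_mono) auto
    then show "ereal (c - k) \<le> payoff ?z s t Y \<omega>" by (simp add: payoff_def)
  qed
  then have le: "AE \<omega> in M ?z. ereal (c - k) \<le> payoff ?z s t Y \<omega>" by (simp add: AE_M[OF zero_control])
  have m: "(\<lambda>_. ereal (c - k)) \<in> borel_measurable (M ?z)" by simp
  from K.ereal_cond_exp_mono[OF m payoff_measurable_M[OF zero_control st BB_measurable[OF Y]] le] K.ereal_cond_exp_F_meas[of "\<lambda>_. ereal (c - k)", OF borel_measurable_const]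
  have "AE \<omega> in M ?z. ereal (c - k) \<le> val ?z s t Y \<omega>" unfolding val_def by eventually_elim simp
  then show ?thesis unfolding AE_M[OF zero_control] by (rule BB_I[OF val_measurable])
qed

end

section \<open>The dynamic process\<close>

context control_problem begin

abbreviation DP :: "('n path \<Rightarrow> real) \<Rightarrow> ('n path \<Rightarrow> real) \<Rightarrow> ('n path \<Rightarrow> ereal) \<Rightarrow> 'n path \<Rightarrow> ereal" where
  "DP \<equiv> dynamic_process \<sigma> \<Lambda> g r T Q"

text \<open>Bifurcation at s: follow \<nu> after s on the set where its value is larger, and \<mu>
  elsewhere. Values are known at s, so this set may be used for pasting, and
  \<open>val_local\<close> evaluates the pasted control on both parts.\<close>

lemma better_control:
  assumes c: "\<mu> \<in> controls" "\<nu> \<in> controls" and st: "precedes s t" and Y: "Y \<in> borel_measurable (S t)"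
  shows "\<exists>\<kappa>\<in>controls. AE \<omega> in C. val \<kappa> s t Y \<omega> = max (val \<mu> s t Y \<omega>) (val \<nu> s t Y \<omega>)"
proof -
  note s = precedesD(1)[OF st]
  define A where "A = {\<omega> \<in> space (S s). val \<mu> s t Y \<omega> < val \<nu> s t Y \<omega>}"
  have A: "A \<in> sets (S s)" unfolding A_def by (rule borel_measurable_less[OF val_measurable val_measurable])
  have A': "\<Omega> - A \<in> sets (S s)" using sets.compl_sets[OF A] by simp
  let ?\<kappa> = "paste s A \<mu> \<nu>"
  have \<kappa>: "?\<kappa> \<in> controls" by (rule paste_control[OF c s A])
  have "AE \<omega> in C. \<omega> \<in> A \<longrightarrow> val ?\<kappa> s t Y \<omega> = val \<nu> s t Y \<omega>"
    by (rule val_local[OF \<kappa> c(2) st A _ Y]) (simp add: paste_def)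
  moreover have "AE \<omega> in C. \<omega> \<in> \<Omega> - A \<longrightarrow> val ?\<kappa> s t Y \<omega> = val \<mu> s t Y \<omega>"
    by (rule val_local[OF \<kappa> c(1) st A' _ Y]) (simp add: paste_def)
  ultimately have "AE \<omega> in C. val ?\<kappa> s t Y \<omega> = max (val \<mu> s t Y \<omega>) (val \<nu> s t Y \<omega>)"
    using AE_space
  proof eventually_elim
    fix \<omega> assume 1: "\<omega> \<in> A \<longrightarrow> val ?\<kappa> s t Y \<omega> = val \<nu> s t Y \<omega>" "\<omega> \<in> \<Omega> - A \<longrightarrow> val ?\<kappa> s t Y \<omega> = val \<mu> s t Y \<omega>" "\<omega> \<in> space C"
    show "val ?\<kappa> s t Y \<omega> = max (val \<mu> s t Y \<omega>) (val \<nu> s t Y \<omega>)"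
    proof (cases "\<omega> \<in> A")
      case True
      then have "val \<mu> s t Y \<omega> < val \<nu> s t Y \<omega>" by (simp add: A_def)
      then show ?thesis using 1(1) True by (simp add: max_absorb2 less_imp_le)
    next
      case False
      then have "val \<nu> s t Y \<omega> \<le> val \<mu> s t Y \<omega>" using 1(3) by (simp add: A_def not_less)
      then show ?thesis using 1(2,3) False by (simp add: max_absorb1)
    qed
  qed
  with \<kappa> show ?thesis by blast
qed

text \<open>Being an essential supremum depends on the members of the family only up to null sets,
  and by \<open>val_penalty\<close> the two families agree in that sense.\<close>

lemma is_ess_sup_DP_iff:
  assumes st: "precedes s t" and Y: "Y \<in> BB t"
  shows "is_ess_sup C (penalized_expectations \<sigma> \<Lambda> g r T Q s t Y) Z \<longleftrightarrow>
    is_ess_sup C ((\<lambda>\<mu>. val \<mu> s t Y) ` controls) Z"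
proof -
  have b: "(\<forall>f\<in>penalized_expectations \<sigma> \<Lambda> g r T Q s t Y. AE \<omega> in C. f \<omega> \<le> W \<omega>) \<longleftrightarrow>
      (\<forall>f\<in>(\<lambda>\<mu>. val \<mu> s t Y) ` controls. AE \<omega> in C. f \<omega> \<le> W \<omega>)" for W
  proof -
    have "(AE \<omega> in C. ereal_cond_exp (M \<mu>) (S s) Y \<omega> - ereal (penalty \<sigma> g r T Q s t \<mu> \<omega>) \<le> W \<omega>) \<longleftrightarrow> (AE \<omega> in C. val \<mu> s t Y \<omega> \<le> W \<omega>)"
      if "\<mu> \<in> controls" for \<mu>
    proof
      assume "AE \<omega> in C. ereal_cond_exp (M \<mu>) (S s) Y \<omega> - ereal (penalty \<sigma> g r T Q s t \<mu> \<omega>) \<le> W \<omega>"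
      with val_penalty[OF that st Y] show "AE \<omega> in C. val \<mu> s t Y \<omega> \<le> W \<omega>" by eventually_elim simp
    next
      assume "AE \<omega> in C. val \<mu> s t Y \<omega> \<le> W \<omega>"
      with val_penalty[OF that st Y]
      show "AE \<omega> in C. ereal_cond_exp (M \<mu>) (S s) Y \<omega> - ereal (penalty \<sigma> g r T Q s t \<mu> \<omega>) \<le> W \<omega>" by eventually_elim simp
    qed
    then show ?thesis unfolding penalized_expectations_def by auto
  qed
  show ?thesis unfolding is_ess_sup_def b ..
qed

text \<open>\<open>is_ess_sup_countable\<close> provides countably many controls. One more member of
  the family does not change the essential supremum, and with the zero control in front the
  increasing sequence built from the enumeration starts at a value bounded below.\<close>

lemma ess_sup_exists:
  assumes st: "precedes s t" and Y: "Y \<in> BB t"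
  shows "\<exists>e :: nat \<Rightarrow> real \<Rightarrow> 'n path \<Rightarrow> real ^ 'n. (\<forall>n. e n \<in> controls) \<and> e 0 = (\<lambda>_ _. 0) \<and> is_ess_sup C ((\<lambda>\<mu>. val \<mu> s t Y) ` controls) (\<lambda>\<omega>. SUP n. val (e n) s t Y \<omega>)"
proof -
  let ?E = "(\<lambda>\<mu>. val \<mu> s t Y) ` controls" and ?z = "\<lambda>(_ :: real) (_ :: 'n path). 0 :: real ^ 'n"
  have E: "?E \<subseteq> borel_measurable C" using S_measurable_C[OF precedesD(1)[OF st] val_measurable] by blast
  obtain D where D: "D \<subseteq> ?E" "countable D" "is_ess_sup C ?E (\<lambda>\<omega>. SUP f\<in>D. f \<omega>)"
    using is_ess_sup_countable[OF C.finite_measure_axioms E] by blast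
  obtain A where A: "A \<subseteq> controls" "countable A" "D = (\<lambda>\<mu>. val \<mu> s t Y) ` A"
    using countable_subset_image[of D "\<lambda>\<mu>. val \<mu> s t Y" controls] D(1,2) by blast
  define e where "e = case_nat ?z (from_nat_into (insert ?z A))"
  have r: "range e = insert ?z A"
  proof -
    have "range (from_nat_into (insert ?z A)) = insert ?z A" using A(2) by (intro range_from_nat_into) auto
    moreover have "range e = insert (e 0) (range (\<lambda>n. e (Suc n)))" using image_insert[of e 0 "range Suc"] by (simp add: UNIV_nat_eq[symmetric] image_image)
    ultimately show ?thesis by (simp add: e_def)
  qed
  have ec: "e n \<in> controls" for n using r A(1) zero_control rangeI[of e n] by auto
  have "is_ess_sup C ?E (\<lambda>\<omega>. SUP n. val (e n) s t Y \<omega>)"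
    unfolding is_ess_sup_def
  proof (intro conjI ballI impI)
    show "(\<lambda>\<omega>. SUP n. val (e n) s t Y \<omega>) \<in> borel_measurable C"
      using S_measurable_C[OF precedesD(1)[OF st] val_measurable] by (intro borel_measurable_SUP) auto
    fix f assume f: "f \<in> ?E"
    have "AE \<omega> in C. f \<omega> \<le> (SUP f\<in>D. f \<omega>)"
      by (rule bspec[OF D(3)[unfolded is_ess_sup_def, THEN conjunct2, THEN conjunct1] f])
    then show "AE \<omega> in C. f \<omega> \<le> (SUP n. val (e n) s t Y \<omega>)"
    proof eventually_elim
      fix \<omega> assume f: "f \<omega> \<le> (SUP f\<in>D. f \<omega>)"
      have "(SUP f\<in>D. f \<omega>) \<le> (SUP n. val (e n) s t Y \<omega>)"
      proof (rule SUP_least)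
        fix f assume "f \<in> D"
        then obtain \<mu> where "\<mu> \<in> A" "f = val \<mu> s t Y" using A(3) by blast
        moreover from this have "\<mu> \<in> range e" unfolding r by simp
        then obtain n where "e n = \<mu>" by blast
        ultimately show "f \<omega> \<le> (SUP n. val (e n) s t Y \<omega>)" by (auto intro: SUP_upper)
      qed
      with f show "f \<omega> \<le> (SUP n. val (e n) s t Y \<omega>)" by (rule order_trans)
    qed
  next
    fix Z assume "\<forall>f\<in>?E. AE \<omega> in C. f \<omega> \<le> Z \<omega>"
    then have "AE \<omega> in C. \<forall>n. val (e n) s t Y \<omega> \<le> Z \<omega>" using ec by (intro AE_all_countable[THEN iffD2]) blast
    then show "AE \<omega> in C. (SUP n. val (e n) s t Y \<omega>) \<le> Z \<omega>" by eventually_elim (rule SUP_least, blast)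
  qed
  then show ?thesis using ec by (intro exI[of _ e]) (simp add: e_def)
qed

text \<open>Existence is what gives the \<open>SOME\<close> in \<open>ess_sup\<close> its meaning.
  The first form belongs to the statement, the second is the one to work with.\<close>

lemma DP_ess_sup:
  assumes st: "precedes s t" and Y: "Y \<in> BB t"
  shows "is_ess_sup C (penalized_expectations \<sigma> \<Lambda> g r T Q s t Y) (DP s t Y)"
    "is_ess_sup C ((\<lambda>\<mu>. val \<mu> s t Y) ` controls) (DP s t Y)"
proof -
  have "\<exists>Z. is_ess_sup C (penalized_expectations \<sigma> \<Lambda> g r T Q s t Y) Z"
    unfolding is_ess_sup_DP_iff[OF st Y] using ess_sup_exists[OF st Y] by blast
  then show 1: "is_ess_sup C (penalized_expectations \<sigma> \<Lambda> g r T Q s t Y) (DP s t Y)"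
    unfolding dynamic_process_def ess_sup_def by (rule someI_ex)
  then show "is_ess_sup C ((\<lambda>\<mu>. val \<mu> s t Y) ` controls) (DP s t Y)" unfolding is_ess_sup_DP_iff[OF st Y] .
qed

lemma DP_upper:
  "precedes s t \<Longrightarrow> Y \<in> BB t \<Longrightarrow> \<mu> \<in> controls \<Longrightarrow> AE \<omega> in C. val \<mu> s t Y \<omega> \<le> DP s t Y \<omega>"
  using DP_ess_sup(2)[of s t Y] unfolding is_ess_sup_def by blast

lemma DP_least:
  assumes "precedes s t" "Y \<in> BB t" "Z \<in> borel_measurable C" "\<And>\<mu>. \<mu> \<in> controls \<Longrightarrow> AE \<omega> in C. val \<mu> s t Y \<omega> \<le> Z \<omega>"
  shows "AE \<omega> in C. DP s t Y \<omega> \<le> Z \<omega>"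
  using DP_ess_sup(2)[OF assms(1,2)] assms(3,4) unfolding is_ess_sup_def by blast

text \<open>Controls can be improved by bifurcation at time \<open>s\<close>, so the essential supremum is a monotone limit.\<close>

lemma DP_approx:
  assumes st: "precedes s t" and Y: "Y \<in> BB t"
  shows "\<exists>\<kappa> :: nat \<Rightarrow> real \<Rightarrow> 'n path \<Rightarrow> real ^ 'n. (\<forall>n. \<kappa> n \<in> controls) \<and> \<kappa> 0 = (\<lambda>_ _. 0) \<and>
    (AE \<omega> in C. incseq (\<lambda>n. val (\<kappa> n) s t Y \<omega>)) \<and> (AE \<omega> in C. (\<lambda>n. val (\<kappa> n) s t Y \<omega>) \<longlonglongrightarrow> DP s t Y \<omega>)"
proof -
  obtain e :: "nat \<Rightarrow> real \<Rightarrow> 'n path \<Rightarrow> real ^ 'n" where e: "\<And>n. e n \<in> controls" "e 0 = (\<lambda>_ _. 0)"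
      "is_ess_sup C ((\<lambda>\<mu>. val \<mu> s t Y) ` controls) (\<lambda>\<omega>. SUP n. val (e n) s t Y \<omega>)"
    using ess_sup_exists[OF st Y] by blast
  have eq: "AE \<omega> in C. DP s t Y \<omega> = (SUP n. val (e n) s t Y \<omega>)"
    by (rule is_ess_sup_unique[OF DP_ess_sup(2)[OF st Y] e(3)])
  define b where "b \<mu> \<nu> = (SOME \<kappa>. \<kappa> \<in> controls \<and> (AE \<omega> in C. val \<kappa> s t Y \<omega> = max (val \<mu> s t Y \<omega>) (val \<nu> s t Y \<omega>)))" for \<mu> \<nu>
  have b: "b \<mu> \<nu> \<in> controls \<and> (AE \<omega> in C. val (b \<mu> \<nu>) s t Y \<omega> = max (val \<mu> s t Y \<omega>) (val \<nu> s t Y \<omega>))"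
    if "\<mu> \<in> controls" "\<nu> \<in> controls" for \<mu> \<nu>
  proof -
    have "\<exists>\<kappa>. \<kappa> \<in> controls \<and> (AE \<omega> in C. val \<kappa> s t Y \<omega> = max (val \<mu> s t Y \<omega>) (val \<nu> s t Y \<omega>))"
      using better_control[OF that st BB_measurable[OF Y]] by blast
    from someI_ex[OF this] show ?thesis unfolding b_def .
  qed
  \<comment> \<open>A running maximum: each further member of the enumeration is merged into the
    control obtained so far.\<close>
  define \<kappa> where "\<kappa> = rec_nat (e 0) (\<lambda>n \<mu>. b \<mu> (e (Suc n)))"
  have \<kappa>0: "\<kappa> 0 = e 0" and \<kappa>S: "\<kappa> (Suc n) = b (\<kappa> n) (e (Suc n))" for n by (simp_all add: \<kappa>_def)
  have \<kappa>c: "\<kappa> n \<in> controls" for n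
  proof (induction n)
    case (Suc n) then show ?case unfolding \<kappa>S using b[OF Suc e(1)] by blast
  qed (simp add: \<kappa>0 e(1))
  have step: "AE \<omega> in C. \<forall>n. val (\<kappa> (Suc n)) s t Y \<omega> = max (val (\<kappa> n) s t Y \<omega>) (val (e (Suc n)) s t Y \<omega>)"
    unfolding \<kappa>S by (intro AE_all_countable[THEN iffD2] allI b[OF \<kappa>c e(1), THEN conjunct2])
  have up: "AE \<omega> in C. \<forall>n. val (\<kappa> n) s t Y \<omega> \<le> DP s t Y \<omega>"
    by (intro AE_all_countable[THEN iffD2] allI DP_upper[OF st Y \<kappa>c])
  have inc: "AE \<omega> in C. incseq (\<lambda>n. val (\<kappa> n) s t Y \<omega>)"
    using step by eventually_elim (auto intro!: incseq_SucI)
  have "AE \<omega> in C. (\<lambda>n. val (\<kappa> n) s t Y \<omega>) \<longlonglongrightarrow> DP s t Y \<omega>"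
    using step up inc eq
  proof eventually_elim
    fix \<omega>
    assume st: "\<forall>n. val (\<kappa> (Suc n)) s t Y \<omega> = max (val (\<kappa> n) s t Y \<omega>) (val (e (Suc n)) s t Y \<omega>)"
      and up: "\<forall>n. val (\<kappa> n) s t Y \<omega> \<le> DP s t Y \<omega>" and inc: "incseq (\<lambda>n. val (\<kappa> n) s t Y \<omega>)"
      and eq: "DP s t Y \<omega> = (SUP n. val (e n) s t Y \<omega>)"
    have "val (e n) s t Y \<omega> \<le> val (\<kappa> n) s t Y \<omega>" for n by (cases n) (simp_all add: \<kappa>0 st)
    then have "DP s t Y \<omega> \<le> (SUP n. val (\<kappa> n) s t Y \<omega>)" unfolding eq by (intro SUP_mono) blast
    moreover have "(SUP n. val (\<kappa> n) s t Y \<omega>) \<le> DP s t Y \<omega>" using up by (intro SUP_least) blast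
    ultimately have "DP s t Y \<omega> = (SUP n. val (\<kappa> n) s t Y \<omega>)" by (rule antisym)
    then show "(\<lambda>n. val (\<kappa> n) s t Y \<omega>) \<longlonglongrightarrow> DP s t Y \<omega>" using LIMSEQ_SUP[OF inc] by simp
  qed
  then show ?thesis using \<kappa>c inc \<kappa>0 e(2) by (intro exI[of _ \<kappa>]) simp
qed

text \<open>An essential supremum over \<open>completion Q\<close> is a priori measurable only
  there. It agrees almost everywhere with a countable supremum of values, which are known at
  s.\<close>

lemma DP_measurable:
  assumes st: "precedes s t" and Y: "Y \<in> BB t"
  shows "DP s t Y \<in> borel_measurable (S s)"
proof -
  obtain e :: "nat \<Rightarrow> real \<Rightarrow> 'n path \<Rightarrow> real ^ 'n" where e: "\<And>n. e n \<in> controls" "is_ess_sup C ((\<lambda>\<mu>. val \<mu> s t Y) ` controls) (\<lambda>\<omega>. SUP n. val (e n) s t Y \<omega>)"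
    using ess_sup_exists[OF st Y] by blast
  have "(\<lambda>\<omega>. SUP n. val (e n) s t Y \<omega>) \<in> borel_measurable (S s)"
    using val_measurable by (intro borel_measurable_SUP) auto
  then show ?thesis
    by (rule measurable_S_cong_AE[OF precedesD(1)[OF st] _ is_ess_sup_unique[OF e(2) DP_ess_sup(2)[OF st Y]]]) simp
qed

lemma DP_BB:
  assumes st: "precedes s t" and Y: "Y \<in> BB t"
  shows "DP s t Y \<in> BB s"
  by (rule BB_mono[OF val_zero_bounded[OF st Y] DP_measurable[OF st Y] DP_upper[OF st Y zero_control]])

lemma DP_measurable_C: "precedes s t \<Longrightarrow> Y \<in> BB t \<Longrightarrow> DP s t Y \<in> borel_measurable C"
  by (rule S_measurable_C[OF precedesD(1) DP_measurable])

section \<open>Monotonicity, translation, convexity and continuity from below\<close>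

lemma DP_mono:
  assumes st: "precedes s t" and Y: "Y \<in> BB t" "Z \<in> BB t" and le: "AE \<omega> in C. Y \<omega> \<le> Z \<omega>"
  shows "AE \<omega> in C. DP s t Y \<omega> \<le> DP s t Z \<omega>"
proof (rule DP_least[OF st Y(1) DP_measurable_C[OF st Y(2)]])
  fix \<mu> assume \<mu>: "\<mu> \<in> controls"
  from val_mono[OF \<mu> st BB_measurable[OF Y(1)] BB_measurable[OF Y(2)] le] DP_upper[OF st Y(2) \<mu>]
  show "AE \<omega> in C. val \<mu> s t Y \<omega> \<le> DP s t Z \<omega>" by eventually_elim (rule order_trans)
qed

lemma BB_shift:
  assumes s: "s \<in> times" and Y: "Y \<in> BB s" and Z: "Z \<in> borel_measurable (S s)" "\<forall>\<omega>\<in>\<Omega>. \<bar>Z \<omega>\<bar> \<le> k"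
  shows "(\<lambda>\<omega>. Y \<omega> + ereal (Z \<omega>)) \<in> BB s"
proof -
  obtain c where c: "AE \<omega> in C. ereal c \<le> Y \<omega>" using BB_bound[OF Y] by blast
  have "AE \<omega> in C. ereal (c - k) \<le> Y \<omega> + ereal (Z \<omega>)"
    using c AE_space
  proof eventually_elim
    fix \<omega> assume 1: "ereal c \<le> Y \<omega>" "\<omega> \<in> space C"
    then have "ereal c + ereal (- k) \<le> Y \<omega> + ereal (Z \<omega>)" using bspec[OF Z(2), of \<omega>] by (intro add_mono) auto
    then show "ereal (c - k) \<le> Y \<omega> + ereal (Z \<omega>)" by simp
  qed
  moreover have "(\<lambda>\<omega>. Y \<omega> + ereal (Z \<omega>)) \<in> borel_measurable (S s)" using BB_measurable[OF Y] Z(1) by measurable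
  ultimately show ?thesis by (rule BB_I[rotated])
qed

lemma DP_shift_le:
  assumes st: "precedes s t" and Y: "Y \<in> BB t" and Z: "Z \<in> borel_measurable (S s)" "\<forall>\<omega>\<in>\<Omega>. \<bar>Z \<omega>\<bar> \<le> k"
  shows "AE \<omega> in C. DP s t (\<lambda>\<omega>. Y \<omega> + ereal (Z \<omega>)) \<omega> \<le> DP s t Y \<omega> + ereal (Z \<omega>)"
proof -
  note s = precedesD(1)[OF st] and t = precedesD(2)[OF st]
  have Zt: "Z \<in> borel_measurable (S t)" by (rule measurable_from_subalg[OF subalgebra_SS[OF s t precedesD(3)[OF st]] Z(1)])
  have W: "(\<lambda>\<omega>. ereal (Z \<omega>)) \<in> borel_measurable (S s)" using Z(1) by measurable
  have WB: "(\<lambda>\<omega>. ereal (Z \<omega>)) \<in> BB s"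
  proof (rule BB_I[OF W, of "- k"])
    show "AE \<omega> in C. ereal (- k) \<le> ereal (Z \<omega>)" by (rule AE_I2) (use Z(2) in force)
  qed
  have m: "(\<lambda>\<omega>. DP s t Y \<omega> + ereal (Z \<omega>)) \<in> borel_measurable C"
    using DP_measurable_C[OF st Y] S_measurable_C[OF s W] by measurable
  show ?thesis
  proof (rule DP_least[OF st BB_shift[OF t Y Zt Z(2)] m])
    fix \<mu> assume \<mu>: "\<mu> \<in> controls"
    from val_shift[OF \<mu> st BB_quasi[OF \<mu> t Y] W BB_quasi[OF \<mu> s WB]] DP_upper[OF st Y \<mu>]
    show "AE \<omega> in C. val \<mu> s t (\<lambda>\<omega>. Y \<omega> + ereal (Z \<omega>)) \<omega> \<le> DP s t Y \<omega> + ereal (Z \<omega>)"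
      by eventually_elim (simp add: add_right_mono)
  qed
qed

text \<open>\<open>DP_shift_le\<close> is one inequality; the other is the same lemma for the
  shifted variable and the shift by - Z.\<close>

lemma DP_shift:
  assumes st: "precedes s t" and Y: "Y \<in> BB t" and Z: "Z \<in> borel_measurable (S s)" "bounded (Z ` \<Omega>)"
  shows "AE \<omega> in C. DP s t (\<lambda>\<omega>. Y \<omega> + ereal (Z \<omega>)) \<omega> = DP s t Y \<omega> + ereal (Z \<omega>)"
proof -
  note s = precedesD(1)[OF st] and t = precedesD(2)[OF st]
  obtain k where k: "\<forall>\<omega>\<in>\<Omega>. \<bar>Z \<omega>\<bar> \<le> k" using Z(2) unfolding bounded_iff by auto
  let ?Y = "\<lambda>\<omega>. Y \<omega> + ereal (Z \<omega>)"
  have Zt: "Z \<in> borel_measurable (S t)" by (rule measurable_from_subalg[OF subalgebra_SS[OF s t precedesD(3)[OF st]] Z(1)])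
  have Z': "(\<lambda>\<omega>. - Z \<omega>) \<in> borel_measurable (S s)" using Z(1) by measurable
  have k': "\<forall>\<omega>\<in>\<Omega>. \<bar>- Z \<omega>\<bar> \<le> k" using k by simp
  \<comment> \<open>Z is real valued, so adding and subtracting it is harmless even where Y is
    infinite.\<close>
  have undo: "(\<lambda>\<omega>. ?Y \<omega> + ereal (- Z \<omega>)) = Y"
  proof
    show "?Y \<omega> + ereal (- Z \<omega>) = Y \<omega>" for \<omega> by (cases "Y \<omega>") auto
  qed
  from DP_shift_le[OF st BB_shift[OF t Y Zt k] Z' k', unfolded undo] DP_shift_le[OF st Y Z(1) k]
  show ?thesis
  proof eventually_elim
    fix \<omega> assume 1: "DP s t Y \<omega> \<le> DP s t ?Y \<omega> + ereal (- Z \<omega>)" "DP s t ?Y \<omega> \<le> DP s t Y \<omega> + ereal (Z \<omega>)"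
    then show "DP s t ?Y \<omega> = DP s t Y \<omega> + ereal (Z \<omega>)"
      by (cases "DP s t Y \<omega>"; cases "DP s t ?Y \<omega>") auto
  qed
qed

text \<open>For a fixed control the value is affine in Y, because the running cost receives the
  total weight c + (1 - c) = 1; a supremum of affine maps is convex.\<close>

lemma DP_convex:
  assumes st: "precedes s t" and Y: "Y \<in> BB t" "Y' \<in> BB t" and c: "0 \<le> c" "c \<le> 1"
  shows "AE \<omega> in C. DP s t (\<lambda>\<omega>. ereal c * Y \<omega> + ereal (1 - c) * Y' \<omega>) \<omega> \<le> ereal c * DP s t Y \<omega> + ereal (1 - c) * DP s t Y' \<omega>"
proof -
  note s = precedesD(1)[OF st] and t = precedesD(2)[OF st]
  let ?Y = "\<lambda>\<omega>. ereal c * Y \<omega> + ereal (1 - c) * Y' \<omega>"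
  have m: "?Y \<in> borel_measurable (S t)" using BB_measurable[OF Y(1)] BB_measurable[OF Y(2)] by measurable
  obtain k k' where k: "AE \<omega> in C. ereal k \<le> Y \<omega>" "AE \<omega> in C. ereal k' \<le> Y' \<omega>" using BB_bound[OF Y(1)] BB_bound[OF Y(2)] by blast
  have "AE \<omega> in C. ereal (c * k + (1 - c) * k') \<le> ?Y \<omega>"
    using k
  proof eventually_elim
    fix \<omega> assume "ereal k \<le> Y \<omega>" "ereal k' \<le> Y' \<omega>"
    then have "ereal c * ereal k + ereal (1 - c) * ereal k' \<le> ?Y \<omega>" using c by (intro add_mono ereal_mult_left_mono) auto
    then show "ereal (c * k + (1 - c) * k') \<le> ?Y \<omega>" by simp
  qed
  then have B: "?Y \<in> BB t" by (rule BB_I[OF m])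
  have mP: "(\<lambda>\<omega>. ereal c * DP s t Y \<omega> + ereal (1 - c) * DP s t Y' \<omega>) \<in> borel_measurable C"
    using DP_measurable_C[OF st Y(1)] DP_measurable_C[OF st Y(2)] by measurable
  show ?thesis
  proof (rule DP_least[OF st B mP])
    fix \<mu> assume \<mu>: "\<mu> \<in> controls"
    interpret K: sigma_finite_subalgebra "M \<mu>" "S s" by (rule cond_subalgebra[OF \<mu> s])
    let ?p = "\<lambda>\<omega>. ereal c * payoff \<mu> s t Y \<omega>" and ?p' = "\<lambda>\<omega>. ereal (1 - c) * payoff \<mu> s t Y' \<omega>"
    have q: "quasi_integrable (M \<mu>) (payoff \<mu> s t Y)" "quasi_integrable (M \<mu>) (payoff \<mu> s t Y')"
      using BB_quasi[OF \<mu> t] Y by (auto intro: payoff_quasi[OF \<mu> \<mu> st])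
    have qp: "quasi_integrable (M \<mu>) ?p" "quasi_integrable (M \<mu>) ?p'"
      using c by (auto intro!: quasi_integrable_cmult q)
    \<comment> \<open>The lower bounds exclude minus infinity. The cases c = 0 and c = 1 are
      separate because 0 times infinity is 0.\<close>
    have "AE \<omega> in M \<mu>. payoff \<mu> s t ?Y \<omega> = ?p \<omega> + ?p' \<omega>"
      unfolding AE_M[OF \<mu>] using k
    proof eventually_elim
      fix \<omega> assume "ereal k \<le> Y \<omega>" "ereal k' \<le> Y' \<omega>"
      then show "payoff \<mu> s t ?Y \<omega> = ?p \<omega> + ?p' \<omega>"
        using c unfolding payoff_def
        by (cases "Y \<omega>"; cases "Y' \<omega>"; cases "c = 0"; cases "c = 1") (auto simp: algebra_simps)
    qed
    from K.ereal_cond_exp_cong[OF payoff_measurable_M[OF \<mu> st m] quasi_integrable_measurable[OF quasi_integrable_add[OF qp]] this]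
      K.ereal_cond_exp_add[OF qp] K.ereal_cond_exp_cmult[OF q(1) c(1)] K.ereal_cond_exp_cmult[OF q(2), of "1 - c"] c
    have "AE \<omega> in M \<mu>. val \<mu> s t ?Y \<omega> = ereal c * val \<mu> s t Y \<omega> + ereal (1 - c) * val \<mu> s t Y' \<omega>"
      unfolding val_def by auto
    then have "AE \<omega> in C. val \<mu> s t ?Y \<omega> = ereal c * val \<mu> s t Y \<omega> + ereal (1 - c) * val \<mu> s t Y' \<omega>"
      unfolding AE_M[OF \<mu>] .
    then show "AE \<omega> in C. val \<mu> s t ?Y \<omega> \<le> ereal c * DP s t Y \<omega> + ereal (1 - c) * DP s t Y' \<omega>"
      using DP_upper[OF st Y(1) \<mu>] DP_upper[OF st Y(2) \<mu>]
    proof eventually_elim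
      fix \<omega> assume 1: "val \<mu> s t ?Y \<omega> = ereal c * val \<mu> s t Y \<omega> + ereal (1 - c) * val \<mu> s t Y' \<omega>"
        "val \<mu> s t Y \<omega> \<le> DP s t Y \<omega>" "val \<mu> s t Y' \<omega> \<le> DP s t Y' \<omega>"
      show "val \<mu> s t ?Y \<omega> \<le> ereal c * DP s t Y \<omega> + ereal (1 - c) * DP s t Y' \<omega>"
        unfolding 1(1) using 1(2,3) c by (intro add_mono ereal_mult_left_mono) auto
    qed
  qed
qed

text \<open>For a fixed control \<open>val_limit\<close> gives continuity from below, and the two
  suprema, over controls and over n, may be interchanged.\<close>

lemma DP_continuous:
  assumes st: "precedes s t" and Y: "\<And>n. Y n \<in> BB t" and Z: "Z \<in> BB t"
    and inc: "AE \<omega> in C. incseq (\<lambda>n. Y n \<omega>)" and lim: "AE \<omega> in C. (\<lambda>n. Y n \<omega>) \<longlonglongrightarrow> Z \<omega>"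
  shows "AE \<omega> in C. incseq (\<lambda>n. DP s t (Y n) \<omega>) \<and> (\<lambda>n. DP s t (Y n) \<omega>) \<longlonglongrightarrow> DP s t Z \<omega>"
proof -
  note t = precedesD(2)[OF st]
  have "AE \<omega> in C. DP s t (Y n) \<omega> \<le> DP s t (Y (Suc n)) \<omega>" for n
  proof (rule DP_mono[OF st Y Y])
    show "AE \<omega> in C. Y n \<omega> \<le> Y (Suc n) \<omega>" using inc by eventually_elim (rule incseq_SucD)
  qed
  then have "AE \<omega> in C. \<forall>n. DP s t (Y n) \<omega> \<le> DP s t (Y (Suc n)) \<omega>" by (simp add: AE_all_countable)
  then have i: "AE \<omega> in C. incseq (\<lambda>n. DP s t (Y n) \<omega>)" by eventually_elim (rule incseq_SucI, simp)
  have "AE \<omega> in C. Y n \<omega> \<le> Z \<omega>" for n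
    using inc lim by eventually_elim (rule incseq_le)
  from DP_mono[OF st Y Z this] have up: "AE \<omega> in C. \<forall>n. DP s t (Y n) \<omega> \<le> DP s t Z \<omega>" by (simp add: AE_all_countable)
  have m: "(\<lambda>\<omega>. SUP n. DP s t (Y n) \<omega>) \<in> borel_measurable C" using DP_measurable_C[OF st Y] by (intro borel_measurable_SUP) auto
  have "AE \<omega> in C. DP s t Z \<omega> \<le> (SUP n. DP s t (Y n) \<omega>)"
  proof (rule DP_least[OF st Z m])
    fix \<mu> assume \<mu>: "\<mu> \<in> controls"
    have "AE \<omega> in C. \<forall>n. val \<mu> s t (Y n) \<omega> \<le> DP s t (Y n) \<omega>" using DP_upper[OF st Y \<mu>] by (simp add: AE_all_countable)
    with val_limit[OF \<mu> st BB_measurable[OF Y] BB_measurable[OF Z] inc lim BB_quasi[OF \<mu> t Y]]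
    show "AE \<omega> in C. val \<mu> s t Z \<omega> \<le> (SUP n. DP s t (Y n) \<omega>)"
    proof eventually_elim
      fix \<omega> assume 1: "(\<lambda>n. val \<mu> s t (Y n) \<omega>) \<longlonglongrightarrow> val \<mu> s t Z \<omega>" "\<forall>n. val \<mu> s t (Y n) \<omega> \<le> DP s t (Y n) \<omega>"
      have "val \<mu> s t (Y n) \<omega> \<le> (SUP n. DP s t (Y n) \<omega>)" for n
        using 1(2) by (intro SUP_upper2[of n]) auto
      then show "val \<mu> s t Z \<omega> \<le> (SUP n. DP s t (Y n) \<omega>)" by (intro LIMSEQ_le_const2[OF 1(1)]) blast
    qed
  qed
  with up i show ?thesis
  proof eventually_elim
    fix \<omega> assume 1: "\<forall>n. DP s t (Y n) \<omega> \<le> DP s t Z \<omega>" "incseq (\<lambda>n. DP s t (Y n) \<omega>)" "DP s t Z \<omega> \<le> (SUP n. DP s t (Y n) \<omega>)"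
    have "(SUP n. DP s t (Y n) \<omega>) \<le> DP s t Z \<omega>" using 1(1) by (intro SUP_least) blast
    with 1(3) have "DP s t Z \<omega> = (SUP n. DP s t (Y n) \<omega>)" by (rule antisym)
    then show "incseq (\<lambda>n. DP s t (Y n) \<omega>) \<and> (\<lambda>n. DP s t (Y n) \<omega>) \<longlonglongrightarrow> DP s t Z \<omega>"
      using 1(2) LIMSEQ_SUP[OF 1(2)] by simp
  qed
qed

text \<open>One inequality is \<open>val_tower\<close> with the inner value replaced by its
  supremum. For the other, the inner supremum is an increasing limit of values of controls \<nu> n;
  following \<mu> up to s and \<nu> n afterwards is again a control of the class, and the limit
  passes through the outer value.\<close>

lemma DP_consistent:
  assumes ord: "precedes s0 s" "precedes s t" and Y: "Y \<in> BB t"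
  shows "AE \<omega> in C. DP s0 s (DP s t Y) \<omega> = DP s0 t Y \<omega>"
proof -
  note s0 = precedesD(1)[OF ord(1)] and s = precedesD(2)[OF ord(1)] and t = precedesD(2)[OF ord(2)] and ot = precedes_trans[OF ord]
  have B: "DP s t Y \<in> BB s" by (rule DP_BB[OF ord(2) Y])
  have "AE \<omega> in C. DP s0 t Y \<omega> \<le> DP s0 s (DP s t Y) \<omega>"
  proof (rule DP_least[OF ot Y DP_measurable_C[OF ord(1) B]])
    fix \<mu> assume \<mu>: "\<mu> \<in> controls"
    from val_tower[OF \<mu> ord BB_quasi[OF \<mu> t Y]] val_mono[OF \<mu> ord(1) val_measurable DP_measurable[OF ord(2) Y] DP_upper[OF ord(2) Y \<mu>]]
      DP_upper[OF ord(1) B \<mu>]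
    show "AE \<omega> in C. val \<mu> s0 t Y \<omega> \<le> DP s0 s (DP s t Y) \<omega>" by eventually_elim (auto intro: order_trans)
  qed
  moreover have "AE \<omega> in C. DP s0 s (DP s t Y) \<omega> \<le> DP s0 t Y \<omega>"
  proof (rule DP_least[OF ord(1) B DP_measurable_C[OF ot Y]])
    fix \<mu> assume \<mu>: "\<mu> \<in> controls"
    obtain \<nu> :: "nat \<Rightarrow> real \<Rightarrow> 'n path \<Rightarrow> real ^ 'n" where \<nu>: "\<And>n. \<nu> n \<in> controls" "\<nu> 0 = (\<lambda>_ _. 0)" "AE \<omega> in C. incseq (\<lambda>n. val (\<nu> n) s t Y \<omega>)"
        "AE \<omega> in C. (\<lambda>n. val (\<nu> n) s t Y \<omega>) \<longlonglongrightarrow> DP s t Y \<omega>"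
      using DP_approx[OF ord(2) Y] by blast
    have \<Omega>: "\<Omega> \<in> sets (S s)" using sets.top[of "S s"] by simp
    have le: "AE \<omega> in C. val \<mu> s0 s (val (\<nu> n) s t Y) \<omega> \<le> DP s0 t Y \<omega>" for n
    proof -
      let ?\<kappa> = "paste s \<Omega> \<mu> (\<nu> n)"
      have \<kappa>: "?\<kappa> \<in> controls" by (rule paste_control[OF \<mu> \<nu>(1) s \<Omega>])
      have "AE \<omega> in C. \<omega> \<in> \<Omega> \<longrightarrow> val ?\<kappa> s t Y \<omega> = val (\<nu> n) s t Y \<omega>"
        by (rule val_local[OF \<kappa> \<nu>(1) ord(2) \<Omega> _ BB_measurable[OF Y]]) (simp add: paste_def)
      with AE_space have "AE \<omega> in C. val ?\<kappa> s t Y \<omega> = val (\<nu> n) s t Y \<omega>" by eventually_elim simp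
      note val_cong[OF \<kappa> ord(1) val_measurable val_measurable this]
      moreover have "AE \<omega> in C. val ?\<kappa> s0 s (val (\<nu> n) s t Y) \<omega> = val \<mu> s0 s (val (\<nu> n) s t Y) \<omega>"
        by (rule val_before[OF \<kappa> \<mu> ord(1) _ val_measurable]) (simp add: paste_def)
      ultimately show ?thesis
        using val_tower[OF \<kappa> ord BB_quasi[OF \<kappa> t Y]] DP_upper[OF ot Y \<kappa>] by eventually_elim simp
    qed
    \<comment> \<open>The sequence begins with the zero control, whose value is bounded below, and
      this holds under the measure of \<mu> as well because null sets are shared. Monotone
      convergence under \<mu> needs such a start.\<close>
    have q: "quasi_integrable (M \<mu>) (val (\<nu> 0) s t Y)"
      unfolding \<nu>(2) by (rule BB_quasi[OF \<mu> s val_zero_bounded[OF ord(2) Y]])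
    have "AE \<omega> in C. \<forall>n. val \<mu> s0 s (val (\<nu> n) s t Y) \<omega> \<le> DP s0 t Y \<omega>" using le by (simp add: AE_all_countable)
    with val_limit[OF \<mu> ord(1) val_measurable DP_measurable[OF ord(2) Y] \<nu>(3,4) q]
    show "AE \<omega> in C. val \<mu> s0 s (DP s t Y) \<omega> \<le> DP s0 t Y \<omega>"
      by eventually_elim (rule LIMSEQ_le_const2, assumption, blast)
  qed
  ultimately show ?thesis by eventually_elim (rule antisym)
qed

section \<open>Assembly of the statement\<close>

lemma DP_properties:
  assumes "precedes s t"
  shows "convex_operator Q (S t) (DP s t)" "monotone_operator Q (S t) (DP s t)"
    "continuous_from_below Q (S t) (DP s t)" "translation_invariant Q (S s) (S t) (DP s t)"
proof -
  show "convex_operator Q (S t) (DP s t)"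
    unfolding convex_operator_def AE_Q using DP_convex[OF assms] by auto
  show "monotone_operator Q (S t) (DP s t)"
    unfolding monotone_operator_def AE_Q using DP_mono[OF assms] by auto
  show "translation_invariant Q (S s) (S t) (DP s t)"
    unfolding translation_invariant_def AE_Q using DP_shift[OF assms] by auto
  show "continuous_from_below Q (S t) (DP s t)"
    unfolding continuous_from_below_def AE_Q
  proof (intro allI impI, elim conjE)
    fix Y Z assume Y: "\<forall>k. Y k \<in> BB t" and Z: "Z \<in> BB t" and a: "AE \<omega> in C. incseq (\<lambda>k. Y k \<omega>) \<and> (\<lambda>k. Y k \<omega>) \<longlonglongrightarrow> Z \<omega>"
    from a have "AE \<omega> in C. incseq (\<lambda>k. Y k \<omega>)" "AE \<omega> in C. (\<lambda>k. Y k \<omega>) \<longlonglongrightarrow> Z \<omega>" by auto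
    from DP_continuous[OF assms _ Z this] Y
    show "AE \<omega> in C. incseq (\<lambda>k. DP s t (Y k) \<omega>) \<and> (\<lambda>k. DP s t (Y k) \<omega>) \<longlonglongrightarrow> DP s t Z \<omega>" by blast
  qed
qed

lemma dynamic_process_properties:
  "(\<forall>s\<in>times. \<forall>t\<in>times. (\<forall>\<omega>\<in>\<Omega>. s \<omega> \<le> t \<omega>) \<longrightarrow>
      (\<forall>Y\<in>BB t. is_ess_sup C (penalized_expectations \<sigma> \<Lambda> g r T Q s t Y) (DP s t Y) \<and> DP s t Y \<in> BB s) \<and>
      convex_operator Q (S t) (DP s t) \<and> monotone_operator Q (S t) (DP s t) \<and> continuous_from_below Q (S t) (DP s t))
   \<and> convex_dynamic_process r T Q DP \<and> time_consistent r T Q DP"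
proof (intro conjI)
  show "\<forall>s\<in>times. \<forall>t\<in>times. (\<forall>\<omega>\<in>\<Omega>. s \<omega> \<le> t \<omega>) \<longrightarrow>
      (\<forall>Y\<in>BB t. is_ess_sup C (penalized_expectations \<sigma> \<Lambda> g r T Q s t Y) (DP s t Y) \<and> DP s t Y \<in> BB s) \<and>
      convex_operator Q (S t) (DP s t) \<and> monotone_operator Q (S t) (DP s t) \<and> continuous_from_below Q (S t) (DP s t)"
  proof (intro ballI impI)
    fix s t assume "s \<in> times" "t \<in> times" "\<forall>\<omega>\<in>\<Omega>. s \<omega> \<le> t \<omega>"
    then have st: "precedes s t" by (simp add: precedes_def)
    show "(\<forall>Y\<in>BB t. is_ess_sup C (penalized_expectations \<sigma> \<Lambda> g r T Q s t Y) (DP s t Y) \<and> DP s t Y \<in> BB s) \<and>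
      convex_operator Q (S t) (DP s t) \<and> monotone_operator Q (S t) (DP s t) \<and> continuous_from_below Q (S t) (DP s t)"
      by (intro conjI ballI DP_ess_sup(1)[OF st] DP_BB[OF st] DP_properties[OF st])
  qed
  show "convex_dynamic_process r T Q DP"
    unfolding convex_dynamic_process_def
  proof (intro ballI impI)
    fix s t assume "s \<in> times" "t \<in> times" "\<forall>\<omega>\<in>\<Omega>. s \<omega> \<le> t \<omega>"
    then have st: "precedes s t" by (simp add: precedes_def)
    show "monotone_operator Q (S t) (DP s t) \<and> translation_invariant Q (S s) (S t) (DP s t) \<and>
        convex_operator Q (S t) (DP s t) \<and> continuous_from_below Q (S t) (DP s t)"
      by (intro conjI DP_properties[OF st])
  qed
  show "time_consistent r T Q DP"
    unfolding time_consistent_def AE_Q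
  proof (intro ballI impI)
    fix s0 s t Y assume "s0 \<in> times" "s \<in> times" "t \<in> times" "\<forall>\<omega>\<in>\<Omega>. s0 \<omega> \<le> s \<omega> \<and> s \<omega> \<le> t \<omega>" and Y: "Y \<in> BB t"
    then have "precedes s0 s" "precedes s t" by (auto simp: precedes_def)
    then show "AE \<omega> in C. DP s0 s (DP s t Y) \<omega> = DP s0 t Y \<omega>" by (rule DP_consistent[OF _ _ Y])
  qed
qed

end

theorem proposition3p7:
  fixes \<sigma> :: "real \<Rightarrow> real ^ 'n \<Rightarrow> real ^ 'n ^ ('n::finite)"
    and \<Lambda> :: "real \<Rightarrow> real ^ 'n \<Rightarrow> (real ^ 'n) set"
    and g :: "real \<Rightarrow> real ^ 'n \<Rightarrow> real ^ 'n \<Rightarrow> ereal"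
    and r T :: real and y :: "real ^ 'n" and Q :: "'n path measure"
  assumes "continuous_on ({0..} \<times> UNIV) (\<lambda>(t, x). \<sigma> t x)"
    and "bounded ((\<lambda>(t, x). \<sigma> t x) ` ({0..} \<times> UNIV))"
    and "strictly_elliptic (diffusion_matrix \<sigma>)"
    and "multivalued_borel \<Lambda>"
    and "\<forall>u\<ge>0. \<forall>x. closed (\<Lambda> u x)"
    and "\<forall>u\<ge>0. \<forall>x. convex (\<Lambda> u x)"
    and "(\<lambda>(u, x, l). g u x l) \<in> borel_measurable (restrict_space borel ({0..} \<times> UNIV))"
    and "\<forall>u\<ge>0. \<forall>x l. g u x l \<noteq> - \<infinity>"
    and "\<forall>u\<ge>0. \<forall>x. {l. g u x l < \<infinity>} = \<Lambda> u x"
    and "polynomial_growth_on \<Lambda> g"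
    and "\<exists>c::real. \<forall>u\<ge>0. \<forall>x. g u x 0 \<le> ereal c"
    and "0 \<le> r" and "r \<le> T"
    and "martingale_problem \<sigma> (\<lambda>_ _. 0) r y Q"
  shows
    "(\<forall>s\<in>simple_stopping_times r T Q. \<forall>t\<in>simple_stopping_times r T Q.
        (\<forall>\<omega>\<in>path_space r. s \<omega> \<le> t \<omega>) \<longrightarrow>
          (\<forall>Y\<in>bounded_below_rvs Q (stopped_algebra r Q t).
             is_ess_sup (completion Q) (penalized_expectations \<sigma> \<Lambda> g r T Q s t Y)
               (dynamic_process \<sigma> \<Lambda> g r T Q s t Y) \<and>
             dynamic_process \<sigma> \<Lambda> g r T Q s t Y \<in> bounded_below_rvs Q (stopped_algebra r Q s)) \<and>
          convex_operator Q (stopped_algebra r Q t) (dynamic_process \<sigma> \<Lambda> g r T Q s t) \<and>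
          monotone_operator Q (stopped_algebra r Q t) (dynamic_process \<sigma> \<Lambda> g r T Q s t) \<and>
          continuous_from_below Q (stopped_algebra r Q t) (dynamic_process \<sigma> \<Lambda> g r T Q s t))
     \<and> convex_dynamic_process r T Q (dynamic_process \<sigma> \<Lambda> g r T Q)
     \<and> time_consistent r T Q (dynamic_process \<sigma> \<Lambda> g r T Q)"
proof -
  have zero: "0 \<in> \<Lambda> u x" if "0 \<le> u" for u x using assms(4) that by (simp add: multivalued_borel_def)
  interpret control_problem \<sigma> r y Q \<Lambda> g T
    by unfold_locales (use assms zero in auto)
  show ?thesis by (rule dynamic_process_properties)
qed

end
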